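(* Let $n\ge1$ be an integer, $i\in\{1,2\}$, and put $\epsilon=\max(|M_1|,|M_2|)$. For every integer $k\ge0$, if $\epsilon$ is sufficiently small, then $$|\partial_x^k\xi_{i;n}(x,t)|\le C_{n,k}\,\epsilon^{n+1}(t+1)^{-k/2}\,\Psi_{i;n-1}(x,t)\qquad(x\in\mathbb{R},\ t\ge0)$$ for some positive constant $C_{n,k}$. In particular, when $|x|\le K$ for some fixed $K>0$, $$|\xi_{i;n}(x,t)|\le C_{n,K}(t+1)^{-\alpha_{n-1}}\qquad(t\ge0)$$ for some $C_{n,K}>0$. Moreover, for any $1\le p\le\infty$ there exists $C_{n,p}>0$ such that $$\|\xi_{i;n}(\cdot,t)\|_{L^p(\mathbb{R})}\le C_{n,p}(t+1)^{-(\alpha_{n-1}-1/p)/2}\qquad(t\ge0).$$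
   Context: Fix constants $\nu>0$, $c>0$, and real numbers $M_1,M_2$. For $i\in\{1,2\}$ put $i'=3-i$ and $\lambda_i=(-1)^{i-1}c$. Constants $C$ and smallness thresholds for $\epsilon$ may depend on the indicated indices and on $\nu,c$, but not on $x,t,M_1,M_2$. Diffusion waves: $\theta_i$ is the self-similar solution of $\partial_t\theta_i+\lambda_i\partial_x\theta_i+\partial_x(\theta_i^2/2)=\frac\nu2\partial_x^2\theta_i$ ($t>-1$) with $\theta_i\to M_i\delta_0$ (Dirac mass at $0$) as $t\searrow-1$; explicitly $$\theta_i(x,t)=\frac{\sqrt\nu\,(e^{M_i/\nu}-1)}{\sqrt{2(t+1)}}e^{-\frac{(x-\lambda_i(t+1))^2}{2\nu(t+1)}}\left[\sqrt\pi+(e^{M_i/\nu}-1)\int_{\frac{x-\lambda_i(t+1)}{\sqrt{2\nu(t+1)}}}^\infty e^{-y^2}dy\right]^{-1}.$$ Higher-order diffusion waves: $\xi_{i;0}=\theta_i/2$, and for $n\ge1$, inductively, $\xi_{i;n}$ is the (bounded classical) solution of $$\partial_t\xi_{i;n}+\lambda_i\partial_x\xi_{i;n}+\partial_x(\theta_i\xi_{i;n})+\partial_x(\theta_{i'}\xi_{i';n-1})=\frac\nu2\partial_x^2\xi_{i;n}\ (x\in\mathbb{R},t>0),\qquad \xi_{i;n}(x,0)=0.$$ Weights: for $n\ge-1$, $\alpha_n=2-2^{-(n+1)}$, $\beta_n=\frac32-2^{-(n+1)}$, $$\psi_n(x,t;\lambda)=[(x-\lambda(t+1))^2+(t+1)]^{-\alpha_n/2},\quad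 \tilde\psi_n(x,t;\lambda)=[|x-\lambda(t+1)|^{\alpha_n}+(t+1)^{\beta_n}]^{-1},$$ $$\Psi_{i;n}(x,t)=\psi_n(x,t;\lambda_i)+\tilde\psi_n(x,t;\lambda_{i'}).$$ *)

theory Defs
  imports "HOL-Analysis.Analysis" "HOL-Probability.Essential_Supremum"
begin

text \<open>
  Functions of space and time are curried as \<open>u x t\<close>. The two wave families are indexed by
  \<open>i \<in> {1, 2}\<close>, the opposite family is \<open>i' = 3 - i\<close>, and the masses are
  \<open>M\<^sub>1 = M 1\<close>, \<open>M\<^sub>2 = M 2\<close>.
\<close>

definition speed :: "real \<Rightarrow> nat \<Rightarrow> real" where
  "speed c i = (-1) ^ (i - 1) * c"

definition diffusion_wave :: "real \<Rightarrow> real \<Rightarrow> (nat \<Rightarrow> real) \<Rightarrow> nat \<Rightarrow> real \<Rightarrow> real \<Rightarrow> real" where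
  "diffusion_wave \<nu> c M i x t =
     sqrt \<nu> * (exp (M i / \<nu>) - 1) / sqrt (2 * (t + 1))
     * exp (- ((x - speed c i * (t + 1))\<^sup>2 / (2 * \<nu> * (t + 1))))
     * inverse (sqrt pi + (exp (M i / \<nu>) - 1)
         * integral {(x - speed c i * (t + 1)) / sqrt (2 * \<nu> * (t + 1))..} (\<lambda>y. exp (- y\<^sup>2)))"

definition dx :: "(real \<Rightarrow> real \<Rightarrow> real) \<Rightarrow> real \<Rightarrow> real \<Rightarrow> real" where
  "dx u x t = deriv (\<lambda>y. u y t) x"

definition dt :: "(real \<Rightarrow> real \<Rightarrow> real) \<Rightarrow> real \<Rightarrow> real \<Rightarrow> real" where
  "dt u x t = deriv (\<lambda>s. u x s) t"

text \<open>
  Regularity of a classical solution of a parabolic initial value problem: continuous up to the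
  initial time, once continuously differentiable in time and twice in space for positive times.
  Since \<open>deriv\<close> is total, the existence of the derivatives is required separately.
\<close>

definition classical_regularity :: "(real \<Rightarrow> real \<Rightarrow> real) \<Rightarrow> bool" where
  "classical_regularity u \<longleftrightarrow>
     continuous_on (UNIV \<times> {0..}) (\<lambda>(x, t). u x t) \<and>
     (\<forall>x. \<forall>t>0. (\<lambda>s. u x s) field_differentiable at t \<and>
                (\<lambda>y. u y t) field_differentiable at x \<and>
                (\<lambda>y. dx u y t) field_differentiable at x) \<and>
     continuous_on (UNIV \<times> {0<..}) (\<lambda>(x, t). dt u x t) \<and>
     continuous_on (UNIV \<times> {0<..}) (\<lambda>(x, t). dx u x t) \<and>
     continuous_on (UNIV \<times> {0<..}) (\<lambda>(x, t). dx (dx u) x t)"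

text \<open>
  \<open>u\<close> is the bounded classical solution of the equation for \<open>\<xi>\<^bsub>i;n\<^esub>\<close>, where \<open>v\<close> is
  \<open>\<xi>\<^bsub>i';n-1\<^esub>\<close>.
\<close>

definition is_next_wave ::
  "real \<Rightarrow> real \<Rightarrow> (nat \<Rightarrow> real) \<Rightarrow> nat \<Rightarrow> (real \<Rightarrow> real \<Rightarrow> real) \<Rightarrow> (real \<Rightarrow> real \<Rightarrow> real) \<Rightarrow> bool" where
  "is_next_wave \<nu> c M i v u \<longleftrightarrow>
     classical_regularity u \<and>
     (\<exists>B. \<forall>x. \<forall>t\<ge>0. \<bar>u x t\<bar> \<le> B) \<and>
     (\<forall>x. \<forall>t>0.
        dt u x t + speed c i * dx u x t
        + dx (\<lambda>y s. diffusion_wave \<nu> c M i y s * u y s) x t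
        + dx (\<lambda>y s. diffusion_wave \<nu> c M (3 - i) y s * v y s) x t
        = \<nu> / 2 * dx (dx u) x t) \<and>
     (\<forall>x. u x 0 = 0)"

text \<open>
  \<open>is_higher_wave \<nu> c M n \<xi>\<close> says that \<open>\<xi> i\<close> is the higher-order diffusion wave
  \<open>\<xi>\<^bsub>i;n\<^esub>\<close>, for both \<open>i = 1\<close> and \<open>i = 2\<close>.
\<close>

primrec is_higher_wave ::
  "real \<Rightarrow> real \<Rightarrow> (nat \<Rightarrow> real) \<Rightarrow> nat \<Rightarrow> (nat \<Rightarrow> real \<Rightarrow> real \<Rightarrow> real) \<Rightarrow> bool" where
  "is_higher_wave \<nu> c M 0 \<xi> \<longleftrightarrow>
     (\<forall>i\<in>{1, 2}. \<forall>x. \<forall>t\<ge>0. \<xi> i x t = diffusion_wave \<nu> c M i x t / 2)"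
| "is_higher_wave \<nu> c M (Suc n) \<xi> \<longleftrightarrow>
     (\<exists>\<eta>. is_higher_wave \<nu> c M n \<eta> \<and>
          (\<forall>i\<in>{1, 2}. is_next_wave \<nu> c M i (\<eta> (3 - i)) (\<xi> i)))"

text \<open>The weights are indexed by integers \<open>n \<ge> -1\<close>.\<close>

definition alpha :: "int \<Rightarrow> real" where
  "alpha n = 2 - 2 powi (- (n + 1))"

definition beta :: "int \<Rightarrow> real" where
  "beta n = 3 / 2 - 2 powi (- (n + 1))"

definition psi :: "int \<Rightarrow> real \<Rightarrow> real \<Rightarrow> real \<Rightarrow> real" where
  "psi n l x t = ((x - l * (t + 1))\<^sup>2 + (t + 1)) powr (- alpha n / 2)"

definition psi_tilde :: "int \<Rightarrow> real \<Rightarrow> real \<Rightarrow> real \<Rightarrow> real" where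
  "psi_tilde n l x t = inverse (\<bar>x - l * (t + 1)\<bar> powr alpha n + (t + 1) powr beta n)"

definition Psi :: "real \<Rightarrow> nat \<Rightarrow> int \<Rightarrow> real \<Rightarrow> real \<Rightarrow> real" where
  "Psi c i n x t = psi n (speed c i) x t + psi_tilde n (speed c (3 - i)) x t"

definition times_differentiable :: "nat \<Rightarrow> (real \<Rightarrow> real) \<Rightarrow> bool" where
  "times_differentiable k f \<longleftrightarrow> (\<forall>j<k. \<forall>x. (deriv ^^ j) f field_differentiable at x)"

text \<open>The norm takes values in the extended nonnegative reals, so that a bound on it entails
  membership in \<open>L\<^sup>p\<close>.\<close>

definition Lp_norm :: "ennreal \<Rightarrow> (real \<Rightarrow> real) \<Rightarrow> ennreal" where
  "Lp_norm p f =
     (if f \<notin> borel_measurable lborel then \<infinity>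
      else if p = \<infinity> then esssup lborel (\<lambda>x. ennreal \<bar>f x\<bar>)
      else let I = (\<integral>\<^sup>+ x. ennreal (\<bar>f x\<bar> powr enn2real p) \<partial>lborel)
           in if I = \<infinity> then \<infinity> else ennreal (enn2real I powr (1 / enn2real p)))"

end

(* The linearised Burgers operator is conjugated to the heat operator by a Cole-Hopf substitution:
   xi_{i;n+1} is the x-derivative of V / phi_i, where theta_i = - nu phi_i' / phi_i and V is the Duhamel
   integral, along the speed lambda_i, of the source h = - phi_i theta_{i'} xi_{i';n}. The maximum principle
   identifies every bounded classical solution with this formula.

   The source h is a Gaussian travelling with the other speed. Hence (lambda_i - lambda_{i'}) h_x is the heat
   operator with speed lambda_i applied to h, up to a remainder r that decays faster by a factor 1/(t+1), and
   Duhamel's integral of h_x over [tau, t] turns into boundary terms and an integral of r. On [0, tau] the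
   derivative falls on the kernel instead. Choosing tau proportional to the distance from the i-th
   characteristic, but at least of order sqrt (t+1), balances both parts and produces the recursion
   alpha_n = 1 + alpha_{n-1} / 2. *)

theory Submission
  imports Defs "HOL-Probability.Probability"
begin

section \<open>The maximum principle\<close>

text \<open>The threshold is the same number 1 for every k: it confines \<open>phi\<close> between
  positive constants, and \<open>eps M \<le> 1\<close> absorbs surplus powers of eps. The x-profile
  of one wave is not fed into the next. Only the time decay T^(-\<alpha>/2) of the previous wave is
  passed on, because the source already receives a Gaussian profile from theta. The profile \<Psi>
  is created anew at each level: its psi part by the balance of the two pieces of Duhamel's
  integral, its psi-tilde part by the boundary term at the final time, which is the source itself.
  The remainder r is a sum of two kinds of terms: products of waves of one speed, where a further
  wave or further derivatives yield the gain 1/T, and products of waves of both speeds, whose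
  overlap is exponentially small. Derivatives of every order are carried along by a calculus of
  families in which each constant is chosen before the masses. Time derivatives are taken only from
  the left and are never differentiated in x, so identities for space derivatives come from explicit
  formulas.\<close>

lemma second_derivative_le_at_max:
  fixes f f' :: "real \<Rightarrow> real"
  assumes f: "\<And>y. (f has_real_derivative f' y) (at y)"
    and f': "(f' has_real_derivative d) (at x)"
    and max: "\<And>y. \<bar>y - x\<bar> < r \<Longrightarrow> f y \<le> f x" and r: "r > 0"
  shows "f' x = 0" "d \<le> 0"
proof -
  show 0: "f' x = 0"
    by (rule DERIV_local_max[OF f r]) (use max in \<open>auto simp: abs_minus_commute\<close>)
  show "d \<le> 0"
  proof (rule ccontr)
    assume "\<not> d \<le> 0"
    then obtain e where e: "e > 0" "\<And>h. 0 < h \<Longrightarrow> h < e \<Longrightarrow> f' x < f' (x + h)"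
      using DERIV_pos_inc_right[OF f'] by auto
    define h where "h = min e r / 2"
    have h: "0 < h" "h < e" "h < r" using e r by (auto simp: h_def)
    have "\<exists>z. x < z \<and> z < x + h \<and> f (x + h) - f x = (x + h - x) * f' z"
      by (rule MVT2) (use h f in auto)
    then obtain z where z: "x < z" "z < x + h" "f (x + h) - f x = h * f' z" by auto
    have "f' z > 0" using e(2)[of "z - x"] z h 0 by auto
    hence "f (x + h) > f x" using z h by (metis diff_gt_0_iff_gt mult_pos_pos)
    thus False using max[of "x + h"] h by auto
  qed
qed

text \<open>The maximum in time is sought on an interval that ends at the time under study, so it
  may sit at the right end, where only earlier times can be compared.\<close>

lemma left_derivative_ge_at_max:
  fixes f :: "real \<Rightarrow> real"
  assumes f: "(f has_real_derivative d) (at_left x)" and ax: "a < x"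
    and max: "\<And>y. a \<le> y \<Longrightarrow> y < x \<Longrightarrow> f y \<le> f x"
  shows "d \<ge> 0"
proof -
  have "((\<lambda>y. (f y - f x) / (y - x)) \<longlongrightarrow> d) (at_left x)"
    using f by (simp add: has_field_derivative_iff)
  moreover have "eventually (\<lambda>y. 0 \<le> (f y - f x) / (y - x)) (at_left x)"
    using eventually_at_left_real[OF ax]
    by eventually_elim (use max in \<open>auto simp: divide_nonpos_neg\<close>)
  ultimately show ?thesis
    by (rule tendsto_lowerbound) simp
qed

text \<open>On the whole line the supremum of \<open>w\<close> need not be attained. Subtracting a
  small multiple of 1 + x^2 forces a maximum on a compact set, and the factor exp(-K (t - a)) makes
  the equation at that point contradict the sign of the time derivative.\<close>

lemma parabolic_max_principle:
  fixes w wx wxx wt b e :: "real \<Rightarrow> real \<Rightarrow> real"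
  assumes cont: "continuous_on (UNIV \<times> {a..T1}) (\<lambda>(x, t). w x t)"
    and bdd: "\<And>x t. t \<in> {a..T1} \<Longrightarrow> \<bar>w x t\<bar> \<le> B0"
    and init: "\<And>x. w x a = 0"
    and wx: "\<And>x t. t \<in> {a<..T1} \<Longrightarrow> ((\<lambda>y. w y t) has_real_derivative wx x t) (at x)"
    and wxx: "\<And>x t. t \<in> {a<..T1} \<Longrightarrow> ((\<lambda>y. wx y t) has_real_derivative wxx x t) (at x)"
    and wt: "\<And>x t. t \<in> {a<..T1} \<Longrightarrow> ((\<lambda>s. w x s) has_real_derivative wt x t) (at_left t)"
    and pde: "\<And>x t. t \<in> {a<..T1} \<Longrightarrow> wt x t = \<mu> * wxx x t - b x t * wx x t - e x t * w x t"
    and b: "\<And>x t. t \<in> {a<..T1} \<Longrightarrow> \<bar>b x t\<bar> \<le> B"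
    and e: "\<And>x t. t \<in> {a<..T1} \<Longrightarrow> \<bar>e x t\<bar> \<le> E"
    and mu: "\<mu> \<ge> 0"
    and t1: "t1 \<in> {a..T1}"
  shows "w x1 t1 \<le> 0"
proof (rule ccontr)
  assume "\<not> w x1 t1 \<le> 0"
  hence pos: "w x1 t1 > 0" by simp
  hence at1: "a < t1" using init t1 by (cases "a = t1") auto
  hence aT: "a < T1" using t1 by auto
  have B: "B \<ge> 0" using b[of T1 0] aT by auto
  have E: "E \<ge> 0" using e[of T1 0] aT by auto
  \<comment> \<open>\<open>E\<close> pays for the zeroth-order term, \<open>2 * \<mu>\<close> for
    the second derivative of the penalty, and \<open>B\<close> for the drift acting on the penalty,
    since 2 |x| \<le> 1 + x^2. The final 1 leaves the contradiction.\<close>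
  define K where "K = E + 2 * \<mu> + B + 1"
  define y where "y x t = w x t * exp (- K * (t - a))" for x t
  have y1: "y x1 t1 > 0" using pos by (simp add: y_def)
  \<comment> \<open>Chosen so that the penalty at the offending point takes only half of its value
    and \<open>Z\<close> stays positive there.\<close>
  define \<delta> where "\<delta> = y x1 t1 / (2 * (1 + x1\<^sup>2))"
  have d1: "1 + x1\<^sup>2 > 0" by (simp add: add_pos_nonneg)
  have \<delta>: "\<delta> > 0" using y1 d1 by (simp add: \<delta>_def)
  define Z where "Z p = y (fst p) (snd p) - \<delta> * (1 + (fst p)\<^sup>2)" for p
  have "\<delta> * (1 + x1\<^sup>2) = y x1 t1 / 2"
  proof -
    have "r / (2 * q) * q = r / 2" if "q > 0" for q r :: real using that by simp
    from this[OF d1] show ?thesis unfolding \<delta>_def .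
  qed
  hence Z1: "Z (x1, t1) > 0" using y1 by (simp add: Z_def)
  \<comment> \<open>Beyond this radius the penalty exceeds the bound on \<open>y\<close>; the
    offending point is kept inside.\<close>
  define R where "R = max \<bar>x1\<bar> (sqrt (B0 / \<delta>))"
  have R: "R \<ge> \<bar>x1\<bar>" "R \<ge> 0" by (auto simp: R_def)
  have B0: "B0 \<ge> 0" using bdd[of T1 0] aT by auto
  have K: "K > 0" using E B mu by (simp add: K_def)
  have yB: "y x t \<le> B0" if "t \<in> {a..T1}" for x t
  proof -
    have "\<bar>y x t\<bar> \<le> B0 * 1"
      unfolding y_def abs_mult using bdd[OF that] B0 K that by (intro mult_mono) auto
    thus ?thesis by auto
  qed
  have far: "Z p < 0" if "\<bar>fst p\<bar> \<ge> R" "snd p \<in> {a..T1}" for p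
  proof -
    have "sqrt (B0 / \<delta>) \<le> \<bar>fst p\<bar>" using that by (auto simp: R_def)
    hence "B0 / \<delta> \<le> (fst p)\<^sup>2" by (metis real_le_rsqrt real_sqrt_abs real_sqrt_le_iff)
    hence "B0 \<le> \<delta> * (fst p)\<^sup>2" using \<delta> by (simp add: field_simps)
    thus ?thesis using yB[OF that(2), of "fst p"] \<delta> by (simp add: Z_def algebra_simps)
  qed
  have contZ: "continuous_on ({-R..R} \<times> {a..t1}) Z"
    unfolding Z_def y_def
    by (intro continuous_intros continuous_on_subset[OF cont, unfolded case_prod_unfold])
       (use t1 in auto)
  have "compact ({-R..R} \<times> {a..t1})" by (intro compact_Times) auto
  then obtain p where p: "p \<in> {-R..R} \<times> {a..t1}" "\<And>q. q \<in> {-R..R} \<times> {a..t1} \<Longrightarrow> Z q \<le> Z p"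
    using continuous_attains_sup[OF _ _ contZ] R at1 by fastforce
  obtain x0 t0 where p0: "p = (x0, t0)" by (cases p)
  have t0: "t0 \<in> {a..t1}" using p p0 by auto
  have t0': "t0 \<in> {a..T1}" using t0 t1 by auto
  have Zp: "Z (x0, t0) > 0" using p(2)[of "(x1, t1)"] R t1 at1 Z1 p0 by (auto simp: abs_le_iff)
  have max: "Z (x, t) \<le> Z (x0, t0)" if "t \<in> {a..t1}" for x t
  proof (cases "\<bar>x\<bar> \<le> R")
    case True thus ?thesis using p(2)[of "(x, t)"] that p0 by (auto simp: abs_le_iff)
  next
    case False
    hence "Z (x, t) < 0" using that t1 by (intro far) auto
    thus ?thesis using Zp by simp
  qed
  have "t0 \<noteq> a"
  proof
    assume "t0 = a"
    hence "Z (x0, t0) \<le> 0" using \<delta> init by (simp add: Z_def y_def)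
    thus False using Zp by simp
  qed
  hence t0a: "a < t0" "t0 \<in> {a<..T1}" using t0 t0' by auto
  let ?k = "exp (- K * (t0 - a))"
  have dZx: "((\<lambda>x. Z (x, t0)) has_real_derivative wx x t0 * ?k - \<delta> * (2 * x)) (at x)" for x
    unfolding Z_def y_def fst_conv snd_conv
    by (auto intro!: derivative_eq_intros wx[OF t0a(2)])
  have dZxx: "((\<lambda>x. wx x t0 * ?k - \<delta> * (2 * x)) has_real_derivative wxx x t0 * ?k - \<delta> * 2) (at x)" for x
    by (auto intro!: derivative_eq_intros wxx[OF t0a(2)])
  note sd = second_derivative_le_at_max[OF dZx dZxx max[OF t0] zero_less_one]
  have dZt: "((\<lambda>t. Z (x0, t)) has_real_derivative wt x0 t0 * ?k + w x0 t0 * (?k * (- K))) (at_left t0)"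
    unfolding Z_def y_def fst_conv snd_conv
    by (auto intro!: derivative_eq_intros wt[OF t0a(2)])
  have "wt x0 t0 * ?k + w x0 t0 * (?k * (- K)) \<ge> 0"
    by (rule left_derivative_ge_at_max[OF dZt t0a(1)]) (use max t0 in auto)
  hence t_ineq: "wt x0 t0 * ?k \<ge> K * y x0 t0" by (simp add: y_def mult_ac)
  have ypos: "y x0 t0 \<ge> \<delta> * (1 + x0\<^sup>2)" using Zp by (simp add: Z_def)
  have "wt x0 t0 * ?k = \<mu> * (wxx x0 t0 * ?k) - b x0 t0 * (wx x0 t0 * ?k) - e x0 t0 * y x0 t0"
    unfolding pde[OF t0a(2)] y_def by (simp only: left_diff_distrib mult.assoc)
  also have "\<dots> \<le> \<mu> * (2 * \<delta>) + B * (\<delta> * (1 + x0\<^sup>2)) + E * y x0 t0"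
  proof -
    have 1: "\<mu> * (wxx x0 t0 * ?k) \<le> \<mu> * (2 * \<delta>)" using sd(2) mu by (intro mult_left_mono) auto
    have "\<bar>2 * x0\<bar> \<le> 1 + x0\<^sup>2"
      using zero_le_power2[of "\<bar>x0\<bar> - 1"] by (simp add: power2_diff)
    hence "\<bar>b x0 t0\<bar> * (\<delta> * \<bar>2 * x0\<bar>) \<le> B * (\<delta> * (1 + x0\<^sup>2))"
      using b[OF t0a(2)] B \<delta> by (intro mult_mono) auto
    moreover have "\<bar>- b x0 t0 * (wx x0 t0 * ?k)\<bar> = \<bar>b x0 t0\<bar> * (\<delta> * \<bar>2 * x0\<bar>)"
      using sd(1) \<delta> by (simp add: abs_mult)
    ultimately have 2: "- b x0 t0 * (wx x0 t0 * ?k) \<le> B * (\<delta> * (1 + x0\<^sup>2))" by linarith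
    have y0: "y x0 t0 \<ge> 0" using ypos \<delta> by (meson add_nonneg_nonneg mult_nonneg_nonneg order_trans less_imp_le zero_le_one zero_le_power2)
    have "- e x0 t0 * y x0 t0 \<le> E * y x0 t0"
      using e[OF t0a(2), of x0] y0 by (intro mult_right_mono) auto
    with 1 2 show ?thesis by linarith
  qed
  also have "\<dots> \<le> 2 * \<mu> * y x0 t0 + B * y x0 t0 + E * y x0 t0"
  proof -
    have "\<delta> \<le> \<delta> * (1 + x0\<^sup>2)" using \<delta> by (simp add: algebra_simps)
    hence "\<delta> \<le> y x0 t0" using ypos by linarith
    hence "\<mu> * (2 * \<delta>) \<le> 2 * \<mu> * y x0 t0" using mult_left_mono[of \<delta> "y x0 t0" "2 * \<mu>"] mu by (simp add: mult_ac)
    moreover have "B * (\<delta> * (1 + x0\<^sup>2)) \<le> B * y x0 t0" using ypos B by (intro mult_left_mono)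
    ultimately show ?thesis by linarith
  qed
  also have "\<dots> = K * y x0 t0 - y x0 t0" by (simp add: K_def algebra_simps)
  finally have "y x0 t0 \<le> 0" using t_ineq by linarith
  moreover have "\<delta> * (1 + x0\<^sup>2) > 0" using \<delta> by (intro mult_pos_pos) (auto simp: add_pos_nonneg)
  ultimately show False using ypos by linarith
qed

lemma parabolic_uniqueness:
  fixes w wx wxx wt b e :: "real \<Rightarrow> real \<Rightarrow> real"
  assumes cont: "continuous_on (UNIV \<times> {a..T1}) (\<lambda>(x, t). w x t)"
    and bdd: "\<And>x t. t \<in> {a..T1} \<Longrightarrow> \<bar>w x t\<bar> \<le> B0"
    and init: "\<And>x. w x a = 0"
    and wx: "\<And>x t. t \<in> {a<..T1} \<Longrightarrow> ((\<lambda>y. w y t) has_real_derivative wx x t) (at x)"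
    and wxx: "\<And>x t. t \<in> {a<..T1} \<Longrightarrow> ((\<lambda>y. wx y t) has_real_derivative wxx x t) (at x)"
    and wt: "\<And>x t. t \<in> {a<..T1} \<Longrightarrow> ((\<lambda>s. w x s) has_real_derivative wt x t) (at_left t)"
    and pde: "\<And>x t. t \<in> {a<..T1} \<Longrightarrow> wt x t = \<mu> * wxx x t - b x t * wx x t - e x t * w x t"
    and b: "\<And>x t. t \<in> {a<..T1} \<Longrightarrow> \<bar>b x t\<bar> \<le> B"
    and e: "\<And>x t. t \<in> {a<..T1} \<Longrightarrow> \<bar>e x t\<bar> \<le> E"
    and mu: "\<mu> \<ge> 0"
    and t1: "t1 \<in> {a..T1}"
  shows "w x1 t1 = 0"
proof (rule antisym)
  show "w x1 t1 \<le> 0"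
    by (rule parabolic_max_principle[OF assms])
  have "- w x1 t1 \<le> 0"
  proof (rule parabolic_max_principle[where w = "\<lambda>x t. - w x t" and wx = "\<lambda>x t. - wx x t"
        and wxx = "\<lambda>x t. - wxx x t" and b = b and e = e and wt = "\<lambda>x t. - wt x t", OF _ _ _ _ _ _ _ b e mu t1])
    show "continuous_on (UNIV \<times> {a..T1}) (\<lambda>(x, t). - w x t)"
      using continuous_on_minus[OF cont] by (simp add: case_prod_unfold)
  qed (use bdd init pde in \<open>auto intro!: DERIV_minus wx wxx wt simp: algebra_simps\<close>)
  thus "w x1 t1 \<ge> 0" by simp
qed

section \<open>The heat semigroup with drift\<close>

text \<open>The mean value inequality bounds all difference quotients by \<open>B\<close>, so
  dominated convergence applies along every sequence. The heat integral, which runs over the whole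
  line, is the intended use.\<close>

lemma has_real_derivative_integral:
  fixes f f' :: "real \<Rightarrow> 'a \<Rightarrow> real"
  assumes x: "x \<in> {a<..<b}"
    and f: "\<And>t. t \<in> {a<..<b} \<Longrightarrow> integrable M (f t)"
    and f': "f' x \<in> borel_measurable M"
    and d: "\<And>t \<omega>. t \<in> {a<..<b} \<Longrightarrow> ((\<lambda>s. f s \<omega>) has_real_derivative f' t \<omega>) (at t)"
    and bd: "\<And>t \<omega>. t \<in> {a<..<b} \<Longrightarrow> \<bar>f' t \<omega>\<bar> \<le> B \<omega>" and B: "integrable M B"
  shows "((\<lambda>t. \<integral>\<omega>. f t \<omega> \<partial>M) has_real_derivative (\<integral>\<omega>. f' x \<omega> \<partial>M)) (at x)"
proof -
  have at: "at x = at x within {a<..<b}" using x by (metis at_within_open open_greaterThanLessThan)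
  show ?thesis
    unfolding has_field_derivative_iff at tendsto_at_iff_sequentially
  proof (intro allI impI)
    fix X assume X: "\<forall>i. X i \<in> {a<..<b} - {x}" "X \<longlonglongrightarrow> x"
    have bnd: "norm ((f (X i) \<omega> - f x \<omega>) / (X i - x)) \<le> B \<omega>" for i \<omega>
    proof -
      have "norm (f (X i) \<omega> - f x \<omega>) \<le> B \<omega> * norm (X i - x)"
      proof (rule field_differentiable_bound[where S = "{a<..<b}" and f = "\<lambda>t. f t \<omega>" and f' = "\<lambda>t. f' t \<omega>"])
        show "X i \<in> {a<..<b}" using X by blast
      qed (use x bd d in \<open>auto intro: has_field_derivative_at_within\<close>)
      thus ?thesis using X by (simp add: divide_simps)
    qed
    have "(\<lambda>i. \<integral>\<omega>. (f (X i) \<omega> - f x \<omega>) / (X i - x) \<partial>M) \<longlonglongrightarrow> (\<integral>\<omega>. f' x \<omega> \<partial>M)"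
    proof (rule integral_dominated_convergence[OF f' _ B])
      show "(\<lambda>\<omega>. (f (X i) \<omega> - f x \<omega>) / (X i - x)) \<in> borel_measurable M" for i
        using f[of "X i"] f[OF x] X by (auto intro!: borel_measurable_divide borel_measurable_diff)
      show "AE \<omega> in M. (\<lambda>i. (f (X i) \<omega> - f x \<omega>) / (X i - x)) \<longlonglongrightarrow> f' x \<omega>"
      proof (rule AE_I2)
        fix \<omega>
        have "((\<lambda>t. (f t \<omega> - f x \<omega>) / (t - x)) \<longlongrightarrow> f' x \<omega>) (at x within {a<..<b})"
          using d[OF x, of \<omega>] by (simp add: has_field_derivative_iff flip: at)
        thus "(\<lambda>i. (f (X i) \<omega> - f x \<omega>) / (X i - x)) \<longlonglongrightarrow> f' x \<omega>"
          using X by (auto simp: tendsto_at_iff_sequentially o_def)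
      qed
    qed (use bnd in auto)
    moreover have "(\<integral>\<omega>. (f (X i) \<omega> - f x \<omega>) / (X i - x) \<partial>M)
        = ((\<integral>\<omega>. f (X i) \<omega> \<partial>M) - (\<integral>\<omega>. f x \<omega> \<partial>M)) / (X i - x)" for i
    proof -
      have "X i \<in> {a<..<b}" using X by blast
      from Bochner_Integration.integral_diff[OF f[OF this] f[OF x]] show ?thesis by simp
    qed
    ultimately show "((\<lambda>y. ((\<integral>\<omega>. f y \<omega> \<partial>M) - (\<integral>\<omega>. f x \<omega> \<partial>M)) / (y - x)) \<circ> X)
        \<longlonglongrightarrow> (\<integral>\<omega>. f' x \<omega> \<partial>M)"
      by (simp only: o_def)
  qed
qed

lemma continuous_on_integral_dominated:
  fixes g :: "'p::first_countable_topology \<Rightarrow> 'a \<Rightarrow> real"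
  assumes c: "\<And>\<omega>. continuous_on S (\<lambda>p. g p \<omega>)"
    and m: "\<And>p. p \<in> S \<Longrightarrow> g p \<in> borel_measurable M"
    and bd: "\<And>p \<omega>. p \<in> S \<Longrightarrow> \<bar>g p \<omega>\<bar> \<le> B \<omega>" and B: "integrable M B"
  shows "continuous_on S (\<lambda>p. \<integral>\<omega>. g p \<omega> \<partial>M)"
  unfolding continuous_on_def tendsto_at_iff_sequentially
proof (intro allI impI ballI)
  fix p X assume p: "p \<in> S" and X: "\<forall>i. X i \<in> S - {p}" "X \<longlonglongrightarrow> p"
  have "(\<lambda>i. \<integral>\<omega>. g (X i) \<omega> \<partial>M) \<longlonglongrightarrow> (\<integral>\<omega>. g p \<omega> \<partial>M)"
  proof (rule integral_dominated_convergence[OF m[OF p] _ B])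
    show "AE \<omega> in M. (\<lambda>i. g (X i) \<omega>) \<longlonglongrightarrow> g p \<omega>"
    proof (rule AE_I2)
      fix \<omega>
      have "((\<lambda>p. g p \<omega>) \<longlongrightarrow> g p \<omega>) (at p within S)"
        using c p by (auto simp: continuous_on_def)
      thus "(\<lambda>i. g (X i) \<omega>) \<longlonglongrightarrow> g p \<omega>"
        using X by (auto simp: tendsto_at_iff_sequentially o_def)
    qed
  qed (use X m bd in auto)
  thus "((\<lambda>p. \<integral>\<omega>. g p \<omega> \<partial>M) \<circ> X) \<longlonglongrightarrow> (\<integral>\<omega>. g p \<omega> \<partial>M)"
    by (simp add: o_def)
qed

lemma integral_derivative_zero:
  fixes F f :: "real \<Rightarrow> real"
  assumes F: "\<And>x. (F has_real_derivative f x) (at x)"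
    and c: "continuous_on UNIV f" and i: "integrable lborel f"
    and top: "(F \<longlongrightarrow> 0) at_top" and bot: "(F \<longlongrightarrow> 0) at_bot"
  shows "(\<integral>x. f x \<partial>lborel) = 0"
proof -
  have "(LBINT x=-\<infinity>..\<infinity>. f x) = 0 - 0"
  proof (rule interval_integral_FTC_integrable[where F = F])
    show "set_integrable lborel (einterval (-\<infinity>) \<infinity>) f"
      using i by (simp add: set_integrable_def)
    show "((F \<circ> real_of_ereal) \<longlongrightarrow> 0) (at_right (- \<infinity>))"
      using bot by (simp add: ereal_tendsto_simps)
    show "((F \<circ> real_of_ereal) \<longlongrightarrow> 0) (at_left \<infinity>)"
      using top by (simp add: ereal_tendsto_simps)
    show "isCont f x" for x
      using c by (simp add: continuous_on_eq_continuous_at)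
  qed (use F in \<open>auto simp: has_real_derivative_iff_has_vector_derivative\<close>)
  thus ?thesis
    by (simp add: interval_lebesgue_integral_def set_lebesgue_integral_def)
qed

section \<open>Integration by parts against the normal density\<close>

lemma poly_exp_bound:
  assumes "\<eta> > 0"
  shows "\<exists>C\<ge>0. \<forall>y::real. \<bar>poly p y\<bar> \<le> C * exp (\<eta> * y\<^sup>2)"
  using assms
proof (induction p arbitrary: \<eta>)
  case 0
  show ?case by (auto intro!: exI[of _ 0])
next
  case (pCons a p)
  \<comment> \<open>Half of the exponent is left to the induction hypothesis; the other half absorbs
    the factor \<open>y\<close> that \<open>pCons\<close> multiplies on.\<close>
  from pCons.IH[of "\<eta> / 2"] pCons.prems obtain C where
    C: "C \<ge> 0" "\<And>y. \<bar>poly p y\<bar> \<le> C * exp (\<eta> / 2 * y\<^sup>2)" by auto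
  define C' where "C' = \<bar>a\<bar> + (1 + 2 / \<eta>) * C"
  show ?case
  proof (intro exI[of _ C'] conjI allI)
    show "C' \<ge> 0" using C pCons.prems by (simp add: C'_def)
    fix y :: real
    have "\<bar>y\<bar> \<le> 1 + y\<^sup>2"
      using zero_le_power2[of "\<bar>y\<bar> - 1/2"] by (simp add: power2_diff power_divide)
    also have "\<dots> \<le> (1 + 2 / \<eta>) * (1 + \<eta> / 2 * y\<^sup>2)"
      using pCons.prems by (simp add: field_simps)
    also have "\<dots> \<le> (1 + 2 / \<eta>) * exp (\<eta> / 2 * y\<^sup>2)"
      using pCons.prems by (intro mult_left_mono exp_ge_add_one_self) auto
    finally have y: "\<bar>y\<bar> \<le> (1 + 2 / \<eta>) * exp (\<eta> / 2 * y\<^sup>2)" .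
    have "\<bar>poly (pCons a p) y\<bar> \<le> \<bar>a\<bar> * 1 + \<bar>y\<bar> * \<bar>poly p y\<bar>"
      by (simp add: abs_triangle_ineq flip: abs_mult)
    also have "\<dots> \<le> \<bar>a\<bar> * exp (\<eta> * y\<^sup>2) + ((1 + 2 / \<eta>) * exp (\<eta> / 2 * y\<^sup>2)) * (C * exp (\<eta> / 2 * y\<^sup>2))"
      using y C pCons.prems by (intro add_mono mult_mono mult_left_mono) auto
    also have "\<dots> = C' * (exp (\<eta> * y\<^sup>2))"
      by (simp add: C'_def algebra_simps flip: exp_add)
    finally show "\<bar>poly (pCons a p) y\<bar> \<le> C' * exp (\<eta> * y\<^sup>2)" .
  qed
qed

lemma std_normal_exp: "std_normal_density y = exp (- (y\<^sup>2 / 2)) / sqrt (2 * pi)"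
  by (simp add: std_normal_density_def)

text \<open>Half of the exponent is spent on the polynomial. The remaining exp(-y^2/4) serves as
  kernel in the later Gaussian estimates and is the origin of the condition
  \<open>D \<ge> 4 * \<nu>\<close>.\<close>

lemma std_normal_poly_bound:
  "\<exists>C\<ge>0. \<forall>y. \<bar>std_normal_density y * poly p y\<bar> \<le> C * exp (- (y\<^sup>2 / 4))"
proof -
  obtain C where C: "C \<ge> 0" "\<And>y. \<bar>poly p y\<bar> \<le> C * exp (1 / 4 * y\<^sup>2)"
    using poly_exp_bound[of "1/4" p] by auto
  have "\<bar>std_normal_density y * poly p y\<bar> \<le> C / sqrt (2 * pi) * exp (- (y\<^sup>2 / 4))" for y
  proof -
    have "\<bar>std_normal_density y * poly p y\<bar> \<le> exp (- (y\<^sup>2 / 2)) / sqrt (2 * pi) * (C * exp (1 / 4 * y\<^sup>2))"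
      unfolding abs_mult std_normal_exp using C by (intro mult_mono) auto
    also have "\<dots> = C / sqrt (2 * pi) * exp (- (y\<^sup>2 / 4))"
      by (simp add: field_simps flip: exp_add)
    finally show ?thesis .
  qed
  thus ?thesis using C by (intro exI[of _ "C / sqrt (2 * pi)"]) auto
qed

lemma gaussian_integral:
  fixes A m :: real assumes "A > 0"
  shows "integrable lborel (\<lambda>y. exp (- (A * (y - m)\<^sup>2)))"
    and "(\<integral>y. exp (- (A * (y - m)\<^sup>2)) \<partial>lborel) = sqrt (pi / A)"
proof -
  define s where "s = sqrt (1 / (2 * A))"
  have s: "s > 0" "s\<^sup>2 = 1 / (2 * A)" using assms by (auto simp: s_def)
  have eq: "exp (- (A * (y - m)\<^sup>2)) = sqrt (pi / A) * normal_density m s y" for y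
    using assms by (simp add: normal_density_def s field_simps real_sqrt_divide real_sqrt_mult)
  show "integrable lborel (\<lambda>y. exp (- (A * (y - m)\<^sup>2)))"
    unfolding eq using s by (intro integrable_mult_right integrable_normal_density)
  show "(\<integral>y. exp (- (A * (y - m)\<^sup>2)) \<partial>lborel) = sqrt (pi / A)"
    unfolding eq using s by simp
qed

lemma integrable_exp_quarter: "integrable lborel (\<lambda>y::real. C * exp (- (y\<^sup>2 / 4)))"
  using gaussian_integral(1)[of "1/4" 0] by (intro integrable_mult_right) simp

lemma exp_neg_square_tendsto:
  fixes a :: real assumes "a > 0"
  shows "((\<lambda>y. exp (- (a * y\<^sup>2))) \<longlongrightarrow> 0) at_top" "((\<lambda>y. exp (- (a * y\<^sup>2))) \<longlongrightarrow> 0) at_bot"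
  using assms by real_asymp+

lemma std_normal_poly_integrable:
  fixes g :: "real \<Rightarrow> real"
  assumes g: "g \<in> borel_measurable borel" and bd: "\<And>y. \<bar>g y\<bar> \<le> B"
  shows "integrable lborel (\<lambda>y. std_normal_density y * poly p y * g y)"
proof -
  obtain C where C: "C \<ge> 0" "\<And>y. \<bar>std_normal_density y * poly p y\<bar> \<le> C * exp (- (y\<^sup>2 / 4))"
    using std_normal_poly_bound by blast
  show ?thesis
  proof (rule Bochner_Integration.integrable_bound[OF integrable_exp_quarter[of "C * B"]])
    have "continuous_on UNIV (poly p)" by (intro continuous_intros)
    hence "poly p \<in> borel_measurable borel" by (rule borel_measurable_continuous_onI)
    thus "(\<lambda>y. std_normal_density y * poly p y * g y) \<in> borel_measurable lborel"
      using g by simp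
    show "AE y in lborel. norm (std_normal_density y * poly p y * g y) \<le> norm (C * B * exp (- (y\<^sup>2 / 4)))"
    proof (rule AE_I2)
      fix y
      have "\<bar>std_normal_density y * poly p y\<bar> * \<bar>g y\<bar> \<le> (C * exp (- (y\<^sup>2 / 4))) * B"
        using C bd by (intro mult_mono) auto
      thus "norm (std_normal_density y * poly p y * g y) \<le> norm (C * B * exp (- (y\<^sup>2 / 4)))"
        using C(1) order_trans[OF abs_ge_zero bd] by (simp add: abs_mult mult_ac)
    qed
  qed
qed

text \<open>The derivative of the density times \<open>p\<close> is the density times p' - y p,
  which explains the polynomial on the right. The factor \<open>\<sigma>\<close> from the chain rule
  stays on the left, so that \<open>\<sigma> = 0\<close> is no exception.\<close>

lemma std_normal_by_parts:
  fixes g g' :: "real \<Rightarrow> real"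
  assumes g: "\<And>y. (g has_real_derivative g' y) (at y)" and g': "continuous_on UNIV g'"
    and B: "\<And>y. \<bar>g y\<bar> \<le> B" and B': "\<And>y. \<bar>g' y\<bar> \<le> B'"
  shows "\<sigma> * (\<integral>y. std_normal_density y * poly p y * g' (a - \<sigma> * y) \<partial>lborel)
       = (\<integral>y. std_normal_density y * poly (pderiv p - [:0, 1:] * p) y * g (a - \<sigma> * y) \<partial>lborel)"
proof -
  define F where "F y = std_normal_density y * poly p y * g (a - \<sigma> * y)" for y
  define f where "f y = std_normal_density y * poly (pderiv p - [:0, 1:] * p) y * g (a - \<sigma> * y)
      - \<sigma> * (std_normal_density y * poly p y * g' (a - \<sigma> * y))" for y
  have gc: "continuous_on UNIV g" using g by (meson DERIV_isCont continuous_at_imp_continuous_on)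
  have cc: "continuous_on UNIV (\<lambda>y. h (a - \<sigma> * y))" if "continuous_on UNIV h" for h :: "real \<Rightarrow> real"
    by (rule continuous_on_compose2[OF that]) (auto intro!: continuous_intros)
  have mm: "(\<lambda>y. h (a - \<sigma> * y)) \<in> borel_measurable borel" if "continuous_on UNIV h" for h :: "real \<Rightarrow> real"
    by (rule borel_measurable_continuous_onI[OF cc[OF that]])
  have i1: "integrable lborel (\<lambda>y. std_normal_density y * poly q y * g (a - \<sigma> * y))" for q
    by (rule std_normal_poly_integrable[OF mm[OF gc]]) (rule B)
  have i2: "integrable lborel (\<lambda>y. std_normal_density y * poly p y * g' (a - \<sigma> * y))"
    by (rule std_normal_poly_integrable[OF mm[OF g']]) (rule B')
  have dF: "(F has_real_derivative f y) (at y)" for y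
    unfolding F_def f_def std_normal_exp
    by (auto intro!: derivative_eq_intros DERIV_chain2[OF g] poly_DERIV) (auto simp: field_simps)
  have cf: "continuous_on UNIV f"
    unfolding f_def std_normal_exp by (intro continuous_intros cc gc g') auto
  have i: "integrable lborel f"
    unfolding f_def by (intro Bochner_Integration.integrable_diff integrable_mult_right i1 i2)
  obtain C where C: "C \<ge> 0" "\<And>y. \<bar>std_normal_density y * poly p y\<bar> \<le> C * exp (- (y\<^sup>2 / 4))"
    using std_normal_poly_bound by blast
  have Fb: "norm (F y) \<le> C * B * exp (- (1/4 * y\<^sup>2))" for y
  proof -
    have "\<bar>std_normal_density y * poly p y\<bar> * \<bar>g (a - \<sigma> * y)\<bar> \<le> (C * exp (- (y\<^sup>2 / 4))) * B"
      using C B by (intro mult_mono) auto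
    thus ?thesis by (simp add: F_def abs_mult mult_ac)
  qed
  have lim: "(F \<longlongrightarrow> 0) at_top" "(F \<longlongrightarrow> 0) at_bot"
    using exp_neg_square_tendsto[of "1/4"]
    by (auto intro!: Lim_null_comparison[OF always_eventually[OF allI[OF Fb]]] tendsto_mult_right_zero)
  have "0 = (\<integral>y. f y \<partial>lborel)"
    using integral_derivative_zero[OF dF cf i lim] by simp
  also have "\<dots> = (\<integral>y. std_normal_density y * poly (pderiv p - [:0, 1:] * p) y * g (a - \<sigma> * y) \<partial>lborel)
      - \<sigma> * (\<integral>y. std_normal_density y * poly p y * g' (a - \<sigma> * y) \<partial>lborel)"
    unfolding f_def by (subst Bochner_Integration.integral_diff[OF i1 integrable_mult_right[OF i2]]) simp
  finally show ?thesis by simp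
qed

text \<open>The polynomial \<open>q\<close> depends on \<open>k\<close> and \<open>p\<close> alone,
  hence the order of the quantifiers: constants derived from it are uniform in the datum, the centre
  and the width. The sequence \<open>G\<close> lists a function together with all its
  derivatives.\<close>

lemma std_normal_by_parts_iterated:
  "\<exists>q. \<forall>(G :: nat \<Rightarrow> real \<Rightarrow> real) B a \<sigma>.
      (\<forall>j y. (G j has_real_derivative G (Suc j) y) (at y)) \<longrightarrow> (\<forall>j y. \<bar>G j y\<bar> \<le> B j) \<longrightarrow>
      \<sigma> ^ k * (\<integral>y. std_normal_density y * poly p y * G k (a - \<sigma> * y) \<partial>lborel)
       = (\<integral>y. std_normal_density y * poly q y * G 0 (a - \<sigma> * y) \<partial>lborel)"
proof (induction k arbitrary: p)
  case 0
  show ?case by (rule exI[of _ p]) simp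
next
  case (Suc k)
  obtain q where q: "\<forall>(G :: nat \<Rightarrow> real \<Rightarrow> real) B a \<sigma>.
      (\<forall>j y. (G j has_real_derivative G (Suc j) y) (at y)) \<longrightarrow> (\<forall>j y. \<bar>G j y\<bar> \<le> B j) \<longrightarrow>
      \<sigma> ^ k * (\<integral>y. std_normal_density y * poly (pderiv p - [:0, 1:] * p) y * G k (a - \<sigma> * y) \<partial>lborel)
       = (\<integral>y. std_normal_density y * poly q y * G 0 (a - \<sigma> * y) \<partial>lborel)"
    using Suc.IH[of "pderiv p - [:0, 1:] * p"] by blast
  show ?case
  proof (intro exI[of _ q] allI impI)
    fix G :: "nat \<Rightarrow> real \<Rightarrow> real" and B a \<sigma>
    assume G: "\<forall>j y. (G j has_real_derivative G (Suc j) y) (at y)" and B: "\<forall>j y. \<bar>G j y\<bar> \<le> B j"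
    have c: "continuous_on UNIV (G (Suc k))"
      using G by (meson DERIV_isCont continuous_at_imp_continuous_on)
    have 1: "\<sigma> * (\<integral>y. std_normal_density y * poly p y * G (Suc k) (a - \<sigma> * y) \<partial>lborel)
       = (\<integral>y. std_normal_density y * poly (pderiv p - [:0, 1:] * p) y * G k (a - \<sigma> * y) \<partial>lborel)"
      by (rule std_normal_by_parts[OF _ c]) (use G B in auto)
    have "\<sigma> ^ Suc k * I = \<sigma> ^ k * (\<sigma> * I)" for I by simp
    note this[of "\<integral>y. std_normal_density y * poly p y * G (Suc k) (a - \<sigma> * y) \<partial>lborel", unfolded 1]
    also note q[THEN spec[of _ G], THEN spec[of _ B], THEN spec[of _ a], THEN spec[of _ \<sigma>], THEN mp, THEN mp, OF G B]
    finally show "\<sigma> ^ Suc k * (\<integral>y. std_normal_density y * poly p y * G (Suc k) (a - \<sigma> * y) \<partial>lborel)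
       = (\<integral>y. std_normal_density y * poly q y * G 0 (a - \<sigma> * y) \<partial>lborel)" .
  qed
qed

text \<open>Convolution with the drifting heat kernel, rescaled to the standard normal density. In
  this form duration 0 gives the identity, and joint continuity in \<open>d\<close> is proved
  without meeting a singular kernel.\<close>

definition heat :: "real \<Rightarrow> real \<Rightarrow> real \<Rightarrow> (real \<Rightarrow> real) \<Rightarrow> real \<Rightarrow> real" where
  "heat \<nu> l d g x = (\<integral>y. std_normal_density y * g (x - l * d - sqrt (\<nu> * d) * y) \<partial>lborel)"

lemma continuous_shift:
  fixes h :: "real \<Rightarrow> real" assumes "continuous_on UNIV h"
  shows "continuous_on UNIV (\<lambda>y. h (a - \<sigma> * y))"
  by (rule continuous_on_compose2[OF assms]) (auto intro!: continuous_intros)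

lemma heat_integrand_integrable:
  assumes g: "continuous_on UNIV g" and bd: "\<And>y. \<bar>g y\<bar> \<le> B"
  shows "integrable lborel (\<lambda>y. std_normal_density y * g (a - \<sigma> * y))"
  using std_normal_poly_integrable[OF borel_measurable_continuous_onI[OF continuous_shift[OF g]] bd, of 1]
  by simp

lemma heat_zero: "heat \<nu> l 0 g x = g x"
  by (simp add: heat_def)

lemma heat_bound:
  assumes g: "continuous_on UNIV g" and bd: "\<And>y. \<bar>g y\<bar> \<le> B"
  shows "\<bar>heat \<nu> l d g x\<bar> \<le> B"
proof -
  have "\<bar>heat \<nu> l d g x\<bar> \<le> (\<integral>y. std_normal_density y * B \<partial>lborel)"
    unfolding heat_def
    by (rule Bochner_Integration.integral_norm_bound_integral[where 'b = real, unfolded real_norm_def])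
       (auto intro!: heat_integrand_integrable[OF g bd] mult_left_mono bd simp: abs_mult)
  thus ?thesis by simp
qed

lemma heat_has_derivative:
  assumes g: "\<And>y. (g has_real_derivative g' y) (at y)" and g': "continuous_on UNIV g'"
    and B: "\<And>y. \<bar>g y\<bar> \<le> B" and B': "\<And>y. \<bar>g' y\<bar> \<le> B'"
  shows "(heat \<nu> l d g has_real_derivative heat \<nu> l d g' x) (at x)"
proof -
  have gc: "continuous_on UNIV g" using g by (meson DERIV_isCont continuous_at_imp_continuous_on)
  have "((\<lambda>t. \<integral>y. std_normal_density y * g (t - l * d - sqrt (\<nu> * d) * y) \<partial>lborel) has_real_derivative
        (\<integral>y. std_normal_density y * g' (x - l * d - sqrt (\<nu> * d) * y) \<partial>lborel)) (at x)"
  proof (rule has_real_derivative_integral[where a = "x - 1" and b = "x + 1" and B = "\<lambda>y. std_normal_density y * B'"])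
    show "integrable lborel (\<lambda>y. std_normal_density y * g (t - l * d - sqrt (\<nu> * d) * y))" for t
      by (rule heat_integrand_integrable[OF gc B])
    show "(\<lambda>y. std_normal_density y * g' (x - l * d - sqrt (\<nu> * d) * y)) \<in> borel_measurable lborel"
      using heat_integrand_integrable[OF g' B'] by auto
    show "((\<lambda>s. std_normal_density y * g (s - l * d - sqrt (\<nu> * d) * y)) has_real_derivative
        std_normal_density y * g' (t - l * d - sqrt (\<nu> * d) * y)) (at t)" for t y
      by (auto intro!: derivative_eq_intros DERIV_chain2[OF g])
  qed (use B' in \<open>auto simp: abs_mult intro!: mult_left_mono\<close>)
  thus ?thesis unfolding heat_def .
qed

lemma heat_continuous:
  fixes f :: "real \<Rightarrow> real \<Rightarrow> real"
  assumes f: "continuous_on (UNIV \<times> S) (\<lambda>(x, t). f x t)" and B: "\<And>x t. t \<in> S \<Longrightarrow> \<bar>f x t\<bar> \<le> B"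
  shows "continuous_on (UNIV \<times> UNIV \<times> S) (\<lambda>(x, d, t). heat \<nu> l d (\<lambda>y. f y t) x)"
proof -
  have fc: "continuous_on UNIV (\<lambda>y. f y t)" if "t \<in> S" for t
    by (rule continuous_on_compose2[OF f, of UNIV "\<lambda>y. (y, t)", simplified])
       (use that in \<open>auto intro!: continuous_intros\<close>)
  have c: "continuous_on (UNIV \<times> UNIV \<times> S) (\<lambda>p. f (fst p - l * fst (snd p) - sqrt (\<nu> * fst (snd p)) * y) (snd (snd p)))" for y
    by (rule continuous_on_compose2[OF f, of _ "\<lambda>p. (fst p - l * fst (snd p) - sqrt (\<nu> * fst (snd p)) * y, snd (snd p))", simplified])
       (auto intro!: continuous_intros)
  have "continuous_on (UNIV \<times> UNIV \<times> S) (\<lambda>p. \<integral>y. std_normal_density y * f (fst p - l * fst (snd p) - sqrt (\<nu> * fst (snd p)) * y) (snd (snd p)) \<partial>lborel)"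
  proof (rule continuous_on_integral_dominated[where B = "\<lambda>y. std_normal_density y * B"])
    show "(\<lambda>y. std_normal_density y * f (fst p - l * fst (snd p) - sqrt (\<nu> * fst (snd p)) * y) (snd (snd p))) \<in> borel_measurable lborel"
      if "p \<in> UNIV \<times> UNIV \<times> S" for p
    proof -
      have "snd (snd p) \<in> S" using that by auto
      from heat_integrand_integrable[OF fc[OF this] B[OF this]] show ?thesis by auto
    qed
  qed (use B in \<open>auto simp: abs_mult intro!: mult_left_mono continuous_intros c\<close>)
  thus ?thesis by (simp add: heat_def case_prod_unfold)
qed

text \<open>Differentiating sqrt(\<nu> d) brings down a factor \<open>y\<close>. Integration by
  parts trades it for sqrt(\<nu> d) and a second space derivative, so the factor that is singular at
  d = 0 cancels.\<close>

lemma heat_has_time_derivative: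
  assumes d: "d > 0" and nu: "\<nu> > 0"
    and g: "\<And>y. (g has_real_derivative g' y) (at y)" and g': "\<And>y. (g' has_real_derivative g'' y) (at y)"
    and g'': "continuous_on UNIV g''"
    and B: "\<And>y. \<bar>g y\<bar> \<le> B" and B': "\<And>y. \<bar>g' y\<bar> \<le> B'" and B'': "\<And>y. \<bar>g'' y\<bar> \<le> B''"
  shows "((\<lambda>d. heat \<nu> l d g x) has_real_derivative
           - l * heat \<nu> l d g' x + \<nu> / 2 * heat \<nu> l d g'' x) (at d)"
proof -
  have gc: "continuous_on UNIV g" using g by (meson DERIV_isCont continuous_at_imp_continuous_on)
  have gc': "continuous_on UNIV g'" using g' by (meson DERIV_isCont continuous_at_imp_continuous_on)
  define \<gamma> where "\<gamma> = std_normal_density"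
  define s where "s t = sqrt (\<nu> * t)" for t
  have s0: "s t > 0" if "t > 0" for t using that nu by (simp add: s_def)
  define f' where "f' t y = \<gamma> y * g' (x - l * t - s t * y) * (- l - \<nu> / (2 * s t) * y)" for t y
  have g0: "\<gamma> y \<ge> 0" for y by (simp add: \<gamma>_def)
  have B'0: "B' \<ge> 0" using B'[of 0] by linarith
  have iy: "integrable lborel (\<lambda>y. \<gamma> y * \<bar>y\<bar>)" "integrable lborel \<gamma>"
    using integrable_normal_moment_abs[of 1 0 1] by (auto simp: \<gamma>_def)
  have ds: "(s has_real_derivative \<nu> / (2 * s t)) (at t)" if "t > 0" for t
  proof -
    have "((\<lambda>t. \<nu> * t) has_real_derivative \<nu>) (at t)" by (auto intro!: derivative_eq_intros)
    from DERIV_chain2[OF DERIV_real_sqrt[OF mult_pos_pos[OF nu that]] this] show ?thesis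
      unfolding s_def by (simp add: field_simps)
  qed
  \<comment> \<open>Near \<open>d\<close> the width \<open>s t\<close> stays above
    \<open>s (d/2)\<close>, which yields an integrable bound independent of
    \<open>t\<close>.\<close>
  have bnd: "\<bar>f' t y\<bar> \<le> B' * (\<gamma> y * \<bar>l\<bar> + \<nu> / (2 * s (d/2)) * (\<gamma> y * \<bar>y\<bar>))" if "t \<in> {d/2<..<2*d}" for t y
  proof -
    have t: "t > 0" using that d by auto
    have "s (d/2) \<le> s t" using that nu by (simp add: s_def)
    hence "\<nu> / (2 * s t) \<le> \<nu> / (2 * s (d/2))" using nu s0[of "d/2"] d by (intro divide_left_mono) auto
    hence "\<bar>- l - \<nu> / (2 * s t) * y\<bar> \<le> \<bar>l\<bar> + \<nu> / (2 * s (d/2)) * \<bar>y\<bar>"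
      using nu s0[OF t] abs_triangle_ineq4[of "-l" "\<nu> / (2 * s t) * y"] mult_right_mono[of "\<nu> / (2 * s t)" "\<nu> / (2 * s (d/2))" "\<bar>y\<bar>"]
      by (auto simp: abs_mult)
    hence "\<bar>f' t y\<bar> \<le> \<gamma> y * B' * (\<bar>l\<bar> + \<nu> / (2 * s (d/2)) * \<bar>y\<bar>)"
      unfolding f'_def abs_mult using g0 B' B'0 by (intro mult_mono) auto
    thus ?thesis by (simp add: algebra_simps)
  qed
  have i1: "integrable lborel (\<lambda>y. \<gamma> y * g' (x - l * d - s d * y))"
    unfolding \<gamma>_def by (rule heat_integrand_integrable[OF gc' B'])
  have i2: "integrable lborel (\<lambda>y. \<gamma> y * y * g' (x - l * d - s d * y))"
    unfolding \<gamma>_def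
    using std_normal_poly_integrable[OF borel_measurable_continuous_onI[OF continuous_shift[OF gc']] B', of "[:0, 1:]"]
    by simp
  have "((\<lambda>t. \<integral>y. \<gamma> y * g (x - l * t - s t * y) \<partial>lborel) has_real_derivative (\<integral>y. f' d y \<partial>lborel)) (at d)"
  proof (rule has_real_derivative_integral[OF _ _ _ _ bnd])
    show "integrable lborel (\<lambda>y. \<gamma> y * g (x - l * t - s t * y))" for t
      unfolding \<gamma>_def by (rule heat_integrand_integrable[OF gc B])
    show "f' d \<in> borel_measurable lborel"
      using borel_measurable_integrable[OF i1] unfolding f'_def by measurable
    show "((\<lambda>t. \<gamma> y * g (x - l * t - s t * y)) has_real_derivative f' t y) (at t)" if "t \<in> {d/2<..<2*d}" for t y
    proof -
      have t: "t > 0" using that d by auto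
      have "((\<lambda>t. x - l * t - s t * y) has_real_derivative (- l - \<nu> / (2 * s t) * y)) (at t)"
        by (auto intro!: derivative_eq_intros ds t)
      from DERIV_cmult[OF DERIV_chain2[OF g this], of "\<gamma> y"] show ?thesis
        by (simp add: f'_def mult.assoc)
    qed
    show "integrable lborel (\<lambda>y. B' * (\<gamma> y * \<bar>l\<bar> + \<nu> / (2 * s (d/2)) * (\<gamma> y * \<bar>y\<bar>)))"
      using iy by (intro integrable_mult_right Bochner_Integration.integrable_add integrable_mult_left) auto
  qed (use d in auto)
  also have "(\<integral>y. f' d y \<partial>lborel) = (\<integral>y. - l * (\<gamma> y * g' (x - l * d - s d * y)) - \<nu> / (2 * s d) * (\<gamma> y * y * g' (x - l * d - s d * y)) \<partial>lborel)"
    by (rule Bochner_Integration.integral_cong) (auto simp: f'_def algebra_simps)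
  also have "\<dots> = - l * heat \<nu> l d g' x - \<nu> / (2 * s d) * (\<integral>y. \<gamma> y * y * g' (x - l * d - s d * y) \<partial>lborel)"
    using i1 i2 by (simp add: heat_def \<gamma>_def s_def)
  \<comment> \<open>By parts with the constant polynomial 1, for which p' - y p is just -y.\<close>
  also have "(\<integral>y. \<gamma> y * y * g' (x - l * d - s d * y) \<partial>lborel) = - s d * heat \<nu> l d g'' x"
    using std_normal_by_parts[OF g' g'' B' B'', of "s d" 1 "x - l * d"]
    by (simp add: heat_def \<gamma>_def s_def mult.assoc)
  also have "- l * heat \<nu> l d g' x - \<nu> / (2 * s d) * (- s d * heat \<nu> l d g'' x)
      = - l * heat \<nu> l d g' x + \<nu> / 2 * heat \<nu> l d g'' x"
    using s0[OF d] by (simp add: field_simps)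
  finally show ?thesis unfolding heat_def \<gamma>_def s_def .
qed

section \<open>Duhamel's integral\<close>

text \<open>The substitution s = a + (t - a) r moves the variable limit into the integrand, so that
  continuity in parameters over a fixed interval applies.\<close>

lemma continuous_on_integral_upper_limit:
  fixes k :: "'p::topological_space \<Rightarrow> real \<Rightarrow> real"
  assumes k: "continuous_on (P \<times> {a..}) (\<lambda>(p, s). k p s)"
  shows "continuous_on (P \<times> {a..}) (\<lambda>(p, t). integral {a..t} (k p))"
proof -
  have eq: "integral {a..t} (k p) = (t - a) * integral (cbox 0 1) (\<lambda>r. k p (a + (t - a) * r))"
    if "t \<ge> a" "p \<in> P" for p t
  proof -
    have kp: "continuous_on {a..t} (k p)"
      by (rule continuous_on_compose2[OF k, of _ "\<lambda>s. (p, s)", simplified])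
         (use that in \<open>auto intro!: continuous_intros\<close>)
    have "((\<lambda>r. (t - a) *\<^sub>R k p (a + (t - a) * r)) has_integral integral {a + (t - a) * 0..a + (t - a) * 1} (k p)) {0..1}"
    proof (rule has_integral_substitution[where c = a and d = t])
      show "(\<lambda>r. a + (t - a) * r) ` {0..1} \<subseteq> {a..t}"
      proof (rule image_subsetI)
        fix r :: real assume "r \<in> {0..1}"
        hence r: "0 \<le> r" "r \<le> 1" by auto
        have "(t - a) * r \<le> t - a" using that r by (intro mult_left_le) auto
        thus "a + (t - a) * r \<in> {a..t}" using that r by simp
      qed
    qed (use that kp in \<open>auto intro!: derivative_eq_intros\<close>)
    hence "((\<lambda>r. (t - a) * k p (a + (t - a) * r)) has_integral integral {a..t} (k p)) {0..1}" by simp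
    from integral_unique[OF this] show ?thesis by simp
  qed
  have "continuous_on (P \<times> {a..}) (\<lambda>q. integral (cbox 0 1) (\<lambda>r. k (fst q) (a + (snd q - a) * r)))"
    by (rule integral_continuous_on_param)
       (auto intro!: continuous_on_compose2[OF k, of _ "\<lambda>z. (fst (fst z), a + (snd (fst z) - a) * snd z)", simplified] continuous_intros
         simp: case_prod_unfold)
  hence "continuous_on (P \<times> {a..}) (\<lambda>q. (snd q - a) * integral (cbox 0 1) (\<lambda>r. k (fst q) (a + (snd q - a) * r)))"
    by (intro continuous_intros)
  thus ?thesis
    by (rule continuous_on_eq) (use eq in \<open>auto simp: case_prod_unfold\<close>)
qed

text \<open>The kernel is assumed differentiable in \<open>t\<close> only off the diagonal, since
  the heat semigroup is known to be merely continuous at duration 0. For \<open>r < t\<close> the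
  increment is split at \<open>r\<close>: on [a, r] Leibniz' rule and the mean value theorem apply,
  and the piece from \<open>r\<close> to \<open>t\<close> is treated by the fundamental theorem with
  \<open>t\<close> frozen in the kernel.\<close>

lemma has_left_derivative_integral_diagonal:
  fixes k k2 :: "real \<Rightarrow> real \<Rightarrow> real"
  assumes k: "continuous_on (UNIV \<times> {a..}) (\<lambda>(t, s). k t s)"
    and k2: "continuous_on (UNIV \<times> {a..}) (\<lambda>(t, s). k2 t s)"
    and d: "\<And>t s. a \<le> s \<Longrightarrow> s < t \<Longrightarrow> ((\<lambda>t. k t s) has_real_derivative k2 t s) (at t)"
    and t: "a < t"
  shows "((\<lambda>t. integral {a..t} (k t)) has_real_derivative k t t + integral {a..t} (k2 t)) (at_left t)"
proof -
  define \<Phi> where "\<Phi> r t = integral {a..r} (k t)" for r t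
  define \<Phi>2 where "\<Phi>2 r t = integral {a..r} (k2 t)" for r t
  have c\<Phi>: "continuous_on (UNIV \<times> {a..}) (\<lambda>(t, r). \<Phi> r t)"
    unfolding \<Phi>_def by (rule continuous_on_integral_upper_limit[OF k])
  have c\<Phi>2: "continuous_on (UNIV \<times> {a..}) (\<lambda>(t, r). \<Phi>2 r t)"
    unfolding \<Phi>2_def by (rule continuous_on_integral_upper_limit[OF k2])
  have ks: "continuous_on {a..} (k t)" for t
    by (rule continuous_on_compose2[OF k, of _ "\<lambda>s. (t, s)", simplified]) (auto intro!: continuous_intros)
  have dx: "((\<lambda>t. \<Phi> r t) has_real_derivative \<Phi>2 r t) (at t)" if "a \<le> r" "r < t" for r t
  proof -
    have "((\<lambda>t. integral (cbox a r) (k t)) has_real_derivative integral (cbox a r) (k2 t)) (at t within {r<..})"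
    proof (rule leibniz_rule_field_derivative)
      show "((\<lambda>t. k t s) has_real_derivative k2 t s) (at t within {r<..})" if "t \<in> {r<..}" "s \<in> cbox a r" for t s
        using that by (auto intro!: has_field_derivative_at_within[OF d])
      show "k t integrable_on cbox a r" for t
        by (intro integrable_continuous continuous_on_subset[OF ks]) auto
      show "continuous_on ({r<..} \<times> cbox a r) (\<lambda>(t, s). k2 t s)"
        by (rule continuous_on_subset[OF k2]) auto
    qed (use that in auto)
    moreover have "at t within {r<..} = at t" using that by (metis at_within_open greaterThan_iff open_greaterThan)
    ultimately show ?thesis by (simp add: \<Phi>_def \<Phi>2_def)
  qed
  have "\<exists>z. r < z \<and> z < t \<and> \<Phi> r t - \<Phi> r r = (t - r) * \<Phi>2 r z" if "a \<le> r" "r < t" for r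
  proof -
    have "continuous_on {r..t} (\<Phi> r)"
      by (rule continuous_on_compose2[OF c\<Phi>, of _ "\<lambda>t. (t, r)", simplified])
         (use that in \<open>auto intro!: continuous_intros\<close>)
    moreover have "\<And>s. r < s \<Longrightarrow> s < t \<Longrightarrow> (\<Phi> r has_derivative (*) (\<Phi>2 r s)) (at s)"
      using dx that by (simp add: has_field_derivative_def)
    ultimately obtain z where "z > r" "z < t" "\<Phi> r t - \<Phi> r r = \<Phi>2 r z * (t - r)"
      using mvt[OF \<open>r < t\<close>, of "\<Phi> r" "\<lambda>s. (*) (\<Phi>2 r s)"] by blast
    thus ?thesis by (auto simp: mult.commute)
  qed
  then obtain z where z: "\<And>r. a \<le> r \<Longrightarrow> r < t \<Longrightarrow> r < z r \<and> z r < t \<and> \<Phi> r t - \<Phi> r r = (t - r) * \<Phi>2 r (z r)"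
    by metis
  have ev: "eventually (\<lambda>r. r \<in> {a<..<t}) (at_left t)" using t by (rule eventually_at_left_real)
  have zlim: "(z \<longlongrightarrow> t) (at_left t)"
  proof (rule tendsto_sandwich[of "\<lambda>r. r" _ _ "\<lambda>_. t"])
    show "eventually (\<lambda>r. r \<le> z r) (at_left t)" "eventually (\<lambda>r. z r \<le> t) (at_left t)"
      using z by (auto intro!: eventually_mono[OF ev] less_imp_le)
  qed auto
  have "((\<lambda>r. \<Phi>2 r (z r)) \<longlongrightarrow> \<Phi>2 t t) (at_left t)"
  proof -
    have "((\<lambda>r. (z r, r)) \<longlongrightarrow> (t, t)) (at_left t)" by (intro tendsto_Pair zlim tendsto_ident_at)
    moreover have "eventually (\<lambda>r. (z r, r) \<in> UNIV \<times> {a..}) (at_left t)"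
      by (rule eventually_mono[OF ev]) auto
    ultimately show ?thesis
      using continuous_on_tendsto_compose[OF c\<Phi>2, of "\<lambda>r. (z r, r)" "(t, t)" "at_left t"] t by simp
  qed
  moreover have "((\<lambda>r. (\<Phi> r t - \<Phi> t t) / (r - t)) \<longlongrightarrow> k t t) (at_left t)"
  proof -
    have "((\<lambda>r. \<Phi> r t) has_real_derivative k t t) (at t within {a..t})"
      unfolding \<Phi>_def
      by (rule integral_has_real_derivative) (use t in \<open>auto intro: continuous_on_subset[OF ks]\<close>)
    thus ?thesis using t by (simp add: has_field_derivative_iff at_within_Icc_at_left)
  qed
  ultimately have lim: "((\<lambda>r. \<Phi>2 r (z r) + (\<Phi> r t - \<Phi> t t) / (r - t)) \<longlongrightarrow> \<Phi>2 t t + k t t) (at_left t)"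
    by (intro tendsto_add)
  have "eventually (\<lambda>r. \<Phi>2 r (z r) + (\<Phi> r t - \<Phi> t t) / (r - t) = (\<Phi> r r - \<Phi> t t) / (r - t)) (at_left t)"
    using ev
  proof eventually_elim
    case (elim r)
    hence "\<Phi> r t - \<Phi> r r = (t - r) * \<Phi>2 r (z r)" using z by auto
    thus ?case using elim by (simp add: field_simps)
  qed
  from Lim_transform_eventually[OF lim this] show ?thesis
    unfolding has_field_derivative_iff by (simp add: \<Phi>_def \<Phi>2_def add.commute)
qed

definition duhamel :: "real \<Rightarrow> real \<Rightarrow> real \<Rightarrow> (real \<Rightarrow> real \<Rightarrow> real) \<Rightarrow> real \<Rightarrow> real \<Rightarrow> real" where
  "duhamel \<nu> l a f x t = integral {a..t} (\<lambda>s. heat \<nu> l (t - s) (\<lambda>y. f y s) x)"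

definition bounded_continuous :: "real \<Rightarrow> (real \<Rightarrow> real \<Rightarrow> real) \<Rightarrow> bool" where
  "bounded_continuous a f \<longleftrightarrow> continuous_on (UNIV \<times> {a..}) (\<lambda>(x, t). f x t) \<and>
     (\<exists>B. \<forall>x. \<forall>t\<ge>a. \<bar>f x t\<bar> \<le> B)"

lemma bounded_continuous_mono: "bounded_continuous a f \<Longrightarrow> a \<le> b \<Longrightarrow> bounded_continuous b f"
  unfolding bounded_continuous_def
  by (meson Sigma_mono atLeast_subset_iff continuous_on_subset order_refl order_trans)

lemma bounded_continuous_slice:
  assumes "bounded_continuous a f" "t \<ge> a"
  shows "continuous_on UNIV (\<lambda>y. f y t)"
  by (rule continuous_on_compose2[of "UNIV \<times> {a..}" "\<lambda>(x, t). f x t" _ "\<lambda>y. (y, t)", simplified])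
     (use assms in \<open>auto simp: bounded_continuous_def intro!: continuous_intros\<close>)

lemma duhamel_integrand_continuous:
  assumes f: "bounded_continuous a f"
  shows "continuous_on ((UNIV \<times> UNIV) \<times> {a..}) (\<lambda>((x, t), s). heat \<nu> l (t - s) (\<lambda>y. f y s) x)"
proof -
  obtain B where B: "\<And>x t. t \<in> {a..} \<Longrightarrow> \<bar>f x t\<bar> \<le> B"
    and c: "continuous_on (UNIV \<times> {a..}) (\<lambda>(x, t). f x t)"
    using f by (auto simp: bounded_continuous_def)
  have "continuous_on ((UNIV \<times> UNIV) \<times> {a..}) (\<lambda>z. heat \<nu> l (snd (fst z) - snd z) (\<lambda>y. f y (snd z)) (fst (fst z)))"
    by (rule continuous_on_compose2[OF heat_continuous[OF c B],
          of _ "\<lambda>z. (fst (fst z), snd (fst z) - snd z, snd z)", simplified])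
       (auto intro!: continuous_intros)
  thus ?thesis by (simp add: case_prod_unfold)
qed

lemma duhamel_integrand_continuous_time:
  assumes f: "bounded_continuous a f"
  shows "continuous_on {a..} (\<lambda>s. heat \<nu> l (t - s) (\<lambda>y. f y s) x)"
  by (rule continuous_on_compose2[OF duhamel_integrand_continuous[OF f], of _ "\<lambda>s. ((x, t), s)", simplified])
     (auto intro!: continuous_intros)

lemma duhamel_integrand_integrable:
  assumes f: "bounded_continuous a f" and "a \<le> b"
  shows "(\<lambda>s. heat \<nu> l (t - s) (\<lambda>y. f y s) x) integrable_on {b..c}"
  by (intro integrable_continuous_interval continuous_on_subset[OF duhamel_integrand_continuous_time[OF f]])
     (use assms in auto)

lemma duhamel_continuous:
  assumes "bounded_continuous a f"
  shows "continuous_on (UNIV \<times> {a..}) (\<lambda>(x, t). duhamel \<nu> l a f x t)"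
proof -
  \<comment> \<open>Time enters twice, as the limit and in the kernel. The two roles are kept apart
    as \<open>r\<close> and \<open>snd p\<close> and identified only afterwards.\<close>
  have c: "continuous_on ((UNIV \<times> UNIV) \<times> {a..}) (\<lambda>(p, r). integral {a..r} (\<lambda>s. heat \<nu> l (snd p - s) (\<lambda>y. f y s) (fst p)))"
    by (rule continuous_on_integral_upper_limit)
       (use duhamel_integrand_continuous[OF assms] in \<open>simp add: case_prod_unfold\<close>)
  have "continuous_on (UNIV \<times> {a..}) (\<lambda>z. duhamel \<nu> l a f (fst z) (snd z))"
    unfolding duhamel_def
    by (rule continuous_on_compose2[OF c, of _ "\<lambda>z. (z, snd z)", simplified])
       (auto intro!: continuous_intros)
  thus ?thesis by (simp add: case_prod_unfold)
qed

lemma duhamel_has_derivative: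
  assumes f: "bounded_continuous a f" and f': "bounded_continuous a f'"
    and d: "\<And>x t. t \<ge> a \<Longrightarrow> ((\<lambda>y. f y t) has_real_derivative f' x t) (at x)"
  shows "((\<lambda>x. duhamel \<nu> l a f x t) has_real_derivative duhamel \<nu> l a f' x t) (at x)"
proof -
  obtain B B' where B: "\<And>x t. t \<ge> a \<Longrightarrow> \<bar>f x t\<bar> \<le> B" "\<And>x t. t \<ge> a \<Longrightarrow> \<bar>f' x t\<bar> \<le> B'"
    using f f' by (auto simp: bounded_continuous_def)
  have "((\<lambda>x. integral (cbox a t) (\<lambda>s. heat \<nu> l (t - s) (\<lambda>y. f y s) x)) has_real_derivative
        integral (cbox a t) (\<lambda>s. heat \<nu> l (t - s) (\<lambda>y. f' y s) x)) (at x within UNIV)"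
  proof (rule leibniz_rule_field_derivative)
    show "((\<lambda>x. heat \<nu> l (t - s) (\<lambda>y. f y s) x) has_real_derivative heat \<nu> l (t - s) (\<lambda>y. f' y s) x) (at x)"
      if "s \<in> cbox a t" for s x
      using that B by (intro heat_has_derivative[where B = B and B' = B'] d bounded_continuous_slice[OF f']) auto
    show "(\<lambda>s. heat \<nu> l (t - s) (\<lambda>y. f y s) x) integrable_on cbox a t" for x
      using duhamel_integrand_integrable[OF f order_refl] by simp
    have "continuous_on (UNIV \<times> cbox a t) (\<lambda>z. heat \<nu> l (t - snd z) (\<lambda>y. f' y (snd z)) (fst z))"
      by (rule continuous_on_compose2[OF duhamel_integrand_continuous[OF f'], of _ "\<lambda>z. ((fst z, t), snd z)", simplified])
         (auto intro!: continuous_intros)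
    thus "continuous_on (UNIV \<times> cbox a t) (\<lambda>(x, s). heat \<nu> l (t - s) (\<lambda>y. f' y s) x)"
      by (simp add: case_prod_unfold)
  qed auto
  thus ?thesis by (simp add: duhamel_def)
qed

lemma duhamel_bound:
  assumes f: "bounded_continuous a f" and B: "\<And>x t. t \<ge> a \<Longrightarrow> \<bar>f x t\<bar> \<le> B" and t: "t \<ge> a"
  shows "\<bar>duhamel \<nu> l a f x t\<bar> \<le> B * (t - a)"
proof -
  have "norm (integral {a..t} (\<lambda>s. heat \<nu> l (t - s) (\<lambda>y. f y s) x)) \<le> integral {a..t} (\<lambda>s. B)"
    by (rule Henstock_Kurzweil_Integration.integral_norm_bound_integral[OF duhamel_integrand_integrable[OF f order_refl]])
       (auto intro!: heat_bound[OF bounded_continuous_slice[OF f]] B)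
  thus ?thesis using t by (simp add: duhamel_def mult.commute)
qed

lemma duhamel_has_left_derivative:
  assumes nu: "\<nu> > 0" and f: "bounded_continuous a f" and f': "bounded_continuous a f'" and f'': "bounded_continuous a f''"
    and d: "\<And>x t. t \<ge> a \<Longrightarrow> ((\<lambda>y. f y t) has_real_derivative f' x t) (at x)"
    and d': "\<And>x t. t \<ge> a \<Longrightarrow> ((\<lambda>y. f' y t) has_real_derivative f'' x t) (at x)"
    and t: "t > a"
  shows "((\<lambda>t. duhamel \<nu> l a f x t) has_real_derivative
           f x t - l * duhamel \<nu> l a f' x t + \<nu> / 2 * duhamel \<nu> l a f'' x t) (at_left t)"
proof -
  define k where "k t s = heat \<nu> l (t - s) (\<lambda>y. f y s) x" for t s
  define k2 where "k2 t s = - l * heat \<nu> l (t - s) (\<lambda>y. f' y s) x + \<nu> / 2 * heat \<nu> l (t - s) (\<lambda>y. f'' y s) x" for t s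
  obtain B B' B'' where B: "\<And>x t. t \<ge> a \<Longrightarrow> \<bar>f x t\<bar> \<le> B" "\<And>x t. t \<ge> a \<Longrightarrow> \<bar>f' x t\<bar> \<le> B'"
      "\<And>x t. t \<ge> a \<Longrightarrow> \<bar>f'' x t\<bar> \<le> B''"
    using f f' f'' by (auto simp: bounded_continuous_def)
  have c: "continuous_on (UNIV \<times> {a..}) (\<lambda>z. heat \<nu> l (fst z - snd z) (\<lambda>y. g y (snd z)) x)"
    if "bounded_continuous a g" for g
    by (rule continuous_on_compose2[OF duhamel_integrand_continuous[OF that], of _ "\<lambda>z. ((x, fst z), snd z)", simplified])
       (auto intro!: continuous_intros)
  have "((\<lambda>t. integral {a..t} (k t)) has_real_derivative k t t + integral {a..t} (k2 t)) (at_left t)"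
  proof (rule has_left_derivative_integral_diagonal[OF _ _ _ t])
    show "continuous_on (UNIV \<times> {a..}) (\<lambda>(t, s). k t s)" "continuous_on (UNIV \<times> {a..}) (\<lambda>(t, s). k2 t s)"
      unfolding k_def k2_def case_prod_unfold by (intro continuous_intros c f f' f'')+
    show "((\<lambda>t. k t s) has_real_derivative k2 t s) (at t)" if "a \<le> s" "s < t" for t s
    proof -
      have "((\<lambda>d. heat \<nu> l d (\<lambda>y. f y s) x) has_real_derivative
           - l * heat \<nu> l (t - s) (\<lambda>y. f' y s) x + \<nu> / 2 * heat \<nu> l (t - s) (\<lambda>y. f'' y s) x) (at (t - s))"
        by (rule heat_has_time_derivative[where B = B and B' = B' and B'' = B''])
           (use that nu B d d' bounded_continuous_slice[OF f''] in auto)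
      moreover have "((\<lambda>t. t - s) has_real_derivative 1) (at t)"
        by (auto intro!: derivative_eq_intros)
      ultimately have "((\<lambda>t. heat \<nu> l (t - s) (\<lambda>y. f y s) x) has_real_derivative
          (- l * heat \<nu> l (t - s) (\<lambda>y. f' y s) x + \<nu> / 2 * heat \<nu> l (t - s) (\<lambda>y. f'' y s) x) * 1) (at t)"
        by (rule DERIV_chain2)
      thus ?thesis by (simp add: k_def k2_def)
    qed
  qed
  moreover have "integral {a..t} (k2 t) = - l * duhamel \<nu> l a f' x t + \<nu> / 2 * duhamel \<nu> l a f'' x t"
    unfolding k2_def duhamel_def
    by (subst Henstock_Kurzweil_Integration.integral_add
          [OF integrable_on_mult_right[OF duhamel_integrand_integrable[OF f' order_refl]]
              integrable_on_mult_right[OF duhamel_integrand_integrable[OF f'' order_refl]]])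
       (simp only: Henstock_Kurzweil_Integration.integral_mult_right)
  moreover have "(\<lambda>t. integral {a..t} (k t)) = (\<lambda>t. duhamel \<nu> l a f x t)"
    by (simp add: k_def[abs_def] duhamel_def)
  moreover have "k t t = f x t" by (simp add: k_def heat_zero)
  ultimately show ?thesis by (simp add: algebra_simps)
qed

section \<open>Parabolic smoothing of Gaussian data\<close>

text \<open>Completing the square. The flow turns the width D S into P = D S + 4 \<nu> (T - S), and
  \<open>D \<ge> 4 * \<nu>\<close> gives P \<le> D T: Gaussians whose width is D times the shifted
  time form a class stable under the flow. The lower bound P \<ge> 4 \<nu> T yields the ratio sqrt S
  / sqrt T, which reflects conservation of mass.\<close>

lemma gaussian_convolution_bound:
  fixes D \<nu> S T a :: real
  assumes nu: "\<nu> > 0" and D: "D \<ge> 4 * \<nu>" and S: "0 < S" "S \<le> T"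
  defines "\<sigma> \<equiv> sqrt (\<nu> * (T - S))"
  shows "integrable lborel (\<lambda>y. exp (- (y\<^sup>2 / 4)) * exp (- ((a - \<sigma> * y)\<^sup>2 / (D * S))))"
    and "(\<integral>y. exp (- (y\<^sup>2 / 4)) * exp (- ((a - \<sigma> * y)\<^sup>2 / (D * S))) \<partial>lborel)
      \<le> sqrt (pi * D / \<nu>) * (sqrt S / sqrt T) * exp (- (a\<^sup>2 / (D * T)))"
proof -
  define P where "P = D * S + 4 * \<sigma>\<^sup>2"
  have D0: "D > 0" using nu D by linarith
  have \<sigma>: "\<sigma>\<^sup>2 = \<nu> * (T - S)" using nu S by (simp add: \<sigma>_def)
  have DS: "D * S > 0" using D0 S by simp
  have P: "P \<le> D * T" "4 * \<nu> * T \<le> P"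
  proof -
    have "4 * \<nu> * (T - S) \<le> D * (T - S)" using D S by (intro mult_right_mono) auto
    thus "P \<le> D * T" by (simp add: P_def \<sigma> algebra_simps)
    have "4 * \<nu> * S \<le> D * S" using D S by (intro mult_right_mono) auto
    thus "4 * \<nu> * T \<le> P" by (simp add: P_def \<sigma> algebra_simps)
  qed
  have T: "T > 0" using S by simp
  have P0: "P > 0" using P(2) mult_pos_pos[OF nu T] by linarith
  define A where "A = P / (4 * (D * S))"
  have A: "A > 0" using P0 DS by (simp add: A_def)
  define m where "m = 4 * a * \<sigma> / P"
  have eq: "exp (- (y\<^sup>2 / 4)) * exp (- ((a - \<sigma> * y)\<^sup>2 / (D * S)))
      = exp (- (a\<^sup>2 / P)) * exp (- (A * (y - m)\<^sup>2))" for y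
  proof -
    have "y\<^sup>2 / 4 + (a - \<sigma> * y)\<^sup>2 / q = a\<^sup>2 / (q + 4 * \<sigma>\<^sup>2) + (q + 4 * \<sigma>\<^sup>2) / (4 * q) * (y - 4 * a * \<sigma> / (q + 4 * \<sigma>\<^sup>2))\<^sup>2"
      if "q > 0" for q
    proof -
      define r where "r = q + 4 * \<sigma>\<^sup>2"
      have r: "r > 0" using that by (simp add: r_def add_pos_nonneg)
      have q: "q = r - 4 * \<sigma>\<^sup>2" by (simp add: r_def)
      have 1: "(y - 4 * a * \<sigma> / r)\<^sup>2 = (r * y - 4 * a * \<sigma>)\<^sup>2 / r\<^sup>2"
      proof -
        have "y - 4 * a * \<sigma> / r = (r * y - 4 * a * \<sigma>) / r" using r by (simp add: diff_divide_distrib)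
        thus ?thesis by (simp only: power_divide)
      qed
      have "r / (4 * q) * (X / r\<^sup>2) + a\<^sup>2 / r = (X + 4 * q * a\<^sup>2) / (4 * q * r)" for X
        using r that by (simp add: divide_simps) (simp add: algebra_simps power2_eq_square)
      hence "r / (4 * q) * ((r * y - 4 * a * \<sigma>)\<^sup>2 / r\<^sup>2) + a\<^sup>2 / r = ((r * y - 4 * a * \<sigma>)\<^sup>2 + 4 * q * a\<^sup>2) / (4 * q * r)" .
      also have "(r * y - 4 * a * \<sigma>)\<^sup>2 + 4 * q * a\<^sup>2 = r * (q * y\<^sup>2 + 4 * (a - \<sigma> * y)\<^sup>2)"
        unfolding q by (simp add: algebra_simps power2_eq_square)
      also have "\<dots> / (4 * q * r) = y\<^sup>2 / 4 + (a - \<sigma> * y)\<^sup>2 / q"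
        using r that by (simp add: field_simps)
      finally show ?thesis using 1 by (simp add: r_def)
    qed
    from this[OF DS] show ?thesis
      by (simp add: A_def m_def P_def flip: exp_add)
  qed
  show "integrable lborel (\<lambda>y. exp (- (y\<^sup>2 / 4)) * exp (- ((a - \<sigma> * y)\<^sup>2 / (D * S))))"
    unfolding eq using gaussian_integral(1)[OF A] by (intro integrable_mult_right)
  have "(\<integral>y. exp (- (y\<^sup>2 / 4)) * exp (- ((a - \<sigma> * y)\<^sup>2 / (D * S))) \<partial>lborel) = exp (- (a\<^sup>2 / P)) * sqrt (pi / A)"
    unfolding eq using gaussian_integral(2)[OF A] by simp
  also have "\<dots> \<le> exp (- (a\<^sup>2 / (D * T))) * (sqrt (pi * D / \<nu>) * (sqrt S / sqrt T))"
  proof (intro mult_mono)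
    show "exp (- (a\<^sup>2 / P)) \<le> exp (- (a\<^sup>2 / (D * T)))"
      using P P0 D0 T by (auto intro!: divide_left_mono mult_pos_pos)
    have "pi / A = pi * D * S * 4 / P" using P0 DS by (simp add: A_def field_simps)
    also have "\<dots> \<le> pi * D * S * 4 / (4 * \<nu> * T)"
      using P nu T D0 S P0 by (intro divide_left_mono) auto
    also have "\<dots> = (pi * D / \<nu>) * (S / T)" using nu T by (simp add: field_simps)
    finally have "sqrt (pi / A) \<le> sqrt ((pi * D / \<nu>) * (S / T))" by (rule real_sqrt_le_mono)
    thus "sqrt (pi / A) \<le> sqrt (pi * D / \<nu>) * (sqrt S / sqrt T)"
      by (simp only: real_sqrt_mult real_sqrt_divide)
  qed (use A in auto)
  finally show "(\<integral>y. exp (- (y\<^sup>2 / 4)) * exp (- ((a - \<sigma> * y)\<^sup>2 / (D * S))) \<partial>lborel)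
      \<le> sqrt (pi * D / \<nu>) * (sqrt S / sqrt T) * exp (- (a\<^sup>2 / (D * T)))"
    by (simp add: mult_ac)
qed

lemma std_normal_poly_gaussian_bound:
  fixes \<nu> D :: real
  assumes nu: "\<nu> > 0" and D: "D \<ge> 4 * \<nu>"
  shows "\<exists>C\<ge>0. \<forall>g S T a m W. 0 < S \<longrightarrow> S \<le> T \<longrightarrow> g \<in> borel_measurable borel \<longrightarrow>
     (\<forall>y. \<bar>g y\<bar> \<le> W * exp (- ((y - m)\<^sup>2 / (D * S)))) \<longrightarrow>
     \<bar>\<integral>y. std_normal_density y * poly p y * g (a - sqrt (\<nu> * (T - S)) * y) \<partial>lborel\<bar>
       \<le> C * W * (sqrt S / sqrt T) * exp (- ((a - m)\<^sup>2 / (D * T)))"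
proof -
  obtain C where C: "C \<ge> 0" "\<And>y. \<bar>std_normal_density y * poly p y\<bar> \<le> C * exp (- (y\<^sup>2 / 4))"
    using std_normal_poly_bound by blast
  show ?thesis
  proof (intro exI[of _ "C * sqrt (pi * D / \<nu>)"] conjI allI impI)
    show "C * sqrt (pi * D / \<nu>) \<ge> 0" using C nu D by simp
    fix g :: "real \<Rightarrow> real" and S T a m W :: real
    assume S: "0 < S" "S \<le> T" and [measurable]: "g \<in> borel_measurable borel"
      and g: "\<forall>y. \<bar>g y\<bar> \<le> W * exp (- ((y - m)\<^sup>2 / (D * S)))"
    define \<sigma> where "\<sigma> = sqrt (\<nu> * (T - S))"
    have W: "W \<ge> 0"
    proof -
      have "0 \<le> W * exp (- ((0 - m)\<^sup>2 / (D * S)))" using g[rule_format, of 0] by linarith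
      thus ?thesis by (simp add: zero_le_mult_iff)
    qed
    define h where "h y = exp (- (y\<^sup>2 / 4)) * exp (- ((a - m - \<sigma> * y)\<^sup>2 / (D * S)))" for y
    note gc = gaussian_convolution_bound[OF nu D S, of "a - m", folded \<sigma>_def h_def]
    have b: "\<bar>std_normal_density y * poly p y * g (a - \<sigma> * y)\<bar> \<le> C * W * h y" for y
    proof -
      have "\<bar>std_normal_density y * poly p y\<bar> * \<bar>g (a - \<sigma> * y)\<bar>
          \<le> (C * exp (- (y\<^sup>2 / 4))) * (W * exp (- ((a - \<sigma> * y - m)\<^sup>2 / (D * S))))"
        using C g by (intro mult_mono) auto
      moreover have "a - \<sigma> * y - m = a - m - \<sigma> * y" by simp
      ultimately show ?thesis by (simp add: h_def abs_mult mult_ac)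
    qed
    have "continuous_on UNIV (poly p)" by (intro continuous_intros)
    hence [measurable]: "poly p \<in> borel_measurable borel" by (rule borel_measurable_continuous_onI)
    have ih: "integrable lborel (\<lambda>y. C * W * h y)" using gc(1) unfolding h_def by (intro integrable_mult_right)
    have "integrable lborel (\<lambda>y. std_normal_density y * poly p y * g (a - \<sigma> * y))"
      by (rule Bochner_Integration.integrable_bound[OF ih])
         (use b order_trans[OF _ abs_ge_self] in auto)
    hence "\<bar>\<integral>y. std_normal_density y * poly p y * g (a - \<sigma> * y) \<partial>lborel\<bar> \<le> (\<integral>y. C * W * h y \<partial>lborel)"
      using Bochner_Integration.integral_norm_bound_integral[OF _ ih, of "\<lambda>y. std_normal_density y * poly p y * g (a - \<sigma> * y)"] b
      by simp
    also have "\<dots> = C * W * (\<integral>y. h y \<partial>lborel)" by simp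
    also have "\<dots> \<le> C * W * (sqrt (pi * D / \<nu>) * (sqrt S / sqrt T) * exp (- ((a - m)\<^sup>2 / (D * T))))"
      using gc(2) C W unfolding h_def by (intro mult_left_mono) auto
    finally show "\<bar>\<integral>y. std_normal_density y * poly p y * g (a - sqrt (\<nu> * (T - S)) * y) \<partial>lborel\<bar>
       \<le> C * sqrt (pi * D / \<nu>) * W * (sqrt S / sqrt T) * exp (- ((a - m)\<^sup>2 / (D * T)))"
      by (simp add: \<sigma>_def mult_ac)
  qed
qed

text \<open>Parabolic smoothing: for \<open>S \<ge> T / 2\<close> the derivatives stay on the datum, otherwise they are
  moved to the kernel, whose width is then comparable to \<open>sqrt T\<close>.\<close>

lemma heat_derivative_gaussian_bound:
  fixes \<nu> D :: real
  assumes nu: "\<nu> > 0" and D: "D \<ge> 4 * \<nu>"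
  shows "\<exists>C\<ge>0. \<forall>(G :: nat \<Rightarrow> real \<Rightarrow> real) B S T l x m W. 0 < S \<longrightarrow> S \<le> T \<longrightarrow>
      (\<forall>j y. (G j has_real_derivative G (Suc j) y) (at y)) \<longrightarrow> (\<forall>j y. \<bar>G j y\<bar> \<le> B j) \<longrightarrow>
      (\<forall>y. \<bar>G 0 y\<bar> \<le> W * exp (- ((y - m)\<^sup>2 / (D * S)))) \<longrightarrow>
      (\<forall>y. \<bar>G k y\<bar> \<le> W / sqrt S ^ k * exp (- ((y - m)\<^sup>2 / (D * S)))) \<longrightarrow>
      \<bar>heat \<nu> l (T - S) (G k) x\<bar>
       \<le> C * W / sqrt T ^ k * (sqrt S / sqrt T) * exp (- ((x - l * (T - S) - m)\<^sup>2 / (D * T)))"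
proof -
  obtain C1 where C1: "C1 \<ge> 0" "\<And>g S T a m W. 0 < S \<Longrightarrow> S \<le> T \<Longrightarrow> g \<in> borel_measurable borel \<Longrightarrow>
     (\<And>y. \<bar>g y\<bar> \<le> W * exp (- ((y - m)\<^sup>2 / (D * S)))) \<Longrightarrow>
     \<bar>\<integral>y. std_normal_density y * poly 1 y * g (a - sqrt (\<nu> * (T - S)) * y) \<partial>lborel\<bar>
       \<le> C1 * W * (sqrt S / sqrt T) * exp (- ((a - m)\<^sup>2 / (D * T)))"
    using std_normal_poly_gaussian_bound[OF nu D, of 1] by blast
  obtain q where q: "\<And>(G :: nat \<Rightarrow> real \<Rightarrow> real) B a \<sigma>.
      (\<forall>j y. (G j has_real_derivative G (Suc j) y) (at y)) \<Longrightarrow> (\<forall>j y. \<bar>G j y\<bar> \<le> B j) \<Longrightarrow>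
      \<sigma> ^ k * (\<integral>y. std_normal_density y * poly 1 y * G k (a - \<sigma> * y) \<partial>lborel)
       = (\<integral>y. std_normal_density y * poly q y * G 0 (a - \<sigma> * y) \<partial>lborel)"
    using std_normal_by_parts_iterated[of k 1] by blast
  obtain C2 where C2: "C2 \<ge> 0" "\<And>g S T a m W. 0 < S \<Longrightarrow> S \<le> T \<Longrightarrow> g \<in> borel_measurable borel \<Longrightarrow>
     (\<And>y. \<bar>g y\<bar> \<le> W * exp (- ((y - m)\<^sup>2 / (D * S)))) \<Longrightarrow>
     \<bar>\<integral>y. std_normal_density y * poly q y * g (a - sqrt (\<nu> * (T - S)) * y) \<partial>lborel\<bar>
       \<le> C2 * W * (sqrt S / sqrt T) * exp (- ((a - m)\<^sup>2 / (D * T)))"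
    using std_normal_poly_gaussian_bound[OF nu D, of q] by blast
  \<comment> \<open>\<open>sqrt 2 ^ k\<close> stems from T \<le> 2 S, where sqrt T and sqrt S are
    comparable; the second term stems from the opposite case, where the kernel width
    \<open>\<sigma>\<close> is at least sqrt(\<nu> T / 2).\<close>
  define C where "C = C1 * sqrt 2 ^ k + C2 * (sqrt 2 / sqrt \<nu>) ^ k"
  have Cp: "C1 * sqrt 2 ^ k \<le> C" "C2 * (sqrt 2 / sqrt \<nu>) ^ k \<le> C" "C \<ge> 0"
    using C1(1) C2(1) nu by (auto simp: C_def)
  show ?thesis
  proof (intro exI[of _ C] conjI allI impI)
    fix G :: "nat \<Rightarrow> real \<Rightarrow> real" and B S T l x m W
    assume S: "0 < S" "S \<le> T" and G: "\<forall>j y. (G j has_real_derivative G (Suc j) y) (at y)"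
      and B: "\<forall>j y. \<bar>G j y\<bar> \<le> B j" and G0: "\<forall>y. \<bar>G 0 y\<bar> \<le> W * exp (- ((y - m)\<^sup>2 / (D * S)))"
      and Gk: "\<forall>y. \<bar>G k y\<bar> \<le> W / sqrt S ^ k * exp (- ((y - m)\<^sup>2 / (D * S)))"
    have T: "T > 0" using S by simp
    have W: "W \<ge> 0"
    proof -
      have "0 \<le> W * exp (- ((0 - m)\<^sup>2 / (D * S)))" using G0[rule_format, of 0] by linarith
      thus ?thesis by (simp add: zero_le_mult_iff)
    qed
    define E where "E = sqrt S / sqrt T * exp (- ((x - l * (T - S) - m)\<^sup>2 / (D * T)))"
    have E: "E \<ge> 0" using S by (simp add: E_def)
    have Gm: "G j \<in> borel_measurable borel" for j
      using G by (meson DERIV_isCont continuous_at_imp_continuous_on borel_measurable_continuous_onI)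
    have "\<bar>heat \<nu> l (T - S) (G k) x\<bar> \<le> C * W / sqrt T ^ k * E"
    proof (cases "T \<le> 2 * S")
      case True
      have "sqrt T \<le> sqrt 2 * sqrt S" using True by (simp flip: real_sqrt_mult)
      hence "sqrt T ^ k \<le> (sqrt 2 * sqrt S) ^ k" using T by (intro power_mono) auto
      hence TS: "1 / sqrt S ^ k \<le> sqrt 2 ^ k / sqrt T ^ k"
        using S T by (simp add: field_simps power_mult_distrib)
      have "\<bar>heat \<nu> l (T - S) (G k) x\<bar> \<le> C1 * (W / sqrt S ^ k) * (sqrt S / sqrt T) * exp (- ((x - l * (T - S) - m)\<^sup>2 / (D * T)))"
        using C1(2)[OF S Gm, of k "W / sqrt S ^ k" m "x - l * (T - S)"] Gk by (simp add: heat_def)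
      also have "\<dots> = C1 * W * E * (1 / sqrt S ^ k)" by (simp add: E_def mult_ac)
      also have "\<dots> \<le> C1 * W * E * (sqrt 2 ^ k / sqrt T ^ k)"
        using TS C1(1) W E by (intro mult_left_mono) auto
      also have "\<dots> = C1 * sqrt 2 ^ k * (W / sqrt T ^ k * E)" by simp
      also have "\<dots> \<le> C * (W / sqrt T ^ k * E)"
        using W T E Cp by (intro mult_right_mono) auto
      finally show ?thesis by simp
    next
      case False
      define \<sigma> where "\<sigma> = sqrt (\<nu> * (T - S))"
      have "sqrt (\<nu> * (T / 2)) \<le> \<sigma>" unfolding \<sigma>_def using False nu by (intro real_sqrt_le_mono mult_left_mono) auto
      hence s1: "sqrt \<nu> / sqrt 2 * sqrt T \<le> \<sigma>" by (simp add: real_sqrt_mult real_sqrt_divide)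
      have s2: "0 < sqrt \<nu> / sqrt 2 * sqrt T" using nu T by simp
      have s3: "(sqrt \<nu> / sqrt 2 * sqrt T) ^ k \<le> \<sigma> ^ k" using s1 s2 by (intro power_mono) auto
      have s4: "\<sigma> ^ k > 0" using s1 s2 by (intro zero_less_power) linarith
      have "\<sigma> ^ k * heat \<nu> l (T - S) (G k) x = (\<integral>y. std_normal_density y * poly q y * G 0 (x - l * (T - S) - \<sigma> * y) \<partial>lborel)"
        using q[OF G B, of \<sigma> "x - l * (T - S)"] by (simp add: heat_def \<sigma>_def)
      hence "\<sigma> ^ k * \<bar>heat \<nu> l (T - S) (G k) x\<bar> = \<bar>\<integral>y. std_normal_density y * poly q y * G 0 (x - l * (T - S) - \<sigma> * y) \<partial>lborel\<bar>"
        using s4 by (metis abs_mult abs_of_pos)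
      also have "\<dots> \<le> C2 * W * (sqrt S / sqrt T) * exp (- ((x - l * (T - S) - m)\<^sup>2 / (D * T)))"
        using C2(2)[OF S Gm, of 0 W m "x - l * (T - S)"] G0 by (simp add: \<sigma>_def)
      also have "\<dots> = C2 * W * E" by (simp add: E_def)
      finally have 1: "\<sigma> ^ k * \<bar>heat \<nu> l (T - S) (G k) x\<bar> \<le> C2 * W * E" .
      have "(sqrt \<nu> / sqrt 2 * sqrt T) ^ k * \<bar>heat \<nu> l (T - S) (G k) x\<bar> \<le> C2 * W * E"
        by (rule order_trans[OF mult_right_mono[OF s3] 1]) simp
      hence "\<bar>heat \<nu> l (T - S) (G k) x\<bar> \<le> C2 * W * E / (sqrt \<nu> / sqrt 2 * sqrt T) ^ k"
        using s2 by (simp add: pos_le_divide_eq mult.commute)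
      also have "\<dots> = C2 * (sqrt 2 / sqrt \<nu>) ^ k * (W / sqrt T ^ k * E)"
        by (simp add: power_mult_distrib power_divide)
      also have "\<dots> \<le> C * (W / sqrt T ^ k * E)"
        using W T E Cp by (intro mult_right_mono) auto
      finally show ?thesis by simp
    qed
    thus "\<bar>heat \<nu> l (T - S) (G k) x\<bar>
       \<le> C * W / sqrt T ^ k * (sqrt S / sqrt T) * exp (- ((x - l * (T - S) - m)\<^sup>2 / (D * T)))"
      by (simp add: E_def)
  qed (use Cp in auto)
qed

section \<open>Families with parabolic decay\<close>

text \<open>The arguments of a family are the masses, \<open>x\<close>, and the shifted time \<open>T = t + 1\<close>; hence \<open>T \<ge> 1\<close>
  throughout.\<close>

type_synonym family = "(nat \<Rightarrow> real) \<Rightarrow> real \<Rightarrow> real \<Rightarrow> real"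

text \<open>The bound 1 is the threshold of the theorem. Fixing the set of masses once makes
  uniformity in them part of every statement about families.\<close>

definition small :: "(nat \<Rightarrow> real) set" where
  "small = {M. \<bar>M 1\<bar> \<le> 1 \<and> \<bar>M 2\<bar> \<le> 1}"

definition Dx :: "family \<Rightarrow> family" where
  "Dx f M x T = deriv (\<lambda>y. f M y T) x"

text \<open>The constant precedes the masses, as the theorem demands; the weight \<open>w\<close>
  may itself contain powers of \<open>eps M\<close>.\<close>

definition dominated :: "family \<Rightarrow> family \<Rightarrow> bool" where
  "dominated w f \<longleftrightarrow> (\<exists>C\<ge>0. \<forall>M\<in>small. \<forall>T\<ge>1. \<forall>x. \<bar>f M x T\<bar> \<le> C * w M x T)"

definition jointly_continuous :: "family \<Rightarrow> bool" where
  "jointly_continuous f \<longleftrightarrow> (\<forall>M\<in>small. continuous_on (UNIV \<times> {1..}) (\<lambda>(x, T). f M x T))"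

definition x_differentiable :: "family \<Rightarrow> bool" where
  "x_differentiable f \<longleftrightarrow> (\<forall>M\<in>small. \<forall>T\<ge>1. \<forall>x. ((\<lambda>y. f M y T) has_real_derivative Dx f M x T) (at x))"

text \<open>Each space derivative gains a factor 1/sqrt T, as in parabolic scaling. The recursion
  changes the weight together with the function, so that the rules for products and inverses go
  through by induction on the order.\<close>

primrec decay_upto :: "nat \<Rightarrow> family \<Rightarrow> family \<Rightarrow> bool" where
  "decay_upto 0 w f \<longleftrightarrow> jointly_continuous f \<and> dominated w f"
| "decay_upto (Suc k) w f \<longleftrightarrow> jointly_continuous f \<and> dominated w f \<and> x_differentiable f
     \<and> decay_upto k (\<lambda>M x T. w M x T / sqrt T) (Dx f)"

definition decay :: "family \<Rightarrow> family \<Rightarrow> bool" where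
  "decay w f \<longleftrightarrow> (\<forall>k. decay_upto k w f)"

lemma dominatedI:
  "C \<ge> 0 \<Longrightarrow> (\<And>M T x. M \<in> small \<Longrightarrow> T \<ge> 1 \<Longrightarrow> \<bar>f M x T\<bar> \<le> C * w M x T) \<Longrightarrow> dominated w f"
  by (auto simp: dominated_def)

lemma dominatedE:
  assumes "dominated w f"
  obtains C where "C \<ge> 0" "\<And>M T x. M \<in> small \<Longrightarrow> T \<ge> 1 \<Longrightarrow> \<bar>f M x T\<bar> \<le> C * w M x T"
  using assms by (auto simp: dominated_def)

lemma dominated_mono:
  assumes f: "dominated w f" and w: "dominated w' w"
  shows "dominated w' f"
proof -
  obtain C where C: "C \<ge> 0" "\<And>M T x. M \<in> small \<Longrightarrow> T \<ge> 1 \<Longrightarrow> \<bar>f M x T\<bar> \<le> C * w M x T"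
    using f by (rule dominatedE) blast
  obtain C' where C': "C' \<ge> 0" "\<And>M T x. M \<in> small \<Longrightarrow> T \<ge> 1 \<Longrightarrow> \<bar>w M x T\<bar> \<le> C' * w' M x T"
    using w by (rule dominatedE) blast
  show ?thesis
  proof (rule dominatedI[of "C * C'"])
    fix M T x assume a: "M \<in> small" "(T::real) \<ge> 1"
    have "\<bar>f M x T\<bar> \<le> C * w M x T" by (rule C(2)[OF a])
    also have "\<dots> \<le> C * (C' * w' M x T)"
      by (rule mult_left_mono[OF order_trans[OF abs_ge_self C'(2)[OF a]] C(1)])
    finally show "\<bar>f M x T\<bar> \<le> C * C' * w' M x T" by simp
  qed (use C C' in auto)
qed

lemma dominated_add:
  assumes "dominated w f" "dominated w g"
  shows "dominated w (\<lambda>M x T. f M x T + g M x T)"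
proof -
  from assms obtain C C' where
    C: "C \<ge> 0" "\<And>M T x. M \<in> small \<Longrightarrow> T \<ge> 1 \<Longrightarrow> \<bar>f M x T\<bar> \<le> C * w M x T" and
    C': "C' \<ge> 0" "\<And>M T x. M \<in> small \<Longrightarrow> T \<ge> 1 \<Longrightarrow> \<bar>g M x T\<bar> \<le> C' * w M x T"
    by (auto simp: dominated_def)
  show ?thesis
  proof (rule dominatedI[of "C + C'"])
    fix M T x assume a: "M \<in> small" "(T::real) \<ge> 1"
    show "\<bar>f M x T + g M x T\<bar> \<le> (C + C') * w M x T"
      using C(2)[OF a, of x] C'(2)[OF a, of x] by (simp add: distrib_right)
  qed (use C C' in auto)
qed

lemma dominated_mult:
  assumes "dominated w f" "dominated v g"
  shows "dominated (\<lambda>M x T. w M x T * v M x T) (\<lambda>M x T. f M x T * g M x T)"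
proof -
  from assms obtain C C' where
    C: "C \<ge> 0" "\<And>M T x. M \<in> small \<Longrightarrow> T \<ge> 1 \<Longrightarrow> \<bar>f M x T\<bar> \<le> C * w M x T" and
    C': "C' \<ge> 0" "\<And>M T x. M \<in> small \<Longrightarrow> T \<ge> 1 \<Longrightarrow> \<bar>g M x T\<bar> \<le> C' * v M x T"
    by (auto simp: dominated_def)
  show ?thesis
  proof (rule dominatedI[of "C * C'"])
    fix M T x assume a: "M \<in> small" "(T::real) \<ge> 1"
    have "\<bar>f M x T\<bar> * \<bar>g M x T\<bar> \<le> (C * w M x T) * (C' * v M x T)"
      using C(2)[OF a, of x] C'(2)[OF a, of x] by (intro mult_mono) auto
    thus "\<bar>f M x T * g M x T\<bar> \<le> C * C' * (w M x T * v M x T)" by (simp add: abs_mult mult_ac)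
  qed (use C C' in auto)
qed

lemma jointly_continuous_add:
  "jointly_continuous f \<Longrightarrow> jointly_continuous g \<Longrightarrow> jointly_continuous (\<lambda>M x T. f M x T + g M x T)"
  unfolding jointly_continuous_def case_prod_unfold by (auto intro!: continuous_intros)

lemma jointly_continuous_mult:
  "jointly_continuous f \<Longrightarrow> jointly_continuous g \<Longrightarrow> jointly_continuous (\<lambda>M x T. f M x T * g M x T)"
  unfolding jointly_continuous_def case_prod_unfold by (auto intro!: continuous_intros)

lemma jointly_continuous_cong:
  assumes "\<And>M x T. M \<in> small \<Longrightarrow> T \<ge> 1 \<Longrightarrow> f M x T = g M x T"
  shows "jointly_continuous f = jointly_continuous g"
  unfolding jointly_continuous_def
  by (intro ball_cong refl continuous_on_cong) (use assms in auto)

lemma dominated_cong: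
  assumes "\<And>M x T. M \<in> small \<Longrightarrow> T \<ge> 1 \<Longrightarrow> f M x T = g M x T"
    and "\<And>M x T. M \<in> small \<Longrightarrow> T \<ge> 1 \<Longrightarrow> w M x T = v M x T"
  shows "dominated w f = dominated v g"
  using assms by (simp add: dominated_def)

lemma Dx_cong:
  assumes "\<And>M x T. M \<in> small \<Longrightarrow> T \<ge> 1 \<Longrightarrow> f M x T = g M x T" "M \<in> small" "T \<ge> 1"
  shows "Dx f M x T = Dx g M x T"
  using assms by (simp add: Dx_def)

lemma x_differentiable_cong:
  assumes "\<And>M x T. M \<in> small \<Longrightarrow> T \<ge> 1 \<Longrightarrow> f M x T = g M x T"
  shows "x_differentiable f = x_differentiable g"
  unfolding x_differentiable_def using assms by (simp add: Dx_def)

lemma decay_upto_cong: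
  assumes "\<And>M x T. M \<in> small \<Longrightarrow> T \<ge> 1 \<Longrightarrow> f M x T = g M x T"
    and "\<And>M x T. M \<in> small \<Longrightarrow> T \<ge> 1 \<Longrightarrow> w M x T = v M x T"
  shows "decay_upto k w f = decay_upto k v g"
  using assms
proof (induction k arbitrary: w v f g)
  case 0
  thus ?case using jointly_continuous_cong[of f g] dominated_cong[of f g w v] by simp
next
  case (Suc k)
  have "decay_upto k (\<lambda>M x T. w M x T / sqrt T) (Dx f) = decay_upto k (\<lambda>M x T. v M x T / sqrt T) (Dx g)"
    by (rule Suc.IH) (use Suc.prems Dx_cong[of f g] in auto)
  thus ?case
    using jointly_continuous_cong[of f g] dominated_cong[of f g w v] x_differentiable_cong[of f g] Suc.prems by simp
qed

lemma decay_cong: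
  assumes "\<And>M x T. M \<in> small \<Longrightarrow> T \<ge> 1 \<Longrightarrow> f M x T = g M x T"
  shows "decay w f = decay w g"
  unfolding decay_def using decay_upto_cong[of f g w w] assms by simp

lemma x_differentiableI:
  assumes "\<And>M x T. M \<in> small \<Longrightarrow> T \<ge> 1 \<Longrightarrow> ((\<lambda>y. f M y T) has_real_derivative g M x T) (at x)"
  shows "x_differentiable f" "\<And>M x T. M \<in> small \<Longrightarrow> T \<ge> 1 \<Longrightarrow> Dx f M x T = g M x T"
proof -
  show *: "\<And>M x T. M \<in> small \<Longrightarrow> T \<ge> 1 \<Longrightarrow> Dx f M x T = g M x T"
    using assms by (auto simp: Dx_def intro!: DERIV_imp_deriv)
  show "x_differentiable f"
    using assms by (simp add: x_differentiable_def *)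
qed

lemma x_differentiableD:
  "x_differentiable f \<Longrightarrow> M \<in> small \<Longrightarrow> T \<ge> 1 \<Longrightarrow> ((\<lambda>y. f M y T) has_real_derivative Dx f M x T) (at x)"
  by (auto simp: x_differentiable_def)

lemma decay_uptoI:
  assumes d: "\<And>M x T. M \<in> small \<Longrightarrow> T \<ge> 1 \<Longrightarrow> ((\<lambda>y. f M y T) has_real_derivative g M x T) (at x)"
    and f: "jointly_continuous f" "dominated w f" and g: "decay_upto k (\<lambda>M x T. w M x T / sqrt T) g"
  shows "decay_upto (Suc k) w f"
  using f g x_differentiableI[of f g, OF d] decay_upto_cong[of "Dx f" g] by simp

lemma decay_upto_Suc_D: "decay_upto (Suc k) w f \<Longrightarrow> decay_upto k w f"
  by (induction k arbitrary: w f) auto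

lemma decay_upto_mono:
  assumes "decay_upto k w f" "dominated v w"
  shows "decay_upto k v f"
  using assms
proof (induction k arbitrary: w v f)
  case 0 thus ?case using dominated_mono[of w f v] by simp
next
  case (Suc k)
  have "dominated (\<lambda>M x T. v M x T / sqrt T) (\<lambda>M x T. w M x T / sqrt T)"
  proof -
    obtain C where C: "C \<ge> 0" "\<And>M T x. M \<in> small \<Longrightarrow> T \<ge> 1 \<Longrightarrow> \<bar>w M x T\<bar> \<le> C * v M x T"
      using Suc.prems(2) by (rule dominatedE) blast
    show ?thesis
      by (rule dominatedI[of C]) (use C in \<open>auto simp: abs_divide intro!: divide_right_mono\<close>)
  qed
  with Suc show ?case using dominated_mono[of w f v] by auto
qed

lemma decay_upto_add:
  assumes "decay_upto k w f" "decay_upto k w g"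
  shows "decay_upto k w (\<lambda>M x T. f M x T + g M x T)"
  using assms
proof (induction k arbitrary: w f g)
  case 0 thus ?case using jointly_continuous_add dominated_add by simp
next
  case (Suc k)
  show ?case
    by (rule decay_uptoI[where g = "\<lambda>M x T. Dx f M x T + Dx g M x T"])
       (use Suc in \<open>auto intro!: DERIV_add jointly_continuous_add dominated_add dest: x_differentiableD\<close>)
qed

text \<open>In the product rule either factor may carry the gain 1/sqrt T, and the two resulting
  products of weights coincide.\<close>

lemma decay_upto_mult:
  assumes "decay_upto k w f" "decay_upto k v g"
  shows "decay_upto k (\<lambda>M x T. w M x T * v M x T) (\<lambda>M x T. f M x T * g M x T)"
  using assms
proof (induction k arbitrary: w v f g)
  case 0 thus ?case using jointly_continuous_mult dominated_mult by simp
next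
  case (Suc k)
  show ?case
  proof (rule decay_uptoI[where g = "\<lambda>M x T. Dx f M x T * g M x T + Dx g M x T * f M x T"])
    have "decay_upto k (\<lambda>M x T. (w M x T / sqrt T) * v M x T) (\<lambda>M x T. Dx f M x T * g M x T)"
      using Suc.prems by (intro Suc.IH) (auto dest: decay_upto_Suc_D simp del: decay_upto.simps simp: decay_upto.simps(2)[of k w f])
    moreover have "decay_upto k (\<lambda>M x T. (v M x T / sqrt T) * w M x T) (\<lambda>M x T. Dx g M x T * f M x T)"
      using Suc.prems by (intro Suc.IH) (auto dest: decay_upto_Suc_D simp del: decay_upto.simps simp: decay_upto.simps(2)[of k v g])
    moreover have "(\<lambda>M x T. (w M x T / sqrt T) * v M x T) = (\<lambda>M x T. w M x T * v M x T / sqrt T)"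
      "(\<lambda>M x T. (v M x T / sqrt T) * w M x T) = (\<lambda>M x T. w M x T * v M x T / sqrt T)" by (auto simp: fun_eq_iff)
    ultimately show "decay_upto k (\<lambda>M x T. w M x T * v M x T / sqrt T) (\<lambda>M x T. Dx f M x T * g M x T + Dx g M x T * f M x T)"
      by (intro decay_upto_add) simp_all
  qed (use Suc.prems in \<open>auto intro!: DERIV_mult jointly_continuous_mult dominated_mult dest: x_differentiableD\<close>)
qed

text \<open>Control of all orders for the derivative leaves only order zero to be checked. This
  suits \<open>phi\<close> and the potentials, which decay less than their derivatives.\<close>

lemma decayI_Dx:
  assumes d: "\<And>M x T. M \<in> small \<Longrightarrow> T \<ge> 1 \<Longrightarrow> ((\<lambda>y. f M y T) has_real_derivative g M x T) (at x)"
    and f: "jointly_continuous f" "dominated w f" and g: "decay (\<lambda>M x T. w M x T / sqrt T) g"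
  shows "decay w f"
  unfolding decay_def
proof
  fix k
  have "decay_upto (Suc k) w f" by (rule decay_uptoI[OF d f]) (use g in \<open>auto simp: decay_def\<close>)
  thus "decay_upto k w f" by (rule decay_upto_Suc_D)
qed

lemma decay_upto_zero:
  assumes "\<And>M x T. M \<in> small \<Longrightarrow> T \<ge> 1 \<Longrightarrow> w M x T \<ge> 0"
  shows "decay_upto k w (\<lambda>_ _ _. 0)"
  using assms
proof (induction k arbitrary: w)
  have zero: "jointly_continuous (\<lambda>_ _ _. 0)" by (simp add: jointly_continuous_def case_prod_unfold)
  {
    case 0
    thus ?case using zero by (auto intro: dominatedI[of 1])
  next
    case (Suc k)
    show ?case
      by (rule decay_uptoI[where g = "\<lambda>_ _ _. 0", OF _ zero dominatedI[of 1] Suc.IH]) (use Suc.prems in auto)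
  }
qed

lemma decay_const: "decay (\<lambda>_ _ _. 1) (\<lambda>_ _ _. a)"
proof (rule decayI_Dx[where g = "\<lambda>_ _ _. 0"])
  show "decay (\<lambda>M x T. 1 / sqrt T) (\<lambda>_ _ _. 0)"
    unfolding decay_def by (intro allI decay_upto_zero) auto
qed (auto simp: jointly_continuous_def case_prod_unfold intro: dominatedI[of "\<bar>a\<bar>"])

lemma jointly_continuous_inverse:
  assumes "jointly_continuous f" "\<And>M x T. M \<in> small \<Longrightarrow> T \<ge> 1 \<Longrightarrow> f M x T \<noteq> 0"
  shows "jointly_continuous (\<lambda>M x T. inverse (f M x T))"
  using assms unfolding jointly_continuous_def case_prod_unfold by (auto intro!: continuous_intros)

text \<open>The derivative -f'/f^2 contains 1/f only to order \<open>k\<close>, which the induction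
  hypothesis covers; the lower bound \<open>c\<close> keeps the constants uniform in the
  masses.\<close>

lemma decay_upto_inverse:
  assumes f: "decay_upto k (\<lambda>_ _ _. 1) f" and c: "c > 0" "\<And>M x T. M \<in> small \<Longrightarrow> T \<ge> 1 \<Longrightarrow> f M x T \<ge> c"
  shows "decay_upto k (\<lambda>_ _ _. 1) (\<lambda>M x T. inverse (f M x T))"
  using f
proof (induction k)
  have ne: "f M x T \<noteq> 0" if "M \<in> small" "T \<ge> 1" for M x T using c(1) c(2)[OF that, of x] by linarith
  have dom: "dominated (\<lambda>_ _ _. 1) (\<lambda>M x T. inverse (f M x T))"
    using c by (intro dominatedI[of "inverse c"]) (auto intro!: le_imp_inverse_le simp: order.trans[OF less_imp_le])
  {
    case 0
    thus ?case using jointly_continuous_inverse[of f] ne dom by simp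
  next
    case (Suc k)
    show ?case
    proof (rule decay_uptoI[where g = "\<lambda>M x T. - 1 * Dx f M x T * (inverse (f M x T) * inverse (f M x T))"])
      show "((\<lambda>y. inverse (f M y T)) has_real_derivative - 1 * Dx f M x T * (inverse (f M x T) * inverse (f M x T))) (at x)"
        if "M \<in> small" "T \<ge> 1" for M x T
      proof -
        have "((\<lambda>y. f M y T) has_real_derivative Dx f M x T) (at x)"
          using Suc.prems that by (auto intro: x_differentiableD)
        from DERIV_inverse'[where f = "\<lambda>y. f M y T", OF this ne[OF that]] show ?thesis by (simp add: mult_ac)
      qed
      have 1: "decay_upto k (\<lambda>_ _ _. 1) (\<lambda>M x T. inverse (f M x T))"
        using Suc decay_upto_Suc_D by blast
      have 2: "decay_upto k (\<lambda>_ _ _. 1) (\<lambda>_ _ _. - 1 :: real)"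
        using decay_const[of "-1"] by (simp add: decay_def)
      show "decay_upto k (\<lambda>M x T. 1 / sqrt T) (\<lambda>M x T. - 1 * Dx f M x T * (inverse (f M x T) * inverse (f M x T)))"
        using decay_upto_mult[OF decay_upto_mult[OF 2, of "\<lambda>M x T. 1 / sqrt T" "Dx f"] decay_upto_mult[OF 1 1]] Suc.prems by simp
    qed (use Suc.prems jointly_continuous_inverse[of f] ne dom in auto)
  }
qed

lemma decay_upto_time_factor:
  assumes a: "continuous_on {1..} a" and b: "\<And>T. T \<ge> 1 \<Longrightarrow> \<bar>a T\<bar> \<le> b T"
    and f: "decay_upto k w f"
  shows "decay_upto k (\<lambda>M x T. b T * w M x T) (\<lambda>M x T. a T * f M x T)"
  using f
proof (induction k arbitrary: w f)
  have c: "jointly_continuous (\<lambda>M x T. a T)"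
    unfolding jointly_continuous_def case_prod_unfold
    by (intro ballI continuous_on_compose2[OF a]) (auto intro!: continuous_intros)
  have d: "dominated (\<lambda>M x T. b T) (\<lambda>M x T. a T)" by (rule dominatedI[of 1]) (use b in auto)
  {
    case 0 thus ?case using jointly_continuous_mult[OF c] dominated_mult[OF d] by auto
  next
    case (Suc k)
    show ?case
    proof (rule decay_uptoI[where g = "\<lambda>M x T. a T * Dx f M x T"])
      show "decay_upto k (\<lambda>M x T. b T * w M x T / sqrt T) (\<lambda>M x T. a T * Dx f M x T)"
        using Suc.IH[of "\<lambda>M x T. w M x T / sqrt T" "Dx f"] Suc.prems by simp
    qed (use Suc.prems jointly_continuous_mult[OF c] dominated_mult[OF d] in
        \<open>auto intro!: DERIV_cmult dest: x_differentiableD\<close>)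
  }
qed

lemma decay_upto_mass_factor:
  assumes b: "\<And>M. M \<in> small \<Longrightarrow> \<bar>a M\<bar> \<le> B * b M" "B \<ge> 0" and f: "decay_upto k w f"
  shows "decay_upto k (\<lambda>M x T. b M * w M x T) (\<lambda>M x T. a M * f M x T)"
  using f
proof (induction k arbitrary: w f)
  have c: "jointly_continuous (\<lambda>M x T. a M)"
    by (auto simp: jointly_continuous_def case_prod_unfold)
  have d: "dominated (\<lambda>M x T. b M) (\<lambda>M x T. a M)" by (rule dominatedI[of B]) (use b in auto)
  {
    case 0 thus ?case using jointly_continuous_mult[OF c] dominated_mult[OF d] by auto
  next
    case (Suc k)
    show ?case
    proof (rule decay_uptoI[where g = "\<lambda>M x T. a M * Dx f M x T"])
      show "decay_upto k (\<lambda>M x T. b M * w M x T / sqrt T) (\<lambda>M x T. a M * Dx f M x T)"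
        using Suc.IH[of "\<lambda>M x T. w M x T / sqrt T" "Dx f"] Suc.prems by simp
    qed (use Suc.prems jointly_continuous_mult[OF c] dominated_mult[OF d] in
        \<open>auto intro!: DERIV_cmult dest: x_differentiableD\<close>)
  }
qed

lemma decay_mono: "decay w f \<Longrightarrow> dominated v w \<Longrightarrow> decay v f"
  by (auto simp: decay_def intro: decay_upto_mono)

lemma decay_add: "decay w f \<Longrightarrow> decay w g \<Longrightarrow> decay w (\<lambda>M x T. f M x T + g M x T)"
  by (auto simp: decay_def intro: decay_upto_add)

lemma decay_mult:
  "decay w f \<Longrightarrow> decay v g \<Longrightarrow> decay (\<lambda>M x T. w M x T * v M x T) (\<lambda>M x T. f M x T * g M x T)"
  by (auto simp: decay_def intro: decay_upto_mult)

lemma decay_inverse: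
  "decay (\<lambda>_ _ _. 1) f \<Longrightarrow> c > 0 \<Longrightarrow> (\<And>M x T. M \<in> small \<Longrightarrow> T \<ge> 1 \<Longrightarrow> f M x T \<ge> c) \<Longrightarrow>
    decay (\<lambda>_ _ _. 1) (\<lambda>M x T. inverse (f M x T))"
  by (auto simp: decay_def intro: decay_upto_inverse)

lemma decay_time_factor:
  "continuous_on {1..} a \<Longrightarrow> (\<And>T. T \<ge> 1 \<Longrightarrow> \<bar>a T\<bar> \<le> b T) \<Longrightarrow> decay w f \<Longrightarrow>
    decay (\<lambda>M x T. b T * w M x T) (\<lambda>M x T. a T * f M x T)"
  by (auto simp: decay_def intro: decay_upto_time_factor)

lemma decay_mass_factor:
  "(\<And>M. M \<in> small \<Longrightarrow> \<bar>a M\<bar> \<le> B * b M) \<Longrightarrow> B \<ge> 0 \<Longrightarrow> decay w f \<Longrightarrow>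
    decay (\<lambda>M x T. b M * w M x T) (\<lambda>M x T. a M * f M x T)"
  by (auto simp: decay_def intro: decay_upto_mass_factor)

lemma decay_cmult: "decay w f \<Longrightarrow> decay w (\<lambda>M x T. a * f M x T)"
  using decay_mass_factor[of "\<lambda>_. a" "\<bar>a\<bar>" "\<lambda>_. 1" w f] by simp

lemma decay_uminus: "decay w f \<Longrightarrow> decay w (\<lambda>M x T. - f M x T)"
  using decay_cmult[of w f "-1"] by simp

lemma decay_diff: "decay w f \<Longrightarrow> decay w g \<Longrightarrow> decay w (\<lambda>M x T. f M x T - g M x T)"
  using decay_add[OF _ decay_uminus, of w f g] by simp

lemma decay_Dx: "decay w f \<Longrightarrow> decay (\<lambda>M x T. w M x T / sqrt T) (Dx f)"
  unfolding decay_def using decay_upto.simps(2) by blast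

lemma decay_D:
  assumes "decay w f"
  shows "jointly_continuous f" "dominated w f" "x_differentiable f"
  using assms[unfolded decay_def, rule_format, of 1] by auto

lemma decay_has_derivative:
  "decay w f \<Longrightarrow> M \<in> small \<Longrightarrow> T \<ge> 1 \<Longrightarrow> ((\<lambda>y. f M y T) has_real_derivative Dx f M x T) (at x)"
  using decay_D(3) x_differentiableD by blast

lemma decay_Dx_funpow: "decay w f \<Longrightarrow> decay (\<lambda>M x T. w M x T / sqrt T ^ k) ((Dx ^^ k) f)"
proof (induction k)
  case (Suc k)
  from decay_Dx[OF Suc.IH[OF Suc.prems]] show ?case by (simp add: mult.commute)
qed simp

text \<open>For families whose iterated derivatives have a closed formula, such as Duhamel
  integrals: each order is then bounded directly.\<close>

lemma decayI_funpow:
  assumes "\<And>k. jointly_continuous ((Dx ^^ k) f)" "\<And>k. x_differentiable ((Dx ^^ k) f)"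
    and "\<And>k. dominated (\<lambda>M x T. w M x T / sqrt T ^ k) ((Dx ^^ k) f)"
  shows "decay w f"
proof -
  have "decay_upto j (\<lambda>M x T. w M x T / sqrt T ^ k) ((Dx ^^ k) f)" for j k
  proof (induction j arbitrary: k)
    case 0 show ?case using assms by simp
  next
    case (Suc j)
    from Suc[of "Suc k"] show ?case using assms by (simp add: mult.commute)
  qed
  from this[of _ 0] show ?thesis by (simp add: decay_def)
qed

lemma decay_bounded_continuous:
  assumes f: "decay w f" and w: "dominated (\<lambda>_ _ _. 1) w" and M: "M \<in> small"
  shows "bounded_continuous 1 (f M)"
proof -
  from dominated_mono[OF decay_D(2)[OF f] w] obtain C where
    "\<And>T x. T \<ge> 1 \<Longrightarrow> \<bar>f M x T\<bar> \<le> C" using M by (auto simp: dominated_def)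
  thus ?thesis using decay_D(1)[OF f] M by (auto simp: bounded_continuous_def jointly_continuous_def)
qed

lemma dominated_divide_sqrt:
  assumes "dominated v w" shows "dominated v (\<lambda>M x T. w M x T / sqrt T ^ k)"
proof -
  obtain C where C: "C \<ge> 0" "\<And>M T x. M \<in> small \<Longrightarrow> T \<ge> 1 \<Longrightarrow> \<bar>w M x T\<bar> \<le> C * v M x T"
    using assms by (rule dominatedE) blast
  show ?thesis
  proof (rule dominatedI[OF C(1)])
    fix M T x assume a: "M \<in> small" "(T::real) \<ge> 1"
    have "1 \<le> sqrt T ^ k" using a by simp
    hence "\<bar>w M x T\<bar> / sqrt T ^ k \<le> \<bar>w M x T\<bar>"
      using divide_left_mono[of 1 "sqrt T ^ k" "\<bar>w M x T\<bar>"] by simp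
    thus "\<bar>w M x T / sqrt T ^ k\<bar> \<le> C * v M x T" using C(2)[OF a, of x] a by (simp add: abs_divide power_abs)
  qed
qed

section \<open>Rules for the space derivative of families\<close>

lemma Dx_mult:
  assumes "decay w f" "decay v g" "M \<in> small" "T \<ge> 1"
  shows "Dx (\<lambda>M x T. f M x T * g M x T) M x T = Dx f M x T * g M x T + f M x T * Dx g M x T"
  unfolding Dx_def[of "\<lambda>M x T. f M x T * g M x T"]
  by (rule DERIV_imp_deriv)
     (use DERIV_mult[OF decay_has_derivative[OF assms(1,3,4)] decay_has_derivative[OF assms(2,3,4)], of x] in \<open>simp add: mult.commute add.commute\<close>)

lemma Dx_add:
  assumes "decay w f" "decay v g" "M \<in> small" "T \<ge> 1"
  shows "Dx (\<lambda>M x T. f M x T + g M x T) M x T = Dx f M x T + Dx g M x T"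
  unfolding Dx_def[of "\<lambda>M x T. f M x T + g M x T"]
  by (rule DERIV_imp_deriv)
     (rule DERIV_add[OF decay_has_derivative[OF assms(1,3,4)] decay_has_derivative[OF assms(2,3,4)]])

lemma Dx_cmult:
  assumes "decay w f" "M \<in> small" "T \<ge> 1"
  shows "Dx (\<lambda>M x T. a * f M x T) M x T = a * Dx f M x T"
  unfolding Dx_def[of "\<lambda>M x T. a * f M x T"]
  by (rule DERIV_imp_deriv) (rule DERIV_cmult[OF decay_has_derivative[OF assms]])

lemma Dx_funpow: "(Dx ^^ k) f M x T = (deriv ^^ k) (\<lambda>y. f M y T) x"
proof (induction k arbitrary: x)
  case (Suc k)
  have "(\<lambda>y. (Dx ^^ k) f M y T) = (deriv ^^ k) (\<lambda>y. f M y T)" using Suc.IH by auto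
  thus ?case by (simp add: Dx_def[of "(Dx ^^ k) f"])
qed simp

section \<open>Diffusion waves\<close>

definition gaussian_tail :: "real \<Rightarrow> real" where
  "gaussian_tail z = integral {z..} (\<lambda>y. exp (- y\<^sup>2))"

lemma gaussian_set_integrable:
  assumes "S \<in> sets borel" shows "set_integrable lborel S (\<lambda>y::real. exp (- y\<^sup>2))"
  using integrable_mult_indicator[of S lborel "\<lambda>y::real. exp (- y\<^sup>2)"] gaussian_integral(1)[of 1 0] assms
  by (simp add: set_integrable_def)

lemma gaussian_tail_lebesgue: "gaussian_tail z = (LINT y:{z..}|lborel. exp (- y\<^sup>2))"
  unfolding gaussian_tail_def
  by (rule set_borel_integral_eq_integral(2)[symmetric, OF gaussian_set_integrable]) simp

lemma gaussian_tail_nonneg: "gaussian_tail z \<ge> 0"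
  unfolding gaussian_tail_lebesgue set_lebesgue_integral_def
  by (intro Bochner_Integration.integral_nonneg) auto

lemma gaussian_tail_le: "gaussian_tail z \<le> sqrt pi"
proof -
  have "gaussian_tail z \<le> (\<integral>y. exp (- y\<^sup>2) \<partial>lborel)"
    unfolding gaussian_tail_lebesgue set_lebesgue_integral_def
    using gaussian_set_integrable[of "{z..}"] gaussian_integral(1)[of 1 0]
    by (intro Bochner_Integration.integral_mono) (auto simp: set_integrable_def indicator_def)
  thus ?thesis using gaussian_integral(2)[of 1 0] by simp
qed

lemma gaussian_tail_has_derivative:
  "(gaussian_tail has_real_derivative - exp (- z\<^sup>2)) (at z)"
proof -
  \<comment> \<open>Cutting the tail at z + 1 leaves a constant and an integral over a bounded
    interval with moving lower end.\<close>
  have split: "gaussian_tail y = integral {y..z+1} (\<lambda>y. exp (- y\<^sup>2)) + gaussian_tail (z + 1)" if "y \<in> {z-1<..<z+1}" for y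
  proof -
    have i: "(\<lambda>y::real. exp (- y\<^sup>2)) integrable_on S" if "S \<in> sets borel" for S
      by (rule set_borel_integral_eq_integral(1)[OF gaussian_set_integrable[OF that]])
    have "integral ({y..z+1} \<union> {z+1..}) (\<lambda>y. exp (- y\<^sup>2)) = integral {y..z+1} (\<lambda>y. exp (- y\<^sup>2)) + integral {z+1..} (\<lambda>y. exp (- y\<^sup>2))"
    proof (rule integral_Un)
      have "{y..z+1} \<inter> {z+1..} = {z+1}" using that by auto
      thus "negligible ({y..z+1} \<inter> {z+1..})" by simp
    qed (auto intro: i)
    moreover have "{y..z+1} \<union> {z+1..} = {y..}" using that by auto
    ultimately show ?thesis by (simp add: gaussian_tail_def)
  qed
  have "((\<lambda>y. integral {y..z+1} (\<lambda>y. exp (- y\<^sup>2))) has_real_derivative - exp (- z\<^sup>2)) (at z within {z-1..z+1})"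
    by (rule integral_has_real_derivative') (auto intro!: continuous_intros)
  hence "((\<lambda>y. integral {y..z+1} (\<lambda>y. exp (- y\<^sup>2))) has_real_derivative - exp (- z\<^sup>2)) (at z within {z-1<..<z+1})"
    by (rule DERIV_subset) auto
  moreover have "at z within {z-1<..<z+1} = at z" by (rule at_within_open) auto
  ultimately have "((\<lambda>y. integral {y..z+1} (\<lambda>y. exp (- y\<^sup>2)) + gaussian_tail (z + 1)) has_real_derivative - exp (- z\<^sup>2) + 0) (at z)"
    by (intro DERIV_add DERIV_const) simp
  hence "((\<lambda>y. integral {y..z+1} (\<lambda>y. exp (- y\<^sup>2)) + gaussian_tail (z + 1)) has_real_derivative - exp (- z\<^sup>2)) (at z)"
    by simp
  thus ?thesis
    by (rule has_field_derivative_transform_within_open[where S = "{z-1<..<z+1}"]) (use split in auto)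
qed

text \<open>The origin of the factor eps: a diffusion wave has amplitude exp(M/\<nu>) - 1, which has
  to be bounded linearly in the mass with a constant uniform on \<open>small\<close>.\<close>

lemma abs_exp_minus_one_le: "\<bar>exp a - 1\<bar> \<le> \<bar>a\<bar> * exp \<bar>a\<bar>" for a :: real
proof (cases "a \<ge> 0")
  case True
  have "1 - a \<le> exp (- a)" using exp_ge_add_one_self[of "- a"] by simp
  hence "(1 - a) * exp a \<le> exp (- a) * exp a" by (intro mult_right_mono) auto
  also have "\<dots> = 1" by (simp flip: exp_add)
  finally show ?thesis using True by (simp add: algebra_simps)
next
  case False
  hence "exp a \<le> 1" by simp
  moreover have "1 + a \<le> exp a" by (rule exp_ge_add_one_self)
  ultimately have "\<bar>exp a - 1\<bar> \<le> \<bar>a\<bar> * 1" by linarith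
  also have "\<dots> \<le> \<bar>a\<bar> * exp \<bar>a\<bar>" by (intro mult_left_mono) auto
  finally show ?thesis .
qed

locale wave_speeds =
  fixes \<nu> c :: real
  assumes nu: "\<nu> > 0" and c: "c > 0"
begin

text \<open>The similarity variable: the distance from the i-th characteristic in diffusive
  units.\<close>

definition zeta :: "nat \<Rightarrow> real \<Rightarrow> real \<Rightarrow> real" where
  "zeta i x T = (x - speed c i * T) / sqrt (2 * \<nu> * T)"

text \<open>The mass argument is a dummy that lets Gaussians serve as weights of families.
  \<open>D\<close> is 4 \<nu> for the waves themselves and 8 \<nu> once half of an exponent has been
  given away to the overlap of two waves.\<close>

definition gauss :: "real \<Rightarrow> nat \<Rightarrow> family" where
  "gauss D i M x T = exp (- ((x - speed c i * T)\<^sup>2 / (D * T)))"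

definition eps :: "(nat \<Rightarrow> real) \<Rightarrow> real" where
  "eps M = max \<bar>M 1\<bar> \<bar>M 2\<bar>"

definition phi :: "nat \<Rightarrow> family" where
  "phi i M x T = sqrt pi + (exp (M i / \<nu>) - 1) * gaussian_tail (zeta i x T)"

definition phix :: "nat \<Rightarrow> family" where
  "phix i M x T = (exp (M i / \<nu>) - 1) * (- 1 / sqrt (2 * \<nu> * T) * exp (- (zeta i x T)\<^sup>2))"

definition theta :: "nat \<Rightarrow> family" where
  "theta i M x T = diffusion_wave \<nu> c M i x (T - 1)"

lemma eps: "M \<in> small \<Longrightarrow> eps M \<le> 1" "eps M \<ge> 0" "i \<in> {1,2} \<Longrightarrow> \<bar>M i\<bar> \<le> eps M"
  by (auto simp: eps_def small_def)

lemma sqrt_2nuT: "T \<ge> 1 \<Longrightarrow> sqrt (2 * \<nu> * T) > 0"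
  using nu by simp

lemma zeta_has_x_derivative: "((\<lambda>x. zeta i x T) has_real_derivative 1 / sqrt (2 * \<nu> * T)) (at x)"
proof -
  have "((\<lambda>x. x - speed c i * T) has_real_derivative 1) (at x)" by (auto intro!: derivative_eq_intros)
  from DERIV_cdivide[OF this, of "sqrt (2 * \<nu> * T)"] show ?thesis unfolding zeta_def .
qed

lemma sqrt_2nuT_sq: "T \<ge> 1 \<Longrightarrow> sqrt (2 * \<nu> * T) * sqrt (2 * \<nu> * T) = 2 * \<nu> * T"
  using nu by simp

lemma zeta_has_time_derivative:
  assumes "T \<ge> 1"
  shows "((\<lambda>T. zeta i x T) has_real_derivative - speed c i / sqrt (2 * \<nu> * T) - zeta i x T / (2 * T)) (at T)"
proof -
  have p: "2 * \<nu> * T > 0" using assms nu by simp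
  have s: "((\<lambda>T. sqrt (2 * \<nu> * T)) has_real_derivative sqrt (2 * \<nu> * T) / (2 * T)) (at T)"
  proof -
    have d: "((\<lambda>T. 2 * \<nu> * T) has_real_derivative 2 * \<nu>) (at T)" by (auto intro!: derivative_eq_intros)
    have "inverse r / 2 * (2 * \<nu>) = r / (2 * T)" if "r * r = 2 * \<nu> * T" "r > 0" for r
      using that assms by (simp add: field_simps)
    from this[OF sqrt_2nuT_sq sqrt_2nuT]
    have "inverse (sqrt (2 * \<nu> * T)) / 2 * (2 * \<nu>) = sqrt (2 * \<nu> * T) / (2 * T)"
      using assms by simp
    with DERIV_chain2[OF DERIV_real_sqrt[OF p] d] show ?thesis by simp
  qed
  have n: "((\<lambda>T. x - speed c i * T) has_real_derivative - speed c i) (at T)"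
    by (auto intro!: derivative_eq_intros)
  have "sqrt (2 * \<nu> * T) \<noteq> 0" using sqrt_2nuT[OF assms] by (metis less_irrefl)
  have "(- speed c i * r - (x - speed c i * T) * (r / (2 * T))) / (r * r) = - speed c i / r - (x - speed c i * T) / r / (2 * T)"
    if "r > 0" for r using that assms by (simp add: field_simps)
  from DERIV_cong[OF DERIV_divide[OF n s \<open>sqrt (2 * \<nu> * T) \<noteq> 0\<close>] this[OF sqrt_2nuT[OF assms]]]
  show ?thesis unfolding zeta_def .
qed

lemma zeta_continuous: "continuous_on (UNIV \<times> {1..}) (\<lambda>z. zeta i (fst z) (snd z))"
  unfolding zeta_def using nu by (intro continuous_intros) auto

lemma gaussian_tail_continuous: "continuous_on S gaussian_tail"
  by (rule continuous_at_imp_continuous_on) (auto intro: DERIV_isCont[OF gaussian_tail_has_derivative])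

lemma exp_zeta_sq: "T \<ge> 1 \<Longrightarrow> exp (- ((zeta i x T)\<^sup>2 / 2)) = gauss (4 * \<nu>) i M x T"
  using nu by (simp add: gauss_def zeta_def power_divide)

lemma gauss_pos: "gauss D i M x T > 0"
  by (simp add: gauss_def)

text \<open>Polynomials in \<open>zeta\<close> times this Gaussian are stable under differentiation:
  the polynomial changes and a factor 1/sqrt(2 \<nu> T) comes out. Half of the exponent absorbs the
  polynomial, which leaves width 4 \<nu> instead of 2 \<nu>.\<close>

lemma decay_gaussian_poly: "decay (gauss (4 * \<nu>) i) (\<lambda>M x T. poly p (zeta i x T) * exp (- (zeta i x T)\<^sup>2))"
  unfolding decay_def
proof
  fix k
  have base: "jointly_continuous (\<lambda>M x T. poly p (zeta i x T) * exp (- (zeta i x T)\<^sup>2))"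
    "dominated (gauss (4 * \<nu>) i) (\<lambda>M x T. poly p (zeta i x T) * exp (- (zeta i x T)\<^sup>2))" for p
  proof -
    show "jointly_continuous (\<lambda>M x T. poly p (zeta i x T) * exp (- (zeta i x T)\<^sup>2))"
      unfolding jointly_continuous_def case_prod_unfold by (intro ballI continuous_intros zeta_continuous)
    obtain C where C: "C \<ge> 0" "\<And>y. \<bar>poly p y\<bar> \<le> C * exp (1/2 * y\<^sup>2)"
      using poly_exp_bound[of "1/2" p] by auto
    show "dominated (gauss (4 * \<nu>) i) (\<lambda>M x T. poly p (zeta i x T) * exp (- (zeta i x T)\<^sup>2))"
    proof (rule dominatedI[OF C(1)])
      fix M T x assume a: "M \<in> small" "(T::real) \<ge> 1"
      have "\<bar>poly p (zeta i x T) * exp (- (zeta i x T)\<^sup>2)\<bar> \<le> C * exp (1/2 * (zeta i x T)\<^sup>2) * exp (- (zeta i x T)\<^sup>2)"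
        unfolding abs_mult using C(2) by (simp add: mult_right_mono)
      also have "\<dots> = C * exp (- ((zeta i x T)\<^sup>2 / 2))" by (simp flip: exp_add)
      finally show "\<bar>poly p (zeta i x T) * exp (- (zeta i x T)\<^sup>2)\<bar> \<le> C * gauss (4 * \<nu>) i M x T"
        using exp_zeta_sq[OF a(2)] by simp
    qed
  qed
  show "decay_upto k (gauss (4 * \<nu>) i) (\<lambda>M x T. poly p (zeta i x T) * exp (- (zeta i x T)\<^sup>2))"
  proof (induction k arbitrary: p)
    case 0 show ?case using base by simp
  next
    case (Suc k)
    let ?q = "pderiv p - smult 2 ([:0, 1:] * p)"
    show ?case
    proof (rule decay_uptoI[where g = "\<lambda>M x T. 1 / sqrt (2 * \<nu> * T) * (poly ?q (zeta i x T) * exp (- (zeta i x T)\<^sup>2))", OF _ base])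
      show "((\<lambda>y. poly p (zeta i y T) * exp (- (zeta i y T)\<^sup>2)) has_real_derivative
          1 / sqrt (2 * \<nu> * T) * (poly ?q (zeta i x T) * exp (- (zeta i x T)\<^sup>2))) (at x)" for T x
        by (auto intro!: derivative_eq_intros zeta_has_x_derivative DERIV_chain2[OF poly_DERIV] simp: algebra_simps)
      have "decay_upto k (\<lambda>M x T. (1 / sqrt (2 * \<nu>)) / sqrt T * gauss (4 * \<nu>) i M x T)
          (\<lambda>M x T. 1 / sqrt (2 * \<nu> * T) * (poly ?q (zeta i x T) * exp (- (zeta i x T)\<^sup>2)))"
        by (rule decay_upto_time_factor[OF _ _ Suc.IH]) (use nu in \<open>auto intro!: continuous_intros simp: real_sqrt_mult\<close>)
      thus "decay_upto k (\<lambda>M x T. gauss (4 * \<nu>) i M x T / sqrt T)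
          (\<lambda>M x T. 1 / sqrt (2 * \<nu> * T) * (poly ?q (zeta i x T) * exp (- (zeta i x T)\<^sup>2)))"
        by (rule decay_upto_mono)
           (use nu gauss_pos[THEN less_imp_le] in \<open>auto intro!: dominatedI[of "1 / sqrt (2 * \<nu>)"] simp: abs_mult field_simps\<close>)
    qed
  qed
qed

lemma exp_mass_bound:
  assumes "i \<in> {1, 2}" "M \<in> small"
  shows "\<bar>exp (M i / \<nu>) - 1\<bar> \<le> (exp (1 / \<nu>) / \<nu>) * eps M"
proof -
  have Mi: "\<bar>M i\<bar> \<le> 1" using assms by (auto simp: small_def)
  have "\<bar>exp (M i / \<nu>) - 1\<bar> \<le> \<bar>M i / \<nu>\<bar> * exp \<bar>M i / \<nu>\<bar>" by (rule abs_exp_minus_one_le)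
  also have "\<dots> \<le> (eps M / \<nu>) * exp (1 / \<nu>)"
    using nu Mi eps(3)[OF assms(1)] eps(2)[of M]
    by (intro mult_mono) (auto simp: abs_divide intro!: divide_right_mono)
  finally show ?thesis by (simp add: mult_ac)
qed

lemma decay_phix:
  assumes "i \<in> {1, 2}"
  shows "decay (\<lambda>M x T. eps M * gauss (4 * \<nu>) i M x T / sqrt T) (phix i)"
proof -
  have "decay (\<lambda>M x T. (1 / sqrt (2 * \<nu>)) / sqrt T * gauss (4 * \<nu>) i M x T)
      (\<lambda>M x T. - 1 / sqrt (2 * \<nu> * T) * (poly 1 (zeta i x T) * exp (- (zeta i x T)\<^sup>2)))"
    by (rule decay_time_factor[OF _ _ decay_gaussian_poly]) (use nu in \<open>auto intro!: continuous_intros simp: real_sqrt_mult\<close>)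
  from decay_mass_factor[OF exp_mass_bound[OF assms] _ this]
  have "decay (\<lambda>M x T. eps M * ((1 / sqrt (2 * \<nu>)) / sqrt T * gauss (4 * \<nu>) i M x T)) (phix i)"
    using nu by (simp add: phix_def[abs_def])
  thus ?thesis
    by (rule decay_mono)
       (use nu gauss_pos[THEN less_imp_le] eps in \<open>auto intro!: dominatedI[of "1 / sqrt (2 * \<nu>)"] simp: abs_mult field_simps\<close>)
qed

lemma phi_has_x_derivative: "((\<lambda>y. phi i M y T) has_real_derivative phix i M x T) (at x)"
  unfolding phi_def phix_def
  by (auto intro!: derivative_eq_intros zeta_has_x_derivative DERIV_chain2[OF gaussian_tail_has_derivative])

text \<open>Since the tail lies between 0 and sqrt pi, \<open>phi\<close> lies between sqrt pi and
  sqrt pi exp(M/\<nu>).\<close>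

lemma phi_lower_bound:
  assumes "i \<in> {1, 2}" "M \<in> small"
  shows "phi i M x T \<ge> sqrt pi * exp (- (1 / \<nu>))"
proof (cases "M i \<ge> 0")
  case True
  hence "phi i M x T \<ge> sqrt pi * 1"
    using nu gaussian_tail_nonneg by (simp add: phi_def)
  moreover have "sqrt pi * exp (- (1 / \<nu>)) \<le> sqrt pi * 1" using nu by (intro mult_left_mono) auto
  ultimately show ?thesis by linarith
next
  case False
  hence "exp (M i / \<nu>) - 1 \<le> 0" using nu by (simp add: divide_nonpos_pos)
  hence "(exp (M i / \<nu>) - 1) * sqrt pi \<le> (exp (M i / \<nu>) - 1) * gaussian_tail (zeta i x T)"
    using gaussian_tail_le by (intro mult_left_mono_neg) auto
  hence "phi i M x T \<ge> sqrt pi * exp (M i / \<nu>)" by (simp add: phi_def algebra_simps)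
  moreover have "exp (- (1 / \<nu>)) \<le> exp (M i / \<nu>)"
  proof -
    have "-1 \<le> M i" using assms by (auto simp: small_def)
    from divide_right_mono[OF this, of \<nu>] nu show ?thesis by simp
  qed
  hence "sqrt pi * exp (- (1 / \<nu>)) \<le> sqrt pi * exp (M i / \<nu>)" by (intro mult_left_mono) auto
  ultimately show ?thesis by linarith
qed

lemma phi_pos: "i \<in> {1, 2} \<Longrightarrow> M \<in> small \<Longrightarrow> phi i M x T > 0"
  by (rule less_le_trans[OF _ phi_lower_bound]) auto

lemma decay_phi:
  assumes "i \<in> {1, 2}" shows "decay (\<lambda>_ _ _. 1) (phi i)"
proof (rule decayI_Dx[OF phi_has_x_derivative])
  show "jointly_continuous (phi i)"
    unfolding jointly_continuous_def phi_def case_prod_unfold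
    by (intro ballI continuous_intros continuous_on_compose2[OF gaussian_tail_continuous[of UNIV] zeta_continuous]) auto
  show "dominated (\<lambda>_ _ _. 1) (phi i)"
  proof (rule dominatedI)
    fix M T x assume a: "M \<in> small" "(T::real) \<ge> 1"
    have "exp (1 / \<nu>) / \<nu> * eps M \<le> exp (1 / \<nu>) / \<nu> * 1" using eps(1)[OF a(1)] nu by (intro mult_left_mono) auto
    with exp_mass_bound[OF assms a(1)] have "\<bar>exp (M i / \<nu>) - 1\<bar> \<le> exp (1 / \<nu>) / \<nu>" by linarith
    hence "\<bar>(exp (M i / \<nu>) - 1) * gaussian_tail (zeta i x T)\<bar> \<le> exp (1 / \<nu>) / \<nu> * sqrt pi"
      unfolding abs_mult using gaussian_tail_nonneg gaussian_tail_le nu by (intro mult_mono) auto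
    thus "\<bar>phi i M x T\<bar> \<le> (sqrt pi + exp (1 / \<nu>) / \<nu> * sqrt pi) * 1"
      unfolding phi_def mult_1_right using real_sqrt_ge_zero[OF pi_ge_zero] by linarith
  qed (use nu in auto)
  show "decay (\<lambda>M x T. 1 / sqrt T) (phix i)"
  proof (rule decay_mono[OF decay_phix[OF assms]], rule dominatedI[of 1])
    fix M T x assume a: "M \<in> small" "(T::real) \<ge> 1"
    have "eps M * gauss (4 * \<nu>) i M x T \<le> 1 * 1"
      using eps a nu by (intro mult_mono) (auto simp: gauss_def)
    moreover have "eps M * gauss (4 * \<nu>) i M x T \<ge> 0" using eps gauss_pos[THEN less_imp_le] by simp
    ultimately show "\<bar>eps M * gauss (4 * \<nu>) i M x T / sqrt T\<bar> \<le> 1 * (1 / sqrt T)"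
      using a by (simp add: divide_right_mono)
  qed simp
qed

lemma Dx_phi: "Dx (phi i) = phix i"
  by (intro ext) (auto simp: Dx_def intro!: DERIV_imp_deriv phi_has_x_derivative)

lemma theta_eq:
  assumes "i \<in> {1, 2}" "M \<in> small" "T \<ge> 1"
  shows "theta i M x T = - \<nu> * (phix i M x T * inverse (phi i M x T))"
proof -
  have 1: "sqrt (2 * \<nu> * T) = sqrt \<nu> * sqrt (2 * T)" by (simp add: real_sqrt_mult)
  have "r * r * (A * (1 / (r * q))) = r * A / q" if "r > 0" for r q A :: real using that by simp
  from this[of "sqrt \<nu>"] have 2: "\<nu> * ((exp (M i / \<nu>) - 1) * (1 / sqrt (2 * \<nu> * T))) = sqrt \<nu> * (exp (M i / \<nu>) - 1) / sqrt (2 * T)"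
    unfolding 1 using nu by simp
  have e: "(x - speed c i * T)\<^sup>2 / (2 * \<nu> * T) = (zeta i x T)\<^sup>2"
    using nu assms(3) by (simp add: zeta_def power_divide)
  have "theta i M x T = (sqrt \<nu> * (exp (M i / \<nu>) - 1) / sqrt (2 * T)) * exp (- (zeta i x T)\<^sup>2) * inverse (phi i M x T)"
    unfolding theta_def diffusion_wave_def phi_def gaussian_tail_def e[symmetric] by (simp add: zeta_def)
  thus ?thesis unfolding phix_def 2[symmetric] by simp
qed

lemma decay_inverse_phi: "i \<in> {1, 2} \<Longrightarrow> decay (\<lambda>_ _ _. 1) (\<lambda>M x T. inverse (phi i M x T))"
  by (rule decay_inverse[OF decay_phi _ phi_lower_bound]) auto

lemma decay_theta:
  assumes "i \<in> {1, 2}"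
  shows "decay (\<lambda>M x T. eps M * gauss (4 * \<nu>) i M x T / sqrt T) (theta i)"
proof -
  have "decay (\<lambda>M x T. eps M * gauss (4 * \<nu>) i M x T / sqrt T * 1) (\<lambda>M x T. - \<nu> * (phix i M x T * inverse (phi i M x T)))"
    by (intro decay_cmult decay_mult decay_phix decay_inverse_phi assms)
  thus ?thesis
    using decay_cong[of "theta i" "\<lambda>M x T. - \<nu> * (phix i M x T * inverse (phi i M x T))"] theta_eq[OF assms] by simp
qed

text \<open>A left time derivative is all that the maximum principle needs, and it spares the case of times
  beyond \<open>T\<close> when Duhamel's integral is differentiated.\<close>

definition solves :: "real \<Rightarrow> family \<Rightarrow> family \<Rightarrow> bool" where
  "solves l f g \<longleftrightarrow> (\<forall>M\<in>small. \<forall>T>1. \<forall>x. ((\<lambda>S. f M x S) has_real_derivative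
     (g M x T - l * Dx f M x T + \<nu> / 2 * Dx (Dx f) M x T)) (at_left T))"

lemma solvesI:
  assumes "\<And>M x T. M \<in> small \<Longrightarrow> T > 1 \<Longrightarrow> ((\<lambda>S. f M x S) has_real_derivative
     (g M x T - l * Dx f M x T + \<nu> / 2 * Dx (Dx f) M x T)) (at_left T)"
  shows "solves l f g"
  using assms by (auto simp: solves_def)

lemma solvesD: "solves l f g \<Longrightarrow> M \<in> small \<Longrightarrow> T > 1 \<Longrightarrow> ((\<lambda>S. f M x S) has_real_derivative
     (g M x T - l * Dx f M x T + \<nu> / 2 * Dx (Dx f) M x T)) (at_left T)"
  by (auto simp: solves_def)

lemma solves_cong:
  assumes s: "solves l f g" and f: "\<And>M x T. M \<in> small \<Longrightarrow> T \<ge> 1 \<Longrightarrow> f' M x T = f M x T"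
    and g: "\<And>M x T. M \<in> small \<Longrightarrow> T > 1 \<Longrightarrow> g' M x T = g M x T"
  shows "solves l f' g'"
proof (rule solvesI)
  fix M x and T :: real assume a: "M \<in> small" "T > 1"
  have d1: "Dx f' M x T = Dx f M x T" if "M \<in> small" "T \<ge> 1" for M x T
    using Dx_cong[of f' f, OF f] that by auto
  have d2: "Dx (Dx f') M x T = Dx (Dx f) M x T" using Dx_cong[of "Dx f'" "Dx f", OF d1] a by auto
  have "((\<lambda>S. f' M x S) has_real_derivative
     (g M x T - l * Dx f M x T + \<nu> / 2 * Dx (Dx f) M x T)) (at_left T)"
  proof -
    have "eventually (\<lambda>S. (f M x S - f M x T) / (S - T) = (f' M x S - f' M x T) / (S - T)) (at_left T)"
      using eventually_at_left_real[OF a(2)] by eventually_elim (use a f in auto)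
    from Lim_transform_eventually[OF _ this] show ?thesis
      using solvesD[OF s a, of x] by (simp add: has_field_derivative_iff)
  qed
  thus "((\<lambda>S. f' M x S) has_real_derivative
     (g' M x T - l * Dx f' M x T + \<nu> / 2 * Dx (Dx f') M x T)) (at_left T)"
    using d1 d2 g a by simp
qed

text \<open>A change of frame: the difference of the transport terms is booked as source. It is
  applied to \<open>phi\<close>, which inside the source meets waves of the other speed, and to the
  source itself, in order to express its x-derivative.\<close>

lemma solves_change_speed: "solves l f g \<Longrightarrow> solves m f (\<lambda>M x T. g M x T + (m - l) * Dx f M x T)"
  by (auto simp: solves_def algebra_simps)

lemma solves_add:
  assumes "solves l f p" "solves l g q" "decay w f" "decay v g"
  shows "solves l (\<lambda>M x T. f M x T + g M x T) (\<lambda>M x T. p M x T + q M x T)"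
proof (rule solvesI)
  fix M x and T :: real assume a: "M \<in> small" "T > 1"
  have d: "Dx (\<lambda>M x T. f M x T + g M x T) M x T = Dx f M x T + Dx g M x T" if "M \<in> small" "T \<ge> 1" for M x T
    by (rule Dx_add[OF assms(3,4) that])
  have d2: "Dx (Dx (\<lambda>M x T. f M x T + g M x T)) M x T = Dx (Dx f) M x T + Dx (Dx g) M x T"
    using Dx_cong[of _ "\<lambda>M x T. Dx f M x T + Dx g M x T", OF d] Dx_add[OF decay_Dx[OF assms(3)] decay_Dx[OF assms(4)]] a by simp
  show "((\<lambda>S. f M x S + g M x S) has_real_derivative p M x T + q M x T
      - l * Dx (\<lambda>M x T. f M x T + g M x T) M x T + \<nu> / 2 * Dx (Dx (\<lambda>M x T. f M x T + g M x T)) M x T) (at_left T)"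
    using DERIV_add[OF solvesD[OF assms(1) a, of x] solvesD[OF assms(2) a, of x]] d[of M T x] d2 a
    by (simp add: algebra_simps)
qed

lemma solves_cmult:
  assumes "solves l f p" "decay w f"
  shows "solves l (\<lambda>M x T. a * f M x T) (\<lambda>M x T. a * p M x T)"
proof (rule solvesI)
  fix M x and T :: real assume A: "M \<in> small" "T > 1"
  have d: "Dx (\<lambda>M x T. a * f M x T) M x T = a * Dx f M x T" if "M \<in> small" "T \<ge> 1" for M x T
    by (rule Dx_cmult[OF assms(2) that])
  have d2: "Dx (Dx (\<lambda>M x T. a * f M x T)) M x T = a * Dx (Dx f) M x T"
    using Dx_cong[of _ "\<lambda>M x T. a * Dx f M x T", OF d] Dx_cmult[OF decay_Dx[OF assms(2)]] A by simp
  show "((\<lambda>S. a * f M x S) has_real_derivative a * p M x T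
      - l * Dx (\<lambda>M x T. a * f M x T) M x T + \<nu> / 2 * Dx (Dx (\<lambda>M x T. a * f M x T)) M x T) (at_left T)"
    using DERIV_cmult[OF solvesD[OF assms(1) A, of x], of a] d[of M T x] d2 A
    by (simp add: algebra_simps)
qed

lemma Dx_Dx_mult:
  assumes "decay w f" "decay v g" "M \<in> small" "T \<ge> 1"
  shows "Dx (Dx (\<lambda>M x T. f M x T * g M x T)) M x T
    = Dx (Dx f) M x T * g M x T + 2 * (Dx f M x T * Dx g M x T) + f M x T * Dx (Dx g) M x T"
proof -
  have d: "Dx (\<lambda>M x T. f M x T * g M x T) M x T = Dx f M x T * g M x T + f M x T * Dx g M x T"
    if "M \<in> small" "T \<ge> 1" for M x T
    by (rule Dx_mult[OF assms(1,2) that])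
  have "Dx (Dx (\<lambda>M x T. f M x T * g M x T)) M x T = Dx (\<lambda>M x T. Dx f M x T * g M x T + f M x T * Dx g M x T) M x T"
    using Dx_cong[OF d] assms(3,4) by auto
  also have "\<dots> = Dx (\<lambda>M x T. Dx f M x T * g M x T) M x T + Dx (\<lambda>M x T. f M x T * Dx g M x T) M x T"
    by (rule Dx_add[OF decay_mult[OF decay_Dx[OF assms(1)] assms(2)] decay_mult[OF assms(1) decay_Dx[OF assms(2)]] assms(3,4)])
  also have "\<dots> = (Dx (Dx f) M x T * g M x T + Dx f M x T * Dx g M x T) + (Dx f M x T * Dx g M x T + f M x T * Dx (Dx g) M x T)"
    by (simp add: Dx_mult[OF decay_Dx[OF assms(1)] assms(2-4)] Dx_mult[OF assms(1) decay_Dx[OF assms(2)] assms(3,4)])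
  finally show ?thesis by simp
qed

text \<open>Only the second derivative violates the simple Leibniz rule; its cross term is the last
  summand.\<close>

lemma solves_mult:
  assumes "solves l f p" "solves l g q" "decay w f" "decay v g"
  shows "solves l (\<lambda>M x T. f M x T * g M x T)
    (\<lambda>M x T. p M x T * g M x T + f M x T * q M x T - \<nu> * (Dx f M x T * Dx g M x T))"
proof (rule solvesI)
  fix M x and T :: real assume a: "M \<in> small" "T > 1"
  hence a1: "T \<ge> 1" by simp
  show "((\<lambda>S. f M x S * g M x S) has_real_derivative
      p M x T * g M x T + f M x T * q M x T - \<nu> * (Dx f M x T * Dx g M x T)
      - l * Dx (\<lambda>M x T. f M x T * g M x T) M x T + \<nu> / 2 * Dx (Dx (\<lambda>M x T. f M x T * g M x T)) M x T) (at_left T)"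
    unfolding Dx_mult[OF assms(3,4) a(1) a1] Dx_Dx_mult[OF assms(3,4) a(1) a1]
    by (rule DERIV_cong[OF DERIV_mult[OF solvesD[OF assms(1) a, of x] solvesD[OF assms(2) a, of x]]])
       (simp add: algebra_simps)
qed

lemma Dx_inverse:
  assumes f: "decay w f" and ne: "\<And>M x T. M \<in> small \<Longrightarrow> T \<ge> 1 \<Longrightarrow> f M x T \<noteq> 0" and a: "M \<in> small" "T \<ge> 1"
  shows "Dx (\<lambda>M x T. inverse (f M x T)) M x T = - (Dx f M x T * (inverse (f M x T) * inverse (f M x T)))"
  unfolding Dx_def[of "\<lambda>M x T. inverse (f M x T)"]
  by (rule DERIV_imp_deriv, rule DERIV_cong[OF DERIV_inverse'[where f = "\<lambda>y. f M y T", OF decay_has_derivative[OF f a] ne[OF a]]])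
     (simp add: mult_ac)

text \<open>The second derivative of 1/f contains 2 f_x^2 / f^3 besides -f_xx / f^2. The latter
  matches the equation of f, the former has to be compensated by the source.\<close>

lemma solves_inverse:
  assumes s: "solves l f (\<lambda>_ _ _. 0)" and f: "decay w f" and i: "decay v (\<lambda>M x T. inverse (f M x T))"
    and ne: "\<And>M x T. M \<in> small \<Longrightarrow> T \<ge> 1 \<Longrightarrow> f M x T \<noteq> 0"
  shows "solves l (\<lambda>M x T. inverse (f M x T)) (\<lambda>M x T. - \<nu> * ((Dx f M x T)\<^sup>2 * inverse (f M x T) ^ 3))"
proof (rule solvesI)
  fix M x and T :: real assume a: "M \<in> small" "T > 1"
  hence a1: "T \<ge> 1" by simp
  let ?g = "\<lambda>M x T. inverse (f M x T)"
  have d: "Dx ?g M x T = - 1 * (Dx f M x T * (?g M x T * ?g M x T))" if "M \<in> small" "T \<ge> 1" for M x T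
    using Dx_inverse[OF f ne that] by simp
  have "Dx (Dx ?g) M x T = Dx (\<lambda>M x T. - 1 * (Dx f M x T * (?g M x T * ?g M x T))) M x T"
    using Dx_cong[OF d] a by auto
  also have "\<dots> = - 1 * (Dx (Dx f) M x T * (?g M x T * ?g M x T) + Dx f M x T * (Dx ?g M x T * ?g M x T + ?g M x T * Dx ?g M x T))"
    by (simp only: Dx_cmult[OF decay_mult[OF decay_Dx[OF f] decay_mult[OF i i]] a(1) a1]
      Dx_mult[OF decay_Dx[OF f] decay_mult[OF i i] a(1) a1] Dx_mult[OF i i a(1) a1])
  finally have d2: "Dx (Dx ?g) M x T = - (Dx (Dx f) M x T * (?g M x T)\<^sup>2) + 2 * ((Dx f M x T)\<^sup>2 * ?g M x T ^ 3)"
    by (simp add: d[OF a(1) a1] power2_eq_square power3_eq_cube algebra_simps)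
  have tne: "f M x T \<noteq> 0" using ne[OF a(1) a1] .
  show "((\<lambda>S. ?g M x S) has_real_derivative - \<nu> * ((Dx f M x T)\<^sup>2 * ?g M x T ^ 3) - l * Dx ?g M x T + \<nu> / 2 * Dx (Dx ?g) M x T) (at_left T)"
    unfolding d2 d[OF a(1) a1]
    by (rule DERIV_cong[OF DERIV_inverse'[where f = "\<lambda>S. f M x S", OF solvesD[OF s a] tne]])
       (simp add: power2_eq_square power3_eq_cube algebra_simps)
qed

lemma Dx_phix: "T \<ge> 1 \<Longrightarrow> Dx (phix i) M x T = (exp (M i / \<nu>) - 1) * (zeta i x T / (\<nu> * T) * exp (- (zeta i x T)\<^sup>2))"
  unfolding Dx_def phix_def
proof (rule DERIV_imp_deriv)
  assume T: "T \<ge> 1"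
  have eq: "(- 1 / r) * (E * (- (2 * z * (1 / r)))) = z / (\<nu> * T) * E" if "r * r = 2 * \<nu> * T" "r > 0" for r E z
  proof -
    have "(- 1 / r) * (E * (- (2 * z * (1 / r)))) = 2 * z * E / (r * r)" using that by (simp add: field_simps)
    thus ?thesis unfolding that using nu T by simp
  qed
  have "((\<lambda>y. exp (- (zeta i y T)\<^sup>2)) has_real_derivative exp (- (zeta i x T)\<^sup>2) * (- (2 * zeta i x T * (1 / sqrt (2 * \<nu> * T))))) (at x)"
    by (auto intro!: derivative_eq_intros zeta_has_x_derivative)
  from DERIV_cmult[OF DERIV_cmult[OF this, of "- 1 / sqrt (2 * \<nu> * T)"], of "exp (M i / \<nu>) - 1"]
  show "((\<lambda>y. (exp (M i / \<nu>) - 1) * (- 1 / sqrt (2 * \<nu> * T) * exp (- (zeta i y T)\<^sup>2))) has_real_derivative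
     (exp (M i / \<nu>) - 1) * (zeta i x T / (\<nu> * T) * exp (- (zeta i x T)\<^sup>2))) (at x)"
    unfolding eq[OF sqrt_2nuT_sq[OF T] sqrt_2nuT[OF T]] .
qed

lemma Dx_Dx_phix:
  assumes "T \<ge> 1" "M \<in> small"
  shows "Dx (Dx (phix i)) M x T = (exp (M i / \<nu>) - 1) * ((1 - 2 * (zeta i x T)\<^sup>2) / (\<nu> * T * sqrt (2 * \<nu> * T)) * exp (- (zeta i x T)\<^sup>2))"
proof -
  have "Dx (Dx (phix i)) M x T = Dx (\<lambda>M x T. (exp (M i / \<nu>) - 1) * (zeta i x T / (\<nu> * T) * exp (- (zeta i x T)\<^sup>2))) M x T"
    by (rule Dx_cong) (use Dx_phix assms in auto)
  also have "\<dots> = (exp (M i / \<nu>) - 1) * ((1 - 2 * (zeta i x T)\<^sup>2) / (\<nu> * T * sqrt (2 * \<nu> * T)) * exp (- (zeta i x T)\<^sup>2))"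
    unfolding Dx_def
  proof (rule DERIV_imp_deriv)
    have "((\<lambda>y. zeta i y T / (\<nu> * T) * exp (- (zeta i y T)\<^sup>2)) has_real_derivative
       (1 / sqrt (2 * \<nu> * T)) / (\<nu> * T) * exp (- (zeta i x T)\<^sup>2)
       + exp (- (zeta i x T)\<^sup>2) * (- (2 * zeta i x T * (1 / sqrt (2 * \<nu> * T)))) * (zeta i x T / (\<nu> * T))) (at x)"
      by (intro DERIV_mult DERIV_cdivide zeta_has_x_derivative) (auto intro!: derivative_eq_intros zeta_has_x_derivative)
    moreover have "(1 / r) / (\<nu> * T) * E + E * (- (2 * z * (1 / r))) * (z / (\<nu> * T)) = (1 - 2 * z\<^sup>2) / (\<nu> * T * r) * E" for r E z
      by (simp add: diff_divide_distrib algebra_simps power2_eq_square)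
    ultimately have "((\<lambda>y. zeta i y T / (\<nu> * T) * exp (- (zeta i y T)\<^sup>2)) has_real_derivative
       (1 - 2 * (zeta i x T)\<^sup>2) / (\<nu> * T * sqrt (2 * \<nu> * T)) * exp (- (zeta i x T)\<^sup>2)) (at x)" by simp
    from DERIV_cmult[OF this, of "exp (M i / \<nu>) - 1"]
    show "((\<lambda>y. (exp (M i / \<nu>) - 1) * (zeta i y T / (\<nu> * T) * exp (- (zeta i y T)\<^sup>2))) has_real_derivative
       (exp (M i / \<nu>) - 1) * ((1 - 2 * (zeta i x T)\<^sup>2) / (\<nu> * T * sqrt (2 * \<nu> * T)) * exp (- (zeta i x T)\<^sup>2))) (at x)" .
  qed
  finally show ?thesis .
qed

lemma solves_phi: "solves (speed c i) (phi i) (\<lambda>_ _ _. 0)"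
proof (rule solvesI)
  fix M x and T :: real assume a: "M \<in> small" "T > 1"
  hence a1: "T \<ge> 1" by simp
  have "((\<lambda>S. phi i M x S) has_real_derivative (exp (M i / \<nu>) - 1) * (- exp (- (zeta i x T)\<^sup>2) * (- speed c i / sqrt (2 * \<nu> * T) - zeta i x T / (2 * T)))) (at T)"
    unfolding phi_def
    by (auto intro!: derivative_eq_intros DERIV_chain2[OF gaussian_tail_has_derivative] zeta_has_time_derivative a1)
  thus "((\<lambda>S. phi i M x S) has_real_derivative 0 - speed c i * Dx (phi i) M x T + \<nu> / 2 * Dx (Dx (phi i)) M x T) (at_left T)"
    unfolding Dx_phi Dx_phix[OF a1] unfolding phix_def
    by (rule DERIV_cong[OF has_field_derivative_at_within])
       (use nu a1 in \<open>simp add: field_simps\<close>)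
qed

text \<open>\<open>solves\<close> speaks about the time derivative at fixed x only, so the equation
  of \<open>phi\<close> cannot simply be differentiated in x; the Gaussian is differentiated
  explicitly instead.\<close>

lemma solves_phix: "solves (speed c i) (phix i) (\<lambda>_ _ _. 0)"
proof (rule solvesI)
  fix M x and T :: real assume a: "M \<in> small" "T > 1"
  hence a1: "T \<ge> 1" by simp
  define s where "s = sqrt (2 * \<nu> * T)"
  have s: "s > 0" using sqrt_2nuT[OF a1] by (simp add: s_def)
  define z where "z = zeta i x T"
  have ds: "((\<lambda>T. inverse (sqrt (2 * \<nu> * T))) has_real_derivative - (inverse s / (2 * T))) (at T)"
  proof -
    have p: "2 * \<nu> * T > 0" using a1 nu by simp
    have d: "((\<lambda>T. 2 * \<nu> * T) has_real_derivative 2 * \<nu>) (at T)" by (auto intro!: derivative_eq_intros)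
    have ss: "s * s = 2 * \<nu> * T" using sqrt_2nuT_sq[OF a1] by (simp add: s_def)
    have sn: "sqrt (2 * \<nu> * T) \<noteq> 0" using s unfolding s_def by (metis less_irrefl)
    have "- (inverse s * (inverse s / 2 * (2 * \<nu>)) * inverse s) = - (inverse s * (\<nu> / (s * s)))"
      using s by (simp add: field_simps)
    also have "\<dots> = - (inverse s / (2 * T))" unfolding ss using nu a1 by (simp add: field_simps)
    finally show ?thesis
      using DERIV_inverse'[where f = "\<lambda>T. sqrt (2 * \<nu> * T)", OF DERIV_chain2[OF DERIV_real_sqrt[OF p] d] sn]
      by (simp add: s_def)
  qed
  have de: "((\<lambda>T. exp (- (zeta i x T)\<^sup>2)) has_real_derivative exp (- z\<^sup>2) * (- (2 * z * (- speed c i / s - z / (2 * T))))) (at T)"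
    by (auto intro!: derivative_eq_intros zeta_has_time_derivative[OF a1] simp: z_def s_def)
  have "((\<lambda>T. (exp (M i / \<nu>) - 1) * (- 1 * (inverse (sqrt (2 * \<nu> * T)) * exp (- (zeta i x T)\<^sup>2)))) has_real_derivative
      (exp (M i / \<nu>) - 1) * (- 1 * (- (inverse s / (2 * T)) * exp (- z\<^sup>2)
        + inverse s * (exp (- z\<^sup>2) * (- (2 * z * (- speed c i / s - z / (2 * T)))))))) (at T)"
    by (rule DERIV_cong[OF DERIV_cmult[OF DERIV_cmult[OF DERIV_mult[OF ds de]]]])
       (simp add: s_def z_def mult.commute)
  moreover have "(\<lambda>T. (exp (M i / \<nu>) - 1) * (- 1 * (inverse (sqrt (2 * \<nu> * T)) * exp (- (zeta i x T)\<^sup>2)))) = (\<lambda>S. phix i M x S)"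
    by (simp add: phix_def fun_eq_iff divide_inverse)
  ultimately have "((\<lambda>S. phix i M x S) has_real_derivative
      (exp (M i / \<nu>) - 1) * (- 1 * (- (inverse s / (2 * T)) * exp (- z\<^sup>2)
        + inverse s * (exp (- z\<^sup>2) * (- (2 * z * (- speed c i / s - z / (2 * T)))))))) (at T)"
    by simp
  moreover have "(exp (M i / \<nu>) - 1) * (- 1 * (- (inverse s / (2 * T)) * exp (- z\<^sup>2)
        + inverse s * (exp (- z\<^sup>2) * (- (2 * z * (- speed c i / s - z / (2 * T)))))))
      = 0 - speed c i * Dx (phix i) M x T + \<nu> / 2 * Dx (Dx (phix i)) M x T"
  proof -
    have ss: "inverse s * (1 / s) = 1 / (2 * \<nu> * T)"
    proof -
      have "s * s = 2 * \<nu> * T" using sqrt_2nuT_sq[OF a1] by (simp add: s_def)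
      moreover have "inverse s * (1 / s) = 1 / (s * s)" by (simp add: divide_inverse)
      ultimately show ?thesis by metis
    qed
    have "inverse s * (exp (- z\<^sup>2) * (- (2 * z * (- speed c i / s - z / (2 * T)))))
      = exp (- z\<^sup>2) * (2 * z * speed c i * (inverse s * (1 / s)) + inverse s * z\<^sup>2 / T)"
      by (simp add: algebra_simps power2_eq_square)
    also have "\<dots> = exp (- z\<^sup>2) * (z * speed c i / (\<nu> * T) + inverse s * z\<^sup>2 / T)"
      unfolding ss using nu a1 by simp
    finally have 1: "inverse s * (exp (- z\<^sup>2) * (- (2 * z * (- speed c i / s - z / (2 * T)))))
      = exp (- z\<^sup>2) * (z * speed c i / (\<nu> * T) + inverse s * z\<^sup>2 / T)" .
    show ?thesis
      unfolding Dx_phix[OF a1] Dx_Dx_phix[OF a1 a(1)] s_def[symmetric] z_def[symmetric] 1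
      using nu a1 s by (simp add: field_simps)
  qed
  ultimately show "((\<lambda>S. phix i M x S) has_real_derivative 0 - speed c i * Dx (phix i) M x T + \<nu> / 2 * Dx (Dx (phix i)) M x T) (at_left T)"
    using has_field_derivative_at_within by metis
qed

end

section \<open>Estimates of the time integrals\<close>

lemma exp_absorbs_powr:
  fixes \<eta> m :: real
  assumes "\<eta> > 0" "m > 0"
  obtains C where "C > 0" "\<And>u. u \<ge> 0 \<Longrightarrow> exp (- (\<eta> * u)) \<le> C * (1 + u) powr (- m)"
proof
  \<comment> \<open>The maximum of (1 + u)^m exp(-\<eta> u) over 1 + u > 0, attained where \<eta> (1
    + u) = m. It comes from ln z \<le> z - 1 at z = \<eta> (1 + u) / m.\<close>
  let ?C = "exp (\<eta> - m - m * ln (\<eta> / m))"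
  show "?C > 0" by simp
  fix u :: real assume u: "u \<ge> 0"
  have "ln (\<eta> / m * (1 + u)) \<le> \<eta> / m * (1 + u) - 1"
    using assms u by (intro ln_le_minus_one) (simp add: add_nonneg_pos add_pos_nonneg)
  hence "ln (1 + u) \<le> \<eta> / m * (1 + u) - 1 - ln (\<eta> / m)"
    using assms u by (simp add: ln_mult ln_div)
  hence "m * ln (1 + u) \<le> m * (\<eta> / m * (1 + u) - 1 - ln (\<eta> / m))"
    using assms by (intro mult_left_mono) auto
  hence "m * ln (1 + u) \<le> \<eta> * (1 + u) - m - m * ln (\<eta> / m)"
    using assms by (simp add: right_diff_distrib)
  hence "- (\<eta> * u) \<le> (\<eta> - m - m * ln (\<eta> / m)) + (- m * ln (1 + u))"
    by (simp add: algebra_simps)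
  hence "exp (- (\<eta> * u)) \<le> exp ((\<eta> - m - m * ln (\<eta> / m)) + (- m * ln (1 + u)))" by simp
  also have "\<dots> = ?C * (1 + u) powr (- m)"
    using u by (subst exp_add) (simp add: powr_def)
  finally show "exp (- (\<eta> * u)) \<le> ?C * (1 + u) powr (- m)" .
qed

lemma powr_exp_bounded:
  fixes \<eta> m :: real
  assumes "\<eta> > 0" "m > 0"
  obtains C where "C > 0" "\<And>u. u > 0 \<Longrightarrow> u powr m * exp (- (\<eta> * u)) \<le> C"
proof -
  obtain C where C: "C > 0" "\<And>u. u \<ge> 0 \<Longrightarrow> exp (- (\<eta> * u)) \<le> C * (1 + u) powr (- m)"
    using exp_absorbs_powr[OF assms] by blast
  show ?thesis
  proof (rule that[OF C(1)])
    fix u :: real assume u: "u > 0"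
    have "u powr m * exp (- (\<eta> * u)) \<le> (1 + u) powr m * (C * (1 + u) powr (- m))"
      using C u assms by (intro mult_mono powr_mono2) auto
    also have "\<dots> = C" using u by (simp add: powr_minus)
    finally show "u powr m * exp (- (\<eta> * u)) \<le> C" .
  qed
qed

lemma integral_powr_le:
  fixes a \<tau> :: real
  assumes "a < 2" "\<tau> \<ge> 1"
  shows "integral {1..\<tau>} (\<lambda>S. S powr (- a / 2)) \<le> \<tau> powr (1 - a / 2) / (1 - a / 2)"
proof -
  have "((\<lambda>S. S powr (- a / 2)) has_integral (\<tau> powr (1 - a / 2) / (1 - a / 2) - 1 powr (1 - a / 2) / (1 - a / 2))) {1..\<tau>}"
  proof (rule fundamental_theorem_of_calculus)
    fix x assume "x \<in> {1..\<tau>}"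
    hence x: "x > 0" by simp
    have p: "1 - a / 2 \<noteq> 0" using assms by simp
    have "((\<lambda>S. S powr p / p) has_real_derivative x powr (p - 1)) (at x within {1..\<tau>})" if "p \<noteq> 0" for p
      using that x by (auto intro!: derivative_eq_intros)
    from this[OF p] show "((\<lambda>S. S powr (1 - a / 2) / (1 - a / 2)) has_vector_derivative x powr (- a / 2)) (at x within {1..\<tau>})"
      by (simp add: has_real_derivative_iff_has_vector_derivative)
  qed (use assms in auto)
  thus ?thesis using assms by (simp add: integral_unique)
qed

lemma integral_exp_square_le:
  fixes \<eta> w p q :: real
  assumes "\<eta> > 0" "T > 0"
  shows "integral {p..q} (\<lambda>S. exp (- (\<eta> * (S - w)\<^sup>2 / T))) \<le> sqrt (pi / \<eta>) * sqrt T"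
proof -
  have i: "integrable lborel (\<lambda>S. exp (- (\<eta> / T * (S - w)\<^sup>2)))"
    and v: "(\<integral>S. exp (- (\<eta> / T * (S - w)\<^sup>2)) \<partial>lborel) = sqrt (pi / (\<eta> / T))"
    using gaussian_integral[of "\<eta> / T" w] assms by auto
  have si: "set_integrable lborel {p..q} (\<lambda>S. exp (- (\<eta> / T * (S - w)\<^sup>2)))"
    unfolding set_integrable_def by (rule integrable_mult_indicator[OF _ i]) simp
  have "integral {p..q} (\<lambda>S. exp (- (\<eta> / T * (S - w)\<^sup>2))) = (LINT S:{p..q}|lborel. exp (- (\<eta> / T * (S - w)\<^sup>2)))"
    by (rule set_borel_integral_eq_integral(2)[OF si, symmetric])
  also have "\<dots> \<le> (\<integral>S. exp (- (\<eta> / T * (S - w)\<^sup>2)) \<partial>lborel)"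
    unfolding set_lebesgue_integral_def
    using si i by (intro Bochner_Integration.integral_mono) (auto simp: set_integrable_def indicator_def)
  also have "\<dots> = sqrt (pi / \<eta>) * sqrt T" unfolding v using assms by (simp flip: real_sqrt_mult)
  finally show ?thesis by simp
qed

text \<open>As a function of the source time the Gaussian has mass of order sqrt T, which the
  prefactor 1/sqrt T cancels: a weight bounded by \<open>B\<close> leaves a bound of order
  \<open>B\<close>.\<close>

lemma integral_exp_weight_le:
  fixes f :: "real \<Rightarrow> real"
  assumes T: "T \<ge> 1" and \<eta>: "\<eta> > 0" and f: "continuous_on {p..q} f" "\<And>S. S \<in> {p..q} \<Longrightarrow> f S \<le> B" and B: "B \<ge> 0"
  shows "1 / sqrt T * integral {p..q} (\<lambda>S. f S * exp (- (\<eta> * (S - w)\<^sup>2 / T))) \<le> B * sqrt (pi / \<eta>)"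
proof -
  have "integral {p..q} (\<lambda>S. f S * exp (- (\<eta> * (S - w)\<^sup>2 / T))) \<le> integral {p..q} (\<lambda>S. B * exp (- (\<eta> * (S - w)\<^sup>2 / T)))"
    using f T by (intro integral_le integrable_continuous_interval continuous_intros mult_right_mono) auto
  also have "\<dots> \<le> B * (sqrt (pi / \<eta>) * sqrt T)"
    using integral_exp_square_le[OF \<eta>, of T p q w] T B by (simp add: mult_left_mono)
  finally have "1 / sqrt T * integral {p..q} (\<lambda>S. f S * exp (- (\<eta> * (S - w)\<^sup>2 / T))) \<le> 1 / sqrt T * (B * (sqrt (pi / \<eta>) * sqrt T))"
    using T by (intro mult_left_mono) auto
  thus ?thesis using T by simp
qed

lemma integral_powr_weight_le:
  fixes g :: "real \<Rightarrow> real"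
  assumes a: "a < 2" and \<tau>: "\<tau> \<ge> 1" and g: "continuous_on {1..\<tau>} g" "\<And>S. S \<in> {1..\<tau>} \<Longrightarrow> g S \<le> B" and B: "B \<ge> 0"
  shows "integral {1..\<tau>} (\<lambda>S. S powr (- a / 2) * g S) \<le> B * (\<tau> powr (1 - a / 2) / (1 - a / 2))"
proof -
  have "integral {1..\<tau>} (\<lambda>S. S powr (- a / 2) * g S) \<le> integral {1..\<tau>} (\<lambda>S. S powr (- a / 2) * B)"
    using g by (intro integral_le integrable_continuous_interval continuous_intros mult_left_mono) auto
  also have "\<dots> = B * integral {1..\<tau>} (\<lambda>S. S powr (- a / 2))" by simp
  also have "\<dots> \<le> B * (\<tau> powr (1 - a / 2) / (1 - a / 2))"
    using integral_powr_le[OF a \<tau>] B by (rule mult_left_mono)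
  finally show ?thesis .
qed

text \<open>For w \<le> 0 every S \<ge> 0 is at least |w| away from w. For 0 < w \<le> 2 sqrt T the
  exponent on the right is at most 4 \<eta>, which the constant repays.\<close>

lemma exp_square_shift_le:
  fixes w S T \<eta> :: real
  assumes "S \<ge> 0" "w \<le> 2 * sqrt T" "T > 0" "\<eta> > 0"
  shows "exp (- (\<eta> * (S - w)\<^sup>2 / T)) \<le> exp (4 * \<eta>) * exp (- (\<eta> * w\<^sup>2 / T))"
proof -
  have "\<eta> * w\<^sup>2 / T \<le> 4 * \<eta> + \<eta> * (S - w)\<^sup>2 / T"
  proof (cases "w \<le> 0")
    case True
    have "w\<^sup>2 \<le> (S - w)\<^sup>2" using True assms by (intro power2_le_iff_abs_le[THEN iffD2]) auto
    hence "\<eta> * w\<^sup>2 / T \<le> \<eta> * (S - w)\<^sup>2 / T" using assms by (intro divide_right_mono mult_left_mono) auto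
    thus ?thesis using assms by linarith
  next
    case False
    hence "w\<^sup>2 \<le> (2 * sqrt T)\<^sup>2" using assms by (intro power_mono) auto
    hence "w\<^sup>2 \<le> 4 * T" using assms by (simp add: power_mult_distrib)
    hence "\<eta> * w\<^sup>2 / T \<le> \<eta> * (4 * T) / T" using assms by (intro divide_right_mono mult_left_mono) auto
    moreover have "\<eta> * (4 * T) / T = 4 * \<eta>" using assms by simp
    moreover have "\<eta> * (S - w)\<^sup>2 / T \<ge> 0" using assms by simp
    ultimately show ?thesis by linarith
  qed
  thus ?thesis by (simp flip: exp_add)
qed

text \<open>Splitting at sqrt T balances both parts: before it the integral of S^(-a/2) grows to
  order T^(1/2 - a/4), after it the weight is at most T^(-a/4) and the Gaussian is integrated. This
  bounds the undifferentiated potential, uniformly in the position \<open>w\<close>.\<close>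

lemma potential_estimate:
  fixes \<eta> a :: real
  assumes \<eta>: "\<eta> > 0" and a: "a \<ge> 0" "a < 2"
  shows "\<exists>C\<ge>0. \<forall>T\<ge>1. \<forall>w. 1 / sqrt T * integral {1..T} (\<lambda>S. S powr (- a / 2) * exp (- (\<eta> * (S - w)\<^sup>2 / T)))
      \<le> C * T powr (- a / 4)"
proof (intro exI[of _ "1 / (1 - a / 2) + sqrt (pi / \<eta>)"] conjI allI impI)
  show "0 \<le> 1 / (1 - a / 2) + sqrt (pi / \<eta>)" using assms by (intro add_nonneg_nonneg) auto
  fix T w :: real assume T: "T \<ge> 1"
  let ?f = "\<lambda>S. S powr (- a / 2) * exp (- (\<eta> * (S - w)\<^sup>2 / T))"
  have sT: "sqrt T \<ge> 1" "sqrt T \<le> T" using T by (auto intro: real_le_lsqrt simp: power2_eq_square)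
  have split: "integral {1..T} ?f = integral {1..sqrt T} ?f + integral {sqrt T..T} ?f"
    using sT T by (intro Henstock_Kurzweil_Integration.integral_combine[symmetric] integrable_continuous_interval continuous_intros) auto
  have sp: "sqrt T powr p = T powr (p / 2)" for p using T by (simp add: powr_half_sqrt[symmetric] powr_powr)
  have "integral {1..sqrt T} ?f \<le> 1 * (sqrt T powr (1 - a / 2) / (1 - a / 2))"
    using sT \<eta> T by (intro integral_powr_weight_le a continuous_intros) auto
  hence "1 / sqrt T * integral {1..sqrt T} ?f \<le> 1 / sqrt T * (sqrt T powr (1 - a / 2) / (1 - a / 2))"
    using T by (intro mult_left_mono) auto
  also have "\<dots> = 1 / (1 - a / 2) * T powr (- a / 4)"
  proof -
    have "sqrt T powr (1 - a / 2) = sqrt T * T powr (- a / 4)"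
      using T powr_add[of "sqrt T" 1 "- a / 2"] by (simp add: sp)
    thus ?thesis using T by simp
  qed
  finally have 1: "1 / sqrt T * integral {1..sqrt T} ?f \<le> 1 / (1 - a / 2) * T powr (- a / 4)" .
  have 2: "1 / sqrt T * integral {sqrt T..T} ?f \<le> T powr (- a / 4) * sqrt (pi / \<eta>)"
  proof (rule integral_exp_weight_le[OF T \<eta>])
    show "S powr (- a / 2) \<le> T powr (- a / 4)" if "S \<in> {sqrt T..T}" for S
    proof -
      have "S powr (- a / 2) \<le> sqrt T powr (- a / 2)" using that a sT by (intro powr_mono2') auto
      thus ?thesis by (simp add: sp)
    qed
  qed (use sT in \<open>auto intro!: continuous_intros\<close>)
  from add_mono[OF 1 2] show "1 / sqrt T * integral {1..T} ?f \<le> (1 / (1 - a / 2) + sqrt (pi / \<eta>)) * T powr (- a / 4)"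
    unfolding split by (simp add: distrib_left distrib_right mult.commute)
qed

text \<open>Up to time \<open>\<tau>\<close> the source is far from the characteristic that leads to \<open>w\<close>, so that a derivative of
  the kernel suffices; from \<open>\<tau>\<close> on, the decay of the source is used.\<close>

lemma splitting_estimate:
  fixes \<eta> a :: real
  assumes \<eta>: "\<eta> > 0" and a: "a \<ge> 0" "a < 2"
  shows "\<exists>C\<ge>0. \<forall>T\<ge>1. \<forall>w. \<exists>\<tau>\<in>{1..T}.
      1 / T * integral {1..\<tau>} (\<lambda>S. S powr (- a / 2) * exp (- (\<eta> * (S - w)\<^sup>2 / T))) \<le> C * (w\<^sup>2 + T) powr (- (1 + a / 2) / 2) \<and>
      1 / sqrt T * (\<tau> powr (- a / 2) * exp (- (\<eta> * (\<tau> - w)\<^sup>2 / T))) \<le> C * (w\<^sup>2 + T) powr (- (1 + a / 2) / 2) \<and>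
      1 / sqrt T * integral {\<tau>..T} (\<lambda>S. S powr (- 1 - a / 2) * exp (- (\<eta> * (S - w)\<^sup>2 / T))) \<le> C * (w\<^sup>2 + T) powr (- (1 + a / 2) / 2)"
proof -
  define \<alpha> where "\<alpha> = 1 + a / 2"
  have \<alpha>: "\<alpha> \<ge> 1" "\<alpha> < 2" using a by (auto simp: \<alpha>_def)
  obtain C1 where C1: "C1 > 0" "\<And>u. u \<ge> 0 \<Longrightarrow> exp (- (\<eta> / 2 * u)) \<le> C1 * (1 + u) powr (- (\<alpha> / 2))"
    using exp_absorbs_powr[of "\<eta> / 2" "\<alpha> / 2"] \<eta> \<alpha> by auto
  obtain C2 where C2: "C2 > 0" "\<And>u. u > 0 \<Longrightarrow> u powr 1 * exp (- (\<eta> / 4 * u)) \<le> C2"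
    using powr_exp_bounded[of "\<eta> / 4" 1] \<eta> by auto
  obtain C3 where C3: "C3 > 0" "\<And>u. u > 0 \<Longrightarrow> u powr (1 / 2 + a / 2) * exp (- (\<eta> / 4 * u)) \<le> C3"
    using powr_exp_bounded[of "\<eta> / 4" "1 / 2 + a / 2"] \<eta> a by auto
  define K where "K = max 1 (1 / (1 - a / 2))"
  have K: "K \<ge> 1" "1 / (1 - a / 2) \<le> K" by (auto simp: K_def)
  define C where "C = exp (4 * \<eta>) * C1 * K * (1 + sqrt (2 * pi / \<eta>)) + 2 powr \<alpha> * (K * C2 + C3 * 2 + 4 * sqrt (pi / \<eta>))"
  have sq0: "sqrt (2 * pi / \<eta>) \<ge> 0" "sqrt (pi / \<eta>) \<ge> 0" using \<eta> by auto
  have C0: "C \<ge> 0" using C1 C2 C3 K sq0 by (auto simp: C_def intro!: add_nonneg_nonneg mult_nonneg_nonneg)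
  \<comment> \<open>A Gaussian in w/sqrt T upgrades the time decay T^(-\<alpha>/2) to the full
    weight in w^2 + T.\<close>
  have far: "exp (- (\<eta> / 2 * (w\<^sup>2 / T))) * T powr (- \<alpha> / 2) \<le> C1 * (w\<^sup>2 + T) powr (- \<alpha> / 2)" if "T \<ge> 1" for w T
  proof -
    have "exp (- (\<eta> / 2 * (w\<^sup>2 / T))) * T powr (- \<alpha> / 2) \<le> C1 * (1 + w\<^sup>2 / T) powr (- (\<alpha> / 2)) * T powr (- \<alpha> / 2)"
      using that by (intro mult_right_mono C1) auto
    also have "\<dots> = C1 * ((1 + w\<^sup>2 / T) powr (- (\<alpha> / 2)) * T powr (- \<alpha> / 2))" by simp
    also have "(1 + w\<^sup>2 / T) powr (- (\<alpha> / 2)) * T powr (- \<alpha> / 2) = ((1 + w\<^sup>2 / T) * T) powr (- \<alpha> / 2)"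
      by (simp add: powr_mult)
    also have "(1 + w\<^sup>2 / T) * T = w\<^sup>2 + T" using that by (simp add: field_simps)
    finally show ?thesis .
  qed
  show ?thesis
  proof (intro exI[of _ C] conjI allI impI C0)
    fix T w :: real assume T: "T \<ge> 1"
    define Y where "Y = (w\<^sup>2 + T) powr (- \<alpha> / 2)"
    have Y0: "Y \<ge> 0" by (simp add: Y_def)
    let ?e = "\<lambda>S. exp (- (\<eta> * (S - w)\<^sup>2 / T))"
    have sT: "sqrt T \<ge> 1" "sqrt T \<le> T" using T by (auto intro: real_le_lsqrt simp: power2_eq_square)
    have sp: "sqrt T powr p = T powr (p / 2)" for p using T by (simp add: powr_half_sqrt[symmetric] powr_powr)
    have "\<exists>\<tau>\<in>{1..T}.
      1 / T * integral {1..\<tau>} (\<lambda>S. S powr (- a / 2) * ?e S) \<le> C * Y \<and>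
      1 / sqrt T * (\<tau> powr (- a / 2) * ?e \<tau>) \<le> C * Y \<and>
      1 / sqrt T * integral {\<tau>..T} (\<lambda>S. S powr (- \<alpha>) * ?e S) \<le> C * Y"
    proof (cases "w \<le> 2 * sqrt T")
      case True
      define E where "E = exp (- (\<eta> / 2 * (w\<^sup>2 / T)))"
      have E: "exp (- (\<eta> * w\<^sup>2 / T)) \<le> E" 
      proof -
        have "\<eta> / 2 * (w\<^sup>2 / T) \<le> \<eta> * (w\<^sup>2 / T)" using \<eta> T by (intro mult_right_mono) auto
        thus ?thesis by (simp add: E_def)
      qed
      have ET: "E * T powr (- \<alpha> / 2) \<le> C1 * Y" using far[OF T, of w] by (simp add: E_def Y_def)
      have e: "?e S \<le> exp (4 * \<eta>) * E" if "S \<ge> 0" for S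
        using order_trans[OF exp_square_shift_le[OF that True _ \<eta>] mult_left_mono[OF E]] T by simp
      \<comment> \<open>The exponent is halved: one half yields the decay \<open>E\<close> in
        \<open>w\<close>, the other is kept for the integration over \<open>S\<close>.\<close>
      have e2: "?e S \<le> exp (4 * \<eta>) * E * exp (- ((\<eta> / 2) * (S - w)\<^sup>2 / T))" if "S \<ge> 0" for S
      proof -
        have "?e S = exp (- ((\<eta> / 2) * (S - w)\<^sup>2 / T)) * exp (- ((\<eta> / 2) * (S - w)\<^sup>2 / T))"
          by (simp flip: exp_add)
        also have "\<dots> \<le> (exp (4 * (\<eta> / 2)) * exp (- ((\<eta> / 2) * w\<^sup>2 / T))) * exp (- ((\<eta> / 2) * (S - w)\<^sup>2 / T))"
          using exp_square_shift_le[OF that True, of "\<eta> / 2"] T \<eta> by (intro mult_right_mono) auto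
        also have "\<dots> \<le> (exp (4 * \<eta>) * E) * exp (- ((\<eta> / 2) * (S - w)\<^sup>2 / T))"
          using \<eta> by (intro mult_right_mono mult_mono) (auto simp: E_def)
        finally show ?thesis .
      qed
      have E0: "E \<ge> 0" by (simp add: E_def)
      have Cbig: "exp (4 * \<eta>) * C1 * K \<le> C" "exp (4 * \<eta>) * C1 * sqrt (2 * pi / \<eta>) \<le> C" "exp (4 * \<eta>) * C1 \<le> C"
      proof -
        have x: "exp (4 * \<eta>) * C1 * K * (1 + sqrt (2 * pi / \<eta>)) \<le> C"
          unfolding C_def using C2 C3 K sq0 by (auto intro!: add_nonneg_nonneg mult_nonneg_nonneg)
        have y: "exp (4 * \<eta>) * C1 * 1 * z \<le> exp (4 * \<eta>) * C1 * K * z" if "z \<ge> 0" for z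
          using C1 K that by (intro mult_right_mono mult_left_mono) auto
        have y': "exp (4 * \<eta>) * C1 * K * 1 \<le> exp (4 * \<eta>) * C1 * K * (1 + sqrt (2 * pi / \<eta>))"
          using C1 K sq0 by (intro mult_left_mono) auto
        have y'': "exp (4 * \<eta>) * C1 * K * sqrt (2 * pi / \<eta>) \<le> exp (4 * \<eta>) * C1 * K * (1 + sqrt (2 * pi / \<eta>))"
          using C1 K sq0 by (intro mult_left_mono) auto
        show "exp (4 * \<eta>) * C1 * K \<le> C" using x y' by linarith
        show "exp (4 * \<eta>) * C1 * sqrt (2 * pi / \<eta>) \<le> C" using x y'' y[OF sq0(1)] by linarith
        show "exp (4 * \<eta>) * C1 \<le> C" using x y' y[of 1] by linarith
      qed
      have fin: "exp (4 * \<eta>) * E * (k * T powr (- \<alpha> / 2)) \<le> C * Y" if "exp (4 * \<eta>) * C1 * k \<le> C" "k \<ge> 0" for k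
      proof -
        have "exp (4 * \<eta>) * E * (k * T powr (- \<alpha> / 2)) = exp (4 * \<eta>) * k * (E * T powr (- \<alpha> / 2))" by simp
        also have "\<dots> \<le> exp (4 * \<eta>) * k * (C1 * Y)" using ET that by (intro mult_left_mono) auto
        also have "\<dots> = exp (4 * \<eta>) * C1 * k * Y" by simp
        also have "\<dots> \<le> C * Y" using that Y0 by (intro mult_right_mono) auto
        finally show ?thesis .
      qed
      show ?thesis
      \<comment> \<open>Close to the characteristic, and on the side w < 0 that corresponds to no
        source time, \<tau> = sqrt T balances the three terms: each is T^(-\<alpha>/2) times
        \<open>E\<close>.\<close>
      proof (intro bexI[of _ "sqrt T"] conjI)
        have "integral {1..sqrt T} (\<lambda>S. S powr (- a / 2) * ?e S) \<le> (exp (4 * \<eta>) * E) * (sqrt T powr (1 - a / 2) / (1 - a / 2))"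
          using sT T e E0 by (intro integral_powr_weight_le a continuous_intros) auto
        hence "1 / T * integral {1..sqrt T} (\<lambda>S. S powr (- a / 2) * ?e S) \<le> 1 / T * ((exp (4 * \<eta>) * E) * (sqrt T powr (1 - a / 2) / (1 - a / 2)))"
          using T by (intro mult_left_mono) auto
        also have "\<dots> = exp (4 * \<eta>) * E * (1 / (1 - a / 2) * T powr (- \<alpha> / 2))"
        proof -
          have "sqrt T powr (1 - a / 2) = T powr (1 + (- \<alpha> / 2))" unfolding sp by (simp add: \<alpha>_def field_simps)
          also have "\<dots> = T * T powr (- \<alpha> / 2)" using T by (simp only: powr_add) simp
          finally show ?thesis using T by simp
        qed
        also have "\<dots> \<le> exp (4 * \<eta>) * E * (K * T powr (- \<alpha> / 2))"
          using K E0 by (intro mult_left_mono mult_right_mono) auto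
        also have "\<dots> \<le> C * Y" using Cbig K by (intro fin) auto
        finally show "1 / T * integral {1..sqrt T} (\<lambda>S. S powr (- a / 2) * ?e S) \<le> C * Y" .
        have "1 / sqrt T * sqrt T powr (- a / 2) = T powr (- \<alpha> / 2)"
        proof -
          have "1 / sqrt T * sqrt T powr (- a / 2) = sqrt T powr (-1) * sqrt T powr (- a / 2)"
            using T powr_neg_one[of "sqrt T"] by simp
          also have "\<dots> = sqrt T powr (- \<alpha>)" by (simp only: powr_add[symmetric]) (simp add: \<alpha>_def)
          finally show ?thesis by (simp add: sp)
        qed
        hence q: "1 / sqrt T * (sqrt T powr (- a / 2) * z) = T powr (- \<alpha> / 2) * z" for z
          by (metis mult.assoc)
        have "1 / sqrt T * (sqrt T powr (- a / 2) * ?e (sqrt T)) \<le> T powr (- \<alpha> / 2) * (exp (4 * \<eta>) * E)"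
          unfolding q using e[of "sqrt T"] sT T by (intro mult_left_mono) auto
        also have "\<dots> = exp (4 * \<eta>) * E * (1 * T powr (- \<alpha> / 2))" by simp
        also have "\<dots> \<le> C * Y" using Cbig by (intro fin) auto
        finally show "1 / sqrt T * (sqrt T powr (- a / 2) * ?e (sqrt T)) \<le> C * Y" .
        let ?e' = "\<lambda>S. exp (- ((\<eta> / 2) * (S - w)\<^sup>2 / T))"
        have "integral {sqrt T..T} (\<lambda>S. S powr (- \<alpha>) * ?e S) \<le> integral {sqrt T..T} (\<lambda>S. exp (4 * \<eta>) * E * (S powr (- \<alpha>) * ?e' S))"
        proof (rule integral_le)
          show "S powr (- \<alpha>) * ?e S \<le> exp (4 * \<eta>) * E * (S powr (- \<alpha>) * ?e' S)" if "S \<in> {sqrt T..T}" for S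
          proof -
            have "sqrt T \<le> S" using that by simp
            with sT(1) have "S \<ge> 0" by linarith
            from mult_left_mono[OF e2[OF this], of "S powr (- \<alpha>)"] show ?thesis by (simp add: mult_ac)
          qed
        qed (use sT T in \<open>auto intro!: integrable_continuous_interval continuous_intros\<close>)
        also have "\<dots> = exp (4 * \<eta>) * E * integral {sqrt T..T} (\<lambda>S. S powr (- \<alpha>) * ?e' S)"
          by (rule Henstock_Kurzweil_Integration.integral_mult_right)
        finally have "1 / sqrt T * integral {sqrt T..T} (\<lambda>S. S powr (- \<alpha>) * ?e S)
            \<le> 1 / sqrt T * (exp (4 * \<eta>) * E * integral {sqrt T..T} (\<lambda>S. S powr (- \<alpha>) * ?e' S))"
          using T by (intro mult_left_mono) auto
        also have "\<dots> = exp (4 * \<eta>) * E * (1 / sqrt T * integral {sqrt T..T} (\<lambda>S. S powr (- \<alpha>) * ?e' S))" by simp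
        also have "\<dots> \<le> exp (4 * \<eta>) * E * (T powr (- \<alpha> / 2) * sqrt (pi / (\<eta> / 2)))"
        proof (intro mult_left_mono integral_exp_weight_le[OF T])
          show "S powr (- \<alpha>) \<le> T powr (- \<alpha> / 2)" if "S \<in> {sqrt T..T}" for S
          proof -
            have "S powr (- \<alpha>) \<le> sqrt T powr (- \<alpha>)" using that \<alpha> sT by (intro powr_mono2') auto
            thus ?thesis by (simp add: sp)
          qed
        qed (use \<eta> E0 sT in \<open>auto intro!: continuous_intros\<close>)
        also have "\<dots> = exp (4 * \<eta>) * E * (sqrt (2 * pi / \<eta>) * T powr (- \<alpha> / 2))" by (simp add: mult_ac)
        also have "\<dots> \<le> C * Y" using Cbig sq0 by (intro fin) auto
        finally show "1 / sqrt T * integral {sqrt T..T} (\<lambda>S. S powr (- \<alpha>) * ?e S) \<le> C * Y" .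
      qed (use sT in auto)
    next
      case False
      hence w: "w > 2 * sqrt T" by simp
      have w2: "w \<ge> 2" using w sT by linarith
      \<comment> \<open>Source times up to w/2 stay at distance at least w/2 from \<open>w\<close>.
        The minimum keeps \<tau> in range when w/2 exceeds every source time.\<close>
      define \<tau> where "\<tau> = min T (w / 2)"
      have \<tau>: "\<tau> \<in> {1..T}" "\<tau> \<le> w / 2" "\<tau> \<ge> 1" using w2 T by (auto simp: \<tau>_def)
      define u where "u = w\<^sup>2 / T"
      have "(2 * sqrt T)\<^sup>2 \<le> w\<^sup>2" using w T by (intro power_mono) auto
      hence wT: "4 * T \<le> w\<^sup>2" using T by (simp add: power_mult_distrib)
      hence u: "u \<ge> 4" "u > 0" using T by (auto simp: u_def field_simps)
      have uw: "T = w\<^sup>2 / u" using T w2 by (simp add: u_def)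
      \<comment> \<open>Here T \<le> w^2/4, so the target weight is comparable to w^(-\<alpha>), and
        all three bounds may be stated in powers of \<open>w\<close>.\<close>
      have uY: "w powr (- \<alpha>) \<le> 2 powr \<alpha> * Y"
      proof -
        have "(2 * w)\<^sup>2 = 4 * w\<^sup>2" by (simp add: power_mult_distrib)
        hence "w\<^sup>2 + T \<le> (2 * w)\<^sup>2" using wT T zero_le_power2[of w] by linarith
        hence "((2 * w)\<^sup>2) powr (- \<alpha> / 2) \<le> Y"
          unfolding Y_def using T \<alpha> by (intro powr_mono2') (auto simp: add_nonneg_pos)
        moreover have "((2 * w)\<^sup>2) powr (- \<alpha> / 2) = (2 * w) powr (- \<alpha>)"
        proof -
          have "(z\<^sup>2) powr (- \<alpha> / 2) = z powr (- \<alpha>)" if "z > 0" for z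
            using powr_powr[of z 2 "- \<alpha> / 2"] that by simp
          from this[of "2 * w"] w2 show ?thesis by simp
        qed
        moreover have "(2 * w) powr (- \<alpha>) = 2 powr (- \<alpha>) * w powr (- \<alpha>)" using w2 by (simp add: powr_mult)
        ultimately have "2 powr (- \<alpha>) * w powr (- \<alpha>) \<le> Y" by simp
        hence "2 powr \<alpha> * (2 powr (- \<alpha>) * w powr (- \<alpha>)) \<le> 2 powr \<alpha> * Y" by (intro mult_left_mono) auto
        moreover have "2 powr \<alpha> * 2 powr (- \<alpha>) = (1::real)" by (simp flip: powr_add)
        ultimately show ?thesis by (simp only: mult.assoc[symmetric])
      qed
      have fin: "k * w powr (- \<alpha>) \<le> C * Y" if "k \<le> K * C2 + C3 * 2 + 4 * sqrt (pi / \<eta>)" "k \<ge> 0" for k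
      proof -
        have "k * w powr (- \<alpha>) \<le> k * (2 powr \<alpha> * Y)" using uY that by (intro mult_left_mono) auto
        also have "\<dots> \<le> (K * C2 + C3 * 2 + 4 * sqrt (pi / \<eta>)) * (2 powr \<alpha> * Y)"
          using that Y0 by (intro mult_right_mono) auto
        also have "\<dots> = 2 powr \<alpha> * (K * C2 + C3 * 2 + 4 * sqrt (pi / \<eta>)) * Y" by simp
        also have "\<dots> \<le> C * Y"
          unfolding C_def using Y0 C1(1) K sq0 by (intro mult_right_mono) (auto intro!: mult_nonneg_nonneg add_nonneg_nonneg)
        finally show ?thesis .
      qed
      have e: "?e S \<le> exp (- (\<eta> / 4 * u))" if "S \<le> w / 2" for S
      proof -
        have "(w / 2)\<^sup>2 \<le> (w - S)\<^sup>2" using that w2 by (intro power_mono) auto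
        hence "\<eta> * (w / 2)\<^sup>2 / T \<le> \<eta> * (S - w)\<^sup>2 / T"
          using \<eta> T by (intro divide_right_mono mult_left_mono) (auto simp: power2_commute)
        thus ?thesis by (simp add: u_def power_divide)
      qed
      have wa: "w powr (- a / 2) = w * w powr (- \<alpha>)"
      proof -
        have "w powr (- a / 2) = w powr (1 + (- \<alpha>))" by (simp add: \<alpha>_def)
        also have "\<dots> = w * w powr (- \<alpha>)" using w2 by (simp only: powr_add) simp
        finally show ?thesis .
      qed
      show ?thesis
      proof (intro bexI[of _ \<tau>] conjI \<tau>)
        have "integral {1..\<tau>} (\<lambda>S. S powr (- a / 2) * ?e S) \<le> exp (- (\<eta> / 4 * u)) * (\<tau> powr (1 - a / 2) / (1 - a / 2))"
          using \<tau> T e by (intro integral_powr_weight_le a continuous_intros) auto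
        also have "\<dots> \<le> exp (- (\<eta> / 4 * u)) * (w powr (1 - a / 2) * K)"
        proof -
          have "\<tau> powr (1 - a / 2) \<le> w powr (1 - a / 2)" using \<tau> w2 a by (intro powr_mono2) auto
          hence "\<tau> powr (1 - a / 2) * (1 / (1 - a / 2)) \<le> w powr (1 - a / 2) * K"
            using K a by (intro mult_mono) auto
          thus ?thesis by (intro mult_left_mono) auto
        qed
        finally have "1 / T * integral {1..\<tau>} (\<lambda>S. S powr (- a / 2) * ?e S) \<le> 1 / T * (exp (- (\<eta> / 4 * u)) * (w powr (1 - a / 2) * K))"
          using T by (intro mult_left_mono) auto
        also have "w powr (1 - a / 2) = w\<^sup>2 * w powr (- \<alpha>)"
        proof -
          have "w powr (1 - a / 2) = w powr (1 + (- a / 2))" by simp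
          also have "\<dots> = w * w powr (- a / 2)" using w2 by (simp only: powr_add) simp
          also have "\<dots> = w * (w * w powr (- \<alpha>))" unfolding wa ..
          finally show ?thesis by (simp add: power2_eq_square)
        qed
        also have "1 / T * (exp (- (\<eta> / 4 * u)) * (w\<^sup>2 * w powr (- \<alpha>) * K)) = K * (u powr 1 * exp (- (\<eta> / 4 * u))) * w powr (- \<alpha>)"
          using T by (simp add: u_def mult_ac)
        also have "\<dots> \<le> K * C2 * w powr (- \<alpha>)"
          using C2(2)[OF u(2)] K by (intro mult_right_mono mult_left_mono) auto
        also have "\<dots> \<le> C * Y" using K C2 C3 sq0 by (intro fin) auto
        finally show "1 / T * integral {1..\<tau>} (\<lambda>S. S powr (- a / 2) * ?e S) \<le> C * Y" .
        \<comment> \<open>Covers both values of the minimum at the cost of a power of u = w^2/T,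
          which the Gaussian factor absorbs.\<close>
        have "2 / w * u \<ge> 1 / \<tau>"
        proof (cases "T \<le> w / 2")
          case True
          hence "1 / \<tau> = 1 / T" by (simp add: \<tau>_def)
          also have "\<dots> \<le> 2 * w / T" using w2 T by (intro divide_right_mono) auto
          also have "\<dots> = 2 / w * u" using w2 by (simp add: u_def power2_eq_square)
          finally show ?thesis .
        next
          case False
          hence "1 / \<tau> = 2 / w * 1" by (simp add: \<tau>_def)
          also have "\<dots> \<le> 2 / w * u" using u w2 by (intro mult_left_mono) auto
          finally show ?thesis .
        qed
        hence "(1 / \<tau>) powr (a / 2) \<le> (2 / w * u) powr (a / 2)" using a \<tau> by (intro powr_mono2) auto
        hence t: "\<tau> powr (- a / 2) \<le> 2 powr (a / 2) * w powr (- a / 2) * u powr (a / 2)"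
          using \<tau> w2 u by (simp add: powr_mult powr_divide powr_minus_divide)
        have sTu: "1 / sqrt T = u powr (1 / 2) / w"
        proof -
          have "sqrt T = w / sqrt u" unfolding uw using w2 by (simp add: real_sqrt_divide)
          thus ?thesis using u w2 by (simp add: powr_half_sqrt)
        qed
        have "1 / sqrt T * (\<tau> powr (- a / 2) * ?e \<tau>) \<le> 1 / sqrt T * ((2 powr (a / 2) * w powr (- a / 2) * u powr (a / 2)) * exp (- (\<eta> / 4 * u)))"
          using t e[OF \<tau>(2)] T by (intro mult_left_mono mult_mono) auto
        also have "\<dots> = 2 powr (a / 2) * (u powr (1 / 2 + a / 2) * exp (- (\<eta> / 4 * u))) * w powr (- \<alpha>)"
          unfolding sTu wa using w2 u by (simp add: powr_add)
        also have "\<dots> \<le> 2 powr 1 * C3 * w powr (- \<alpha>)"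
          using C3(2)[OF u(2)] a by (intro mult_right_mono mult_mono powr_mono) auto
        also have "\<dots> \<le> C * Y" using K C2 C3 sq0 by (intro fin) auto
        finally show "1 / sqrt T * (\<tau> powr (- a / 2) * ?e \<tau>) \<le> C * Y" .
        show "1 / sqrt T * integral {\<tau>..T} (\<lambda>S. S powr (- \<alpha>) * ?e S) \<le> C * Y"
        proof (cases "T \<le> w / 2")
          case True
          hence "\<tau> = T" by (simp add: \<tau>_def)
          thus ?thesis using C0 Y0 by simp
        next
          case False
          hence te: "\<tau> = w / 2" by (simp add: \<tau>_def)
          have "1 / sqrt T * integral {\<tau>..T} (\<lambda>S. S powr (- \<alpha>) * ?e S) \<le> (w / 2) powr (- \<alpha>) * sqrt (pi / \<eta>)"
            using \<tau> te \<alpha> w2 by (intro integral_exp_weight_le[OF T \<eta>]) (auto intro!: continuous_intros powr_mono2')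
          also have "(w / 2) powr (- \<alpha>) = 2 powr \<alpha> * w powr (- \<alpha>)"
            using w2 by (simp add: powr_divide powr_minus_divide)
          also have "2 powr \<alpha> * w powr (- \<alpha>) * sqrt (pi / \<eta>) \<le> (4 * sqrt (pi / \<eta>)) * w powr (- \<alpha>)"
          proof -
            have "2 powr \<alpha> \<le> 2 powr 2" using \<alpha> by (intro powr_mono) auto
            hence "2 powr \<alpha> \<le> 4" by simp
            from mult_right_mono[OF this, of "w powr (- \<alpha>) * sqrt (pi / \<eta>)"] show ?thesis using sq0 by (simp add: mult_ac)
          qed
          also have "\<dots> \<le> C * Y" using K C2 C3 sq0 by (intro fin) auto
          finally show ?thesis .
        qed
      qed
    qed
    thus "\<exists>\<tau>\<in>{1..T}.
      1 / T * integral {1..\<tau>} (\<lambda>S. S powr (- a / 2) * exp (- (\<eta> * (S - w)\<^sup>2 / T))) \<le> C * (w\<^sup>2 + T) powr (- (1 + a / 2) / 2) \<and>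
      1 / sqrt T * (\<tau> powr (- a / 2) * exp (- (\<eta> * (\<tau> - w)\<^sup>2 / T))) \<le> C * (w\<^sup>2 + T) powr (- (1 + a / 2) / 2) \<and>
      1 / sqrt T * integral {\<tau>..T} (\<lambda>S. S powr (- 1 - a / 2) * exp (- (\<eta> * (S - w)\<^sup>2 / T))) \<le> C * (w\<^sup>2 + T) powr (- (1 + a / 2) / 2)"
      by (simp add: Y_def \<alpha>_def)
  qed
qed

section \<open>Interaction of waves with different speeds\<close>

context wave_speeds
begin

lemma decay_bounded_continuous_Dx:
  assumes f: "decay w f" "dominated (\<lambda>_ _ _. 1) w" "M \<in> small"
  shows "bounded_continuous 1 ((Dx ^^ k) f M)"
  by (rule decay_bounded_continuous[OF decay_Dx_funpow[OF f(1)] dominated_divide_sqrt[OF f(2)] f(3)])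

text \<open>Both sides solve the same equation from time \<tau> on with the same datum, and both are
  bounded, so \<open>parabolic_uniqueness\<close> makes their difference vanish.\<close>

lemma duhamel_representation_0:
  assumes h: "decay w h" "dominated (\<lambda>_ _ _. 1) w" and g: "decay v g" "dominated (\<lambda>_ _ _. 1) v"
    and s: "solves l h g" and M: "M \<in> small" and \<tau>: "1 \<le> \<tau>" "\<tau> \<le> T"
  shows "h M x T = heat \<nu> l (T - \<tau>) (\<lambda>y. h M y \<tau>) x + duhamel \<nu> l \<tau> (g M) x T"
proof -
  note bh = decay_bounded_continuous_Dx[OF h M] and bg = bounded_continuous_mono[OF decay_bounded_continuous_Dx[OF g M] \<tau>(1)]
  note dh = decay_has_derivative[OF decay_Dx_funpow[OF h(1)] M] and dg = decay_has_derivative[OF decay_Dx_funpow[OF g(1)] M]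
  obtain B where B: "\<And>k x t. t \<ge> 1 \<Longrightarrow> \<bar>(Dx ^^ k) h M x t\<bar> \<le> B k"
    using bh unfolding bounded_continuous_def by metis
  obtain Bg where Bg: "\<And>x t. t \<ge> \<tau> \<Longrightarrow> \<bar>g M x t\<bar> \<le> Bg"
    using bg[of 0] unfolding bounded_continuous_def by auto
  define H where "H k x t = heat \<nu> l (t - \<tau>) (\<lambda>y. (Dx ^^ k) h M y \<tau>) x" for k x t
  define U where "U k x t = duhamel \<nu> l \<tau> ((Dx ^^ k) g M) x t" for k x t
  have ch: "continuous_on UNIV (\<lambda>y. (Dx ^^ k) h M y \<tau>)" for k
    by (rule bounded_continuous_slice[OF bh \<tau>(1)])
  have dH: "((\<lambda>y. H k y t) has_real_derivative H (Suc k) x t) (at x)" for k x t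
    unfolding H_def
    by (rule heat_has_derivative[OF _ ch B B]) (use dh[of \<tau> k] \<tau> in \<open>auto\<close>)
  have dU: "((\<lambda>y. U k y t) has_real_derivative U (Suc k) x t) (at x)" for k x t
    unfolding U_def by (rule duhamel_has_derivative[OF bg bg]) (use dg[of _ k] \<tau> in auto)
  let ?w = "\<lambda>x t. (Dx ^^ 0) h M x t - H 0 x t - U 0 x t"
  have "?w x T = 0"
  proof (rule parabolic_uniqueness[where w = ?w and a = \<tau> and ?x1.0 = x and ?t1.0 = T and ?T1.0 = T and \<mu> = "\<nu> / 2" and b = "\<lambda>_ _. l" and e = "\<lambda>_ _. 0" and B = "\<bar>l\<bar>" and E = 0
        and wx = "\<lambda>x t. (Dx ^^ 1) h M x t - H 1 x t - U 1 x t" and wxx = "\<lambda>x t. (Dx ^^ 2) h M x t - H 2 x t - U 2 x t"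
        and wt = "\<lambda>x t. (g M x t - l * Dx h M x t + \<nu> / 2 * Dx (Dx h) M x t) - (- l * H 1 x t + \<nu> / 2 * H 2 x t)
            - (g M x t - l * U 1 x t + \<nu> / 2 * U 2 x t)"])
    have c1: "continuous_on (UNIV \<times> {\<tau>..T}) (\<lambda>z. h M (fst z) (snd z))"
      by (rule continuous_on_subset[of "UNIV \<times> {1..}"]) (use bh[of 0] \<tau> in \<open>auto simp: bounded_continuous_def case_prod_unfold\<close>)
    \<comment> \<open>The datum is regarded as a function constant in time, in order to use the
      joint continuity of \<open>heat\<close>.\<close>
    have hb: "bounded_continuous 1 (\<lambda>x t. h M x \<tau>)"
    proof -
      have "continuous_on (UNIV \<times> {1..}) (\<lambda>z :: real \<times> real. h M (fst z) \<tau>)"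
        by (rule continuous_on_compose2[OF ch[of 0], of _ fst, simplified]) (intro continuous_intros)
      thus ?thesis unfolding bounded_continuous_def case_prod_unfold using B[of \<tau> 0] \<tau> by auto
    qed
    have c2: "continuous_on (UNIV \<times> {\<tau>..T}) (\<lambda>z. H 0 (fst z) (snd z))"
      unfolding H_def funpow_0
      by (rule continuous_on_compose2[OF heat_continuous[of "{1..}" "\<lambda>x t. h M x \<tau>" "B 0" \<nu> l],
           of _ "\<lambda>z. (fst z, snd z - \<tau>, 1)", simplified])
         (use hb B[of \<tau> 0] \<tau> in \<open>auto simp: bounded_continuous_def intro!: continuous_intros\<close>)
    have c3: "continuous_on (UNIV \<times> {\<tau>..T}) (\<lambda>z. U 0 (fst z) (snd z))"
      unfolding U_def
      by (rule continuous_on_subset[OF duhamel_continuous[OF bg[of 0], unfolded case_prod_unfold]]) auto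
    show "continuous_on (UNIV \<times> {\<tau>..T}) (\<lambda>(x, t). ?w x t)"
      unfolding case_prod_unfold using c1 c2 c3 by (auto intro!: continuous_intros)
    show "\<bar>?w x t\<bar> \<le> B 0 + B 0 + Bg * (T - \<tau>)" if "t \<in> {\<tau>..T}" for x t
    proof -
      have 1: "\<bar>(Dx ^^ 0) h M x t\<bar> \<le> B 0" using B[of t 0] that \<tau> by auto
      have 2: "\<bar>H 0 x t\<bar> \<le> B 0" unfolding H_def by (rule heat_bound[OF ch B[OF \<tau>(1)]])
      have "\<bar>U 0 x t\<bar> \<le> Bg * (t - \<tau>)"
        unfolding U_def by (rule duhamel_bound[OF bg]) (use Bg that in auto)
      also have "\<dots> \<le> Bg * (T - \<tau>)"
        using that order_trans[OF abs_ge_zero Bg[of \<tau> 0]] by (intro mult_left_mono) auto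
      finally show ?thesis using 1 2 by linarith
    qed
    show "?w x \<tau> = 0" for x by (simp add: H_def U_def heat_zero duhamel_def)
    show "((\<lambda>y. ?w y t) has_real_derivative (Dx ^^ 1) h M x t - H 1 x t - U 1 x t) (at x)" if "t \<in> {\<tau><..T}" for x t
      using dh[of t 0] dH[of 0] dU[of 0] that \<tau> by (auto intro!: DERIV_diff)
    show "((\<lambda>y. (Dx ^^ 1) h M y t - H 1 y t - U 1 y t) has_real_derivative (Dx ^^ 2) h M x t - H 2 x t - U 2 x t) (at x)"
      if "t \<in> {\<tau><..T}" for x t
      using dh[of t 1] dH[of 1] dU[of 1] that \<tau> by (auto intro!: DERIV_diff simp: numeral_2_eq_2)
    show "((\<lambda>s. ?w x s) has_real_derivative (g M x t - l * Dx h M x t + \<nu> / 2 * Dx (Dx h) M x t) - (- l * H 1 x t + \<nu> / 2 * H 2 x t)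
            - (g M x t - l * U 1 x t + \<nu> / 2 * U 2 x t)) (at_left t)" if t: "t \<in> {\<tau><..T}" for x t
    proof (intro DERIV_diff)
      show "((\<lambda>s. (Dx ^^ 0) h M x s) has_real_derivative (g M x t - l * Dx h M x t + \<nu> / 2 * Dx (Dx h) M x t)) (at_left t)"
        using solvesD[OF s M, of t x] t \<tau> by simp
      have "((\<lambda>d. heat \<nu> l d (\<lambda>y. (Dx ^^ 0) h M y \<tau>) x) has_real_derivative - l * H 1 x t + \<nu> / 2 * H 2 x t) (at (t - \<tau>))"
        unfolding H_def
        by (rule heat_has_time_derivative[OF _ nu _ _ ch B B B])
           (use t dh[of \<tau> 0] dh[of \<tau> 1] \<tau> in \<open>auto simp: numeral_2_eq_2\<close>)
      moreover have "((\<lambda>s. s - \<tau>) has_real_derivative 1) (at_left t)" by (auto intro!: derivative_eq_intros)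
      ultimately have "((\<lambda>s. heat \<nu> l (s - \<tau>) (\<lambda>y. (Dx ^^ 0) h M y \<tau>) x) has_real_derivative (- l * H 1 x t + \<nu> / 2 * H 2 x t) * 1) (at_left t)"
        by (rule DERIV_chain2)
      thus "((\<lambda>s. H 0 x s) has_real_derivative - l * H 1 x t + \<nu> / 2 * H 2 x t) (at_left t)"
        by (simp add: H_def)
      have "((\<lambda>s. duhamel \<nu> l \<tau> ((Dx ^^ 0) g M) x s) has_real_derivative
          (Dx ^^ 0) g M x t - l * duhamel \<nu> l \<tau> ((Dx ^^ 1) g M) x t + \<nu> / 2 * duhamel \<nu> l \<tau> ((Dx ^^ 2) g M) x t) (at_left t)"
        by (rule duhamel_has_left_derivative[OF nu bg bg bg])
           (use t dg[of _ 0] dg[of _ 1] \<tau> in \<open>auto simp: numeral_2_eq_2\<close>)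
      thus "((\<lambda>s. U 0 x s) has_real_derivative (g M x t - l * U 1 x t + \<nu> / 2 * U 2 x t)) (at_left t)"
        by (simp add: U_def)
    qed
  qed (use nu \<tau> in \<open>auto simp: numeral_2_eq_2 algebra_simps\<close>)
  thus ?thesis by (simp add: H_def U_def)
qed

text \<open>The representation is differentiated in x instead of the equation: the derivatives of
  both terms on the right are known, and no mixed derivatives of \<open>h\<close> arise.\<close>

lemma duhamel_representation:
  assumes h: "decay w h" "dominated (\<lambda>_ _ _. 1) w" and g: "decay v g" "dominated (\<lambda>_ _ _. 1) v"
    and s: "solves l h g" and M: "M \<in> small" and \<tau>: "1 \<le> \<tau>" "\<tau> \<le> T"
  shows "(Dx ^^ k) h M x T = heat \<nu> l (T - \<tau>) (\<lambda>y. (Dx ^^ k) h M y \<tau>) x + duhamel \<nu> l \<tau> ((Dx ^^ k) g M) x T"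
proof (induction k arbitrary: x)
  case 0
  show ?case using duhamel_representation_0[OF assms] by simp
next
  case (Suc k)
  note bh = decay_bounded_continuous_Dx[OF h M] and bg = bounded_continuous_mono[OF decay_bounded_continuous_Dx[OF g M] \<tau>(1)]
  note dh = decay_has_derivative[OF decay_Dx_funpow[OF h(1)] M] and dg = decay_has_derivative[OF decay_Dx_funpow[OF g(1)] M]
  obtain B where B: "\<And>k x t. t \<ge> 1 \<Longrightarrow> \<bar>(Dx ^^ k) h M x t\<bar> \<le> B k"
    using bh unfolding bounded_continuous_def by metis
  have 1: "((\<lambda>x. heat \<nu> l (T - \<tau>) (\<lambda>y. (Dx ^^ k) h M y \<tau>) x) has_real_derivative
      heat \<nu> l (T - \<tau>) (\<lambda>y. (Dx ^^ Suc k) h M y \<tau>) x) (at x)"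
    by (rule heat_has_derivative[OF _ bounded_continuous_slice[OF bh \<tau>(1)] B B]) (use dh[of \<tau> k] \<tau> in auto)
  have 2: "((\<lambda>x. duhamel \<nu> l \<tau> ((Dx ^^ k) g M) x T) has_real_derivative duhamel \<nu> l \<tau> ((Dx ^^ Suc k) g M) x T) (at x)"
    by (rule duhamel_has_derivative[OF bg bg]) (use dg[of _ k] \<tau> in auto)
  have "((\<lambda>x. (Dx ^^ k) h M x T) has_real_derivative
      heat \<nu> l (T - \<tau>) (\<lambda>y. (Dx ^^ Suc k) h M y \<tau>) x + duhamel \<nu> l \<tau> ((Dx ^^ Suc k) g M) x T) (at x)"
    unfolding Suc.IH by (rule DERIV_add[OF 1 2])
  moreover have "((\<lambda>x. (Dx ^^ k) h M x T) has_real_derivative (Dx ^^ Suc k) h M x T) (at x)"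
    using dh[of T k] \<tau> by simp
  ultimately show ?case by (rule DERIV_unique[symmetric])
qed

text \<open>The smoothing estimate at each time S, for a family whose Gaussian is then centred at
  \<open>speed c j * S\<close>. The constant is uniform in the masses and in both times, as the time
  integration requires.\<close>

lemma heat_family_bound:
  assumes D: "D \<ge> 4 * \<nu>" and f: "decay (\<lambda>M x T. A M * T powr (- q) * gauss D j M x T) f"
    and A: "\<And>M. M \<in> small \<Longrightarrow> 0 \<le> A M \<and> A M \<le> 1" and q: "q \<ge> 0"
  shows "\<exists>C\<ge>0. \<forall>M\<in>small. \<forall>S\<ge>1. \<forall>T\<ge>S. \<forall>x. \<bar>heat \<nu> l (T - S) (\<lambda>y. (Dx ^^ k) f M y S) x\<bar>
     \<le> C * A M * S powr (- q) / sqrt T ^ k * (sqrt S / sqrt T) * exp (- ((x - l * (T - S) - speed c j * S)\<^sup>2 / (D * T)))"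
proof -
  have w1: "dominated (\<lambda>_ _ _. 1) (\<lambda>M x T. A M * T powr (- q) * gauss D j M x T)"
  proof (rule dominatedI[of 1])
    fix M T x assume a: "M \<in> small" "(T::real) \<ge> 1"
    have D0: "D > 0" using D nu by linarith
    have "A M * T powr (- q) * gauss D j M x T \<le> 1 * 1 * 1"
      using A[OF a(1)] a q D0 powr_mono[of "- q" 0 T] by (intro mult_mono) (auto simp: gauss_def)
    moreover have "0 \<le> A M * T powr (- q) * gauss D j M x T" using A[OF a(1)] gauss_pos[THEN less_imp_le] by simp
    ultimately show "\<bar>A M * T powr (- q) * gauss D j M x T\<bar> \<le> 1 * 1" by simp
  qed simp
  obtain C where C: "C \<ge> 0" "\<And>(G :: nat \<Rightarrow> real \<Rightarrow> real) B S T l x m W. 0 < S \<Longrightarrow> S \<le> T \<Longrightarrow>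
      (\<forall>j y. (G j has_real_derivative G (Suc j) y) (at y)) \<Longrightarrow> (\<forall>j y. \<bar>G j y\<bar> \<le> B j) \<Longrightarrow>
      (\<forall>y. \<bar>G 0 y\<bar> \<le> W * exp (- ((y - m)\<^sup>2 / (D * S)))) \<Longrightarrow>
      (\<forall>y. \<bar>G k y\<bar> \<le> W / sqrt S ^ k * exp (- ((y - m)\<^sup>2 / (D * S)))) \<Longrightarrow>
      \<bar>heat \<nu> l (T - S) (G k) x\<bar>
       \<le> C * W / sqrt T ^ k * (sqrt S / sqrt T) * exp (- ((x - l * (T - S) - m)\<^sup>2 / (D * T)))"
    using heat_derivative_gaussian_bound[OF nu D, of k] by blast
  from decay_D(2)[OF f] obtain C0 where C0: "C0 \<ge> 0" "\<And>M T x. M \<in> small \<Longrightarrow> T \<ge> 1 \<Longrightarrow>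
      \<bar>f M x T\<bar> \<le> C0 * (A M * T powr (- q) * gauss D j M x T)"
    by (rule dominatedE) blast
  from decay_D(2)[OF decay_Dx_funpow[OF f, of k]] obtain Ck where Ck: "Ck \<ge> 0" "\<And>M T x. M \<in> small \<Longrightarrow> T \<ge> 1 \<Longrightarrow>
      \<bar>(Dx ^^ k) f M x T\<bar> \<le> Ck * (A M * T powr (- q) * gauss D j M x T / sqrt T ^ k)"
    by (rule dominatedE) blast
  show ?thesis
  \<comment> \<open>The smoothing estimate asks for one amplitude for the datum and its k-th
    derivative, hence the larger of the two constants.\<close>
  proof (intro exI[of _ "C * max C0 Ck"] conjI ballI allI impI)
    show "C * max C0 Ck \<ge> 0" using C C0 by simp
    fix M S T x assume M: "M \<in> small" and S: "(1::real) \<le> S" "S \<le> T"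
    obtain B where B: "\<And>k x t. t \<ge> 1 \<Longrightarrow> \<bar>(Dx ^^ k) f M x t\<bar> \<le> B k"
      using decay_bounded_continuous_Dx[OF f w1 M] unfolding bounded_continuous_def by metis
    let ?W = "max C0 Ck * (A M * S powr (- q))"
    have W: "A M * S powr (- q) * gauss D j M y S \<ge> 0" for y
      using A[OF M] gauss_pos[THEN less_imp_le] by simp
    have "\<bar>heat \<nu> l (T - S) (\<lambda>y. (Dx ^^ k) f M y S) x\<bar>
       \<le> C * ?W / sqrt T ^ k * (sqrt S / sqrt T) * exp (- ((x - l * (T - S) - speed c j * S)\<^sup>2 / (D * T)))"
    proof (rule C(2)[where G = "\<lambda>j y. (Dx ^^ j) f M y S" and B = B])
      show "\<forall>j y. ((\<lambda>y. (Dx ^^ j) f M y S) has_real_derivative (Dx ^^ Suc j) f M y S) (at y)"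
        using decay_has_derivative[OF decay_Dx_funpow[OF f] M] S by auto
      show "\<forall>y. \<bar>(Dx ^^ 0) f M y S\<bar> \<le> ?W * exp (- ((y - speed c j * S)\<^sup>2 / (D * S)))"
      proof
        fix y
        have "\<bar>f M y S\<bar> \<le> max C0 Ck * (A M * S powr (- q) * gauss D j M y S)"
          by (rule order_trans[OF C0(2)[OF M S(1)] mult_right_mono[OF max.cobounded1 W]])
        thus "\<bar>(Dx ^^ 0) f M y S\<bar> \<le> ?W * exp (- ((y - speed c j * S)\<^sup>2 / (D * S)))"
          by (simp add: gauss_def mult.assoc)
      qed
      show "\<forall>y. \<bar>(Dx ^^ k) f M y S\<bar> \<le> ?W / sqrt S ^ k * exp (- ((y - speed c j * S)\<^sup>2 / (D * S)))"
      proof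
        fix y
        have "\<bar>(Dx ^^ k) f M y S\<bar> \<le> max C0 Ck * (A M * S powr (- q) * gauss D j M y S / sqrt S ^ k)"
          by (rule order_trans[OF Ck(2)[OF M S(1)] mult_right_mono[OF max.cobounded2 divide_nonneg_nonneg[OF W]]])
             (use S in auto)
        thus "\<bar>(Dx ^^ k) f M y S\<bar> \<le> ?W / sqrt S ^ k * exp (- ((y - speed c j * S)\<^sup>2 / (D * S)))"
          by (simp add: gauss_def mult.assoc)
      qed
    qed (use S B in auto)
    thus "\<bar>heat \<nu> l (T - S) (\<lambda>y. (Dx ^^ k) f M y S) x\<bar>
     \<le> C * max C0 Ck * A M * S powr (- q) / sqrt T ^ k * (sqrt S / sqrt T) * exp (- ((x - l * (T - S) - speed c j * S)\<^sup>2 / (D * T)))"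
      by (simp add: mult.assoc)
  qed
qed

lemma Dx_funpow_add:
  assumes "decay w f" "decay v g" "M \<in> small" "T \<ge> 1"
  shows "(Dx ^^ k) (\<lambda>M x T. f M x T + g M x T) M x T = (Dx ^^ k) f M x T + (Dx ^^ k) g M x T"
  using assms
proof (induction k arbitrary: x M T)
  case (Suc k)
  have "(Dx ^^ Suc k) (\<lambda>M x T. f M x T + g M x T) M x T = Dx (\<lambda>M x T. (Dx ^^ k) f M x T + (Dx ^^ k) g M x T) M x T"
    using Dx_cong[of "(Dx ^^ k) (\<lambda>M x T. f M x T + g M x T)", OF Suc.IH[OF Suc.prems(1,2)]] Suc.prems by simp
  also have "\<dots> = Dx ((Dx ^^ k) f) M x T + Dx ((Dx ^^ k) g) M x T"
    by (rule Dx_add[OF decay_Dx_funpow[OF Suc.prems(1)] decay_Dx_funpow[OF Suc.prems(2)] Suc.prems(3,4)])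
  finally show ?case by simp
qed simp

lemma Dx_funpow_cmult:
  assumes "decay w f" "M \<in> small" "T \<ge> 1"
  shows "(Dx ^^ k) (\<lambda>M x T. a * f M x T) M x T = a * (Dx ^^ k) f M x T"
  using assms
proof (induction k arbitrary: x M T)
  case (Suc k)
  have "(Dx ^^ Suc k) (\<lambda>M x T. a * f M x T) M x T = Dx (\<lambda>M x T. a * (Dx ^^ k) f M x T) M x T"
    using Dx_cong[of "(Dx ^^ k) (\<lambda>M x T. a * f M x T)", OF Suc.IH[OF Suc.prems(1)]] Suc.prems by simp
  also have "\<dots> = a * Dx ((Dx ^^ k) f) M x T"
    by (rule Dx_cmult[OF decay_Dx_funpow[OF Suc.prems(1)] Suc.prems(2,3)])
  finally show ?case by simp
qed simp

end

lemma heat_linear: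
  assumes f: "continuous_on UNIV f" "\<And>y. \<bar>f y\<bar> \<le> B" and g: "continuous_on UNIV g" "\<And>y. \<bar>g y\<bar> \<le> B'"
  shows "heat \<nu> l d (\<lambda>y. f y + a * g y) x = heat \<nu> l d f x + a * heat \<nu> l d g x"
proof -
  note i = heat_integrand_integrable[OF f, of "x - l * d" "sqrt (\<nu> * d)"] heat_integrand_integrable[OF g, of "x - l * d" "sqrt (\<nu> * d)"]
  have "heat \<nu> l d (\<lambda>y. f y + a * g y) x
      = (\<integral>y. std_normal_density y * f (x - l * d - sqrt (\<nu> * d) * y) + a * (std_normal_density y * g (x - l * d - sqrt (\<nu> * d) * y)) \<partial>lborel)"
    unfolding heat_def by (rule Bochner_Integration.integral_cong) (auto simp: algebra_simps)
  also have "\<dots> = heat \<nu> l d f x + a * heat \<nu> l d g x"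
    unfolding heat_def by (subst Bochner_Integration.integral_add[OF i(1) integrable_mult_right[OF i(2)]]) simp
  finally show ?thesis .
qed

lemma duhamel_linear:
  assumes f: "bounded_continuous b f" and g: "bounded_continuous b g" and ba: "b \<le> a"
    and e: "\<And>y s. s \<ge> a \<Longrightarrow> h y s = f y s + k * g y s"
  shows "duhamel \<nu> l a h x t = duhamel \<nu> l a f x t + k * duhamel \<nu> l a g x t"
proof -
  obtain B B' where B: "\<And>x t. t \<ge> b \<Longrightarrow> \<bar>f x t\<bar> \<le> B" "\<And>x t. t \<ge> b \<Longrightarrow> \<bar>g x t\<bar> \<le> B'"
    using f g by (auto simp: bounded_continuous_def)
  have "duhamel \<nu> l a h x t = integral {a..t} (\<lambda>s. heat \<nu> l (t - s) (\<lambda>y. f y s) x + k * heat \<nu> l (t - s) (\<lambda>y. g y s) x)"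
    unfolding duhamel_def
  proof (rule Henstock_Kurzweil_Integration.integral_cong)
    fix s assume "s \<in> {a..t}"
    hence s: "s \<ge> b" "s \<ge> a" using ba by auto
    show "heat \<nu> l (t - s) (\<lambda>y. h y s) x = heat \<nu> l (t - s) (\<lambda>y. f y s) x + k * heat \<nu> l (t - s) (\<lambda>y. g y s) x"
      unfolding e[OF s(2)]
      by (rule heat_linear[OF bounded_continuous_slice[OF f s(1)] B(1)[OF s(1)] bounded_continuous_slice[OF g s(1)] B(2)[OF s(1)]])
  qed
  also have "\<dots> = duhamel \<nu> l a f x t + k * duhamel \<nu> l a g x t"
    unfolding duhamel_def
    by (subst Henstock_Kurzweil_Integration.integral_add
          [OF duhamel_integrand_integrable[OF f ba] integrable_on_mult_right[OF duhamel_integrand_integrable[OF g ba]]])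
       (simp only: Henstock_Kurzweil_Integration.integral_mult_right)
  finally show ?thesis .
qed

text \<open>The mass factor sqrt s of the pointwise bound combines with the decay s^(-m), whence the
  exponent 1/2 - m.\<close>

lemma duhamel_segment_bound:
  assumes f: "bounded_continuous 1 f" and pq: "1 \<le> p" "q \<le> T" "1 \<le> T"
    and b: "\<And>s. s \<in> {p..q} \<Longrightarrow> \<bar>heat \<nu> l (T - s) (\<lambda>y. f y s) x\<bar> \<le> C * s powr (- m) * (sqrt s / sqrt T) * exp (- (\<eta> * (s - w)\<^sup>2 / T))"
  shows "\<bar>integral {p..q} (\<lambda>s. heat \<nu> l (T - s) (\<lambda>y. f y s) x)\<bar>
    \<le> C * (1 / sqrt T * integral {p..q} (\<lambda>s. s powr (1/2 - m) * exp (- (\<eta> * (s - w)\<^sup>2 / T))))"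
proof -
  have "norm (integral {p..q} (\<lambda>s. heat \<nu> l (T - s) (\<lambda>y. f y s) x))
      \<le> integral {p..q} (\<lambda>s. C * (1 / sqrt T) * (s powr (1/2 - m) * exp (- (\<eta> * (s - w)\<^sup>2 / T))))"
  proof (rule Henstock_Kurzweil_Integration.integral_norm_bound_integral[OF duhamel_integrand_integrable[OF f pq(1)]])
    show "(\<lambda>s. C * (1 / sqrt T) * (s powr (1/2 - m) * exp (- (\<eta> * (s - w)\<^sup>2 / T)))) integrable_on {p..q}"
      using pq by (intro integrable_continuous_interval continuous_intros) auto
    fix s assume s: "s \<in> {p..q}"
    have "s powr (1/2 - m) = s powr (1/2 + (- m))" by simp
    also have "\<dots> = sqrt s * s powr (- m)" using s pq powr_half_sqrt[of s] by (simp only: powr_add) auto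
    finally show "norm (heat \<nu> l (T - s) (\<lambda>y. f y s) x) \<le> C * (1 / sqrt T) * (s powr (1/2 - m) * exp (- (\<eta> * (s - w)\<^sup>2 / T)))"
      using b[OF s] by (simp add: mult_ac)
  qed
  also have "\<dots> = C * (1 / sqrt T * integral {p..q} (\<lambda>s. s powr (1/2 - m) * exp (- (\<eta> * (s - w)\<^sup>2 / T))))"
    by (simp only: Henstock_Kurzweil_Integration.integral_mult_right mult.assoc)
  finally show ?thesis by simp
qed

context wave_speeds
begin

text \<open>Space derivatives of a Duhamel integral may be placed on its source, so the potential
  inherits the regularity of the source. The lower limit 1 is t = 0 in shifted time.\<close>

lemma Dx_funpow_duhamel:
  fixes l :: real
  assumes h: "decay w h" "dominated (\<lambda>_ _ _. 1) w"
  defines "V \<equiv> \<lambda>M x T. duhamel \<nu> l 1 (h M) x T"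
  shows "M \<in> small \<Longrightarrow> (Dx ^^ k) V M x T = duhamel \<nu> l 1 ((Dx ^^ k) h M) x T"
    and "jointly_continuous ((Dx ^^ k) V)" and "x_differentiable ((Dx ^^ k) V)"
proof -
  have d: "((\<lambda>y. duhamel \<nu> l 1 ((Dx ^^ k) h M) y T) has_real_derivative duhamel \<nu> l 1 ((Dx ^^ Suc k) h M) x T) (at x)"
    if "M \<in> small" for k M x T
    by (rule duhamel_has_derivative[OF decay_bounded_continuous_Dx[OF h that] decay_bounded_continuous_Dx[OF h that]])
       (use decay_has_derivative[OF decay_Dx_funpow[OF h(1)] that] in auto)
  have e: "(Dx ^^ k) V M x T = duhamel \<nu> l 1 ((Dx ^^ k) h M) x T" if "M \<in> small" for k M x T
    using that
  proof (induction k arbitrary: x)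
    case (Suc k)
    hence "(\<lambda>y. (Dx ^^ k) V M y T) = (\<lambda>y. duhamel \<nu> l 1 ((Dx ^^ k) h M) y T)" by auto
    thus ?case using DERIV_imp_deriv[OF d[OF Suc.prems]] by (simp add: Dx_def[of "(Dx ^^ k) V"])
  qed (simp add: V_def)
  show "M \<in> small \<Longrightarrow> (Dx ^^ k) V M x T = duhamel \<nu> l 1 ((Dx ^^ k) h M) x T" by (rule e)
  show "jointly_continuous ((Dx ^^ k) V)"
    unfolding jointly_continuous_def
    using duhamel_continuous[OF decay_bounded_continuous_Dx[OF h]] by (simp add: e case_prod_unfold)
  show "x_differentiable ((Dx ^^ k) V)"
    by (rule x_differentiableI(1)[where g = "\<lambda>M x T. duhamel \<nu> l 1 ((Dx ^^ Suc k) h M) x T"])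
       (use d e in auto)
qed

lemma speed_difference: "i \<in> {1, 2} \<Longrightarrow> (speed c i - speed c (3 - i))\<^sup>2 = 4 * c\<^sup>2"
  by (auto simp: speed_def power2_eq_square)

lemma gauss_weight_bounded:
  assumes D: "D > 0" and A: "\<And>M. M \<in> small \<Longrightarrow> 0 \<le> A M \<and> A M \<le> 1" and q: "q \<ge> 0"
  shows "dominated (\<lambda>_ _ _. 1) (\<lambda>M x T. A M * T powr (- q) * gauss D j M x T)"
proof (rule dominatedI[of 1])
  fix M T x assume a: "M \<in> small" "(T::real) \<ge> 1"
  have "A M * T powr (- q) * gauss D j M x T \<le> 1 * 1 * 1"
    using A[OF a(1)] a q D powr_mono[of "- q" 0 T] by (intro mult_mono) (auto simp: gauss_def)
  moreover have "0 \<le> A M * T powr (- q) * gauss D j M x T" using A[OF a(1)] gauss_pos[THEN less_imp_le] by simp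
  ultimately show "\<bar>A M * T powr (- q) * gauss D j M x T\<bar> \<le> 1 * 1" by simp
qed simp

text \<open>The source \<open>h\<close> travels with speed \<open>speed c j\<close>, the kernel with the other speed, so that
  \<open>(speed c i - speed c j) * Dx h\<close> equals the kernel's operator applied to \<open>h\<close>, up to the faster
  decaying \<open>r\<close>. This replaces a space derivative by boundary terms and \<open>r\<close>.\<close>

lemma interaction_estimate:
  assumes i: "i \<in> {1, 2}" and D: "D \<ge> 4 * \<nu>" and a: "1 \<le> a" "a < 2"
    and A: "\<And>M. M \<in> small \<Longrightarrow> 0 \<le> A M \<and> A M \<le> 1"
    and h: "decay (\<lambda>M x T. A M * T powr (- (1/2 + a/2)) * gauss D (3 - i) M x T) h"
    and r: "decay (\<lambda>M x T. A M * T powr (- (3/2 + a/2)) * gauss D (3 - i) M x T) r"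
    and s: "solves (speed c (3 - i)) h r"
  defines "V \<equiv> \<lambda>M x T. duhamel \<nu> (speed c i) 1 (h M) x T"
  shows "dominated (\<lambda>M x T. A M * T powr (- a/4)) V"
    and "decay (\<lambda>M x T. A M * (((x - speed c i * T)\<^sup>2 + T) powr (- (1 + a/2)/2)
           + T powr (- (1/2 + a/2)) * gauss D (3 - i) M x T)) (Dx V)"
proof -
  define j where "j = 3 - i"
  define l where "l = speed c i"
  define \<kappa> where "\<kappa> = l - speed c j"
  have \<kappa>: "\<kappa>\<^sup>2 = 4 * c\<^sup>2" "\<kappa>\<^sup>2 > 0" "\<kappa> \<noteq> 0"
    using speed_difference[OF i] c by (auto simp: \<kappa>_def l_def j_def)
  have D0: "D > 0" using D nu by linarith
  define \<eta> where "\<eta> = \<kappa>\<^sup>2 / D"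
  have \<eta>: "\<eta> > 0" using \<kappa> D0 by (simp add: \<eta>_def)
  \<comment> \<open>The source time whose contribution arrives at (x, T): the centre of the source
    at time S, carried on with speed \<open>l\<close> for T - S, reaches x exactly when S = w. The
    exponent is therefore \<eta> (S - w)^2 / T with \<eta> = \<kappa>^2 / D.\<close>
  define w where "w x T = - (x - l * T) / \<kappa>" for x T
  have sq: "exp (- ((x - l * (T - S) - speed c j * S)\<^sup>2 / (D * T))) = exp (- (\<eta> * (S - w x T)\<^sup>2 / T))" for x S T
  proof -
    have "x - l * (T - S) - speed c j * S = \<kappa> * (S - w x T)"
      using \<kappa>(3) by (simp add: w_def \<kappa>_def field_simps)
    thus ?thesis by (simp add: \<eta>_def power_mult_distrib)
  qed
  note h' = h[folded j_def] and r' = r[folded j_def]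
  have wh: "dominated (\<lambda>_ _ _. 1) (\<lambda>M x T. A M * T powr (- (1/2 + a/2)) * gauss D j M x T)"
    and wr: "dominated (\<lambda>_ _ _. 1) (\<lambda>M x T. A M * T powr (- (3/2 + a/2)) * gauss D j M x T)"
    by (rule gauss_weight_bounded[OF D0 A]; use a in simp)+
  note bh = decay_bounded_continuous_Dx[OF h' wh] and br = decay_bounded_continuous_Dx[OF r' wr]
  have VV: "V = (\<lambda>M x T. duhamel \<nu> l 1 (h M) x T)" by (simp add: V_def l_def)
  note Vd = Dx_funpow_duhamel[OF h' wh, where l = l, folded VV]
  have hb: "\<exists>C\<ge>0. \<forall>M\<in>small. \<forall>S\<ge>1. \<forall>T\<ge>S. \<forall>x. \<bar>heat \<nu> l (T - S) (\<lambda>y. (Dx ^^ k) f M y S) x\<bar>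
     \<le> C * A M / sqrt T ^ k * S powr (- q) * (sqrt S / sqrt T) * exp (- (\<eta> * (S - w x T)\<^sup>2 / T))"
    if f: "decay (\<lambda>M x T. A M * T powr (- q) * gauss D j M x T) f" and "q \<ge> 0" for k f q
    using heat_family_bound[OF D f A \<open>q \<ge> 0\<close>, where k = k and l = l, unfolded sq] by (simp add: mult_ac)
  have A0: "A M \<ge> 0" if "M \<in> small" for M using A[OF that] by simp
  show "dominated (\<lambda>M x T. A M * T powr (- a/4)) V"
  proof -
    obtain C where C: "C \<ge> 0" "\<And>M S T x. M \<in> small \<Longrightarrow> S \<ge> 1 \<Longrightarrow> T \<ge> S \<Longrightarrow> \<bar>heat \<nu> l (T - S) (\<lambda>y. (Dx ^^ 0) h M y S) x\<bar>
     \<le> C * A M / sqrt T ^ 0 * S powr (- (1/2 + a/2)) * (sqrt S / sqrt T) * exp (- (\<eta> * (S - w x T)\<^sup>2 / T))"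
      using hb[OF h', of 0] a by fastforce
    obtain C' where C': "C' \<ge> 0" "\<And>T w. T \<ge> 1 \<Longrightarrow> 1 / sqrt T * integral {1..T} (\<lambda>S. S powr (- a / 2) * exp (- (\<eta> * (S - w)\<^sup>2 / T)))
      \<le> C' * T powr (- a / 4)"
      using potential_estimate[OF \<eta>, of a] a by force
    show ?thesis
    proof (rule dominatedI[of "C * C'"])
      fix M T x assume M: "M \<in> small" and T: "(T::real) \<ge> 1"
      have "\<bar>integral {1..T} (\<lambda>s. heat \<nu> l (T - s) (\<lambda>y. (Dx ^^ 0) h M y s) x)\<bar>
          \<le> C * A M * (1 / sqrt T * integral {1..T} (\<lambda>s. s powr (1/2 - (1/2 + a/2)) * exp (- (\<eta> * (s - w x T)\<^sup>2 / T))))"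
        by (rule duhamel_segment_bound[OF bh[OF M]]) (use C(2)[OF M] T in auto)
      also have "\<dots> \<le> C * A M * (C' * T powr (- a / 4))"
        using C'(2)[OF T, of "w x T"] C(1) A0[OF M] by (intro mult_left_mono) auto
      finally show "\<bar>V M x T\<bar> \<le> C * C' * (A M * T powr (- a/4))"
        by (simp add: VV duhamel_def mult_ac)
    qed (use C C' in auto)
  qed
  define Z where "Z M x T = ((x - l * T)\<^sup>2 + T) powr (- (1 + a/2)/2) + T powr (- (1/2 + a/2)) * gauss D j M x T" for M x T
  have "decay (\<lambda>M x T. A M * Z M x T) (Dx V)"
  proof (rule decayI_funpow)
    fix k
    have k: "(Dx ^^ k) (Dx V) = (Dx ^^ Suc k) V" by (simp only: funpow_Suc_right o_apply)
    show "jointly_continuous ((Dx ^^ k) (Dx V))" "x_differentiable ((Dx ^^ k) (Dx V))"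
      unfolding k by (rule Vd)+
    obtain C1 where C1: "C1 \<ge> 0" "\<And>M S T x. M \<in> small \<Longrightarrow> S \<ge> 1 \<Longrightarrow> T \<ge> S \<Longrightarrow> \<bar>heat \<nu> l (T - S) (\<lambda>y. (Dx ^^ Suc k) h M y S) x\<bar>
     \<le> C1 * A M / sqrt T ^ Suc k * S powr (- (1/2 + a/2)) * (sqrt S / sqrt T) * exp (- (\<eta> * (S - w x T)\<^sup>2 / T))"
      using hb[OF h', of "Suc k"] a by fastforce
    obtain C2 where C2: "C2 \<ge> 0" "\<And>M S T x. M \<in> small \<Longrightarrow> S \<ge> 1 \<Longrightarrow> T \<ge> S \<Longrightarrow> \<bar>heat \<nu> l (T - S) (\<lambda>y. (Dx ^^ k) h M y S) x\<bar>
     \<le> C2 * A M / sqrt T ^ k * S powr (- (1/2 + a/2)) * (sqrt S / sqrt T) * exp (- (\<eta> * (S - w x T)\<^sup>2 / T))"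
      using hb[OF h', of k] a by fastforce
    obtain C3 where C3: "C3 \<ge> 0" "\<And>M S T x. M \<in> small \<Longrightarrow> S \<ge> 1 \<Longrightarrow> T \<ge> S \<Longrightarrow> \<bar>heat \<nu> l (T - S) (\<lambda>y. (Dx ^^ k) r M y S) x\<bar>
     \<le> C3 * A M / sqrt T ^ k * S powr (- (3/2 + a/2)) * (sqrt S / sqrt T) * exp (- (\<eta> * (S - w x T)\<^sup>2 / T))"
      using hb[OF r', of k] a by fastforce
    obtain C4 where C4: "C4 \<ge> 0" "\<And>M T x. M \<in> small \<Longrightarrow> T \<ge> 1 \<Longrightarrow>
        \<bar>(Dx ^^ k) h M x T\<bar> \<le> C4 * (A M * T powr (- (1/2 + a/2)) * gauss D j M x T / sqrt T ^ k)"
      using decay_D(2)[OF decay_Dx_funpow[OF h', of k]] by (rule dominatedE) blast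
    define Y where "Y x T = ((w x T)\<^sup>2 + T) powr (- (1 + a / 2) / 2)" for x T
    obtain C0 where C0: "C0 \<ge> 0" and split: "\<And>T w. T \<ge> 1 \<Longrightarrow> \<exists>\<tau>\<in>{1..T}.
      1 / T * integral {1..\<tau>} (\<lambda>S. S powr (- a / 2) * exp (- (\<eta> * (S - w)\<^sup>2 / T))) \<le> C0 * (w\<^sup>2 + T) powr (- (1 + a / 2) / 2) \<and>
      1 / sqrt T * (\<tau> powr (- a / 2) * exp (- (\<eta> * (\<tau> - w)\<^sup>2 / T))) \<le> C0 * (w\<^sup>2 + T) powr (- (1 + a / 2) / 2) \<and>
      1 / sqrt T * integral {\<tau>..T} (\<lambda>S. S powr (- 1 - a / 2) * exp (- (\<eta> * (S - w)\<^sup>2 / T))) \<le> C0 * (w\<^sup>2 + T) powr (- (1 + a / 2) / 2)"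
      using splitting_estimate[OF \<eta>, of a] a by auto
    \<comment> \<open>Up to sign \<open>w\<close> is the distance from the i-th characteristic
      divided by \<kappa>; this constant converts w^2 + T back into the weight in x.\<close>
    define m where "m = min (1 / \<kappa>\<^sup>2) 1"
    have m: "m > 0" using \<kappa> by (simp add: m_def)
    define CY where "CY = m powr (- (1 + a/2)/2)"
    have YZ: "Y x T \<le> CY * ((x - l * T)\<^sup>2 + T) powr (- (1 + a/2)/2)" if "T \<ge> 1" for x T
    proof -
      have "m * (x - l * T)\<^sup>2 \<le> 1 / \<kappa>\<^sup>2 * (x - l * T)\<^sup>2" by (intro mult_right_mono) (auto simp: m_def)
      moreover have "m * T \<le> 1 * T" using that by (intro mult_right_mono) (auto simp: m_def)
      moreover have "(w x T)\<^sup>2 = 1 / \<kappa>\<^sup>2 * (x - l * T)\<^sup>2" by (simp add: w_def power_divide power2_commute)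
      ultimately have "m * ((x - l * T)\<^sup>2 + T) \<le> (w x T)\<^sup>2 + T" by (simp add: distrib_left)
      moreover have "0 < m * ((x - l * T)\<^sup>2 + T)" using m that by (intro mult_pos_pos add_nonneg_pos) auto
      ultimately have "Y x T \<le> (m * ((x - l * T)\<^sup>2 + T)) powr (- (1 + a/2)/2)"
        unfolding Y_def using a by (intro powr_mono2') auto
      thus ?thesis by (simp add: powr_mult CY_def)
    qed
    define C where "C = C1 * C0 * CY + (C4 + C2 * C0 * CY + C3 * C0 * CY) / \<bar>\<kappa>\<bar>"
    have CY: "CY \<ge> 0" by (simp add: CY_def)
    show "dominated (\<lambda>M x T. A M * Z M x T / sqrt T ^ k) ((Dx ^^ k) (Dx V))"
    proof (rule dominatedI[of C])
      show "C \<ge> 0" using C0 C1 C2 C3 C4 CY by (auto simp: C_def)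
      fix M T x assume M: "M \<in> small" and T: "(T::real) \<ge> 1"
      obtain \<tau> where \<tau>: "\<tau> \<in> {1..T}"
        and s1: "1 / T * integral {1..\<tau>} (\<lambda>S. S powr (- a / 2) * exp (- (\<eta> * (S - w x T)\<^sup>2 / T))) \<le> C0 * Y x T"
        and s2: "1 / sqrt T * (\<tau> powr (- a / 2) * exp (- (\<eta> * (\<tau> - w x T)\<^sup>2 / T))) \<le> C0 * Y x T"
        and s3: "1 / sqrt T * integral {\<tau>..T} (\<lambda>S. S powr (- 1 - a / 2) * exp (- (\<eta> * (S - w x T)\<^sup>2 / T))) \<le> C0 * Y x T"
        using split[OF T, of "w x T"] unfolding Y_def by blast
      have \<tau>': "1 \<le> \<tau>" "\<tau> \<le> T" using \<tau> by auto
      define P where "P = A M / sqrt T ^ k"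
      have P: "P \<ge> 0" using A0[OF M] T by (simp add: P_def)
      define y where "y = ((x - l * T)\<^sup>2 + T) powr (- (1 + a/2)/2)"
      define z where "z = T powr (- (1/2 + a/2)) * gauss D j M x T"
      have yz: "y \<ge> 0" "z \<ge> 0" using gauss_pos[THEN less_imp_le] by (auto simp: y_def z_def)
      have Yy: "C0 * Y x T \<le> C0 * CY * y" using YZ[OF T, of x] C0 by (simp add: y_def mult.assoc mult_left_mono)
      \<comment> \<open>Before \<tau> smoothing applies to all \<open>Suc k\<close> derivatives and
        yields one more factor 1/sqrt T; after \<tau> one derivative is removed by means of the
        equation.\<close>
      define I1 where "I1 = integral {1..\<tau>} (\<lambda>s. heat \<nu> l (T - s) (\<lambda>y. (Dx ^^ Suc k) h M y s) x)"
      define I2 where "I2 = duhamel \<nu> l \<tau> ((Dx ^^ Suc k) h M) x T"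
      have "(Dx ^^ Suc k) V M x T = I1 + I2"
        unfolding Vd(1)[OF M] I1_def I2_def duhamel_def
        by (rule Henstock_Kurzweil_Integration.integral_combine[symmetric, OF \<tau>'])
           (rule duhamel_integrand_integrable[OF bh[OF M] order_refl])
      have "\<bar>I1\<bar> \<le> (C1 * A M / sqrt T ^ Suc k) * (1 / sqrt T * integral {1..\<tau>} (\<lambda>s. s powr (1/2 - (1/2 + a/2)) * exp (- (\<eta> * (s - w x T)\<^sup>2 / T))))"
        unfolding I1_def
        by (rule duhamel_segment_bound[OF bh[OF M]]) (use C1(2)[OF M] T \<tau>' in auto)
      also have "\<dots> = C1 * P * (1 / T * integral {1..\<tau>} (\<lambda>S. S powr (- a / 2) * exp (- (\<eta> * (S - w x T)\<^sup>2 / T))))"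
        using T by (simp add: P_def)
      also have "\<dots> \<le> C1 * P * (C0 * CY * y)"
        using s1 Yy C1(1) P by (intro mult_left_mono) auto
      finally have I1: "\<bar>I1\<bar> \<le> C1 * C0 * CY * (P * y)" by (simp add: mult_ac)
      define H where "H = heat \<nu> l (T - \<tau>) (\<lambda>y. (Dx ^^ k) h M y \<tau>) x"
      define R where "R = duhamel \<nu> l \<tau> ((Dx ^^ k) r M) x T"
      have "\<bar>H\<bar> \<le> C2 * A M / sqrt T ^ k * \<tau> powr (- (1/2 + a/2)) * (sqrt \<tau> / sqrt T) * exp (- (\<eta> * (\<tau> - w x T)\<^sup>2 / T))"
        unfolding H_def by (rule C2(2)[OF M \<tau>'])
      also have "\<dots> = C2 * P * (1 / sqrt T * (\<tau> powr (- a / 2) * exp (- (\<eta> * (\<tau> - w x T)\<^sup>2 / T))))"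
      proof -
        have "\<tau> powr (- a / 2) = \<tau> powr (- (1/2 + a/2) + 1/2)" by simp
        also have "\<dots> = \<tau> powr (- (1/2 + a/2)) * sqrt \<tau>" using \<tau>' powr_half_sqrt[of \<tau>] by (simp only: powr_add)
        finally show ?thesis by (simp add: P_def)
      qed
      also have "\<dots> \<le> C2 * P * (C0 * CY * y)"
        using s2 Yy C2(1) P by (intro mult_left_mono) auto
      finally have H: "\<bar>H\<bar> \<le> C2 * C0 * CY * (P * y)" by (simp add: mult_ac)
      have "\<bar>R\<bar> \<le> (C3 * A M / sqrt T ^ k) * (1 / sqrt T * integral {\<tau>..T} (\<lambda>s. s powr (1/2 - (3/2 + a/2)) * exp (- (\<eta> * (s - w x T)\<^sup>2 / T))))"
        unfolding R_def duhamel_def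
        by (rule duhamel_segment_bound[OF br[OF M]]) (use C3(2)[OF M] T \<tau>' in auto)
      also have "\<dots> = C3 * P * (1 / sqrt T * integral {\<tau>..T} (\<lambda>S. S powr (- 1 - a / 2) * exp (- (\<eta> * (S - w x T)\<^sup>2 / T))))"
        by (simp add: P_def)
      also have "\<dots> \<le> C3 * P * (C0 * CY * y)"
        using s3 Yy C3(1) P by (intro mult_left_mono) auto
      finally have R: "\<bar>R\<bar> \<le> C3 * C0 * CY * (P * y)" by (simp add: mult_ac)
      \<comment> \<open>The boundary term at the final time is the source itself; it survives as the
        Gaussian summand of the weight.\<close>
      have hk: "\<bar>(Dx ^^ k) h M x T\<bar> \<le> C4 * (P * z)" using C4(2)[OF M T, of x] by (simp add: P_def z_def mult_ac)
      have d1: "decay (\<lambda>_ _ _. 1) r" by (rule decay_mono[OF r' wr])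
      have d2: "decay (\<lambda>_ _ _. 1) (Dx h)"
        by (rule decay_mono[OF decay_Dx[OF h'] dominated_divide_sqrt[OF wh, of 1, unfolded power_one_right]])
      \<comment> \<open>In the frame of the kernel the equation of \<open>h\<close> has \<kappa> h_x
        on its right-hand side, so its Duhamel formula can be solved for the integral of
        h_x.\<close>
      have "solves l h (\<lambda>M x T. r M x T + \<kappa> * Dx h M x T)"
        using solves_change_speed[OF s, of l] by (simp add: \<kappa>_def j_def)
      from duhamel_representation[OF h' wh decay_add[OF d1 decay_cmult[OF d2]] _ this M \<tau>', of k x]
      have rep: "(Dx ^^ k) h M x T = H + duhamel \<nu> l \<tau> ((Dx ^^ k) (\<lambda>M x T. r M x T + \<kappa> * Dx h M x T) M) x T"
        by (simp add: H_def dominatedI[of 1])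
      have "duhamel \<nu> l \<tau> ((Dx ^^ k) (\<lambda>M x T. r M x T + \<kappa> * Dx h M x T) M) x T = R + \<kappa> * I2"
        unfolding R_def I2_def
      proof (rule duhamel_linear[OF br[OF M] bh[OF M] \<tau>'(1)])
        fix y s assume "\<tau> \<le> s"
        hence s: "s \<ge> 1" using \<tau>' by simp
        show "(Dx ^^ k) (\<lambda>M x T. r M x T + \<kappa> * Dx h M x T) M y s = (Dx ^^ k) r M y s + \<kappa> * (Dx ^^ Suc k) h M y s"
          using Dx_funpow_add[OF d1 decay_cmult[OF d2] M s, of k \<kappa> y] Dx_funpow_cmult[OF d2 M s, of k \<kappa> y]
          by (simp only: funpow_Suc_right o_apply)
      qed
      hence "\<kappa> * I2 = (Dx ^^ k) h M x T - H - R" using rep by simp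
      hence "\<bar>\<kappa>\<bar> * \<bar>I2\<bar> \<le> \<bar>(Dx ^^ k) h M x T\<bar> + \<bar>H\<bar> + \<bar>R\<bar>"
        by (simp flip: abs_mult)
      also have "\<dots> \<le> C4 * (P * z) + C2 * C0 * CY * (P * y) + C3 * C0 * CY * (P * y)"
        using hk H R by linarith
      also have "\<dots> \<le> (C4 + C2 * C0 * CY + C3 * C0 * CY) * (P * (y + z))"
        using C4(1) C2(1) C3(1) C0 CY P yz by (simp add: algebra_simps)
      finally have I2: "\<bar>I2\<bar> \<le> (C4 + C2 * C0 * CY + C3 * C0 * CY) / \<bar>\<kappa>\<bar> * (P * (y + z))"
        using \<kappa>(3) by (simp add: pos_le_divide_eq mult.commute)
      have "C1 * C0 * CY * (P * y) \<le> C1 * C0 * CY * (P * (y + z))"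
        using C1(1) C0 CY P yz by (intro mult_left_mono) auto
      hence "\<bar>I1 + I2\<bar> \<le> C * (P * (y + z))"
        using I1 I2 abs_triangle_ineq[of I1 I2] unfolding C_def distrib_right by linarith
      thus "\<bar>(Dx ^^ k) (Dx V) M x T\<bar> \<le> C * (A M * Z M x T / sqrt T ^ k)"
        unfolding k \<open>(Dx ^^ Suc k) V M x T = I1 + I2\<close> by (simp add: Z_def P_def y_def z_def)
    qed
  qed
  thus "decay (\<lambda>M x T. A M * (((x - speed c i * T)\<^sup>2 + T) powr (- (1 + a/2)/2)
           + T powr (- (1/2 + a/2)) * gauss D (3 - i) M x T)) (Dx V)"
    by (simp add: Z_def[abs_def] l_def j_def)
qed

end

section \<open>Higher-order diffusion waves\<close>

lemma two_powi: "(2::real) powi (- (int n + 1)) = inverse (2 ^ n) / 2"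
proof -
  have "(2::real) powi (- int (Suc n)) = inverse (2 ^ Suc n)" by (simp only: power_int_minus power_int_of_nat)
  thus ?thesis by (simp add: add.commute)
qed

lemma alpha_step: "alpha (int n) = 1 + alpha (int n - 1) / 2"
  unfolding alpha_def two_powi by (simp add: power_int_minus)

lemma beta_eq: "beta (int n) = 1 / 2 + alpha (int n - 1) / 2"
  unfolding alpha_def beta_def two_powi by (simp add: power_int_minus diff_divide_distrib)

lemma alpha_bounds: "1 \<le> alpha (int n - 1)" "alpha (int n - 1) < 2"
proof -
  have "alpha (int n - 1) = 2 - inverse (2 ^ n)" by (simp add: alpha_def power_int_minus)
  moreover have "inverse (2 ^ n) \<le> (1::real)" by (simp add: inverse_le_1_iff)
  ultimately show "1 \<le> alpha (int n - 1)" "alpha (int n - 1) < 2" by auto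
qed

context wave_speeds
begin

text \<open>The waves as explicit functions of the masses; that every bounded classical solution
  agrees with them is proved separately. Duhamel's integral from the shifted time 1 encodes the zero
  initial datum.\<close>

primrec higher :: "nat \<Rightarrow> nat \<Rightarrow> family" where
  "higher 0 i = (\<lambda>M x T. theta i M x T / 2)"
| "higher (Suc n) i = Dx (\<lambda>M x T. - duhamel \<nu> (speed c i) 1
     (\<lambda>y S. phi i M y S * (theta (3 - i) M y S * higher n (3 - i) M y S)) x T * inverse (phi i M x T))"

definition source :: "nat \<Rightarrow> nat \<Rightarrow> family" where
  "source n i M x T = phi i M x T * (theta (3 - i) M x T * higher n (3 - i) M x T)"

definition potential :: "nat \<Rightarrow> nat \<Rightarrow> family" where
  "potential n i M x T = - duhamel \<nu> (speed c i) 1 (source n i M) x T"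

lemma higher_Suc: "higher (Suc n) i = Dx (\<lambda>M x T. potential n i M x T * inverse (phi i M x T))"
  by (simp add: potential_def source_def[abs_def])

text \<open>The right-hand side that \<open>solves\<close> expects for the waves. At level 0 the
  factor 1/2 arises because theta/2 inherits the nonlinear equation of theta instead of its
  linearisation.\<close>

primrec residual :: "nat \<Rightarrow> nat \<Rightarrow> family" where
  "residual 0 i = (\<lambda>M x T. (- 1/2) * Dx (\<lambda>M x T. theta i M x T * higher 0 i M x T) M x T)"
| "residual (Suc n) i = (\<lambda>M x T. - Dx (\<lambda>M x T. theta i M x T * higher (Suc n) i M x T) M x T
     - Dx (\<lambda>M x T. theta (3 - i) M x T * higher n (3 - i) M x T) M x T)"

text \<open>Independent of x: the next source receives its profile from theta, so only the supremum
  of the previous wave is passed on.\<close>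

definition base_weight :: "nat \<Rightarrow> family" where
  "base_weight n M x T = eps M ^ (n + 1) * T powr (- alpha (int n - 1) / 2)"

definition Psi_weight :: "nat \<Rightarrow> nat \<Rightarrow> family" where
  "Psi_weight n i M x T = Psi c i (int n) x (T - 1)"

lemma gauss_mono: "0 < D \<Longrightarrow> D \<le> D' \<Longrightarrow> T \<ge> 1 \<Longrightarrow> gauss D j M x T \<le> gauss D' j M x T"
  by (auto simp: gauss_def intro!: divide_left_mono)

text \<open>The centres are 2 c T apart, so the squared distances from them add up to at least 2 c^2
  T^2. Half of the joint exponent turns this into exp(-c^2 T / (4 \<nu>)); the other half retains
  one Gaussian of doubled width. Six factors 1/sqrt T are extracted from the exponential: three for
  the decay of the remainder and three to dominate T^(-\<alpha>/2).\<close>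

lemma gauss_product:
  assumes i: "i \<in> {1, 2}"
  obtains C where "C \<ge> 0" "\<And>M x T. T \<ge> 1 \<Longrightarrow>
    gauss (4 * \<nu>) i M x T * gauss (4 * \<nu>) (3 - i) M x T \<le> C * (1 / sqrt T) ^ 6 * gauss (8 * \<nu>) (3 - i) M x T"
proof -
  obtain C where C: "C > 0" "\<And>u. u > 0 \<Longrightarrow> u powr 3 * exp (- (c\<^sup>2 / (4 * \<nu>) * u)) \<le> C"
    using powr_exp_bounded[of "c\<^sup>2 / (4 * \<nu>)" 3] nu c by auto
  show ?thesis
  proof (rule that[of C])
    fix M x and T :: real assume T: "T \<ge> 1"
    define a b where "a = x - speed c i * T" and "b = x - speed c (3 - i) * T"
    have "(a - b)\<^sup>2 = 4 * c\<^sup>2 * T\<^sup>2"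
    proof -
      have "a - b = - (speed c i - speed c (3 - i)) * T" by (simp add: a_def b_def algebra_simps)
      thus ?thesis using speed_difference[OF i] by (simp only: power_mult_distrib power2_minus)
    qed
    moreover have "(a - b)\<^sup>2 \<le> 2 * a\<^sup>2 + 2 * b\<^sup>2"
      using zero_le_power2[of "a + b"] by (simp add: power2_eq_square algebra_simps)
    ultimately have ab: "a\<^sup>2 + b\<^sup>2 \<ge> 2 * c\<^sup>2 * T\<^sup>2" by simp
    have "c\<^sup>2 / (4 * \<nu>) * T + b\<^sup>2 / (8 * \<nu> * T) = (2 * c\<^sup>2 * T\<^sup>2 + b\<^sup>2) / (8 * \<nu> * T)"
      using nu T by (simp add: field_simps power2_eq_square)
    also have "\<dots> \<le> (2 * (a\<^sup>2 + b\<^sup>2)) / (8 * \<nu> * T)"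
    proof (rule divide_right_mono)
      show "2 * c\<^sup>2 * T\<^sup>2 + b\<^sup>2 \<le> 2 * (a\<^sup>2 + b\<^sup>2)" using ab by (smt (verit) zero_le_power2)
    qed (use nu T in auto)
    also have "\<dots> = a\<^sup>2 / (4 * \<nu> * T) + b\<^sup>2 / (4 * \<nu> * T)"
      using nu T by (simp add: field_simps)
    finally have "gauss (4 * \<nu>) i M x T * gauss (4 * \<nu>) (3 - i) M x T \<le> exp (- (c\<^sup>2 / (4 * \<nu>) * T)) * gauss (8 * \<nu>) (3 - i) M x T"
      unfolding gauss_def a_def[symmetric] b_def[symmetric] by (simp flip: exp_add)
    also have "exp (- (c\<^sup>2 / (4 * \<nu>) * T)) \<le> C * (1 / sqrt T) ^ 6"
    proof -
      have "sqrt T ^ 6 = ((sqrt T)\<^sup>2) ^ 3" by (simp flip: power_mult)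
      also have "\<dots> = T powr 3" using T by (simp add: powr_numeral)
      finally have s: "sqrt T ^ 6 = T powr 3" .
      have "T powr 3 * exp (- (c\<^sup>2 / (4 * \<nu>) * T)) \<le> C" using C(2)[of T] T by simp
      thus ?thesis using T by (simp add: power_divide s pos_le_divide_eq mult.commute)
    qed
    finally show "gauss (4 * \<nu>) i M x T * gauss (4 * \<nu>) (3 - i) M x T \<le> C * (1 / sqrt T) ^ 6 * gauss (8 * \<nu>) (3 - i) M x T"
      using gauss_pos[of "8 * \<nu>" "3 - i" M x T] by (simp add: mult_right_mono)
  qed (use C in auto)
qed

lemma powr_weights:
  assumes "T \<ge> 1"
  shows "T powr (- (3/2 + a/2)) = (1 / sqrt T) ^ 3 * T powr (- a/2)" "T powr (- (1/2 + a/2)) = 1 / sqrt T * T powr (- a/2)"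
proof -
  have s: "1 / sqrt T = T powr (- 1/2)"
    using assms powr_half_sqrt[of T] powr_minus_divide[of T "1/2"] by simp
  have "(1 / sqrt T) ^ 3 = T powr (3 * (- 1/2))"
    unfolding s using powr_powr[of T "- 1/2" 3] assms by (simp add: powr_numeral mult.commute)
  thus "T powr (- (3/2 + a/2)) = (1 / sqrt T) ^ 3 * T powr (- a/2)"
    by (simp only: powr_add[symmetric]) simp
  show "T powr (- (1/2 + a/2)) = 1 / sqrt T * T powr (- a/2)"
    unfolding s by (simp only: powr_add[symmetric]) simp
qed

text \<open>One factor eps / sqrt T and the Gaussian come from theta, the rest from
  \<open>base_weight\<close>. The width 8 \<nu> leaves room for the overlap terms of the remainder,
  so that both families share one Gaussian.\<close>

definition source_weight :: "nat \<Rightarrow> nat \<Rightarrow> family" where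
  "source_weight n i M x T = eps M ^ (n + 2) * T powr (- (1/2 + alpha (int n - 1)/2)) * gauss (8 * \<nu>) (3 - i) M x T"

definition remainder_weight :: "nat \<Rightarrow> nat \<Rightarrow> family" where
  "remainder_weight n i M x T = eps M ^ (n + 2) * T powr (- (3/2 + alpha (int n - 1)/2)) * gauss (8 * \<nu>) (3 - i) M x T"

lemma small_powers:
  assumes "M \<in> small" "T \<ge> 1" "p \<ge> 0"
  shows "0 \<le> 1 / sqrt T" "1 / sqrt T \<le> 1" "0 \<le> T powr (- p)" "T powr (- p) \<le> 1"
  using assms powr_mono[of "- p" 0 T] by auto

text \<open>For products in which only waves of speed \<open>speed c (3 - i)\<close> meet. The three
  visible factors 1/sqrt T are better by 1/T than those of the source; surplus powers of eps and the
  bounded factor \<open>b\<close> are discarded.\<close>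

lemma dominated_remainder_own:
  assumes "k \<ge> n + 2" "\<And>M x T. M \<in> small \<Longrightarrow> T \<ge> 1 \<Longrightarrow>
    w M x T = eps M ^ k * (1 / sqrt T) ^ 3 * T powr (- alpha (int n - 1)/2) * gauss (4 * \<nu>) (3 - i) M x T * b M x T"
    and "\<And>M x T. M \<in> small \<Longrightarrow> T \<ge> 1 \<Longrightarrow> 0 \<le> b M x T \<and> b M x T \<le> 1"
  shows "dominated (remainder_weight n i) w"
proof (rule dominatedI[of 1])
  fix M x and T :: real assume a: "M \<in> small" "T \<ge> 1"
  note g = gauss_pos[THEN less_imp_le, of _ "3 - i" M x T]
  have g48: "gauss (4 * \<nu>) (3 - i) M x T \<le> gauss (8 * \<nu>) (3 - i) M x T" using nu a by (intro gauss_mono) auto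
  have e: "eps M ^ k \<le> eps M ^ (n + 2)" using eps(1)[OF a(1)] eps(2) assms(1) by (intro power_decreasing) auto
  have "w M x T \<le> eps M ^ (n + 2) * (1 / sqrt T) ^ 3 * T powr (- alpha (int n - 1)/2) * gauss (8 * \<nu>) (3 - i) M x T * 1"
    unfolding assms(2)[OF a] using a assms(3)[OF a, of x] eps(2) g g48 e
    by (intro mult_mono mult_nonneg_nonneg zero_le_power) auto
  moreover have "0 \<le> w M x T"
    unfolding assms(2)[OF a] using a assms(3)[OF a, of x] eps(2) g by (intro mult_nonneg_nonneg zero_le_power) auto
  ultimately show "\<bar>w M x T\<bar> \<le> 1 * remainder_weight n i M x T"
    unfolding remainder_weight_def powr_weights(1)[OF a(2)] by (simp add: mult_ac)
qed simp

text \<open>The two diffusion waves overlap only in an exponentially small region.\<close>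

lemma dominated_remainder_overlap:
  assumes i: "i \<in> {1, 2}" and "k \<ge> n + 2" "\<And>M x T. M \<in> small \<Longrightarrow> T \<ge> 1 \<Longrightarrow>
    w M x T = eps M ^ k * (gauss (4 * \<nu>) i M x T * gauss (4 * \<nu>) (3 - i) M x T) * b M x T"
    and "\<And>M x T. M \<in> small \<Longrightarrow> T \<ge> 1 \<Longrightarrow> 0 \<le> b M x T \<and> b M x T \<le> 1"
  shows "dominated (remainder_weight n i) w"
proof -
  obtain C where C: "C \<ge> 0" "\<And>M x T. T \<ge> 1 \<Longrightarrow>
    gauss (4 * \<nu>) i M x T * gauss (4 * \<nu>) (3 - i) M x T \<le> C * (1 / sqrt T) ^ 6 * gauss (8 * \<nu>) (3 - i) M x T"
    using gauss_product[OF i] by blast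
  show ?thesis
  proof (rule dominatedI[OF C(1)])
    fix M x and T :: real assume a: "M \<in> small" "T \<ge> 1"
    note g = gauss_pos[THEN less_imp_le, of _ _ M x T]
    have e: "eps M ^ k \<le> eps M ^ (n + 2)" using eps(1)[OF a(1)] eps(2) assms(2) by (intro power_decreasing) auto
    \<comment> \<open>Possible because \<alpha> < 3: three of the six factors stand in for the time
      decay of the wave.\<close>
    have u3: "(1 / sqrt T) ^ 3 \<le> T powr (- alpha (int n - 1)/2)"
    proof -
      have "(1 / sqrt T) ^ 3 * T powr (- 0 / 2) = T powr (- (3 / 2 + 0 / 2))"
        by (rule powr_weights(1)[OF a(2), symmetric])
      hence "(1 / sqrt T) ^ 3 = T powr (- 3/2)" using a by simp
      also have "\<dots> \<le> T powr (- alpha (int n - 1)/2)" using a alpha_bounds[of n] by (intro powr_mono) auto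
      finally show ?thesis .
    qed
    have "(1 / sqrt T) ^ 6 = (1 / sqrt T) ^ 3 * (1 / sqrt T) ^ 3" by (simp flip: power_add)
    also have "\<dots> \<le> (1 / sqrt T) ^ 3 * T powr (- alpha (int n - 1)/2)"
      using u3 a by (intro mult_left_mono) auto
    also have "\<dots> = T powr (- (3/2 + alpha (int n - 1)/2))" by (rule powr_weights(1)[OF a(2), symmetric])
    finally have u6: "(1 / sqrt T) ^ 6 \<le> T powr (- (3/2 + alpha (int n - 1)/2))" .
    have "w M x T \<le> eps M ^ (n + 2) * (C * (1 / sqrt T) ^ 6 * gauss (8 * \<nu>) (3 - i) M x T) * 1"
      unfolding assms(3)[OF a] using assms(4)[OF a, of x] eps(2)[of M] g C(1)
      by (intro mult_mono[OF mult_mono[OF e C(2)[OF a(2)]]]) auto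
    also have "\<dots> = C * (eps M ^ (n + 2) * (1 / sqrt T) ^ 6 * gauss (8 * \<nu>) (3 - i) M x T)" by simp
    also have "\<dots> \<le> C * (eps M ^ (n + 2) * T powr (- (3/2 + alpha (int n - 1)/2)) * gauss (8 * \<nu>) (3 - i) M x T)"
      using u6 C(1) g eps(2) by (intro mult_left_mono mult_right_mono) auto
    finally have "w M x T \<le> C * remainder_weight n i M x T" by (simp add: remainder_weight_def)
    moreover have "0 \<le> w M x T"
      unfolding assms(3)[OF a] using a assms(4)[OF a, of x] eps(2) g by (intro mult_nonneg_nonneg zero_le_power) auto
    ultimately show "\<bar>w M x T\<bar> \<le> C * remainder_weight n i M x T" by simp
  qed
qed

section \<open>The source and its equation\<close>

definition theta_weight :: "nat \<Rightarrow> family" where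
  "theta_weight i M x T = eps M * gauss (4 * \<nu>) i M x T / sqrt T"

lemma decay_theta': "i \<in> {1, 2} \<Longrightarrow> decay (theta_weight i) (theta i)"
  using decay_theta by (simp add: theta_weight_def[abs_def])

lemma decay_phix': "i \<in> {1, 2} \<Longrightarrow> decay (theta_weight i) (phix i)"
  using decay_phix by (simp add: theta_weight_def[abs_def])

lemma solves_inverse_phi:
  "i \<in> {1, 2} \<Longrightarrow> solves (speed c i) (\<lambda>M x T. inverse (phi i M x T))
     (\<lambda>M x T. - \<nu> * ((phix i M x T)\<^sup>2 * inverse (phi i M x T) ^ 3))"
  using solves_inverse[OF solves_phi decay_phi decay_inverse_phi] phi_pos
  by (simp add: Dx_phi less_imp_neq[symmetric])

lemma Dx_inverse_phi:
  "i \<in> {1, 2} \<Longrightarrow> M \<in> small \<Longrightarrow> T \<ge> 1 \<Longrightarrow> Dx (\<lambda>M x T. inverse (phi i M x T)) M x T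
    = - 1 * (phix i M x T * (inverse (phi i M x T) * inverse (phi i M x T)))"
  using Dx_inverse[OF decay_phi, of i M T x] phi_pos by (simp add: Dx_phi less_imp_neq[symmetric])

lemma Dx_theta:
  assumes i: "i \<in> {1, 2}" and a: "M \<in> small" "T \<ge> 1"
  shows "Dx (theta i) M x T = - \<nu> * (Dx (phix i) M x T * inverse (phi i M x T)
     + phix i M x T * (- 1 * (phix i M x T * (inverse (phi i M x T) * inverse (phi i M x T)))))"
proof -
  have "Dx (theta i) M x T = Dx (\<lambda>M x T. - \<nu> * (phix i M x T * inverse (phi i M x T))) M x T"
    by (rule Dx_cong[OF _ a]) (rule theta_eq[OF i])
  also have "\<dots> = - \<nu> * Dx (\<lambda>M x T. phix i M x T * inverse (phi i M x T)) M x T"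
    by (rule Dx_cmult[OF decay_mult[OF decay_phix[OF i] decay_inverse_phi[OF i]] a])
  finally show ?thesis
    by (simp only: Dx_mult[OF decay_phix[OF i] decay_inverse_phi[OF i] a] Dx_inverse_phi[OF i a])
qed

text \<open>Burgers' equation, read off from the quotient -\<nu> phi_x / phi by the product rule;
  the nonlinear term is what the cross term and the equation of 1/phi leave over.\<close>

lemma solves_theta:
  assumes i: "i \<in> {1, 2}"
  shows "solves (speed c i) (theta i) (\<lambda>M x T. - 1 * (theta i M x T * Dx (theta i) M x T))"
proof (rule solves_cong[OF solves_cmult[OF solves_mult[OF solves_phix solves_inverse_phi[OF i] decay_phix[OF i] decay_inverse_phi[OF i]]
        decay_mult[OF decay_phix[OF i] decay_inverse_phi[OF i]]] theta_eq[OF i]])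
  fix M x and T :: real assume a: "M \<in> small" "T > 1"
  hence a1: "T \<ge> 1" by simp
  show "- 1 * (theta i M x T * Dx (theta i) M x T) =
    - \<nu> * (0 * inverse (phi i M x T) + phix i M x T * (- \<nu> * ((phix i M x T)\<^sup>2 * inverse (phi i M x T) ^ 3))
      - \<nu> * (Dx (phix i) M x T * Dx (\<lambda>M x T. inverse (phi i M x T)) M x T))"
    unfolding Dx_theta[OF i a(1) a1] Dx_inverse_phi[OF i a(1) a1] theta_eq[OF i a(1) a1]
    by (simp add: power2_eq_square power3_eq_cube algebra_simps)
qed (use i in auto)

text \<open>Literally what \<open>solves_mult\<close>, used twice, returns for phi times (theta
  times wave), with \<open>phi\<close> transferred to the other speed. The summand 0 and the factor
  -1 keep the shape that those rules produce.\<close>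

definition source_remainder :: "nat \<Rightarrow> nat \<Rightarrow> family" where
  "source_remainder n i = (let j = 3 - i; X = higher n j; \<theta> = theta j in
     (\<lambda>M x T. (0 + (speed c j - speed c i) * Dx (phi i) M x T) * (\<theta> M x T * X M x T)
       + phi i M x T * (- 1 * (\<theta> M x T * Dx \<theta> M x T) * X M x T + \<theta> M x T * residual n j M x T - \<nu> * (Dx \<theta> M x T * Dx X M x T))
       - \<nu> * (Dx (phi i) M x T * Dx (\<lambda>M x T. \<theta> M x T * X M x T) M x T)))"

lemma source_solves:
  assumes i: "i \<in> {1, 2}" and X: "decay (base_weight n) (higher n (3 - i))"
    and s: "solves (speed c (3 - i)) (higher n (3 - i)) (residual n (3 - i))"
  shows "solves (speed c (3 - i)) (source n i) (source_remainder n i)"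
proof -
  have j: "3 - i \<in> {1, 2}" using i by auto
  show ?thesis
    unfolding source_def[abs_def] source_remainder_def Let_def
    by (rule solves_mult[OF solves_change_speed[OF solves_phi] solves_mult[OF solves_theta[OF j] s decay_theta[OF j] X]
          decay_phi[OF i] decay_mult[OF decay_theta[OF j] X]])
qed

lemma source_decay:
  assumes i: "i \<in> {1, 2}" and X: "decay (base_weight n) (higher n (3 - i))"
  shows "decay (source_weight n i) (source n i)"
proof -
  have j: "3 - i \<in> {1, 2}" using i by auto
  show ?thesis
    unfolding source_def[abs_def]
  proof (rule decay_mono[OF decay_mult[OF decay_phi[OF i] decay_mult[OF decay_theta[OF j] X]]], rule dominatedI[of 1])
    fix M x and T :: real assume a: "M \<in> small" "T \<ge> 1"
    note g = gauss_pos[THEN less_imp_le, of _ "3 - i" M x T]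
    have g48: "gauss (4 * \<nu>) (3 - i) M x T \<le> gauss (8 * \<nu>) (3 - i) M x T" using nu a by (intro gauss_mono) auto
    have "1 * (eps M * gauss (4 * \<nu>) (3 - i) M x T / sqrt T * base_weight n M x T)
       = eps M ^ (n + 2) * T powr (- (1/2 + alpha (int n - 1)/2)) * gauss (4 * \<nu>) (3 - i) M x T"
      unfolding base_weight_def powr_weights(2)[OF a(2)] by (simp add: mult_ac)
    also have "\<dots> \<le> source_weight n i M x T"
      unfolding source_weight_def using g48 eps(2) by (intro mult_left_mono) auto
    finally show "\<bar>1 * (eps M * gauss (4 * \<nu>) (3 - i) M x T / sqrt T * base_weight n M x T)\<bar> \<le> 1 * source_weight n i M x T"
      using g eps(2) a by (simp add: base_weight_def)
  qed simp
qed

text \<open>The residual of a wave of level m + 1 contains the wave of level m of the opposite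
  family, hence the assumption on level \<open>m\<close>. Multiplied by theta of the other speed,
  that part becomes an overlap term; the remaining part involves waves of one speed only.\<close>

lemma residual_term_decay:
  assumes i: "i \<in> {1, 2}" and X: "decay (base_weight n) (higher n (3 - i))"
    and Y: "\<And>m. n = Suc m \<Longrightarrow> decay (base_weight m) (higher m i)"
  shows "decay (remainder_weight n i) (\<lambda>M x T. theta (3 - i) M x T * residual n (3 - i) M x T)"
proof -
  define j where "j = 3 - i"
  have j: "j \<in> {1, 2}" "3 - j = i" using i by (auto simp: j_def)
  note X = X[folded j_def]
  have own: "decay (remainder_weight n i) (\<lambda>M x T. theta j M x T * Dx (\<lambda>M x T. theta j M x T * higher n j M x T) M x T)"
  proof (rule decay_mono[OF decay_mult[OF decay_theta'[OF j(1)] decay_Dx[OF decay_mult[OF decay_theta'[OF j(1)] X]]]],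
         rule dominated_remainder_own[where k = "n + 3" and b = "\<lambda>M x T. gauss (4 * \<nu>) j M x T"])
    show "0 \<le> gauss (4 * \<nu>) j M x T \<and> gauss (4 * \<nu>) j M x T \<le> 1" if "M \<in> small" "T \<ge> 1" for M x T
      using that nu by (auto simp: gauss_def)
  qed (auto simp: theta_weight_def base_weight_def j_def power3_eq_cube power_add mult_ac)
  show ?thesis
  proof (cases n)
    case 0
    show ?thesis unfolding j_def[symmetric]
      using decay_cmult[OF own, of "-1/2"] by (simp add: 0 mult_ac)
  next
    case (Suc m)
    have other: "decay (remainder_weight n i) (\<lambda>M x T. theta j M x T * Dx (\<lambda>M x T. theta i M x T * higher m i M x T) M x T)"
    proof (rule decay_mono[OF decay_mult[OF decay_theta'[OF j(1)] decay_Dx[OF decay_mult[OF decay_theta'[OF i] Y[OF Suc]]]]],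
           rule dominated_remainder_overlap[OF i, where k = "n + 2" and b = "\<lambda>M x T. (1 / sqrt T) ^ 3 * T powr (- (alpha (int m - 1) / 2))"])
      show "0 \<le> (1 / sqrt T) ^ 3 * T powr (- (alpha (int m - 1) / 2)) \<and> (1 / sqrt T) ^ 3 * T powr (- (alpha (int m - 1) / 2)) \<le> 1"
        if "M \<in> small" "T \<ge> 1" for M and x T :: real
      proof -
        have "(1 / sqrt T) ^ 3 * T powr (- (alpha (int m - 1) / 2)) \<le> 1 * 1"
          using small_powers[of M T "alpha (int m - 1) / 2"] that alpha_bounds[of m] by (intro mult_mono power_le_one) auto
        thus ?thesis using that by auto
      qed
    qed (auto simp: theta_weight_def base_weight_def j_def power3_eq_cube power_add mult_ac Suc)
    show ?thesis unfolding j_def[symmetric]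
      using decay_diff[OF decay_uminus[OF own] other] by (simp add: Suc j(2) algebra_simps)
  qed
qed

lemma source_remainder_decay:
  assumes i: "i \<in> {1, 2}" and X: "decay (base_weight n) (higher n (3 - i))"
    and Y: "\<And>m. n = Suc m \<Longrightarrow> decay (base_weight m) (higher m i)"
  shows "decay (remainder_weight n i) (source_remainder n i)"
proof -
  define j where "j = 3 - i"
  have j: "j \<in> {1, 2}" using i by (auto simp: j_def)
  note X' = X[folded j_def]
  let ?X = "higher n j" and ?\<theta> = "theta j"
  have pos: "0 \<le> 1 / sqrt T * (1 / sqrt T) * T powr (- (alpha (int n - 1) / 2)) \<and> 1 / sqrt T * (1 / sqrt T) * T powr (- (alpha (int n - 1) / 2)) \<le> 1"
    if "M \<in> small" "T \<ge> 1" for M T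
  proof -
    have "1 / sqrt T * (1 / sqrt T) * T powr (- (alpha (int n - 1) / 2)) \<le> 1 * 1 * 1"
      using small_powers[of M T "alpha (int n - 1) / 2"] that alpha_bounds[of n] by (intro mult_mono) auto
    thus ?thesis using that by auto
  qed
  \<comment> \<open>Terms with a derivative of \<open>phi i\<close> are overlap terms, since
    \<open>phix i\<close> is localised at the i-th characteristic. The other terms must find the
    gain 1/T among their own factors.\<close>
  have t1: "decay (remainder_weight n i) (\<lambda>M x T. phix i M x T * (?\<theta> M x T * ?X M x T))"
    by (rule decay_mono[OF decay_mult[OF decay_phix'[OF i] decay_mult[OF decay_theta'[OF j] X']]],
        rule dominated_remainder_overlap[OF i, where k = "n + 3" and b = "\<lambda>M x T. 1 / sqrt T * (1 / sqrt T) * T powr (- (alpha (int n - 1) / 2))"])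
       (use pos in \<open>auto simp: theta_weight_def base_weight_def j_def power3_eq_cube power_add mult_ac\<close>)
  have t5: "decay (remainder_weight n i) (\<lambda>M x T. phix i M x T * Dx (\<lambda>M x T. ?\<theta> M x T * ?X M x T) M x T)"
  proof (rule decay_mono[OF decay_mult[OF decay_phix'[OF i] decay_Dx[OF decay_mult[OF decay_theta'[OF j] X']]]],
        rule dominated_remainder_overlap[OF i, where k = "n + 3" and b = "\<lambda>M x T. 1 / sqrt T * (1 / sqrt T * (1 / sqrt T) * T powr (- (alpha (int n - 1) / 2)))"])
    show "0 \<le> 1 / sqrt T * (1 / sqrt T * (1 / sqrt T) * T powr (- (alpha (int n - 1) / 2)))
        \<and> 1 / sqrt T * (1 / sqrt T * (1 / sqrt T) * T powr (- (alpha (int n - 1) / 2))) \<le> 1" if "M \<in> small" "T \<ge> 1" for M and x T :: real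
      using pos[OF that] mult_mono[of "1 / sqrt T" 1 "1 / sqrt T * (1 / sqrt T) * T powr (- (alpha (int n - 1) / 2))" 1] that by auto
  qed (auto simp: theta_weight_def base_weight_def j_def power3_eq_cube power_add mult_ac)
  have b1: "0 \<le> gauss (4 * \<nu>) j M x T \<and> gauss (4 * \<nu>) j M x T \<le> 1" if "M \<in> small" "T \<ge> 1" for M x T
    using that nu by (auto simp: gauss_def)
  have t2: "decay (remainder_weight n i) (\<lambda>M x T. ?\<theta> M x T * Dx ?\<theta> M x T * ?X M x T)"
    by (rule decay_mono[OF decay_mult[OF decay_mult[OF decay_theta'[OF j] decay_Dx[OF decay_theta'[OF j]]] X']],
        rule dominated_remainder_own[where k = "n + 3" and b = "\<lambda>M x T. gauss (4 * \<nu>) j M x T"])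
       (use b1 in \<open>auto simp: theta_weight_def base_weight_def j_def power3_eq_cube power_add mult_ac\<close>)
  \<comment> \<open>No second theta is present here; the two derivatives supply the gain
    1/T.\<close>
  have t4: "decay (remainder_weight n i) (\<lambda>M x T. Dx ?\<theta> M x T * Dx ?X M x T)"
    by (rule decay_mono[OF decay_mult[OF decay_Dx[OF decay_theta'[OF j]] decay_Dx[OF X']]],
        rule dominated_remainder_own[where k = "n + 2" and b = "\<lambda>M x T. 1"])
       (auto simp: theta_weight_def base_weight_def j_def power3_eq_cube power_add mult_ac)
  note t3 = residual_term_decay[OF i X Y, folded j_def]
  have mid: "decay (\<lambda>M x T. 1 * remainder_weight n i M x T)
    (\<lambda>M x T. phi i M x T * (- 1 * (?\<theta> M x T * Dx ?\<theta> M x T * ?X M x T) + ?\<theta> M x T * residual n j M x T - \<nu> * (Dx ?\<theta> M x T * Dx ?X M x T)))"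
    by (intro decay_mult[OF decay_phi[OF i]] decay_add decay_diff decay_cmult t2 t4 t3) auto
  have "decay (remainder_weight n i) (\<lambda>M x T. (speed c j - speed c i) * (phix i M x T * (?\<theta> M x T * ?X M x T))
     + phi i M x T * (- 1 * (?\<theta> M x T * Dx ?\<theta> M x T * ?X M x T) + ?\<theta> M x T * residual n j M x T - \<nu> * (Dx ?\<theta> M x T * Dx ?X M x T))
     - \<nu> * (phix i M x T * Dx (\<lambda>M x T. ?\<theta> M x T * ?X M x T) M x T))"
    using mid by (intro decay_diff decay_add decay_cmult t1 t5) simp
  thus ?thesis
    unfolding source_remainder_def Let_def j_def[symmetric] Dx_phi by (simp add: mult.assoc)
qed


section \<open>Comparison of the weights with powers of time and Gaussians\<close>

lemma Psi_weight_eq: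
  "Psi_weight n i M x T = ((x - speed c i * T)\<^sup>2 + T) powr (- (1 + alpha (int n - 1) / 2) / 2)
    + inverse (\<bar>x - speed c (3 - i) * T\<bar> powr (1 + alpha (int n - 1) / 2) + T powr (1/2 + alpha (int n - 1) / 2))"
  by (simp add: Psi_weight_def Psi_def psi_def psi_tilde_def alpha_step beta_eq)

lemma Psi_weight_pos: "T \<ge> 1 \<Longrightarrow> Psi_weight n i M x T > 0"
  unfolding Psi_weight_eq by (intro add_nonneg_pos) (auto intro!: add_nonneg_pos)

text \<open>Since \<beta> = \<alpha> - 1/2 \<ge> \<alpha>/2, the second weight is dominated by one
  of parabolic width sqrt T.\<close>

lemma psi_tilde_upper:
  assumes "T \<ge> 1"
  shows "inverse (\<bar>z\<bar> powr (1 + alpha (int n - 1) / 2) + T powr (1/2 + alpha (int n - 1) / 2))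
    \<le> inverse (\<bar>z\<bar> powr (1 + alpha (int n - 1) / 2) + T powr ((1 + alpha (int n - 1) / 2) / 2))"
proof (rule le_imp_inverse_le)
  have "T powr ((1 + alpha (int n - 1) / 2) / 2) \<le> T powr (1/2 + alpha (int n - 1) / 2)"
    using assms alpha_bounds[of n] by (intro powr_mono) auto
  thus "\<bar>z\<bar> powr (1 + alpha (int n - 1) / 2) + T powr ((1 + alpha (int n - 1) / 2) / 2)
    \<le> \<bar>z\<bar> powr (1 + alpha (int n - 1) / 2) + T powr (1/2 + alpha (int n - 1) / 2)" by simp
qed (use assms in \<open>auto intro!: add_nonneg_pos\<close>)

lemma Psi_weight_upper:
  assumes T: "T \<ge> 1"
  shows "Psi_weight n i M x T \<le> 2 * T powr (- (1 + alpha (int n - 1) / 2) / 2)"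
proof -
  define \<alpha> where "\<alpha> = 1 + alpha (int n - 1) / 2"
  have \<alpha>: "\<alpha> \<ge> 1" using alpha_bounds[of n] by (simp add: \<alpha>_def)
  have 1: "((x - speed c i * T)\<^sup>2 + T) powr (- \<alpha> / 2) \<le> T powr (- \<alpha> / 2)"
    using T \<alpha> by (intro powr_mono2') auto
  let ?z = "x - speed c (3 - i) * T"
  have "inverse (\<bar>?z\<bar> powr \<alpha> + T powr (1/2 + alpha (int n - 1) / 2)) \<le> inverse (\<bar>?z\<bar> powr \<alpha> + T powr (\<alpha> / 2))"
    using psi_tilde_upper[OF T, of ?z n] by (simp only: \<alpha>_def)
  also have "\<dots> \<le> inverse (T powr (\<alpha> / 2))" using T by (intro le_imp_inverse_le) auto
  also have "\<dots> = T powr (- \<alpha> / 2)" by (simp add: powr_minus)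
  finally show ?thesis using 1 by (simp add: Psi_weight_eq \<alpha>_def)
qed

lemma dominated_time_Psi:
  "dominated (\<lambda>M x T. eps M ^ m * T powr (- (1 + alpha (int n - 1) / 2) / 2)) (\<lambda>M x T. eps M ^ m * Psi_weight n i M x T)"
proof (rule dominatedI[of 2])
  fix M x and T :: real assume a: "M \<in> small" "T \<ge> 1"
  have "eps M ^ m * Psi_weight n i M x T \<le> eps M ^ m * (2 * T powr (- (1 + alpha (int n - 1) / 2) / 2))"
    using Psi_weight_upper[OF a(2)] eps(2) by (intro mult_left_mono) auto
  moreover have "0 \<le> eps M ^ m * Psi_weight n i M x T"
    using Psi_weight_pos[OF a(2), of n i M x] eps(2)[of M] by simp
  ultimately show "\<bar>eps M ^ m * Psi_weight n i M x T\<bar> \<le> 2 * (eps M ^ m * T powr (- (1 + alpha (int n - 1) / 2) / 2))"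
    by simp
qed simp

lemma gauss_le_psi:
  assumes \<alpha>: "\<alpha> \<ge> 1" and D: "D > 0"
  obtains C where "C \<ge> 0" "\<And>M x T. T \<ge> 1 \<Longrightarrow>
    T powr (- \<alpha> / 2) * gauss D i M x T \<le> C * ((x - speed c i * T)\<^sup>2 + T) powr (- \<alpha> / 2)"
proof -
  obtain C where C: "C > 0" "\<And>u. u \<ge> 0 \<Longrightarrow> exp (- (1 / D * u)) \<le> C * (1 + u) powr (- (\<alpha> / 2))"
    using exp_absorbs_powr[of "1 / D" "\<alpha> / 2"] D \<alpha> by auto
  show ?thesis
  proof (rule that[of C])
    fix M x and T :: real assume T: "T \<ge> 1"
    define z where "z = x - speed c i * T"
    have "gauss D i M x T = exp (- (1 / D * (z\<^sup>2 / T)))" by (simp add: gauss_def z_def)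
    also have "\<dots> \<le> C * (1 + z\<^sup>2 / T) powr (- (\<alpha> / 2))" using T by (intro C) auto
    finally have "T powr (- \<alpha> / 2) * gauss D i M x T \<le> T powr (- \<alpha> / 2) * (C * (1 + z\<^sup>2 / T) powr (- (\<alpha> / 2)))"
      by (intro mult_left_mono) auto
    also have "\<dots> = C * (T * (1 + z\<^sup>2 / T)) powr (- \<alpha> / 2)" by (simp add: powr_mult)
    also have "T * (1 + z\<^sup>2 / T) = z\<^sup>2 + T" using T by (simp add: field_simps)
    finally show "T powr (- \<alpha> / 2) * gauss D i M x T \<le> C * ((x - speed c i * T)\<^sup>2 + T) powr (- \<alpha> / 2)"
      by (simp add: z_def)
  qed (use C in auto)
qed

text \<open>|z|^\<alpha> times the Gaussian is of order T^(\<alpha>/2), hence at most of order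
  T^\<beta>. This is how the boundary term of Duhamel's integral turns into the psi-tilde part of
  the weight.\<close>

lemma gauss_le_psi_tilde:
  assumes D: "D > 0"
  obtains C where "C \<ge> 0" "\<And>M x T. T \<ge> 1 \<Longrightarrow> T powr (- (1/2 + alpha (int n - 1) / 2)) * gauss D j M x T
    \<le> C * inverse (\<bar>x - speed c j * T\<bar> powr (1 + alpha (int n - 1) / 2) + T powr (1/2 + alpha (int n - 1) / 2))"
proof -
  define \<alpha> \<beta> where "\<alpha> = 1 + alpha (int n - 1) / 2" and "\<beta> = 1/2 + alpha (int n - 1) / 2"
  have ab: "\<alpha> \<ge> 1" "\<alpha> / 2 \<le> \<beta>" using alpha_bounds[of n] by (auto simp: \<alpha>_def \<beta>_def)
  obtain C where C: "C > 0" "\<And>u. u > 0 \<Longrightarrow> u powr (\<alpha> / 2) * exp (- (1 / D * u)) \<le> C"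
    using powr_exp_bounded[of "1 / D" "\<alpha> / 2"] D ab by auto
  show ?thesis
  proof (rule that[of "C + 1", folded \<alpha>_def \<beta>_def])
    fix M x and T :: real assume T: "T \<ge> 1"
    define z where "z = x - speed c j * T"
    have g1: "gauss D j M x T \<le> 1" using D T by (simp add: gauss_def)
    have "\<bar>z\<bar> powr \<alpha> * gauss D j M x T \<le> C * T powr \<beta>"
    proof (cases "z = 0")
      case False
      have "\<bar>z\<bar> powr \<alpha> = (z\<^sup>2) powr (\<alpha> / 2)"
        using powr_powr[of "\<bar>z\<bar>" 2 "\<alpha> / 2"] False by simp
      also have "\<dots> = T powr (\<alpha> / 2) * (z\<^sup>2 / T) powr (\<alpha> / 2)"
        using T by (simp flip: powr_mult)
      finally have "\<bar>z\<bar> powr \<alpha> * gauss D j M x T = T powr (\<alpha> / 2) * ((z\<^sup>2 / T) powr (\<alpha> / 2) * exp (- (1 / D * (z\<^sup>2 / T))))"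
        by (simp add: gauss_def z_def)
      also have "\<dots> \<le> T powr \<beta> * C"
        using C(2)[of "z\<^sup>2 / T"] False T ab by (intro mult_mono powr_mono) auto
      finally show ?thesis by (simp add: mult.commute)
    qed (use C in auto)
    moreover have "T powr \<beta> * gauss D j M x T \<le> T powr \<beta> * 1" using g1 by (intro mult_left_mono) auto
    ultimately have "gauss D j M x T * (\<bar>z\<bar> powr \<alpha> + T powr \<beta>) \<le> (C + 1) * T powr \<beta>"
      by (simp add: algebra_simps)
    moreover have "\<bar>z\<bar> powr \<alpha> + T powr \<beta> > 0" using T by (intro add_nonneg_pos) auto
    ultimately have "gauss D j M x T \<le> (C + 1) * T powr \<beta> * inverse (\<bar>z\<bar> powr \<alpha> + T powr \<beta>)"
      by (simp add: pos_le_divide_eq flip: divide_inverse)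
    hence "T powr (- \<beta>) * gauss D j M x T \<le> T powr (- \<beta>) * ((C + 1) * T powr \<beta> * inverse (\<bar>z\<bar> powr \<alpha> + T powr \<beta>))"
      by (intro mult_left_mono) auto
    also have "\<dots> = (T powr (- \<beta>) * T powr \<beta>) * ((C + 1) * inverse (\<bar>z\<bar> powr \<alpha> + T powr \<beta>))" by simp
    also have "T powr (- \<beta>) * T powr \<beta> = 1" using T by (simp flip: powr_add)
    finally show "T powr (- \<beta>) * gauss D j M x T \<le> (C + 1) * inverse (\<bar>x - speed c j * T\<bar> powr \<alpha> + T powr \<beta>)"
      by (simp add: z_def)
  qed (use C in auto)
qed

text \<open>Differentiating the first equation in x would involve mixed derivatives; the second
  holds because \<open>Dx V\<close> is again a Duhamel integral, with source
  \<open>Dx h\<close>.\<close>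

lemma solves_duhamel:
  fixes l :: real
  assumes h: "decay w h" "dominated (\<lambda>_ _ _. 1) w"
  defines "V \<equiv> \<lambda>M x T. duhamel \<nu> l 1 (h M) x T"
  shows "solves l V h" and "solves l (Dx V) (Dx h)"
proof -
  have s: "((\<lambda>S. duhamel \<nu> l 1 ((Dx ^^ k) h M) x S) has_real_derivative
      (Dx ^^ k) h M x T - l * duhamel \<nu> l 1 ((Dx ^^ (k + 1)) h M) x T + \<nu> / 2 * duhamel \<nu> l 1 ((Dx ^^ (k + 2)) h M) x T) (at_left T)"
    if "M \<in> small" "T > 1" for k M x T
    by (rule duhamel_has_left_derivative[OF nu decay_bounded_continuous_Dx[OF h that(1)] decay_bounded_continuous_Dx[OF h that(1)]
          decay_bounded_continuous_Dx[OF h that(1)]])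
       (use that decay_has_derivative[OF decay_Dx_funpow[OF h(1), of k] that(1)]
          decay_has_derivative[OF decay_Dx_funpow[OF h(1), of "Suc k"] that(1)] in auto)
  note e = Dx_funpow_duhamel(1)[OF h, where l = l, folded V_def]
  show "solves l V h"
  proof (rule solvesI)
    fix M x and T :: real assume a: "M \<in> small" "T > 1"
    show "((\<lambda>S. V M x S) has_real_derivative h M x T - l * Dx V M x T + \<nu> / 2 * Dx (Dx V) M x T) (at_left T)"
      using s[OF a, of 0 x] e[OF a(1), of 1 x T] e[OF a(1), of 2 x T] by (simp add: V_def numeral_2_eq_2)
  qed
  show "solves l (Dx V) (Dx h)"
  proof (rule solvesI)
    fix M x and T :: real assume a: "M \<in> small" "T > 1"
    have "(\<lambda>S. Dx V M x S) = (\<lambda>S. duhamel \<nu> l 1 ((Dx ^^ 1) h M) x S)"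
      using e[OF a(1), of 1 x] by auto
    thus "((\<lambda>S. Dx V M x S) has_real_derivative Dx h M x T - l * Dx (Dx V) M x T + \<nu> / 2 * Dx (Dx (Dx V)) M x T) (at_left T)"
      using s[OF a, of 1 x] e[OF a(1), of 2 x T] e[OF a(1), of 3 x T] by (simp add: numeral_2_eq_2 numeral_3_eq_3)
  qed
qed

text \<open>V / phi satisfies an equation with drift theta, because the cross term of the quotient
  contains \<nu> phi_x / phi. One space derivative brings the drift into divergence form, which is
  the linearised Burgers operator. The derivative is expanded beforehand and its products are
  treated singly, which is why the equation of \<open>Dx V\<close> is assumed as well.\<close>

lemma solves_cole_hopf:
  assumes i: "i \<in> {1, 2}" and s: "solves (speed c i) V h" and s1: "solves (speed c i) (Dx V) (Dx h)"
    and V: "decay w V" and h: "decay v h"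
  defines "u \<equiv> Dx (\<lambda>M x T. V M x T * inverse (phi i M x T))"
  shows "solves (speed c i) u (\<lambda>M x T. - Dx (\<lambda>M x T. theta i M x T * u M x T) M x T
      + Dx (\<lambda>M x T. h M x T * inverse (phi i M x T)) M x T)"
proof -
  let ?b = "\<lambda>M x T. inverse (phi i M x T)"
  let ?b1 = "\<lambda>M x T. - 1 * (phix i M x T * (?b M x T * ?b M x T))"
  note db = decay_inverse_phi[OF i] and dp = decay_phix[OF i]
  note db1 = decay_cmult[OF decay_mult[OF dp decay_mult[OF db db]], of "-1"]
  note ub = Dx_mult[OF V db]
  have u: "u M x T = Dx V M x T * ?b M x T + V M x T * ?b1 M x T" if "M \<in> small" "T \<ge> 1" for M x T
    unfolding u_def ub[OF that] Dx_inverse_phi[OF i that] ..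
  note Sb = solves_inverse_phi[OF i]
  \<comment> \<open>The equation of the derivative of 1/phi, assembled from products in the same
    way.\<close>
  note Sb1 = solves_cmult[OF solves_mult[OF solves_phix solves_mult[OF Sb Sb db db] dp decay_mult[OF db db]] decay_mult[OF dp decay_mult[OF db db]], of "-1"]
  note S = solves_add[OF solves_mult[OF s1 Sb decay_Dx[OF V] db] solves_mult[OF s Sb1 V db1] decay_mult[OF decay_Dx[OF V] db] decay_mult[OF V db1]]
  show ?thesis
  proof (rule solves_cong[OF S u])
    fix M x and T :: real assume a: "M \<in> small" "T > 1"
    hence a': "M \<in> small" "T \<ge> 1" by auto
    have d1: "Dx ?b1 M x T = - 1 * (Dx (phix i) M x T * (?b M x T * ?b M x T) + phix i M x T * (?b1 M x T * ?b M x T + ?b M x T * ?b1 M x T))"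
      unfolding Dx_cmult[OF decay_mult[OF dp decay_mult[OF db db]] a'] Dx_mult[OF dp decay_mult[OF db db] a'] Dx_mult[OF db db a']
        Dx_inverse_phi[OF i a'] ..
    have du: "decay (\<lambda>M x T. w M x T / sqrt T) u"
      unfolding u_def using decay_Dx[OF decay_mult[OF V db]] by simp
    have dxu: "Dx u M x T = (Dx (Dx V) M x T * ?b M x T + Dx V M x T * ?b1 M x T) + (Dx V M x T * ?b1 M x T + V M x T * Dx ?b1 M x T)"
    proof -
      have "Dx u M x T = Dx (\<lambda>M x T. Dx V M x T * ?b M x T + V M x T * ?b1 M x T) M x T"
        by (rule Dx_cong[OF _ a']) (rule u)
      also have "\<dots> = Dx (\<lambda>M x T. Dx V M x T * ?b M x T) M x T + Dx (\<lambda>M x T. V M x T * ?b1 M x T) M x T"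
        by (rule Dx_add[OF decay_mult[OF decay_Dx[OF V] db] decay_mult[OF V db1] a'])
      finally show ?thesis
        unfolding Dx_mult[OF decay_Dx[OF V] db a'] Dx_mult[OF V db1 a'] Dx_inverse_phi[OF i a'] .
    qed
    have dtu: "Dx (\<lambda>M x T. theta i M x T * u M x T) M x T = Dx (theta i) M x T * u M x T + theta i M x T * Dx u M x T"
      by (rule Dx_mult[OF decay_theta[OF i] du a'])
    show "- Dx (\<lambda>M x T. theta i M x T * u M x T) M x T + Dx (\<lambda>M x T. h M x T * inverse (phi i M x T)) M x T =
      Dx h M x T * ?b M x T + Dx V M x T * (- \<nu> * ((phix i M x T)\<^sup>2 * ?b M x T ^ 3)) - \<nu> * (Dx (Dx V) M x T * Dx ?b M x T)
      + (h M x T * ?b1 M x T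
       + V M x T * (- 1 * (0 * (?b M x T * ?b M x T)
           + phix i M x T * ((- \<nu> * ((phix i M x T)\<^sup>2 * ?b M x T ^ 3)) * ?b M x T + ?b M x T * (- \<nu> * ((phix i M x T)\<^sup>2 * ?b M x T ^ 3))
               - \<nu> * (Dx ?b M x T * Dx ?b M x T))
           - \<nu> * (Dx (phix i) M x T * Dx (\<lambda>M x T. ?b M x T * ?b M x T) M x T)))
       - \<nu> * (Dx V M x T * Dx ?b1 M x T))"
      unfolding dtu dxu d1 u[OF a'] Dx_theta[OF i a'] theta_eq[OF i a'] Dx_mult[OF h db a'] Dx_mult[OF db db a'] Dx_inverse_phi[OF i a']
      by (simp add: power2_eq_square power3_eq_cube algebra_simps)
  qed
qed

text \<open>The induction step. The derivative of V / phi has two parts: V_x / phi inherits the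
  interaction estimate, and in V phi_x / phi^2 the weak decay of V is compensated by the
  localisation of phi_x at the i-th characteristic.\<close>

lemma next_wave:
  assumes i: "i \<in> {1, 2}" and X: "decay (base_weight n) (higher n (3 - i))"
    and Y: "\<And>m. n = Suc m \<Longrightarrow> decay (base_weight m) (higher m i)"
    and sX: "solves (speed c (3 - i)) (higher n (3 - i)) (residual n (3 - i))"
  shows "decay (\<lambda>M x T. eps M ^ (n + 2) * Psi_weight n i M x T) (higher (Suc n) i)"
    and "solves (speed c i) (higher (Suc n) i) (residual (Suc n) i)"
proof -
  have j: "3 - i \<in> {1, 2}" using i by auto
  define a where "a = alpha (int n - 1)"
  have a: "1 \<le> a" "a < 2" using alpha_bounds[of n] by (auto simp: a_def)
  have A: "0 \<le> eps M ^ (n + 2) \<and> eps M ^ (n + 2) \<le> 1" if "M \<in> small" for M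
    using eps(1)[OF that] eps(2)[of M] by (auto intro!: power_le_one simp del: power_Suc)
  note h = source_decay[OF i X] and r = source_remainder_decay[OF i X Y]
  have D8: "8 * \<nu> \<ge> 4 * \<nu>" "8 * \<nu> > 0" "4 * \<nu> > 0" using nu by auto
  define V where "V = (\<lambda>M x T. duhamel \<nu> (speed c i) 1 (source n i M) x T)"
  note ie = interaction_estimate[OF i D8(1) a A h[unfolded source_weight_def[abs_def], folded a_def]
      r[unfolded remainder_weight_def[abs_def], folded a_def] source_solves[OF i X sX], folded V_def]
  have wh: "dominated (\<lambda>_ _ _. 1) (source_weight n i)"
    unfolding source_weight_def[abs_def] by (rule gauss_weight_bounded[OF D8(2) A]) (use alpha_bounds[of n] in auto)
  \<comment> \<open>\<open>V\<close> carries the source without its minus sign, which returns as the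
    factor -1.\<close>
  have PV: "potential n i = (\<lambda>M x T. - 1 * V M x T)" by (simp add: potential_def V_def fun_eq_iff)
  note Psi_eq = Psi_weight_eq[of n i, folded a_def]
  have d1: "decay (\<lambda>M x T. eps M ^ (n + 2) * Psi_weight n i M x T) (Dx V)"
  proof (rule decay_mono[OF ie(2)])
    obtain C where C: "C \<ge> 0" "\<And>M x T. T \<ge> 1 \<Longrightarrow> T powr (- (1/2 + a / 2)) * gauss (8 * \<nu>) (3 - i) M x T
      \<le> C * inverse (\<bar>x - speed c (3 - i) * T\<bar> powr (1 + a / 2) + T powr (1/2 + a / 2))"
      using gauss_le_psi_tilde[OF D8(2), of n "3 - i"] unfolding a_def by blast
    show "dominated (\<lambda>M x T. eps M ^ (n + 2) * Psi_weight n i M x T)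
      (\<lambda>M x T. eps M ^ (n + 2) * (((x - speed c i * T)\<^sup>2 + T) powr (- (1 + a / 2) / 2) + T powr (- (1 / 2 + a / 2)) * gauss (8 * \<nu>) (3 - i) M x T))"
    proof (rule dominatedI[of "1 + C"])
      fix M x and T :: real assume M: "M \<in> small" "T \<ge> 1"
      define y where "y = ((x - speed c i * T)\<^sup>2 + T) powr (- (1 + a / 2) / 2)"
      define z where "z = inverse (\<bar>x - speed c (3 - i) * T\<bar> powr (1 + a / 2) + T powr (1/2 + a / 2))"
      define g where "g = T powr (- (1/2 + a / 2)) * gauss (8 * \<nu>) (3 - i) M x T"
      have pos: "y \<ge> 0" "z \<ge> 0" "g \<ge> 0" using gauss_pos[THEN less_imp_le] by (auto simp: y_def z_def g_def)
      have "g \<le> C * z" using C(2)[OF M(2)] by (simp add: g_def z_def)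
      moreover have "0 \<le> C * y" using C pos by simp
      ultimately have "y + g \<le> (1 + C) * (y + z)" using pos by (simp add: algebra_simps)
      hence "eps M ^ (n + 2) * (y + g) \<le> eps M ^ (n + 2) * ((1 + C) * (y + z))"
        using A[OF M(1)] by (intro mult_left_mono) auto
      moreover have "0 \<le> eps M ^ (n + 2) * (y + g)" using A[OF M(1)] pos by (intro mult_nonneg_nonneg) auto
      ultimately show "\<bar>eps M ^ (n + 2) * (((x - speed c i * T)\<^sup>2 + T) powr (- (1 + a / 2) / 2) + T powr (- (1 / 2 + a / 2)) * gauss (8 * \<nu>) (3 - i) M x T)\<bar>
        \<le> (1 + C) * (eps M ^ (n + 2) * Psi_weight n i M x T)"
        unfolding Psi_eq y_def[symmetric] z_def[symmetric] g_def[symmetric] by (simp add: mult_ac)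
    qed (use C in auto)
  qed
  \<comment> \<open>V itself decays only like T^(-a/4), but its derivatives are already known from
    \<open>d1\<close>; T^(-a/4) / sqrt T is exactly T^(-\<alpha>/2) with \<alpha> = 1 + a/2.\<close>
  have dV: "decay (\<lambda>M x T. eps M ^ (n + 2) * T powr (- a/4)) V"
  proof (rule decayI_Dx[where g = "Dx V"])
    note Vd = Dx_funpow_duhamel[OF h wh, where l = "speed c i", folded V_def]
    show "((\<lambda>y. V M y T) has_real_derivative Dx V M x T) (at x)" if "M \<in> small" "T \<ge> 1" for M x T
      using x_differentiableD[OF Vd(3)[of 0] that] by simp
    show "jointly_continuous V" using Vd(2)[of 0] by simp
    show "dominated (\<lambda>M x T. eps M ^ (n + 2) * T powr (- a/4)) V" by (rule ie(1))
    have e: "eps M ^ (n + 2) * T powr (- (1 + a/2) / 2) = eps M ^ (n + 2) * T powr (- a/4) / sqrt T" if "T \<ge> 1" for M T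
    proof -
      have "- (1 + a/2) / 2 = - (1/2 + (a/2)/2)" by (simp add: field_simps)
      hence "T powr (- (1 + a/2) / 2) = T powr (- (1/2 + (a/2)/2))" by (simp only:)
      also have "\<dots> = 1 / sqrt T * T powr (- (a/2)/2)" by (rule powr_weights(2)[OF that])
      finally show ?thesis by simp
    qed
    show "decay (\<lambda>M x T. eps M ^ (n + 2) * T powr (- a/4) / sqrt T) (Dx V)"
    proof (rule decay_mono[OF decay_mono[OF d1 dominated_time_Psi[of "n + 2" n i, folded a_def]]])
      show "dominated (\<lambda>M x T. eps M ^ (n + 2) * T powr (- a/4) / sqrt T) (\<lambda>M x T. eps M ^ (n + 2) * T powr (- (1 + a/2) / 2))"
      proof (rule dominatedI[of 1])
        fix M x and T :: real assume M: "M \<in> small" "T \<ge> 1"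
        show "\<bar>eps M ^ (n + 2) * T powr (- (1 + a/2) / 2)\<bar> \<le> 1 * (eps M ^ (n + 2) * T powr (- a/4) / sqrt T)"
        proof -
          have "0 \<le> eps M ^ (n + 2) * T powr (- (1 + a/2) / 2)" using A[OF M(1)] by (intro mult_nonneg_nonneg) auto
          thus ?thesis unfolding e[OF M(2), symmetric] by (simp only: abs_of_nonneg mult_1_left)
        qed
      qed simp
    qed
  qed
  note dV1 = decay_cmult[OF dV, of "-1"]
  have d2: "decay (\<lambda>M x T. eps M ^ (n + 2) * Psi_weight n i M x T)
      (\<lambda>M x T. V M x T * (phix i M x T * (inverse (phi i M x T) * inverse (phi i M x T))))"
  proof (rule decay_mono[OF decay_mult[OF dV decay_mult[OF decay_phix[OF i] decay_mult[OF decay_inverse_phi[OF i] decay_inverse_phi[OF i]]]]])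
    \<comment> \<open>T^(-a/4) from V and 1/sqrt T from phi_x make T^(-(1 + a/2)/2), which together
      with the Gaussian stays below the psi part of the weight.\<close>
    obtain C where C: "C \<ge> 0" "\<And>M x T. T \<ge> 1 \<Longrightarrow>
      T powr (- (1 + a/2) / 2) * gauss (4 * \<nu>) i M x T \<le> C * ((x - speed c i * T)\<^sup>2 + T) powr (- (1 + a/2) / 2)"
      by (rule gauss_le_psi[of "1 + a/2" "4 * \<nu>" i]) (use D8 a in auto)
    show "dominated (\<lambda>M x T. eps M ^ (n + 2) * Psi_weight n i M x T)
       (\<lambda>M x T. eps M ^ (n + 2) * T powr (- a/4) * (eps M * gauss (4 * \<nu>) i M x T / sqrt T * (1 * 1)))"
    proof (rule dominatedI[OF C(1)])
      fix M x and T :: real assume M: "M \<in> small" "T \<ge> 1"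
      have g0: "gauss (4 * \<nu>) i M x T \<ge> 0" by (rule gauss_pos[THEN less_imp_le])
      have T: "T powr (- (1 + a/2) / 2) = T powr (- a/4) / sqrt T"
      proof -
        have "- (1 + a/2) / 2 = - (1/2 + (a/2)/2)" by (simp add: field_simps)
        hence "T powr (- (1 + a/2) / 2) = T powr (- (1/2 + (a/2)/2))" by (simp only:)
        also have "\<dots> = 1 / sqrt T * T powr (- (a/2)/2)" by (rule powr_weights(2)[OF M(2)])
        finally show ?thesis by simp
      qed
      have "eps M ^ (n + 2) * T powr (- a/4) * (eps M * gauss (4 * \<nu>) i M x T / sqrt T * (1 * 1))
        = eps M ^ (n + 2) * (eps M * (T powr (- (1 + a/2) / 2) * gauss (4 * \<nu>) i M x T))" unfolding T by simp
      also have "\<dots> \<le> eps M ^ (n + 2) * (1 * (C * Psi_weight n i M x T))"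
      proof (rule mult_left_mono[OF mult_mono])
        have "T powr (- (1 + a/2) / 2) * gauss (4 * \<nu>) i M x T \<le> C * ((x - speed c i * T)\<^sup>2 + T) powr (- (1 + a/2) / 2)"
          by (rule C(2)[OF M(2)])
        also have "\<dots> \<le> C * Psi_weight n i M x T" unfolding Psi_eq using C(1) by (intro mult_left_mono) auto
        finally show "T powr (- (1 + a/2) / 2) * gauss (4 * \<nu>) i M x T \<le> C * Psi_weight n i M x T" .
      qed (use eps(1)[OF M(1)] eps(2)[of M] g0 in auto)
      finally have le: "eps M ^ (n + 2) * T powr (- a/4) * (eps M * gauss (4 * \<nu>) i M x T / sqrt T * (1 * 1))
        \<le> C * (eps M ^ (n + 2) * Psi_weight n i M x T)" by (simp add: mult_ac)
      have "0 \<le> eps M ^ (n + 2) * T powr (- a/4) * (eps M * gauss (4 * \<nu>) i M x T / sqrt T * (1 * 1))"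
        using eps(2)[of M] g0 M by (intro mult_nonneg_nonneg divide_nonneg_nonneg) auto
      with le show "\<bar>eps M ^ (n + 2) * T powr (- a/4) * (eps M * gauss (4 * \<nu>) i M x T / sqrt T * (1 * 1))\<bar>
        \<le> C * (eps M ^ (n + 2) * Psi_weight n i M x T)" by linarith
    qed
  qed
  have u: "higher (Suc n) i M x T = - 1 * (Dx V M x T * inverse (phi i M x T))
      + V M x T * (phix i M x T * (inverse (phi i M x T) * inverse (phi i M x T)))" if M: "M \<in> small" "T \<ge> 1" for M x T
    unfolding higher_Suc PV Dx_mult[OF dV1 decay_inverse_phi[OF i] M] Dx_cmult[OF dV M] Dx_inverse_phi[OF i M]
    by simp
  have "decay (\<lambda>M x T. eps M ^ (n + 2) * Psi_weight n i M x T)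
     (\<lambda>M x T. - 1 * (Dx V M x T * inverse (phi i M x T)) + V M x T * (phix i M x T * (inverse (phi i M x T) * inverse (phi i M x T))))"
    using decay_add[OF decay_cmult[OF decay_mult[OF d1 decay_inverse_phi[OF i]], of "-1"]] d2 by simp
  thus "decay (\<lambda>M x T. eps M ^ (n + 2) * Psi_weight n i M x T) (higher (Suc n) i)"
    by (rule decay_cong[THEN iffD2, rotated]) (rule u)
  note sV = solves_duhamel[OF h wh, where l = "speed c i", folded V_def]
  have DV: "Dx (\<lambda>M x T. - 1 * V M x T) M x T = - 1 * Dx V M x T" if "M \<in> small" "T \<ge> 1" for M x T
    by (rule Dx_cmult[OF dV that])
  have Dh: "Dx (\<lambda>M x T. - 1 * source n i M x T) M x T = - 1 * Dx (source n i) M x T" if "M \<in> small" "T \<ge> 1" for M x T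
    by (rule Dx_cmult[OF h that])
  have s1: "solves (speed c i) (Dx (\<lambda>M x T. - 1 * V M x T)) (Dx (\<lambda>M x T. - 1 * source n i M x T))"
    by (rule solves_cong[OF solves_cmult[OF sV(2) decay_Dx[OF dV], of "-1"]]) (use DV Dh in auto)
  have HV: "Dx (\<lambda>M x T. - 1 * V M x T * inverse (phi i M x T)) = higher (Suc n) i"
    by (simp only: higher_Suc PV)
  note S = solves_cole_hopf[OF i solves_cmult[OF sV(1) dV, of "-1"] s1 dV1 decay_cmult[OF h, of "-1"], unfolded HV]
  show "solves (speed c i) (higher (Suc n) i) (residual (Suc n) i)"
  proof (rule solves_cong[OF S refl])
    fix M x and T :: real assume M: "M \<in> small" "T > 1"
    hence M': "M \<in> small" "T \<ge> 1" by auto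
    have "Dx (\<lambda>M x T. - 1 * source n i M x T * inverse (phi i M x T)) M x T
      = Dx (\<lambda>M x T. - 1 * (theta (3 - i) M x T * higher n (3 - i) M x T)) M x T"
    proof (rule Dx_cong[OF _ M'])
      show "- 1 * source n i M x T * inverse (phi i M x T) = - 1 * (theta (3 - i) M x T * higher n (3 - i) M x T)"
        if "M \<in> small" for M x T
        using phi_pos[OF i that, of x T] by (simp add: source_def)
    qed
    also have "\<dots> = - 1 * Dx (\<lambda>M x T. theta (3 - i) M x T * higher n (3 - i) M x T) M x T"
      by (rule Dx_cmult[OF decay_mult[OF decay_theta[OF j] X] M'])
    finally show "residual (Suc n) i M x T = - Dx (\<lambda>M x T. theta i M x T * higher (Suc n) i M x T) M x T
      + Dx (\<lambda>M x T. - 1 * source n i M x T * inverse (phi i M x T)) M x T"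
      by simp
  qed
qed

lemma base_weight_dominates:
  "dominated (base_weight (Suc n)) (\<lambda>M x T. eps M ^ (n + 2) * Psi_weight n i M x T)"
proof -
  have "base_weight (Suc n) = (\<lambda>M x T. eps M ^ (n + 2) * T powr (- (1 + alpha (int n - 1) / 2) / 2))"
    by (simp add: base_weight_def fun_eq_iff alpha_step)
  thus ?thesis using dominated_time_Psi[of "n + 2" n i] by (simp only:)
qed

text \<open>The last conjunct carries the level below with the opposite index, since the remainder
  of the next source reaches two levels down from the wave it generates.\<close>

lemma higher_invariant:
  "i \<in> {1, 2} \<Longrightarrow> decay (base_weight n) (higher n i) \<and> solves (speed c i) (higher n i) (residual n i)
     \<and> (\<forall>m. n = Suc m \<longrightarrow> decay (base_weight m) (higher m (3 - i)))"
proof (induction n arbitrary: i)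
  case 0
  have eq: "higher 0 i = (\<lambda>M x T. 1/2 * theta i M x T)" by simp
  have "decay (base_weight 0) (theta i)"
  proof (rule decay_mono[OF decay_theta[OF 0]], rule dominatedI[of 1])
    fix M x and T :: real assume M: "M \<in> small" "T \<ge> 1"
    have "base_weight 0 M x T = eps M / sqrt T"
      using powr_weights(2)[OF M(2), of 0] M by (simp add: base_weight_def alpha_def)
    moreover have "eps M * gauss (4 * \<nu>) i M x T / sqrt T \<le> eps M * 1 / sqrt T"
      using M nu eps(2)[of M] by (intro divide_right_mono mult_left_mono) (auto simp: gauss_def)
    moreover have "0 \<le> eps M * gauss (4 * \<nu>) i M x T / sqrt T"
      using M eps(2)[of M] gauss_pos[THEN less_imp_le] by simp
    ultimately show "\<bar>eps M * gauss (4 * \<nu>) i M x T / sqrt T\<bar> \<le> 1 * base_weight 0 M x T" by simp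
  qed simp
  hence "decay (base_weight 0) (higher 0 i)" unfolding eq by (rule decay_cmult)
  moreover have "solves (speed c i) (higher 0 i) (residual 0 i)"
  proof (rule solves_cong[OF solves_cmult[OF solves_theta[OF 0] decay_theta[OF 0], of "1/2"]])
    fix M x and T :: real assume M: "M \<in> small" "T > 1"
    hence M': "M \<in> small" "T \<ge> 1" by auto
    have "Dx (\<lambda>M x T. theta i M x T * higher 0 i M x T) M x T = Dx (\<lambda>M x T. 1/2 * (theta i M x T * theta i M x T)) M x T"
      by simp
    also have "\<dots> = 1/2 * (Dx (theta i) M x T * theta i M x T + theta i M x T * Dx (theta i) M x T)"
      unfolding Dx_cmult[OF decay_mult[OF decay_theta[OF 0] decay_theta[OF 0]] M'] Dx_mult[OF decay_theta[OF 0] decay_theta[OF 0] M'] ..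
    finally show "residual 0 i M x T = 1/2 * (- 1 * (theta i M x T * Dx (theta i) M x T))" by simp
  qed simp
  ultimately show ?case by simp
next
  case (Suc n)
  have j: "3 - i \<in> {1, 2}" "3 - (3 - i) = i" using Suc.prems by auto
  note IH = Suc.IH[OF j(1), unfolded j(2)]
  have X: "decay (base_weight n) (higher n (3 - i))" "solves (speed c (3 - i)) (higher n (3 - i)) (residual n (3 - i))"
    and Y: "\<And>m. n = Suc m \<Longrightarrow> decay (base_weight m) (higher m i)"
    using IH by auto
  note nw = next_wave[OF Suc.prems X(1) Y X(2)]
  show ?case using decay_mono[OF nw(1) base_weight_dominates] nw(2) X(1) by auto
qed

lemma higher_decay:
  assumes "i \<in> {1, 2}"
  shows "decay (\<lambda>M x T. eps M ^ (n + 2) * Psi_weight n i M x T) (higher (Suc n) i)"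
proof -
  have j: "3 - i \<in> {1, 2}" "3 - (3 - i) = i" using assms by auto
  show ?thesis
    by (rule next_wave(1)[OF assms]) (use higher_invariant[OF j(1), of n] j(2) in auto)
qed

end

section \<open>Uniqueness\<close>

lemma left_derivative_shift:
  fixes f :: "real \<Rightarrow> real"
  assumes "(f has_real_derivative d) (at_left (t + 1))"
  shows "((\<lambda>s. f (s + 1)) has_real_derivative d) (at_left t)"
proof -
  have "((\<lambda>y. (f y - f (t + 1)) / (y - (t + 1))) \<longlongrightarrow> d) (at_left (t + 1))"
    using assms by (simp add: has_field_derivative_iff)
  moreover have "filterlim (\<lambda>s. s + 1) (at_left (t + 1)) (at_left t)"
    by (auto simp: filterlim_at eventually_at_filter intro!: tendsto_eq_intros)
  ultimately have "((\<lambda>s. (f (s + 1) - f (t + 1)) / (s + 1 - (t + 1))) \<longlongrightarrow> d) (at_left t)"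
    by (rule filterlim_compose)
  thus ?thesis by (simp add: has_field_derivative_iff)
qed

lemma field_differentiableD: "f field_differentiable at x \<Longrightarrow> (f has_real_derivative deriv f x) (at x)"
  for f :: "real \<Rightarrow> real"
  by (simp add: DERIV_deriv_iff_field_differentiable)

context wave_speeds
begin

lemma base_weight_bounded: "dominated (\<lambda>_ _ _. 1) (base_weight n)"
proof (rule dominatedI[of 1])
  fix M x and T :: real assume a: "M \<in> small" "T \<ge> 1"
  have "T powr (- alpha (int n - 1) / 2) \<le> 1"
    using small_powers(4)[OF a, of "alpha (int n - 1) / 2"] alpha_bounds[of n] by simp
  hence "eps M ^ (n + 1) * T powr (- alpha (int n - 1) / 2) \<le> 1 * 1"
    using eps(1)[OF a(1)] eps(2)[of M] by (intro mult_mono power_le_one) auto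
  thus "\<bar>base_weight n M x T\<bar> \<le> 1 * 1" using eps(2)[of M] by (simp add: base_weight_def abs_mult)
qed simp

lemma theta_weight_bounded: "dominated (\<lambda>_ _ _. 1) (theta_weight i)"
proof (rule dominatedI[of 1])
  fix M x and T :: real assume a: "M \<in> small" "T \<ge> 1"
  have "eps M * gauss (4 * \<nu>) i M x T \<le> 1 * 1"
    using eps(1)[OF a(1)] eps(2)[of M] nu a gauss_pos[THEN less_imp_le] by (intro mult_mono) (auto simp: gauss_def)
  hence "eps M * gauss (4 * \<nu>) i M x T / sqrt T \<le> 1 / sqrt T" using a by (intro divide_right_mono) auto
  also have "\<dots> \<le> 1" using a by simp
  finally show "\<bar>theta_weight i M x T\<bar> \<le> 1 * 1"
    using eps(2)[of M] gauss_pos[THEN less_imp_le] a by (simp add: theta_weight_def abs_mult)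
qed simp

text \<open>The coupling term is the same for both functions and cancels. Their difference solves a
  linear equation with drift speed + theta and zeroth-order coefficient theta_x, both bounded, and
  starts from zero.\<close>

lemma next_wave_unique:
  assumes i: "i \<in> {1, 2}" and M: "M \<in> small" and u: "is_next_wave \<nu> c M i v u"
    and v: "\<And>x t. t \<ge> 0 \<Longrightarrow> v x t = higher n (3 - i) M x (t + 1)" and t0: "t0 \<ge> 0"
  shows "u x0 t0 = higher (Suc n) i M x0 (t0 + 1)"
proof -
  define X where "X = higher (Suc n) i"
  have dX: "decay (base_weight (Suc n)) X" and sX: "solves (speed c i) X (residual (Suc n) i)"
    using higher_invariant[OF i, of "Suc n"] by (auto simp: X_def simp del: higher.simps residual.simps)
  note bX = decay_bounded_continuous[OF dX base_weight_bounded M]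
  note bth = decay_bounded_continuous_Dx[OF decay_theta'[OF i] theta_weight_bounded M]
  obtain BX where BX: "\<And>x t. t \<ge> 1 \<Longrightarrow> \<bar>X M x t\<bar> \<le> BX" using bX by (auto simp: bounded_continuous_def)
  obtain B0 B1 where B0: "\<And>x t. t \<ge> 1 \<Longrightarrow> \<bar>theta i M x t\<bar> \<le> B0" and B1: "\<And>x t. t \<ge> 1 \<Longrightarrow> \<bar>Dx (theta i) M x t\<bar> \<le> B1"
    using bth[of 0] bth[of 1] by (auto simp: bounded_continuous_def)
  have ru: "classical_regularity u" and pde: "\<And>x t. t > 0 \<Longrightarrow> dt u x t + speed c i * dx u x t
        + dx (\<lambda>y s. diffusion_wave \<nu> c M i y s * u y s) x t
        + dx (\<lambda>y s. diffusion_wave \<nu> c M (3 - i) y s * v y s) x t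
        = \<nu> / 2 * dx (dx u) x t" and init: "\<And>x. u x 0 = 0"
    using u by (auto simp: is_next_wave_def)
  obtain Bu where Bu: "\<And>x t. t \<ge> 0 \<Longrightarrow> \<bar>u x t\<bar> \<le> Bu" using u by (auto simp: is_next_wave_def)
  have cu: "continuous_on (UNIV \<times> {0..}) (\<lambda>(x, t). u x t)"
    and fu: "\<And>x t. t > 0 \<Longrightarrow> (\<lambda>s. u x s) field_differentiable at t"
      "\<And>x t. t > 0 \<Longrightarrow> (\<lambda>y. u y t) field_differentiable at x"
      "\<And>x t. t > 0 \<Longrightarrow> (\<lambda>y. dx u y t) field_differentiable at x"
    using ru by (auto simp: classical_regularity_def)
  have du: "((\<lambda>s. u x s) has_real_derivative dt u x t) (at t)" "((\<lambda>y. u y t) has_real_derivative dx u x t) (at x)"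
    "((\<lambda>y. dx u y t) has_real_derivative dx (dx u) x t) (at x)" if "t > 0" for x t
    using fu[OF that, THEN field_differentiableD] by (auto simp: dt_def dx_def)
  \<comment> \<open>Duhamel's integral over {1..1} vanishes for every x, hence so does the
    derivative that defines the wave.\<close>
  have X1: "X M x 1 = 0" for x
    by (simp add: X_def Dx_def potential_def duhamel_def)
  let ?w = "\<lambda>x t. u x t - X M x (t + 1)"
  have "?w x0 t0 = 0"
  proof (rule parabolic_uniqueness[where w = ?w and a = 0 and ?T1.0 = t0 and ?x1.0 = x0 and ?t1.0 = t0 and \<mu> = "\<nu> / 2"
        and b = "\<lambda>x t. speed c i + theta i M x (t + 1)" and e = "\<lambda>x t. Dx (theta i) M x (t + 1)"
        and B = "\<bar>speed c i\<bar> + B0" and E = B1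
        and wx = "\<lambda>x t. dx u x t - Dx X M x (t + 1)" and wxx = "\<lambda>x t. dx (dx u) x t - Dx (Dx X) M x (t + 1)"
        and wt = "\<lambda>x t. dt u x t - (residual (Suc n) i M x (t + 1) - speed c i * Dx X M x (t + 1) + \<nu> / 2 * Dx (Dx X) M x (t + 1))"])
    have "continuous_on (UNIV \<times> {0..}) (\<lambda>z. X M (fst z) (snd z + 1))"
      by (rule continuous_on_compose2[of "UNIV \<times> {1..}" "\<lambda>(x, t). X M x t" _ "\<lambda>z. (fst z, snd z + 1)", simplified])
         (use bX in \<open>auto simp: bounded_continuous_def intro!: continuous_intros\<close>)
    hence "continuous_on (UNIV \<times> {0..}) (\<lambda>z. u (fst z) (snd z) - X M (fst z) (snd z + 1))"
      using cu by (intro continuous_on_diff) (auto simp: case_prod_unfold)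
    thus "continuous_on (UNIV \<times> {0..t0}) (\<lambda>(x, t). ?w x t)"
      unfolding case_prod_unfold by (rule continuous_on_subset) auto
    show "\<bar>?w x t\<bar> \<le> Bu + BX" if "t \<in> {0..t0}" for x t
      using Bu[of t x] BX[of "t + 1" x] that by auto
    show "?w x 0 = 0" for x using init X1 by simp
    show "((\<lambda>y. ?w y t) has_real_derivative dx u x t - Dx X M x (t + 1)) (at x)" if "t \<in> {0<..t0}" for x t
      using that by (intro DERIV_diff du decay_has_derivative[OF dX M]) auto
    show "((\<lambda>y. dx u y t - Dx X M y (t + 1)) has_real_derivative dx (dx u) x t - Dx (Dx X) M x (t + 1)) (at x)"
      if "t \<in> {0<..t0}" for x t
      using that by (intro DERIV_diff du decay_has_derivative[OF decay_Dx[OF dX] M]) auto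
    show "((\<lambda>s. ?w x s) has_real_derivative dt u x t -
        (residual (Suc n) i M x (t + 1) - speed c i * Dx X M x (t + 1) + \<nu> / 2 * Dx (Dx X) M x (t + 1))) (at_left t)"
      if "t \<in> {0<..t0}" for x t
      using that by (intro DERIV_diff has_field_derivative_at_within[OF du(1)] left_derivative_shift solvesD[OF sX M]) auto
    show "dt u x t - (residual (Suc n) i M x (t + 1) - speed c i * Dx X M x (t + 1) + \<nu> / 2 * Dx (Dx X) M x (t + 1))
       = \<nu> / 2 * (dx (dx u) x t - Dx (Dx X) M x (t + 1)) - (speed c i + theta i M x (t + 1)) * (dx u x t - Dx X M x (t + 1))
         - Dx (theta i) M x (t + 1) * ?w x t" if "t \<in> {0<..t0}" for x t
    proof -
      have t: "t > 0" "t + 1 \<ge> 1" using that by auto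
      have 1: "dx (\<lambda>y s. diffusion_wave \<nu> c M i y s * u y s) x t = Dx (theta i) M x (t + 1) * u x t + dx u x t * theta i M x (t + 1)"
        unfolding dx_def[of "\<lambda>y s. diffusion_wave \<nu> c M i y s * u y s"]
        using DERIV_imp_deriv[OF DERIV_mult[OF decay_has_derivative[OF decay_theta[OF i] M t(2)] du(2)[OF t(1)]], of x]
        by (simp add: theta_def)
      have 2: "dx (\<lambda>y s. diffusion_wave \<nu> c M (3 - i) y s * v y s) x t
          = Dx (\<lambda>M x T. theta (3 - i) M x T * higher n (3 - i) M x T) M x (t + 1)"
        unfolding dx_def Dx_def using v t by (simp add: theta_def)
      have 3: "Dx (\<lambda>M x T. theta i M x T * X M x T) M x (t + 1) = Dx (theta i) M x (t + 1) * X M x (t + 1) + theta i M x (t + 1) * Dx X M x (t + 1)"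
        by (rule Dx_mult[OF decay_theta[OF i] dX M t(2)])
      have 4: "residual (Suc n) i M x (t + 1) = - (Dx (theta i) M x (t + 1) * X M x (t + 1) + theta i M x (t + 1) * Dx X M x (t + 1))
          - dx (\<lambda>y s. diffusion_wave \<nu> c M (3 - i) y s * v y s) x t"
        unfolding 2 3[symmetric] by (simp add: X_def del: higher.simps)
      show ?thesis using pde[OF t(1), of x] unfolding 1 4 by (simp add: algebra_simps)
    qed
    show "\<bar>speed c i + theta i M x (t + 1)\<bar> \<le> \<bar>speed c i\<bar> + B0" if "t \<in> {0<..t0}" for x t
      using B0[of "t + 1" x] that by auto
    show "\<bar>Dx (theta i) M x (t + 1)\<bar> \<le> B1" if "t \<in> {0<..t0}" for x t
      using B1[of "t + 1" x] that by auto
  qed (use nu t0 in auto)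
  thus ?thesis by (simp add: X_def)
qed

lemma higher_wave_unique:
  assumes M: "M \<in> small"
  shows "is_higher_wave \<nu> c M n \<xi> \<Longrightarrow> i \<in> {1, 2} \<Longrightarrow> t \<ge> 0 \<Longrightarrow> \<xi> i x t = higher n i M x (t + 1)"
proof (induction n arbitrary: \<xi> i x t)
  case 0
  thus ?case by (auto simp: theta_def)
next
  case (Suc n)
  from Suc.prems(1) obtain \<eta> where \<eta>: "is_higher_wave \<nu> c M n \<eta>" "\<forall>i\<in>{1, 2}. is_next_wave \<nu> c M i (\<eta> (3 - i)) (\<xi> i)"
    by auto
  have j: "3 - i \<in> {1, 2}" using Suc.prems by auto
  show ?case
    using next_wave_unique[OF Suc.prems(2) M \<eta>(2)[rule_format, OF Suc.prems(2)] Suc.IH[OF \<eta>(1) j] Suc.prems(3)] .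
qed

text \<open>From T = 2 K / c on, both characteristics are at distance at least c T / 2 from every
  |x| \<le> K, so each weight is of order T^(-\<alpha>). Earlier times form a bounded range, where
  constants suffice.\<close>

lemma Psi_weight_compact:
  assumes K: "K > 0"
  obtains C where "C > 0" "\<And>i M x T. i \<in> {1, 2} \<Longrightarrow> \<bar>x\<bar> \<le> K \<Longrightarrow> T \<ge> 1 \<Longrightarrow> Psi_weight n i M x T \<le> C * T powr (- alpha (int n))"
proof -
  define \<alpha> \<beta> where "\<alpha> = 1 + alpha (int n - 1) / 2" and "\<beta> = 1/2 + alpha (int n - 1) / 2"
  have ab: "\<alpha> \<ge> 1" "\<beta> \<ge> 0" using alpha_bounds[of n] by (auto simp: \<alpha>_def \<beta>_def)
  \<comment> \<open>The first entry of each minimum serves late times, the second early ones, where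
    c T / (2 K) < 1.\<close>
  define \<mu> where "\<mu> = min (c / 2) (c / (2 * K))"
  define \<mu>2 where "\<mu>2 = min (c\<^sup>2 / 4) (c / (2 * K))"
  have mu: "\<mu> > 0" "\<mu>2 > 0" using c K by (auto simp: \<mu>_def \<mu>2_def)
  have far: "\<bar>x - speed c i * T\<bar> \<ge> c / 2 * T" if "\<bar>x\<bar> \<le> K" "T \<ge> 2 * K / c" "i \<in> {1, 2}" "T \<ge> 1" for x T i
  proof -
    have "2 * K \<le> c * T" using that c by (simp add: field_simps)
    moreover have "\<bar>speed c i * T\<bar> = c * T" using that c by (auto simp: speed_def abs_mult)
    ultimately show ?thesis using that by linarith
  qed
  have near: "c / (2 * K) * T \<le> 1" if "T < 2 * K / c" for T using that c K by (simp add: field_simps)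
  show ?thesis
  proof (rule that[of "\<mu>2 powr (- \<alpha> / 2) + \<mu> powr (- \<alpha>)"])
    show "\<mu>2 powr (- \<alpha> / 2) + \<mu> powr (- \<alpha>) > 0" using mu by (intro add_pos_pos) auto
    fix i :: nat and M :: "nat \<Rightarrow> real" and x T :: real assume i: "i \<in> {1, 2}" and x: "\<bar>x\<bar> \<le> K" and T: "T \<ge> 1"
    have j: "3 - i \<in> {1, 2}" using i by auto
    have 1: "\<mu>2 * T\<^sup>2 \<le> (x - speed c i * T)\<^sup>2 + T"
    proof (cases "T \<ge> 2 * K / c")
      case True
      have "(c / 2 * T)\<^sup>2 \<le> (x - speed c i * T)\<^sup>2"
        using far[OF x True i T] c T by (metis abs_ge_zero power2_abs power_mono mult_nonneg_nonneg less_imp_le half_gt_zero zero_le_one order_trans)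
      hence "c\<^sup>2 / 4 * T\<^sup>2 \<le> (x - speed c i * T)\<^sup>2" by (simp add: power_mult_distrib power_divide)
      moreover have "\<mu>2 * T\<^sup>2 \<le> c\<^sup>2 / 4 * T\<^sup>2" by (intro mult_right_mono) (auto simp: \<mu>2_def)
      ultimately show ?thesis using T by linarith
    next
      case False
      have "\<mu>2 * T\<^sup>2 \<le> c / (2 * K) * T\<^sup>2" by (intro mult_right_mono) (auto simp: \<mu>2_def)
      also have "\<dots> = c / (2 * K) * T * T" by (simp add: power2_eq_square)
      also have "\<dots> \<le> 1 * T" using near[of T] False T by (intro mult_right_mono) auto
      finally show ?thesis using zero_le_power2[of "x - speed c i * T"] by linarith
    qed
    have "((x - speed c i * T)\<^sup>2 + T) powr (- \<alpha> / 2) \<le> (\<mu>2 * T\<^sup>2) powr (- \<alpha> / 2)"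
      using 1 mu T ab by (intro powr_mono2') auto
    also have "\<dots> = \<mu>2 powr (- \<alpha> / 2) * T powr (- \<alpha>)"
      using powr_powr[of T 2 "- \<alpha> / 2"] T by (simp add: powr_mult)
    finally have p: "((x - speed c i * T)\<^sup>2 + T) powr (- \<alpha> / 2) \<le> \<mu>2 powr (- \<alpha> / 2) * T powr (- \<alpha>)" .
    let ?z = "x - speed c (3 - i) * T"
    have 2: "(\<mu> * T) powr \<alpha> \<le> \<bar>?z\<bar> powr \<alpha> + T powr \<beta>"
    proof (cases "T \<ge> 2 * K / c")
      case True
      have "\<mu> * T \<le> c / 2 * T" using T by (intro mult_right_mono) (auto simp: \<mu>_def)
      hence "\<mu> * T \<le> \<bar>?z\<bar>" using far[OF x True j T] by linarith
      hence "(\<mu> * T) powr \<alpha> \<le> \<bar>?z\<bar> powr \<alpha>" using mu T ab by (intro powr_mono2) auto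
      thus ?thesis by (simp add: add_increasing2)
    next
      case False
      have "\<mu> * T \<le> c / (2 * K) * T" using T by (intro mult_right_mono) (auto simp: \<mu>_def)
      hence "\<mu> * T \<le> 1" using near[of T] False by linarith
      hence "(\<mu> * T) powr \<alpha> \<le> 1" using mu T ab by (intro powr_le1) auto
      also have "1 \<le> T powr \<beta>" using T ab by (simp add: ge_one_powr_ge_zero)
      finally show ?thesis by (simp add: add_increasing)
    qed
    have "inverse (\<bar>?z\<bar> powr \<alpha> + T powr \<beta>) \<le> inverse ((\<mu> * T) powr \<alpha>)"
      using 2 mu T by (intro le_imp_inverse_le) auto
    also have "\<dots> = \<mu> powr (- \<alpha>) * T powr (- \<alpha>)" by (simp add: powr_mult powr_minus)
    finally show "Psi_weight n i M x T \<le> (\<mu>2 powr (- \<alpha> / 2) + \<mu> powr (- \<alpha>)) * T powr (- alpha (int n))"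
      using p unfolding Psi_weight_eq alpha_step \<alpha>_def[symmetric] \<beta>_def[symmetric] by (simp add: distrib_right)
  qed
qed

end

lemma nn_integral_decaying_power:
  assumes "\<alpha> > 1"
  shows "(\<integral>\<^sup>+x. ennreal ((1 + \<bar>x\<bar>) powr (- \<alpha>)) \<partial>lborel) \<le> ennreal (2 / (\<alpha> - 1))"
proof -
  define q :: "real \<Rightarrow> real" where "q x = (1 + \<bar>x\<bar>) powr (- \<alpha>)" for x
  have qm [measurable]: "q \<in> borel_measurable borel"
    unfolding q_def by (intro borel_measurable_continuous_onI continuous_intros) auto
  have half: "(\<integral>\<^sup>+x. ennreal (q x) * indicator {0..} x \<partial>lborel) = ennreal (1 / (\<alpha> - 1))"
  proof -
    \<comment> \<open>On the half-line \<open>max 0 x\<close> is x, and it keeps the base positive,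
      hence the integrand continuous, on the whole line.\<close>
    have "(\<integral>\<^sup>+x. ennreal ((1 + \<bar>x\<bar>) powr (- \<alpha>)) * indicator {0..} x \<partial>lborel)
        = (\<integral>\<^sup>+x. ennreal ((1 + max 0 x) powr (- \<alpha>)) * indicator {0..} x \<partial>lborel)"
      by (rule nn_integral_cong) (auto simp: indicator_def)
    also have "\<dots> = ennreal (0 - (- ((1 + 0) powr (1 - \<alpha>)) / (\<alpha> - 1)))"
    proof (rule nn_integral_FTC_atLeast)
      show "(\<lambda>x. (1 + max 0 x) powr (- \<alpha>)) \<in> borel_measurable borel"
        by (intro borel_measurable_continuous_onI continuous_intros) auto
      show "((\<lambda>x. - ((1 + x) powr (1 - \<alpha>)) / (\<alpha> - 1)) has_real_derivative (1 + max 0 x) powr (- \<alpha>)) (at x)" if "0 \<le> x" for x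
      proof -
        have "((\<lambda>x. - ((1 + x) powr (1 - \<alpha>)) / (\<alpha> - 1)) has_real_derivative - ((1 - \<alpha>) * (1 + x) powr (1 - \<alpha> - 1)) / (\<alpha> - 1)) (at x)"
          using that assms by (auto intro!: derivative_eq_intros)
        moreover have "- ((1 - \<alpha>) * z) / (\<alpha> - 1) = z" for z using assms by (simp add: field_simps)
        ultimately show ?thesis using that by simp
      qed
      show "((\<lambda>x. - ((1 + x) powr (1 - \<alpha>)) / (\<alpha> - 1)) \<longlongrightarrow> 0) at_top"
        using assms by real_asymp
    qed auto
    finally show ?thesis by (simp add: q_def)
  qed
  have "(\<integral>\<^sup>+x. ennreal (q x) * indicator {..0} x \<partial>lborel) = \<bar>-1::real\<bar> * (\<integral>\<^sup>+x. ennreal (q (0 + (-1) * x)) * indicator {..0} (0 + (-1) * x) \<partial>lborel)"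
    by (rule nn_integral_real_affine) auto
  also have "\<dots> = (\<integral>\<^sup>+x. ennreal (q x) * indicator {0..} x \<partial>lborel)"
    by (auto simp: q_def indicator_def intro!: nn_integral_cong)
  finally have other: "(\<integral>\<^sup>+x. ennreal (q x) * indicator {..0} x \<partial>lborel) = ennreal (1 / (\<alpha> - 1))" using half by simp
  have "(\<integral>\<^sup>+x. ennreal (q x) \<partial>lborel) \<le> (\<integral>\<^sup>+x. ennreal (q x) * indicator {..0} x + ennreal (q x) * indicator {0..} x \<partial>lborel)"
    by (rule nn_integral_mono) (auto simp: indicator_def)
  also have "\<dots> = ennreal (1 / (\<alpha> - 1)) + ennreal (1 / (\<alpha> - 1))"
    by (subst nn_integral_add) (auto simp: half other)
  also have "\<dots> = ennreal (2 / (\<alpha> - 1))" using assms by (simp flip: ennreal_plus)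
  finally have "(\<integral>\<^sup>+x. ennreal (q x) \<partial>lborel) \<le> ennreal (2 / (\<alpha> - 1))" .
  thus ?thesis by (simp add: q_def)
qed

section \<open>Compact sets and Lebesgue norms\<close>

lemma nn_integral_scaled_decaying_power:
  assumes "\<alpha> > 1" "s > 0"
  shows "(\<integral>\<^sup>+x. ennreal ((1 + \<bar>(x - m) / s\<bar>) powr (- \<alpha>)) \<partial>lborel) \<le> ennreal (2 / (\<alpha> - 1) * s)"
proof -
  have "1 + \<bar>(x - m) / s\<bar> \<noteq> 0" for x using abs_ge_zero[of "(x - m) / s"] by linarith
  hence "(\<lambda>x. (1 + \<bar>(x - m) / s\<bar>) powr (- \<alpha>)) \<in> borel_measurable borel"
    using assms by (intro borel_measurable_continuous_onI continuous_intros) auto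
  hence "(\<integral>\<^sup>+x. ennreal ((1 + \<bar>(x - m) / s\<bar>) powr (- \<alpha>)) \<partial>lborel)
      = \<bar>s\<bar> * (\<integral>\<^sup>+x. ennreal ((1 + \<bar>(m + s * x - m) / s\<bar>) powr (- \<alpha>)) \<partial>lborel)"
    using assms by (intro nn_integral_real_affine) auto
  also have "\<dots> = ennreal s * (\<integral>\<^sup>+x. ennreal ((1 + \<bar>x\<bar>) powr (- \<alpha>)) \<partial>lborel)"
    using assms by simp
  also have "\<dots> \<le> ennreal s * ennreal (2 / (\<alpha> - 1))"
    by (intro mult_left_mono nn_integral_decaying_power assms) auto
  also have "\<dots> = ennreal (2 / (\<alpha> - 1) * s)"
    using assms by (simp add: mult.commute flip: ennreal_mult)
  finally show ?thesis .
qed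

lemma Lp_norm_infinity_bound:
  assumes f: "f \<in> borel_measurable lborel" and fS: "\<And>x. \<bar>f x\<bar> \<le> S"
  shows "Lp_norm \<infinity> f \<le> ennreal S"
proof -
  have "esssup lborel (\<lambda>x. ennreal \<bar>f x\<bar>) \<le> ennreal S"
    using f fS by (intro esssup_I AE_I2 ennreal_leI) auto
  thus ?thesis using f by (simp add: Lp_norm_def)
qed

text \<open>|f|^r \<le> S^(r - 1) g interpolates between the supremum and the integral of the
  majorant \<open>g\<close>.\<close>

lemma Lp_norm_interpolation:
  assumes f: "f \<in> borel_measurable lborel" and gm: "g \<in> borel_measurable lborel" and fg: "\<And>x. \<bar>f x\<bar> \<le> g x" and gS: "\<And>x. g x \<le> S"
    and g: "(\<integral>\<^sup>+x. ennreal (g x) \<partial>lborel) \<le> ennreal J" and J: "J \<ge> 0" and r: "r \<ge> 1"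
  shows "Lp_norm (ennreal r) f \<le> ennreal ((S powr (r - 1) * J) powr (1 / r))"
proof -
  define I where "I = (\<integral>\<^sup>+x. ennreal (\<bar>f x\<bar> powr r) \<partial>lborel)"
  have g0: "g x \<ge> 0" for x using fg[of x] by linarith
  have "I \<le> (\<integral>\<^sup>+x. ennreal (S powr (r - 1)) * ennreal (g x) \<partial>lborel)"
    unfolding I_def
  proof (rule nn_integral_mono)
    fix x
    have "\<bar>f x\<bar> powr r = \<bar>f x\<bar> powr (r - 1) * \<bar>f x\<bar>"
    proof (cases "f x = 0")
      case False
      thus ?thesis using powr_add[of "\<bar>f x\<bar>" "r - 1" 1] by simp
    qed (use r in auto)
    also have "\<dots> \<le> S powr (r - 1) * g x"
      using fg[of x] gS[of x] g0[of x] r by (intro mult_mono powr_mono2) auto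
    finally show "ennreal (\<bar>f x\<bar> powr r) \<le> ennreal (S powr (r - 1)) * ennreal (g x)"
      using g0 by (simp add: ennreal_leI flip: ennreal_mult)
  qed
  also have "\<dots> \<le> ennreal (S powr (r - 1)) * ennreal J"
    using gm g by (simp add: nn_integral_cmult mult_left_mono)
  also have "\<dots> = ennreal (S powr (r - 1) * J)" using J by (simp add: ennreal_mult)
  finally have I: "I \<le> ennreal (S powr (r - 1) * J)" .
  hence "enn2real I \<le> S powr (r - 1) * J" using J by (simp add: enn2real_leI)
  hence "enn2real I powr (1 / r) \<le> (S powr (r - 1) * J) powr (1 / r)" using r by (intro powr_mono2) auto
  moreover have "I \<noteq> \<infinity>" using I by (auto simp: top_unique)
  ultimately show ?thesis
    using f r by (simp add: Lp_norm_def I_def Let_def ennreal_leI)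
qed

context wave_speeds
begin

text \<open>In units of sqrt T both weights are bounded by T^(-\<alpha>/2) times one fixed profile,
  because (1 + y)^2 \<le> 4 (1 + y^2) and (1 + y)^\<alpha> \<le> 2^\<alpha> (1 + y^\<alpha>).
  Integrals then follow by scaling.\<close>

lemma Psi_weight_profile:
  fixes n :: nat
  assumes T: "T \<ge> 1"
  defines "\<alpha> \<equiv> 1 + alpha (int n - 1) / 2"
  shows "Psi_weight n i M x T \<le> 2 powr \<alpha> * T powr (- \<alpha> / 2) *
    ((1 + \<bar>(x - speed c i * T) / sqrt T\<bar>) powr (- \<alpha>) + (1 + \<bar>(x - speed c (3 - i) * T) / sqrt T\<bar>) powr (- \<alpha>))"
proof -
  have \<alpha>: "\<alpha> \<ge> 1" using alpha_bounds[of n] by (simp add: \<alpha>_def)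
  have psi: "(z\<^sup>2 + T) powr (- \<alpha> / 2) \<le> 2 powr \<alpha> * T powr (- \<alpha> / 2) * (1 + \<bar>z / sqrt T\<bar>) powr (- \<alpha>)" for z
  proof -
    define y where "y = \<bar>z / sqrt T\<bar>"
    have y: "y \<ge> 0" by (simp add: y_def)
    have "z\<^sup>2 + T = T * (1 + y\<^sup>2)" using T by (simp add: y_def power_divide field_simps)
    moreover have "((1 + y) / 2)\<^sup>2 \<le> 1 + y\<^sup>2"
    proof -
      have "2 * y \<le> 1 + y\<^sup>2" using zero_le_power2[of "y - 1"] by (simp add: power2_diff)
      moreover have "((1 + y) / 2)\<^sup>2 = (1 + 2 * y + y\<^sup>2) / 4" by (simp add: power_divide power2_sum)
      moreover have "(1 + 2 * y + Y) / 4 \<le> 1 + Y" if "2 * y \<le> 1 + Y" "Y \<ge> 0" for Y using that by simp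
      ultimately show ?thesis using zero_le_power2[of y] by presburger
    qed
    moreover have "0 < ((1 + y) / 2)\<^sup>2" using y by simp
    ultimately have "(z\<^sup>2 + T) powr (- \<alpha> / 2) \<le> T powr (- \<alpha> / 2) * (((1 + y) / 2)\<^sup>2) powr (- \<alpha> / 2)"
      using \<alpha> by (simp only: powr_mult) (intro mult_left_mono powr_mono2'; simp)
    also have "(((1 + y) / 2)\<^sup>2) powr (- \<alpha> / 2) = ((1 + y) / 2) powr (- \<alpha>)"
      using powr_powr[of "(1 + y) / 2" 2 "- \<alpha> / 2"] y by simp
    also have "\<dots> = 2 powr \<alpha> * (1 + y) powr (- \<alpha>)" using y by (simp add: powr_divide powr_minus_divide)
    finally show ?thesis by (simp add: y_def mult_ac)
  qed
  have psi': "inverse (\<bar>z\<bar> powr \<alpha> + T powr (1/2 + alpha (int n - 1) / 2)) \<le> 2 powr \<alpha> * T powr (- \<alpha> / 2) * (1 + \<bar>z / sqrt T\<bar>) powr (- \<alpha>)" for z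
  proof -
    define y where "y = \<bar>z / sqrt T\<bar>"
    have y: "y \<ge> 0" by (simp add: y_def)
    have zy: "\<bar>z\<bar> = sqrt T * y" using T by (simp add: y_def)
    have "T powr (\<alpha> / 2) = sqrt T powr \<alpha>" using T by (simp add: powr_half_sqrt[symmetric] powr_powr)
    hence eq: "\<bar>z\<bar> powr \<alpha> + T powr (\<alpha> / 2) = T powr (\<alpha> / 2) * (y powr \<alpha> + 1)"
      unfolding zy by (simp add: powr_mult algebra_simps)
    have "(1 + y) powr \<alpha> \<le> (2 * max 1 y) powr \<alpha>" using y \<alpha> by (intro powr_mono2) auto
    also have "\<dots> = 2 powr \<alpha> * (max 1 y) powr \<alpha>" by (simp add: powr_mult)
    also have "(max 1 y) powr \<alpha> \<le> y powr \<alpha> + 1" by (auto simp: max_def)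
    finally have "(1 + y) powr \<alpha> \<le> 2 powr \<alpha> * (y powr \<alpha> + 1)" by (simp add: mult_left_mono)
    hence "T powr (\<alpha> / 2) * ((1 + y) powr \<alpha> / 2 powr \<alpha>) \<le> T powr (\<alpha> / 2) * (y powr \<alpha> + 1)"
      by (intro mult_left_mono) (auto simp: divide_simps mult.commute)
    hence "inverse (\<bar>z\<bar> powr \<alpha> + T powr (\<alpha> / 2)) \<le> inverse (T powr (\<alpha> / 2) * ((1 + y) powr \<alpha> / 2 powr \<alpha>))"
      unfolding eq using y T by (intro le_imp_inverse_le) auto
    also have "\<dots> = 2 powr \<alpha> * T powr (- \<alpha> / 2) * (1 + y) powr (- \<alpha>)"
    proof -
      have 1: "T powr (- \<alpha> / 2) = inverse (T powr (\<alpha> / 2))" by (simp add: powr_minus)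
      show ?thesis unfolding 1 powr_minus[of "1 + y"]
        by (simp only: divide_inverse inverse_mult_distrib inverse_inverse_eq mult_ac)
    qed
    finally show ?thesis using psi_tilde_upper[OF T, of z n, folded \<alpha>_def] by (simp add: y_def)
  qed
  show ?thesis
    unfolding Psi_weight_eq \<alpha>_def[symmetric] using add_mono[OF psi psi'] by (simp add: distrib_left)
qed

text \<open>Scaling by sqrt T adds 1/2 to the exponent -\<alpha>/2. The profile is integrable
  because \<alpha> = 1 + \<open>alpha (int n - 1)\<close> / 2 is at least 3/2.\<close>

lemma Psi_weight_integral:
  obtains C where "C > 0" "\<And>i M T. T \<ge> 1 \<Longrightarrow>
    (\<integral>\<^sup>+x. ennreal (Psi_weight n i M x T) \<partial>lborel) \<le> ennreal (C * T powr ((1 - alpha (int n)) / 2))"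
proof -
  define \<alpha> where "\<alpha> = 1 + alpha (int n - 1) / 2"
  have \<alpha>: "\<alpha> > 1" using alpha_bounds[of n] by (simp add: \<alpha>_def)
  define L where "L = 2 / (\<alpha> - 1)"
  have L: "L > 0" using \<alpha> by (simp add: L_def)
  show ?thesis
  proof (rule that[of "2 powr \<alpha> * (2 * L)"])
    show "2 powr \<alpha> * (2 * L) > 0" using L by simp
    fix i :: nat and M :: "nat \<Rightarrow> real" and T :: real assume T: "T \<ge> 1"
    define q where "q m x = (1 + \<bar>(x - m) / sqrt T\<bar>) powr (- \<alpha>)" for m x
    have [measurable]: "q m \<in> borel_measurable borel" for m
    proof -
      have "1 + \<bar>(x - m) / sqrt T\<bar> \<noteq> 0" for x using abs_ge_zero[of "(x - m) / sqrt T"] by linarith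
      thus ?thesis unfolding q_def using T by (intro borel_measurable_continuous_onI continuous_intros) auto
    qed
    have q0: "q m x \<ge> 0" for m x by (simp add: q_def)
    have qi: "(\<integral>\<^sup>+x. ennreal (q m x) \<partial>lborel) \<le> ennreal (L * sqrt T)" for m
      unfolding q_def L_def by (rule nn_integral_scaled_decaying_power[OF \<alpha>]) (use T in auto)
    define K where "K = 2 powr \<alpha> * T powr (- \<alpha> / 2)"
    have K: "K \<ge> 0" by (simp add: K_def)
    have "(\<integral>\<^sup>+x. ennreal (Psi_weight n i M x T) \<partial>lborel)
        \<le> (\<integral>\<^sup>+x. ennreal K * (ennreal (q (speed c i * T) x) + ennreal (q (speed c (3 - i) * T) x)) \<partial>lborel)"
    proof (rule nn_integral_mono)
      fix x
      have "Psi_weight n i M x T \<le> K * (q (speed c i * T) x + q (speed c (3 - i) * T) x)"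
        using Psi_weight_profile[OF T, of n i M x] by (simp add: K_def q_def \<alpha>_def)
      thus "ennreal (Psi_weight n i M x T) \<le> ennreal K * (ennreal (q (speed c i * T) x) + ennreal (q (speed c (3 - i) * T) x))"
        using q0 K by (simp add: ennreal_leI flip: ennreal_plus ennreal_mult)
    qed
    also have "\<dots> = ennreal K * ((\<integral>\<^sup>+x. ennreal (q (speed c i * T) x) \<partial>lborel) + (\<integral>\<^sup>+x. ennreal (q (speed c (3 - i) * T) x) \<partial>lborel))"
      by (simp add: nn_integral_cmult nn_integral_add)
    also have "\<dots> \<le> ennreal K * (ennreal (L * sqrt T) + ennreal (L * sqrt T))"
      by (intro mult_left_mono add_mono qi) auto
    also have "\<dots> = ennreal (K * (2 * (L * sqrt T)))"
      using K L T by (simp flip: ennreal_plus ennreal_mult)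
    also have "K * (2 * (L * sqrt T)) = 2 powr \<alpha> * (2 * L) * (T powr (- \<alpha> / 2) * T powr (1 / 2))"
      using T by (simp add: K_def powr_half_sqrt)
    also have "T powr (- \<alpha> / 2) * T powr (1 / 2) = T powr ((1 - alpha (int n)) / 2)"
      by (simp add: alpha_step \<alpha>_def diff_divide_distrib flip: powr_add)
    finally show "(\<integral>\<^sup>+x. ennreal (Psi_weight n i M x T) \<partial>lborel) \<le> ennreal (2 powr \<alpha> * (2 * L) * T powr ((1 - alpha (int n)) / 2))" .
  qed
qed

section \<open>Pointwise, local and integral bounds for all solutions\<close>

lemma higher_wave_pointwise:
  "\<exists>C>0. \<forall>M \<xi>. max \<bar>M 1\<bar> \<bar>M 2\<bar> \<le> 1 \<longrightarrow> is_higher_wave \<nu> c M (Suc m) \<xi> \<longrightarrow>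
     (\<forall>i\<in>{1, 2}. \<forall>t\<ge>0. times_differentiable k (\<lambda>y. \<xi> i y t) \<and>
       (\<forall>x. \<bar>(deriv ^^ k) (\<lambda>y. \<xi> i y t) x\<bar>
          \<le> C * max \<bar>M 1\<bar> \<bar>M 2\<bar> ^ (m + 2) * (t + 1) powr (- (real k / 2)) * Psi c i (int m) x t))"
proof -
  have "\<exists>C\<ge>0. \<forall>M\<in>small. \<forall>T\<ge>1. \<forall>x. \<bar>(Dx ^^ k) (higher (Suc m) i) M x T\<bar> \<le> C * (eps M ^ (m + 2) * Psi_weight m i M x T / sqrt T ^ k)"
    if "i \<in> {1, 2}" for i
    using decay_D(2)[OF decay_Dx_funpow[OF higher_decay[OF that, of m], of k]] unfolding dominated_def .
  then obtain Cf where Cf: "\<And>i. i \<in> {1, 2} \<Longrightarrow> Cf i \<ge> 0"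
    "\<And>i M T x. i \<in> {1, 2} \<Longrightarrow> M \<in> small \<Longrightarrow> T \<ge> 1 \<Longrightarrow> \<bar>(Dx ^^ k) (higher (Suc m) i) M x T\<bar> \<le> Cf i * (eps M ^ (m + 2) * Psi_weight m i M x T / sqrt T ^ k)"
    by metis
  \<comment> \<open>One constant for both families; the summand 1 makes it strictly
    positive.\<close>
  define C where "C = Cf 1 + Cf 2 + 1"
  have C: "C > 0" using Cf(1)[of 1] Cf(1)[of 2] by (simp add: C_def)
  have CfC: "Cf i \<le> C" if "i \<in> {1, 2}" for i using that Cf(1)[of 1] Cf(1)[of 2] by (auto simp: C_def)
  show ?thesis
  proof (intro exI[of _ C] conjI C allI impI ballI)
    fix M :: "nat \<Rightarrow> real" and \<xi> and i :: nat and t :: real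
    assume "max \<bar>M 1\<bar> \<bar>M 2\<bar> \<le> 1" and hw: "is_higher_wave \<nu> c M (Suc m) \<xi>" and i: "i \<in> {1, 2}" and t: "0 \<le> t"
    hence M: "M \<in> small" by (simp add: small_def)
    have T: "t + 1 \<ge> 1" using t by simp
    have \<xi>: "(\<lambda>y. \<xi> i y t) = (\<lambda>y. higher (Suc m) i M y (t + 1))"
      using higher_wave_unique[OF M hw i t] by (simp only:)
    have dk: "(deriv ^^ j) (\<lambda>y. \<xi> i y t) x = (Dx ^^ j) (higher (Suc m) i) M x (t + 1)" for j x
      unfolding \<xi> Dx_funpow ..
    show "times_differentiable k (\<lambda>y. \<xi> i y t)"
      unfolding times_differentiable_def
    proof (intro allI impI)
      fix j x
      have "(deriv ^^ j) (\<lambda>y. \<xi> i y t) = (\<lambda>x. (Dx ^^ j) (higher (Suc m) i) M x (t + 1))" using dk by auto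
      moreover have "((\<lambda>x. (Dx ^^ j) (higher (Suc m) i) M x (t + 1)) has_real_derivative Dx ((Dx ^^ j) (higher (Suc m) i)) M x (t + 1)) (at x)"
        by (rule decay_has_derivative[OF decay_Dx_funpow[OF higher_decay[OF i]] M T])
      ultimately show "(deriv ^^ j) (\<lambda>y. \<xi> i y t) field_differentiable at x"
        unfolding field_differentiable_def by auto
    qed
    fix x
    have P: "Psi_weight m i M x (t + 1) = Psi c i (int m) x t" by (simp add: Psi_weight_def)
    have s: "1 / sqrt (t + 1) ^ k = (t + 1) powr (- (real k / 2))"
    proof -
      have "sqrt (t + 1) ^ k = sqrt (t + 1) powr real k" using t by (simp add: powr_realpow)
      also have "\<dots> = (t + 1) powr (real k / 2)" using t by (simp add: powr_half_sqrt[symmetric] powr_powr)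
      finally show ?thesis by (simp add: powr_minus_divide)
    qed
    have "\<bar>(deriv ^^ k) (\<lambda>y. \<xi> i y t) x\<bar> \<le> Cf i * (eps M ^ (m + 2) * Psi c i (int m) x t / sqrt (t + 1) ^ k)"
      unfolding dk using Cf(2)[OF i M T, of x] by (simp add: P)
    also have "\<dots> \<le> C * (eps M ^ (m + 2) * Psi c i (int m) x t / sqrt (t + 1) ^ k)"
      using CfC[OF i] Psi_weight_pos[OF T, of m i M x] eps(2)[of M] t
      by (intro mult_right_mono divide_nonneg_nonneg mult_nonneg_nonneg) (auto simp: P)
    also have "\<dots> = C * eps M ^ (m + 2) * (1 / sqrt (t + 1) ^ k) * Psi c i (int m) x t" by simp
    finally show "\<bar>(deriv ^^ k) (\<lambda>y. \<xi> i y t) x\<bar>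
          \<le> C * max \<bar>M 1\<bar> \<bar>M 2\<bar> ^ (m + 2) * (t + 1) powr (- (real k / 2)) * Psi c i (int m) x t"
      unfolding s eps_def .
  qed
qed

text \<open>eps is estimated by 1 here, since the local and the integral bounds carry no power of
  the masses.\<close>

lemma higher_wave_envelope:
  obtains C where "C > 0" "\<And>M \<xi> i t x. max \<bar>M 1\<bar> \<bar>M 2\<bar> \<le> 1 \<Longrightarrow> is_higher_wave \<nu> c M (Suc m) \<xi> \<Longrightarrow>
    i \<in> {1, 2} \<Longrightarrow> t \<ge> 0 \<Longrightarrow> \<bar>\<xi> i x t\<bar> \<le> C * Psi_weight m i M x (t + 1)"
proof -
  obtain C where C: "C > 0" "\<And>M \<xi> i t x. max \<bar>M 1\<bar> \<bar>M 2\<bar> \<le> 1 \<Longrightarrow> is_higher_wave \<nu> c M (Suc m) \<xi> \<Longrightarrow>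
    i \<in> {1, 2} \<Longrightarrow> t \<ge> 0 \<Longrightarrow> \<bar>(deriv ^^ 0) (\<lambda>y. \<xi> i y t) x\<bar>
      \<le> C * max \<bar>M 1\<bar> \<bar>M 2\<bar> ^ (m + 2) * (t + 1) powr (- (real 0 / 2)) * Psi c i (int m) x t"
    using higher_wave_pointwise[of m 0] by blast
  show ?thesis
  proof (rule that[OF C(1)])
    fix M :: "nat \<Rightarrow> real" and \<xi> and i :: nat and t x :: real
    assume a: "max \<bar>M 1\<bar> \<bar>M 2\<bar> \<le> 1" "is_higher_wave \<nu> c M (Suc m) \<xi>" "i \<in> {1, 2}" "t \<ge> 0"
    have P: "Psi_weight m i M x (t + 1) = Psi c i (int m) x t" by (simp add: Psi_weight_def)
    have p0: "Psi_weight m i M x (t + 1) \<ge> 0" using Psi_weight_pos[of "t + 1" m i M x] a by simp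
    have "\<bar>\<xi> i x t\<bar> \<le> C * max \<bar>M 1\<bar> \<bar>M 2\<bar> ^ (m + 2) * Psi_weight m i M x (t + 1)"
      using C(2)[OF a, of x] a(4) unfolding P by simp
    also have "\<dots> \<le> C * 1 * Psi_weight m i M x (t + 1)"
      using C(1) a(1) p0 by (intro mult_right_mono mult_left_mono power_le_one) auto
    finally show "\<bar>\<xi> i x t\<bar> \<le> C * Psi_weight m i M x (t + 1)" by simp
  qed
qed

lemma higher_wave_compact:
  assumes "K > 0"
  shows "\<exists>C>0. \<forall>M \<xi>. max \<bar>M 1\<bar> \<bar>M 2\<bar> \<le> 1 \<longrightarrow> is_higher_wave \<nu> c M (Suc m) \<xi> \<longrightarrow>
     (\<forall>i\<in>{1, 2}. \<forall>x t. \<bar>x\<bar> \<le> K \<longrightarrow> t \<ge> 0 \<longrightarrow> \<bar>\<xi> i x t\<bar> \<le> C * (t + 1) powr (- alpha (int m)))"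
proof -
  obtain C where C: "C > 0" "\<And>M \<xi> i t x. max \<bar>M 1\<bar> \<bar>M 2\<bar> \<le> 1 \<Longrightarrow> is_higher_wave \<nu> c M (Suc m) \<xi> \<Longrightarrow>
    i \<in> {1, 2} \<Longrightarrow> t \<ge> 0 \<Longrightarrow> \<bar>\<xi> i x t\<bar> \<le> C * Psi_weight m i M x (t + 1)"
    using higher_wave_envelope by blast
  obtain C' where C': "C' > 0" "\<And>i M x T. i \<in> {1, 2} \<Longrightarrow> \<bar>x\<bar> \<le> K \<Longrightarrow> T \<ge> 1 \<Longrightarrow> Psi_weight m i M x T \<le> C' * T powr (- alpha (int m))"
    using Psi_weight_compact[OF assms] by blast
  show ?thesis
  proof (intro exI[of _ "C * C'"] conjI allI impI ballI)
    show "C * C' > 0" using C C' by simp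
    fix M :: "nat \<Rightarrow> real" and \<xi> and i :: nat and x t :: real
    assume a: "max \<bar>M 1\<bar> \<bar>M 2\<bar> \<le> 1" "is_higher_wave \<nu> c M (Suc m) \<xi>" "i \<in> {1, 2}" and x: "\<bar>x\<bar> \<le> K" and t: "0 \<le> t"
    have "\<bar>\<xi> i x t\<bar> \<le> C * Psi_weight m i M x (t + 1)" by (rule C(2)[OF a t])
    also have "\<dots> \<le> C * (C' * (t + 1) powr (- alpha (int m)))"
      using C'(2)[OF a(3) x, of "t + 1" M] t C(1) by (intro mult_left_mono) auto
    finally show "\<bar>\<xi> i x t\<bar> \<le> C * C' * (t + 1) powr (- alpha (int m))" by simp
  qed
qed

lemma higher_wave_Lp:
  fixes p :: ennreal
  assumes p: "p \<ge> 1"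
  shows "\<exists>C>0. \<forall>M \<xi>. max \<bar>M 1\<bar> \<bar>M 2\<bar> \<le> 1 \<longrightarrow> is_higher_wave \<nu> c M (Suc m) \<xi> \<longrightarrow>
     (\<forall>i\<in>{1, 2}. \<forall>t\<ge>0. Lp_norm p (\<lambda>x. \<xi> i x t)
        \<le> ennreal (C * (t + 1) powr (- ((alpha (int m) - enn2real (1 / p)) / 2))))"
proof -
  define \<alpha> where "\<alpha> = alpha (int m)"
  have \<alpha>: "\<alpha> = 1 + alpha (int m - 1) / 2" by (simp add: \<alpha>_def alpha_step)
  obtain C where C: "C > 0" "\<And>M \<xi> i t x. max \<bar>M 1\<bar> \<bar>M 2\<bar> \<le> 1 \<Longrightarrow> is_higher_wave \<nu> c M (Suc m) \<xi> \<Longrightarrow>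
    i \<in> {1, 2} \<Longrightarrow> t \<ge> 0 \<Longrightarrow> \<bar>\<xi> i x t\<bar> \<le> C * Psi_weight m i M x (t + 1)"
    using higher_wave_envelope by blast
  \<comment> \<open>Measurability is taken from the explicit wave, which agrees with \<xi> at the
    time in question and is differentiable in x.\<close>
  have meas: "(\<lambda>x. \<xi> i x t) \<in> borel_measurable lborel"
    if "max \<bar>M 1\<bar> \<bar>M 2\<bar> \<le> 1" "is_higher_wave \<nu> c M (Suc m) \<xi>" "i \<in> {1, 2}" "t \<ge> 0" for M \<xi> i t
  proof -
    have M: "M \<in> small" using that by (simp add: small_def)
    have "(\<lambda>x. \<xi> i x t) = (\<lambda>x. higher (Suc m) i M x (t + 1))"
      using higher_wave_unique[OF M that(2-4)] by (simp only:)
    moreover have "continuous_on UNIV (\<lambda>x. higher (Suc m) i M x (t + 1))"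
      using decay_has_derivative[OF higher_decay[OF that(3)] M, of "t + 1"] that(4)
      by (meson DERIV_isCont continuous_at_imp_continuous_on le_add_same_cancel2)
    ultimately show ?thesis by (simp add: borel_measurable_continuous_onI)
  qed
  have sup: "C * Psi_weight m i M x (t + 1) \<le> 2 * C * (t + 1) powr (- \<alpha> / 2)" if "t \<ge> 0" for i M x t
    using Psi_weight_upper[of "t + 1" m i M x] C(1) that by (simp add: \<alpha>)
  show ?thesis
  proof (cases "p = \<infinity>")
    case True
    show ?thesis
    proof (intro exI[of _ "2 * C"] conjI allI impI ballI)
      fix M :: "nat \<Rightarrow> real" and \<xi> and i :: nat and t :: real
      assume a: "max \<bar>M 1\<bar> \<bar>M 2\<bar> \<le> 1" "is_higher_wave \<nu> c M (Suc m) \<xi>" "i \<in> {1, 2}" "0 \<le> t"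
      have "Lp_norm p (\<lambda>x. \<xi> i x t) \<le> ennreal (2 * C * (t + 1) powr (- \<alpha> / 2))"
        unfolding True by (rule Lp_norm_infinity_bound[OF meas[OF a] order_trans[OF C(2)[OF a] sup[OF a(4)]]])
      \<comment> \<open>In the extended reals 1 / \<infinity> = 0, so the exponent for p =
        \<infinity> is plainly -\<alpha>/2.\<close>
      moreover have "enn2real (1 / p) = 0" by (simp add: True)
      ultimately show "Lp_norm p (\<lambda>x. \<xi> i x t) \<le> ennreal (2 * C * (t + 1) powr (- ((alpha (int m) - enn2real (1 / p)) / 2)))"
        by (simp add: \<alpha>_def)
    qed (use C in auto)
  next
    case False
    then obtain r where r: "p = ennreal r" "r \<ge> 1"
      using p by (cases p) (auto simp flip: ennreal_1)
    obtain L where L: "L > 0" "\<And>i M T. T \<ge> 1 \<Longrightarrow>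
      (\<integral>\<^sup>+x. ennreal (Psi_weight m i M x T) \<partial>lborel) \<le> ennreal (L * T powr ((1 - alpha (int m)) / 2))"
      using Psi_weight_integral by blast
    \<comment> \<open>The constants that interpolation produces, without the powers of T. The latter
      combine to -(\<alpha>/2) (r - 1)/r + (1 - \<alpha>)/(2 r) = -(\<alpha> - 1/r)/2.\<close>
    define B where "B = ((2 * C) powr (r - 1) * (C * L)) powr (1 / r)"
    have rp: "enn2real (1 / p) = 1 / r" unfolding r(1) using r(2) by (simp add: divide_ennreal flip: ennreal_1)
    show ?thesis
    proof (intro exI[of _ B] conjI allI impI ballI)
      show "B > 0" using C L by (simp add: B_def)
      fix M :: "nat \<Rightarrow> real" and \<xi> and i :: nat and t :: real
      assume a: "max \<bar>M 1\<bar> \<bar>M 2\<bar> \<le> 1" "is_higher_wave \<nu> c M (Suc m) \<xi>" "i \<in> {1, 2}" "0 \<le> t"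
      define T where "T = t + 1"
      have T: "T \<ge> 1" using a by (simp add: T_def)
      have m: "(\<lambda>x. Psi_weight m i M x T) \<in> borel_measurable borel"
        unfolding Psi_weight_eq by measurable
      have mC: "(\<lambda>x. C * Psi_weight m i M x T) \<in> borel_measurable lborel" using m by simp
      have "(\<integral>\<^sup>+x. ennreal (C * Psi_weight m i M x T) \<partial>lborel) = ennreal C * (\<integral>\<^sup>+x. ennreal (Psi_weight m i M x T) \<partial>lborel)"
        using C(1) Psi_weight_pos[OF T, THEN less_imp_le] m by (simp add: ennreal_mult nn_integral_cmult)
      also have "\<dots> \<le> ennreal C * ennreal (L * T powr ((1 - \<alpha>) / 2))"
        using L(2)[OF T] by (intro mult_left_mono) (auto simp: \<alpha>_def)
      also have "\<dots> = ennreal (C * L * T powr ((1 - \<alpha>) / 2))" using C(1) L(1) by (simp add: mult.assoc flip: ennreal_mult)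
      finally have J: "(\<integral>\<^sup>+x. ennreal (C * Psi_weight m i M x T) \<partial>lborel) \<le> ennreal (C * L * T powr ((1 - \<alpha>) / 2))" .
      have "Lp_norm p (\<lambda>x. \<xi> i x t) \<le> ennreal (((2 * C * T powr (- \<alpha> / 2)) powr (r - 1) * (C * L * T powr ((1 - \<alpha>) / 2))) powr (1 / r))"
        unfolding r(1)
        by (rule Lp_norm_interpolation[OF meas[OF a] mC C(2)[OF a, folded T_def] sup[OF a(4), folded T_def] J]) (use C L r in auto)
      also have "((2 * C * T powr (- \<alpha> / 2)) powr (r - 1) * (C * L * T powr ((1 - \<alpha>) / 2))) powr (1 / r)
          = B * (T powr (- \<alpha> / 2 * (r - 1) * (1 / r)) * T powr ((1 - \<alpha>) / 2 * (1 / r)))"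
        by (simp add: B_def powr_mult powr_powr mult_ac)
      also have "\<dots> = B * T powr ((- \<alpha> / 2 * (r - 1) + (1 - \<alpha>) / 2) * (1 / r))"
        by (simp only: powr_add[symmetric] distrib_right)
      also have "(- \<alpha> / 2 * (r - 1) + (1 - \<alpha>) / 2) * (1 / r) = - ((\<alpha> - 1 / r) / 2)"
        using r(2) by (simp add: field_simps)
      finally show "Lp_norm p (\<lambda>x. \<xi> i x t) \<le> ennreal (B * (t + 1) powr (- ((alpha (int m) - enn2real (1 / p)) / 2)))"
        unfolding rp by (simp add: T_def \<alpha>_def)
    qed
  qed
qed

end

theorem proposition2p1:
  fixes \<nu> c :: real and n :: nat
  assumes "\<nu> > 0" and "c > 0" and "n \<ge> 1"
  shows
    "(\<forall>k::nat. \<exists>\<epsilon>\<^sub>0>0. \<exists>C>0. \<forall>M \<xi>. max \<bar>M 1\<bar> \<bar>M 2\<bar> \<le> \<epsilon>\<^sub>0 \<longrightarrow> is_higher_wave \<nu> c M n \<xi> \<longrightarrow>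
        (\<forall>i\<in>{1, 2}. \<forall>t\<ge>0. times_differentiable k (\<lambda>y. \<xi> i y t) \<and>
          (\<forall>x. \<bar>(deriv ^^ k) (\<lambda>y. \<xi> i y t) x\<bar>
             \<le> C * max \<bar>M 1\<bar> \<bar>M 2\<bar> ^ (n + 1) * (t + 1) powr (- (real k / 2)) * Psi c i (int n - 1) x t)))
     \<and>
     (\<exists>\<epsilon>\<^sub>0>0.
        (\<forall>K>0. \<exists>C>0. \<forall>M \<xi>. max \<bar>M 1\<bar> \<bar>M 2\<bar> \<le> \<epsilon>\<^sub>0 \<longrightarrow> is_higher_wave \<nu> c M n \<xi> \<longrightarrow>
          (\<forall>i\<in>{1, 2}. \<forall>x t. \<bar>x\<bar> \<le> K \<longrightarrow> t \<ge> 0 \<longrightarrow>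
            \<bar>\<xi> i x t\<bar> \<le> C * (t + 1) powr (- alpha (int n - 1))))
        \<and>
        (\<forall>p::ennreal. p \<ge> 1 \<longrightarrow> (\<exists>C>0. \<forall>M \<xi>. max \<bar>M 1\<bar> \<bar>M 2\<bar> \<le> \<epsilon>\<^sub>0 \<longrightarrow> is_higher_wave \<nu> c M n \<xi> \<longrightarrow>
          (\<forall>i\<in>{1, 2}. \<forall>t\<ge>0.
            Lp_norm p (\<lambda>x. \<xi> i x t)
              \<le> ennreal (C * (t + 1) powr (- ((alpha (int n - 1) - enn2real (1 / p)) / 2)))))))"
proof -
  interpret wave_speeds \<nu> c by unfold_locales (use assms in auto)
  obtain m where m: "n = Suc m" using assms(3) by (cases n) auto
  \<comment> \<open>The wave of level n = m + 1 is governed by the weight of index m, the n - 1 of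
    the statement.\<close>
  have n: "int n - 1 = int m" "n + 1 = m + 2" by (simp_all add: m)
  show ?thesis
    unfolding n unfolding m
  proof (rule conjI, rule allI)
    show "\<exists>\<epsilon>\<^sub>0>0. \<exists>C>0. \<forall>M \<xi>. max \<bar>M 1\<bar> \<bar>M 2\<bar> \<le> \<epsilon>\<^sub>0 \<longrightarrow> is_higher_wave \<nu> c M (Suc m) \<xi> \<longrightarrow>
        (\<forall>i\<in>{1, 2}. \<forall>t\<ge>0. times_differentiable k (\<lambda>y. \<xi> i y t) \<and>
          (\<forall>x. \<bar>(deriv ^^ k) (\<lambda>y. \<xi> i y t) x\<bar>
             \<le> C * max \<bar>M 1\<bar> \<bar>M 2\<bar> ^ (m + 2) * (t + 1) powr (- (real k / 2)) * Psi c i (int m) x t))" for k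
      \<comment> \<open>The threshold is 1, independently of \<open>k\<close>.\<close>
      by (rule exI[of _ 1], rule conjI[OF zero_less_one], rule higher_wave_pointwise)
  qed (rule exI[of _ 1], intro conjI allI impI zero_less_one higher_wave_compact higher_wave_Lp)
qed

end
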